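(* There exists an absolute (large) constant $A$ such that the following holds. Let $\kappa>0$, let $\chi$ be a primitive real character modulo $q$ and $\beta$ a real zero of $L(s,\chi)$ with $\beta\ge1-\kappa/\log q$. Fix $u>1$, let $z\ge q^A$, $x=z^u$, and let $\Delta>0$ be such that $(1-\beta)\log x\le\Delta$. Then for every positive integer $k<u$ and every $a$ with $\gcd(a,q)=1$, \[ \pi_k(x,z;q,a)=\big(1+(-1)^k\chi(a)+O(\Delta)\big)\frac{\pi_{k,q}(x,z)}{\phi(q)}, \] uniformly, with implied constant depending only on $u$.
   Context: $\pi_k(x,z)$ denotes the number of integers $n\le x$ of the form $n=p_1\cdots p_k$ with all $p_i$ primes $>z$; $\pi_k(x,z;q,a)$ counts those with $n\equiv a\pmod q$; $\pi_{k,q}(x,z)$ counts those with $\gcd(n,q)=1$. $\phi$ is Euler's totient function. *)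

theory Defs
  imports "HOL-Complex_Analysis.Complex_Analysis" "HOL-Number_Theory.Number_Theory"
begin

definition dirichlet_character :: "nat \<Rightarrow> (int \<Rightarrow> complex) \<Rightarrow> bool" where
  "dirichlet_character q chi \<longleftrightarrow>
     q > 0 \<and>
     (\<forall>n. chi (n + int q) = chi n) \<and>
     (\<forall>m n. chi (m * n) = chi m * chi n) \<and>
     (\<forall>n. chi n \<noteq> 0 \<longleftrightarrow> coprime n (int q))"

definition real_character :: "(int \<Rightarrow> complex) \<Rightarrow> bool" where
  "real_character chi \<longleftrightarrow> (\<forall>n. chi n \<in> \<real>)"

text \<open>A character is primitive if no character of a proper divisor of the modulus induces it.\<close>
definition primitive_character :: "nat \<Rightarrow> (int \<Rightarrow> complex) \<Rightarrow> bool" where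
  "primitive_character q chi \<longleftrightarrow>
     dirichlet_character q chi \<and>
     \<not> (\<exists>d \<psi>. d dvd q \<and> d < q \<and> dirichlet_character d \<psi> \<and>
              (\<forall>n. coprime n (int q) \<longrightarrow> chi n = \<psi> n))"

definition continues_dirichlet_series ::
    "(int \<Rightarrow> complex) \<Rightarrow> (complex \<Rightarrow> complex) \<Rightarrow> bool" where
  "continues_dirichlet_series chi f \<longleftrightarrow>
     f nicely_meromorphic_on UNIV \<and>
     (\<forall>s. Re s > 1 \<longrightarrow> (\<lambda>n. chi (int (Suc n)) / of_nat (Suc n) powr s) sums f s)"

text \<open>
  The function \<open>L(s, chi)\<close> on the whole plane, as the meromorphic continuation of its Dirichlet
  series. Nice meromorphicity removes the removable singularities and fixes the value \<open>0\<close> at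
  poles, so a zero of this function is a genuine zero of \<open>L(s, chi)\<close> only away from the
  poles; there are none unless \<open>chi\<close> is principal.
\<close>
definition dirichlet_L :: "(int \<Rightarrow> complex) \<Rightarrow> complex \<Rightarrow> complex" where
  "dirichlet_L chi = (THE f. continues_dirichlet_series chi f)"

lemma continues_dirichlet_series_unique:
  assumes f: "continues_dirichlet_series chi f" and g: "continues_dirichlet_series chi g"
  shows "f = g"
proof
  fix z
  have fm: "f nicely_meromorphic_on UNIV" and gm: "g nicely_meromorphic_on UNIV"
    using f g by (auto simp: continues_dirichlet_series_def)
  have nice: "remove_sings F w = F w" if "F nicely_meromorphic_on UNIV" for F w
    using that unfolding nicely_meromorphic_on_def by (metis UNIV_I remove_sings_at_pole remove_sings_eqI)
  have eq: "f s = g s" if "Re s > 1" for s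
    using f g that unfolding continues_dirichlet_series_def by (blast intro: sums_unique2)
  define d where "d = (\<lambda>w. f w - g w)"
  have dm: "d meromorphic_on UNIV"
    using fm gm unfolding d_def nicely_meromorphic_on_def by (intro meromorphic_intros) auto
  have open_H: "open {s. Re s > 1}"
    by (simp add: open_halfspace_Re_gt)
  have d0: "remove_sings d s = 0" if "Re s > 1" for s
  proof (rule remove_sings_eqI, rule tendsto_eventually)
    have "eventually (\<lambda>w. w \<in> {s. Re s > 1}) (at s)"
      using open_H that by (intro eventually_at_in_open') auto
    then show "eventually (\<lambda>w. d w = 0) (at s)"
      by eventually_elim (simp add: d_def eq)
  qed
  have "remove_sings d constant_on UNIV"
  proof (rule constant_on_extend_nicely_meromorphic_on)
    show "remove_sings d nicely_meromorphic_on UNIV"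
      using dm by (rule remove_sings_nicely_meromorphic)
    show "remove_sings d constant_on {s. Re s > 1}"
      using d0 by (auto simp: constant_on_def)
    show "{s. Re s > 1} \<noteq> {}"
      by (auto intro!: exI[of _ 2])
  qed (use open_H in auto)
  then have d0': "remove_sings d w = 0" for w
    using d0[of 2] by (auto simp: constant_on_def)
  have "isolated_singularity_at d z"
    using dm by (simp add: meromorphic_on_isolated_singularity meromorphic_on_subset)
  then have "eventually (\<lambda>w. remove_sings d w = d w) (at z)"
    by (rule eventually_remove_sings_eq_at)
  then have "eventually (\<lambda>w. f w = g w) (at z)"
    by eventually_elim (use d0' in \<open>simp add: d_def\<close>)
  then have "remove_sings f z = remove_sings g z"
    by (rule remove_sings_cong) simp
  then show "f z = g z"
    using nice[OF fm] nice[OF gm] by simp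
qed

lemma dirichlet_L_eqI: "continues_dirichlet_series chi f \<Longrightarrow> dirichlet_L chi = f"
  unfolding dirichlet_L_def by (blast intro: continues_dirichlet_series_unique the_equality)

definition rough_products :: "nat \<Rightarrow> real \<Rightarrow> real \<Rightarrow> nat set" where
  "rough_products k x z =
     {n. real n \<le> x \<and>
         (\<exists>ps. length ps = k \<and> (\<forall>p\<in>set ps. prime p \<and> real p > z) \<and> n = prod_list ps)}"

definition pi_progression :: "nat \<Rightarrow> real \<Rightarrow> real \<Rightarrow> nat \<Rightarrow> int \<Rightarrow> nat" where
  "pi_progression k x z q a = card {n \<in> rough_products k x z. [int n = a] (mod int q)}"

definition pi_coprime :: "nat \<Rightarrow> nat \<Rightarrow> real \<Rightarrow> real \<Rightarrow> nat" where
  "pi_coprime k q x z = card {n \<in> rough_products k x z. coprime n q}"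

end

theory Submission
  imports Defs "HOL-Real_Asymp.Real_Asymp"
begin

text \<open>
  Write \<open>lam = 1 * chi\<close> (Dirichlet convolution). A zero \<open>\<beta>\<close> close to \<open>1\<close> forces \<open>chi p = -1\<close> for most primes: comparing the
  partial sums of \<open>lam n / n\<close>, which are at least of order \<open>L(1, chi) / (1 - \<beta>)\<close>, with those up to a larger bound, which are
  \<open>O(L(1, chi) ln y)\<close>, shows that the \<open>lam\<close>-weight of the integers free of small primes is \<open>O((1 - \<beta>) ln y)\<close>.

  For a class \<open>a\<close> consider the kernel \<open>Ka a n\<close>, the indicator of \<open>n = a (mod q)\<close> minus \<open>(1 + chi a chi n) / \<phi>(q)\<close> for \<open>n\<close> prime to
  \<open>q\<close>. It has bounded partial sums against both \<open>1\<close> and \<open>chi\<close>. Since \<open>mangoldt = nu * (chi * ln)\<close> with \<open>nu\<close> the inverse of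
  \<open>lam\<close>, truncating \<open>nu\<close> splits the sum of \<open>Ka a n mangoldt n\<close>, weighted by an upper bound sieve, into a negligible part and
  a part over \<open>n = d1 d2 d\<close> with weight \<open>lam d1 lam d2 mangoldt d\<close> and one of \<open>d1, d2\<close> large. Sieving the largest of the
  three variables and using the scarcity of \<open>lam\<close> bounds it by \<open>O((1 - \<beta>) ln y * y / \<phi>(q))\<close>.

  For products of \<open>k\<close> large primes one fixes all prime factors but the largest: the kernel is invariant under shifting
  \<open>a\<close> by the cofactor, so the prime case applies, and \<open>chi n\<close> differs from \<open>(-1)^k\<close> by at most the \<open>lam\<close>-weight of its prime
  factors.
\<close>

section \<open>Chebyshev and Mertens estimates\<close>

text \<open>The obstacle is that L(1, chi) may be tiny: only \<open>L1\<close> \<ge> 1 / (64 q) is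
  proved. Its size has to cancel, and it does because every sifted sum of \<open>lam\<close> is
  bounded through the ratio \<open>L1 / H w\<close>, while the zero forces \<open>H w\<close> \<ge>
  \<open>L1 / (2 * (1 - b))\<close>. The same lower bound for \<open>H\<close>, taken at a fixed
  power of q, compared with a trivial upper bound shows that 1 - b is at least a negative power of q
  (\<open>zero_gap\<close>). Hence every error that saves a power of w is already as small as 1 - b,
  and this is why z must exceed a large fixed power of q. The tail of the truncated identity is
  small only on integers without small prime factors, so a sieve weight has to be attached to the
  whole product d1 d2 d although one variable is sieved at a time. The weight must therefore stay
  sievable in the presence of a fixed cofactor; this dictates its binomial form and the auxiliary
  bounds \<open>kap\<close> and \<open>hh\<close>. At the end the error (1 - b) x / phi(q) is
  compared with the number of products, of order at least x / ln x once z is large in terms of u;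
  the quotient (1 - b) ln x is bounded by \<Delta>.\<close>

definition primes_le :: "real \<Rightarrow> nat set" where
  "primes_le y = {p. prime p \<and> real p \<le> y}"

lemma mem_primes_le [simp]: "p \<in> primes_le y \<longleftrightarrow> prime p \<and> real p \<le> y"
  by (simp add: primes_le_def)

lemma finite_nat_real_le [simp, intro]: "finite {n::nat. real n \<le> y}"
  by (rule finite_subset[of _ "{..nat \<lfloor>y\<rfloor>}"]) (auto simp: le_nat_floor)

lemma finite_primes_le [simp, intro]: "finite (primes_le y)"
  by (rule finite_subset[OF _ finite_nat_real_le[of y]]) auto

lemma real_div_le: "real N / real d \<le> real (N div d) + 1"
proof -
  have "real (N div d) = of_int \<lfloor>real N / real d\<rfloor>" by (simp add: floor_divide_of_nat_eq)
  then show ?thesis by linarith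
qed

text \<open>Passing from \<open>N\<close> to \<open>N + 1\<close> raises \<open>N div d\<close> by
  one exactly when \<open>d\<close> divides \<open>N + 1\<close>, and these divisors contribute ln
  (N + 1) by \<open>mangoldt_sum\<close>.\<close>

lemma ln_fact_eq_sum_mangoldt:
  "ln (fact N :: real) = (\<Sum>d=1..N. mangoldt d * real (N div d))"
proof (induction N)
  case 0
  then show ?case by simp
next
  case (Suc N)
  have "(\<Sum>d=1..Suc N. mangoldt d * real (Suc N div d))
      = (\<Sum>d=1..Suc N. mangoldt d * real (N div d) + (if d dvd Suc N then mangoldt d else 0))"
    by (intro sum.cong refl) (auto simp: div_Suc dvd_eq_mod_eq_0 algebra_simps)
  also have "... = (\<Sum>d=1..N. mangoldt d * real (N div d)) + (\<Sum>d | d dvd Suc N. mangoldt d)"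
  proof -
    have "(\<Sum>d=1..Suc N. if d dvd Suc N then mangoldt d else (0::real)) = (\<Sum>d | d dvd Suc N. mangoldt d)"
      by (rule sum.mono_neutral_cong_right) (auto simp: Suc_le_eq dvd_imp_le intro!: Nat.gr0I)
    then show ?thesis by (simp add: sum.distrib)
  qed
  also have "... = ln (fact N) + ln (real (Suc N))"
    using mangoldt_sum[of "Suc N", where ?'a = real] Suc.IH by simp
  also have "... = ln (fact (Suc N))"
    by (simp add: ln_mult del: of_nat_Suc)
  finally show ?case by simp
qed

definition psi :: "nat \<Rightarrow> real" where "psi N = (\<Sum>d=1..N. mangoldt d)"

text \<open>Chebyshev's device: \<open>N div d\<close> minus twice \<open>N div 2 div d\<close> is
  the parity of \<open>N div d\<close>. The coefficients are thus 0 or 1, and they are 1 for N / 2 <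
  d \<le> N, which yields bounds for \<open>psi\<close> in both directions.\<close>

lemma ln_fact_minus_half:
  "ln (fact N :: real) - 2 * ln (fact (N div 2)) = (\<Sum>d=1..N. mangoldt d * real ((N div d) mod 2))"
proof -
  have "(\<Sum>d=1..N div 2. mangoldt d * real (N div 2 div d)) = (\<Sum>d=1..N. mangoldt d * real (N div 2 div d))"
    by (rule sum.mono_neutral_left) auto
  then have "ln (fact N :: real) - 2 * ln (fact (N div 2))
      = (\<Sum>d=1..N. mangoldt d * (real (N div d) - 2 * real (N div 2 div d)))"
    by (simp add: ln_fact_eq_sum_mangoldt sum_distrib_left sum_subtractf algebra_simps)
  also have "... = (\<Sum>d=1..N. mangoldt d * real ((N div d) mod 2))"
  proof (intro sum.cong refl)
    fix d
    have "N div 2 div d = N div d div 2"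
      by (metis div_mult2_eq mult.commute)
    moreover have "N div d = 2 * (N div d div 2) + N div d mod 2" by simp
    ultimately have "real (N div d) - 2 * real (N div 2 div d) = real ((N div d) mod 2)"
      by (metis add_diff_cancel_left' of_nat_add of_nat_mult of_nat_numeral)
    then show "mangoldt d * (real (N div d) - 2 * real (N div 2 div d)) = mangoldt d * real ((N div d) mod 2)"
      by simp
  qed
  finally show ?thesis .
qed

lemma psi_half_le: "psi N - psi (N div 2) \<le> ln (fact N :: real) - 2 * ln (fact (N div 2))"
proof -
  have eq: "psi N = psi (N div 2) + (\<Sum>d=N div 2+1..N. mangoldt d)"
    unfolding psi_def
    by (subst sum.union_disjoint[symmetric]) (auto intro!: sum.cong simp: ivl_disj_un)
  have "(\<Sum>d=N div 2+1..N. (mangoldt d :: real)) = (\<Sum>d=N div 2+1..N. mangoldt d * real ((N div d) mod 2))"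
  proof (intro sum.cong refl)
    fix d assume d: "d \<in> {N div 2+1..N}"
    then have "N div d = 1"
      by (intro div_nat_eqI) auto
    then show "mangoldt d = mangoldt d * real ((N div d) mod 2)" by simp
  qed
  also have "... \<le> (\<Sum>d=1..N. mangoldt d * real ((N div d) mod 2))"
    by (rule sum_mono2) (auto simp: mangoldt_nonneg)
  finally show ?thesis using eq by (simp add: ln_fact_minus_half)
qed

lemma ln_fact_half_le_psi: "ln (fact N :: real) - 2 * ln (fact (N div 2)) \<le> psi N"
  unfolding ln_fact_minus_half psi_def
proof (rule sum_mono)
  fix d
  have "real ((N div d) mod 2) \<le> 1" using mod_less_divisor[of 2 "N div d"] by linarith
  then show "mangoldt d * real ((N div d) mod 2) \<le> mangoldt d"
    using mult_left_mono[of _ 1 "mangoldt d"] mangoldt_nonneg[of d] by fastforce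
qed

text \<open>For even \<open>N\<close> this is the bound 2^N for the central binomial coefficient;
  the factor \<open>N + 1\<close> pays for the extra factor in an odd factorial.\<close>

lemma fact_le_half_sq: "(fact N :: real) \<le> real (N + 1) * 2 ^ N * (fact (N div 2))\<^sup>2"
proof -
  obtain m where m: "N = 2 * m \<or> N = 2 * m + 1" by (metis oddE evenE)
  have c: "fact (2 * m) = (fact m)\<^sup>2 * real ((2 * m) choose m)"
    using binomial_fact[of m "2 * m", where ?'a = real] by (simp add: field_simps power2_eq_square mult_2)
  have b: "real ((2 * m) choose m) \<le> 2 ^ (2 * m)"
    using binomial_le_pow2[of "2 * m" m] by (metis of_nat_le_iff of_nat_numeral of_nat_power)
  have l: "fact (2 * m) \<le> 2 ^ (2 * m) * (fact m :: real)\<^sup>2"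
    unfolding c using mult_left_mono[OF b, of "(fact m)\<^sup>2"] by (simp add: mult.commute)
  show ?thesis
  proof (cases "N = 2 * m")
    case True
    have "2 ^ (2 * m) * (fact m :: real)\<^sup>2 \<le> real (N + 1) * (2 ^ (2 * m) * (fact m :: real)\<^sup>2)"
      using mult_right_mono[of 1 "real (N + 1)" "2 ^ (2 * m) * (fact m :: real)\<^sup>2"] by simp
    then have "fact (2 * m) \<le> real (N + 1) * (2 ^ (2 * m) * (fact m :: real)\<^sup>2)" using l by linarith
    then show ?thesis using True by (simp add: mult.assoc)
  next
    case False
    then have N: "N = 2 * m + 1" using m by simp
    have "fact N = real N * fact (2 * m)" using N by simp
    also have "... \<le> real N * (2 ^ (2 * m) * (fact m :: real)\<^sup>2)" using l by (intro mult_left_mono) auto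
    also have "... \<le> real (N + 1) * (2 ^ N * (fact m)\<^sup>2)"
      using N by (intro mult_mono) auto
    finally show ?thesis using N by (simp add: mult.assoc)
  qed
qed

lemma psi_le: "psi N \<le> 6 * real N"
proof (induction N rule: less_induct)
  case (less N)
  show ?case
  proof (cases "N = 0")
    case True
    then show ?thesis by (simp add: psi_def)
  next
    case False
    then have IH: "psi (N div 2) \<le> 6 * real (N div 2)" by (intro less.IH) auto
    have "ln (fact N :: real) \<le> ln (real (N + 1) * 2 ^ N * (fact (N div 2))\<^sup>2)"
      using fact_le_half_sq[of N] by (subst ln_le_cancel_iff) auto
    also have "... = ln (real (N+1)) + real N * ln 2 + 2 * ln (fact (N div 2))"
      by (simp add: ln_mult ln_realpow del: of_nat_Suc of_nat_add)
    finally have "psi N \<le> psi (N div 2) + ln (real (N+1)) + real N * ln 2"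
      using psi_half_le[of N] by linarith
    moreover have "ln (real (N+1)) \<le> real N" using ln_add_one_self_le_self[of "real N"] by (simp add: add.commute)
    moreover have "real N * ln 2 \<le> real N" using ln_2_less_1 by (intro mult_left_le) auto
    moreover have "real (N div 2) \<le> real N / 2" by linarith
    ultimately show ?thesis using IH by linarith
  qed
qed

lemma psi_ge: "psi N \<ge> real N / 6" if "N \<ge> 2"
proof -
  define m where "m = N div 2"
  have m: "m \<ge> 1" "N \<ge> 2 * m" "N \<le> 2 * m + 1" using that by (auto simp: m_def)
  have c: "fact (2 * m) = (fact m)\<^sup>2 * real ((2 * m) choose m)"
    using binomial_fact[of m "2 * m", where ?'a = real] by (simp add: field_simps power2_eq_square mult_2)
  \<comment> \<open>The lower bound 4^m / (2 m) for the central binomial coefficient loses a factor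
    2 m, which is at most 2^m; so 2^m remains.\<close>
  have "2 * m \<le> 2 ^ m" using m(1)
    by (induction m rule: dec_induct) auto
  then have "real (2 * m) \<le> 2 ^ m" by (metis of_nat_le_iff of_nat_numeral of_nat_power)
  moreover have "4 ^ m / (2 * real m) \<le> real (2 * m choose m)"
    using central_binomial_lower_bound[of m] m by simp
  then have "4 ^ m \<le> real (2 * m choose m) * real (2 * m)"
    using m by (simp add: field_simps)
  ultimately have "4 ^ m \<le> real (2 * m choose m) * 2 ^ m"
    by (meson mult_left_mono of_nat_0_le_iff order_trans)
  moreover have "(4::real) ^ m = 2 ^ m * 2 ^ m" by (simp flip: power_mult_distrib)
  ultimately have b: "2 ^ m \<le> real (2 * m choose m)" by simp
  have "real m * ln 2 = ln (2 ^ m)" by (simp add: ln_realpow)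
  also have "... \<le> ln (real (2 * m choose m))" using b by (subst ln_le_cancel_iff) (auto intro: less_le_trans[OF _ b])
  also have "... = ln (fact (2 * m)) - 2 * ln (fact m)"
    unfolding c by (subst ln_mult) (auto simp: ln_realpow)
  also have "... \<le> ln (fact N) - 2 * ln (fact m)"
    using m by (simp add: fact_mono)
  also have "... \<le> psi N" using ln_fact_half_le_psi[of N] by (simp add: m_def)
  finally have "real m * ln 2 \<le> psi N" .
  moreover have "ln 2 \<ge> (1/2 :: real)" using ln2_ge_two_thirds by simp
  then have "real m * ln 2 \<ge> real m * (1/2)" by (intro mult_left_mono) auto
  moreover have "real N \<le> 3 * real m" using m by linarith
  ultimately show ?thesis by linarith
qed

lemma ln_fact_ge: "ln (fact n :: real) \<ge> real n * ln (real n) - real n"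
proof (induction n)
  case (Suc n)
  show ?case
  proof (cases "n = 0")
    case False
    have "ln (real (Suc n) / real n) \<le> real (Suc n) / real n - 1"
      using False by (intro ln_le_minus_one) auto
    also have "... = 1 / real n" using False by (simp add: field_simps)
    finally have "real n * (ln (real (Suc n)) - ln (real n)) \<le> 1"
      using False by (simp add: ln_div field_simps)
    moreover have "ln (fact (Suc n)) = ln (fact n) + ln (real (Suc n))"
      by (simp add: ln_mult del: of_nat_Suc)
    ultimately show ?thesis using Suc.IH by (simp add: algebra_simps)
  qed auto
qed auto

text \<open>Replacing \<open>N div d\<close> by N / d in the formula for \<open>ln (fact N)\<close>
  costs at most \<open>mangoldt d\<close> for each \<open>d\<close>, hence \<open>psi N\<close>
  \<le> 6 N in total. This is the 6.\<close>

lemma mertens_upper: "(\<Sum>d=1..N. mangoldt d / real d) \<le> ln (real N) + 6" if "N \<ge> 1"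
proof -
  have "real N * (\<Sum>d=1..N. mangoldt d / real d) = (\<Sum>d=1..N. mangoldt d * (real N / real d))"
    by (simp add: sum_distrib_left field_simps)
  also have "... \<le> (\<Sum>d=1..N. mangoldt d * (real (N div d) + 1))"
    by (intro sum_mono mult_left_mono mangoldt_nonneg real_div_le)
  also have "... = ln (fact N) + psi N"
    by (simp add: ln_fact_eq_sum_mangoldt psi_def algebra_simps sum.distrib)
  also have "... \<le> real N * ln (real N) + 6 * real N"
  proof -
    have "(fact N :: real) \<le> real N ^ N" using fact_le_power[of N, where ?'a = real] by simp
    then have "ln (fact N :: real) \<le> ln (real N ^ N)" using that by (subst ln_le_cancel_iff) auto
    then show ?thesis using that psi_le[of N] by (simp add: ln_realpow)
  qed
  also have "... = real N * (ln (real N) + 6)" by (simp add: algebra_simps)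
  finally show ?thesis using that by simp
qed

lemma mertens_lower: "(\<Sum>d=1..N. mangoldt d / real d) \<ge> ln (real N) - 1" if "N \<ge> 1"
proof -
  have "real N * (ln (real N) - 1) \<le> ln (fact N)" using ln_fact_ge[of N] by (simp add: algebra_simps)
  also have "... \<le> (\<Sum>d=1..N. mangoldt d * (real N / real d))"
    unfolding ln_fact_eq_sum_mangoldt
    by (intro sum_mono mult_left_mono mangoldt_nonneg of_nat_div_le_of_nat)
  also have "... = real N * (\<Sum>d=1..N. mangoldt d / real d)"
    by (simp add: sum_distrib_left field_simps)
  finally show ?thesis using that by simp
qed

text \<open>The geometric series of 1 / p^k over k \<ge> 1 has sum 1 / (p - 1), so each prime
  absorbs all its powers.\<close>

lemma sum_mangoldt_le_primes:
  "(\<Sum>d=1..N. mangoldt d / real d) \<le> (\<Sum>p\<in>primes_le (real N). ln (real p) / (real p - 1))"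
proof -
  let ?S = "primes_le (real N) \<times> {1..N}"
  have "(\<Sum>d=1..N. mangoldt d / real d) = (\<Sum>d\<in>{d\<in>{1..N}. primepow d}. mangoldt d / real d)"
    by (rule sum.mono_neutral_right) (auto simp: mangoldt_def)
  also have "... \<le> (\<Sum>d\<in>(\<lambda>(p,k). p ^ k) ` ?S. mangoldt d / real d)"
  proof (rule sum_mono2)
    show "{d\<in>{1..N}. primepow d} \<subseteq> (\<lambda>(p,k). p ^ k) ` ?S"
    proof safe
      fix d assume d: "d \<in> {1..N}" "primepow d"
      then obtain p k where pk: "prime p" "k > 0" "d = p ^ k" by (auto simp: primepow_def)
      have "p \<le> d" using pk by (metis self_le_power prime_gt_0_nat Suc_leI One_nat_def)
      moreover have "k < 2 ^ k" by (rule less_exp)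
      moreover have "2 ^ k \<le> d" unfolding pk(3) using prime_ge_2_nat[OF pk(1)] by (rule power_mono) simp
      ultimately have "p \<le> N" "k \<le> N" using d(1) by (linarith | (unfold atLeastAtMost_iff, linarith))+
      then show "d \<in> (\<lambda>(p,k). p ^ k) ` ?S"
        using pk by (intro image_eqI[of _ _ "(p,k)"]) auto
    qed
  qed (auto simp: mangoldt_nonneg)
  also have "... \<le> (\<Sum>x\<in>?S. mangoldt ((\<lambda>(p,k). p ^ k) x) / real ((\<lambda>(p,k). p ^ k) x))"
    using sum_image_le[of ?S "\<lambda>d. mangoldt d / real d" "\<lambda>(p,k). p ^ k"]
    by (simp add: o_def mangoldt_nonneg)
  also have "... = (\<Sum>p\<in>primes_le (real N). \<Sum>k=1..N. ln (real p) / real p ^ k)"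
    by (subst sum.cartesian_product) (auto intro!: sum.cong simp: mangoldt_primepow')
  also have "... \<le> (\<Sum>p\<in>primes_le (real N). ln (real p) / (real p - 1))"
  proof (rule sum_mono)
    fix p assume "p \<in> primes_le (real N)"
    then have p: "real p \<ge> 2" using prime_ge_2_nat by fastforce
    have gp: "(\<Sum>k=1..n. 1 / real p ^ k) \<le> 1 / (real p - 1) - 1 / (real p - 1) / real p ^ n" for n
    proof (induction n)
      case (Suc n)
      have "1 / (x - 1) / c - 1 / (x * c) = 1 / (x - 1) / (x * c)" if "x \<ge> 2" "c > 0" for x c :: real
        using that by (simp add: divide_simps)
      from this[of "real p" "real p ^ n"] Suc.IH p show ?case by simp
    qed simp
    have "(\<Sum>k=1..N. ln (real p) / real p ^ k) = ln (real p) * (\<Sum>k=1..N. 1 / real p ^ k)"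
      by (simp add: sum_distrib_left)
    also have "... \<le> ln (real p) * (1 / (real p - 1))"
      using gp[of N] p by (intro mult_left_mono) (auto intro: order_trans)
    finally show "(\<Sum>k=1..N. ln (real p) / real p ^ k) \<le> ln (real p) / (real p - 1)" by simp
  qed
  finally show ?thesis .
qed

lemma mertens_primes_lower:
  obtains C where "C > 0" "\<And>N. N \<ge> 1 \<Longrightarrow> (\<Sum>p\<in>primes_le (real N). ln (real p) / real p) \<ge> ln (real N) - C"
proof -
  \<comment> \<open>The difference between ln p / (p - 1) and ln p / p. Its sum over all integers
    converges and supplies the constant.\<close>
  define f where "f = (\<lambda>n::nat. if n < 2 then 0 else ln (real n) / (real n * (real n - 1)))"
  have summ: "summable f"
  proof (rule summable_comparison_test)
    show "summable (\<lambda>n::nat. 4 * (real n powr (-3/2)))"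
      by (intro summable_mult) (simp add: summable_real_powr_iff)
    show "\<exists>N. \<forall>n\<ge>N. norm (f n) \<le> 4 * (real n powr (-3/2))"
    proof (intro exI[of _ 2] allI impI)
      fix n :: nat assume n: "n \<ge> 2"
      have "ln (real n) = 2 * ln (sqrt (real n))" using n by (simp add: ln_sqrt)
      also have "... \<le> 2 * sqrt (real n)"
        using n ln_le_minus_one[of "sqrt (real n)"] by simp
      finally have l: "ln (real n) \<le> 2 * sqrt (real n)" .
      have "f n \<le> 2 * sqrt (real n) / (real n * (real n / 2))"
      proof -
        have "real n * (real n / 2) \<le> real n * (real n - 1)" using n by (intro mult_left_mono) auto
        moreover have "0 < real n * (real n / 2)" using n by auto
        ultimately have "ln (real n) / (real n * (real n - 1)) \<le> 2 * sqrt (real n) / (real n * (real n / 2))"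
          using l by (intro frac_le) auto
        then show ?thesis unfolding f_def using n by simp
      qed
      also have "... = 4 * (real n powr (1/2) / real n powr 2)"
        using n by (simp add: powr_half_sqrt power2_eq_square)
      also have "... = 4 * real n powr (-3/2)"
        by (simp only: powr_diff[symmetric]) simp
      finally show "norm (f n) \<le> 4 * (real n powr (-3/2))"
        using n by (auto simp: f_def)
    qed
  qed
  have f0: "f n \<ge> 0" for n by (auto simp: f_def)
  show ?thesis
  proof (rule that[of "suminf f + 2"])
    show "suminf f + 2 > 0" using suminf_nonneg[OF summ f0] by simp
    fix N :: nat assume N: "N \<ge> 1"
    have "ln (real N) - 1 \<le> (\<Sum>p\<in>primes_le (real N). ln (real p) / (real p - 1))"
      using mertens_lower[OF N] sum_mangoldt_le_primes[of N] by linarith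
    also have "... = (\<Sum>p\<in>primes_le (real N). ln (real p) / real p + f p)"
    proof (intro sum.cong refl)
      fix p assume "p \<in> primes_le (real N)"
      then have p: "p \<ge> 2" using prime_ge_2_nat by fastforce
      then show "ln (real p) / (real p - 1) = ln (real p) / real p + f p"
        by (auto simp: f_def field_simps)
    qed
    also have "... \<le> (\<Sum>p\<in>primes_le (real N). ln (real p) / real p) + suminf f"
      unfolding sum.distrib by (intro add_left_mono sum_le_suminf summ) (auto simp: f0)
    finally show "(\<Sum>p\<in>primes_le (real N). ln (real p) / real p) \<ge> ln (real N) - (suminf f + 2)" by simp
  qed
qed

text \<open>A proper prime power is m^2 or m^2 p with m = p^j, and \<open>p\<close> is recovered
  from \<open>m\<close> as \<open>aprimedivisor m\<close>. Since m \<le> sqrt y, there are two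
  families of at most sqrt y members each.\<close>

lemma card_nonprime_primepow_le:
  "real (card {d. primepow d \<and> \<not> prime d \<and> real d \<le> y}) \<le> 2 * sqrt y" if "y \<ge> 0"
proof -
  let ?s = "nat \<lfloor>sqrt y\<rfloor>"
  let ?A = "(\<lambda>m. m\<^sup>2) ` {1..?s} \<union> (\<lambda>m. m\<^sup>2 * aprimedivisor m) ` {1..?s}"
  have "{d. primepow d \<and> \<not> prime d \<and> real d \<le> y} \<subseteq> ?A"
  proof
    fix d assume "d \<in> {d. primepow d \<and> \<not> prime d \<and> real d \<le> y}"
    then have d: "primepow d" "\<not> prime d" "real d \<le> y" by auto
    then obtain p k where pk: "prime p" "k > 0" "d = p ^ k" by (auto simp: primepow_def)
    have k: "k \<noteq> 1" using pk d by auto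
    define j where "j = k div 2"
    have j: "j \<ge> 1" using k pk(2) by (auto simp: j_def)
    have p0: "p > 0" using pk(1) prime_gt_0_nat by blast
    have "(p ^ j)\<^sup>2 \<le> d" unfolding pk(3) power_mult[symmetric] using p0
      by (intro power_increasing) (auto simp: j_def)
    then have "real ((p ^ j)\<^sup>2) \<le> y" using d(3) by linarith
    then have "real (p ^ j) \<le> sqrt y" by (intro real_le_rsqrt) (simp)
    then have m: "p ^ j \<in> {1..?s}" using p0 by (auto simp: le_nat_floor Suc_le_eq)
    show "d \<in> ?A"
    proof (cases "even k")
      case True
      then have "d = (p ^ j)\<^sup>2" unfolding pk(3) by (auto simp: j_def power_mult[symmetric])
      then show ?thesis using m by blast
    next
      case False
      then have "k = j * 2 + 1" by (auto simp: j_def elim!: oddE)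
      then have "d = (p ^ j)\<^sup>2 * aprimedivisor (p ^ j)"
        unfolding pk(3) using aprimedivisor_prime_power[OF pk(1), of j] j by (auto simp: power_mult power_add)
      then show ?thesis using m by blast
    qed
  qed
  then have "card {d. primepow d \<and> \<not> prime d \<and> real d \<le> y} \<le> card ?A" by (intro card_mono) auto
  also have "... \<le> card ((\<lambda>m. m\<^sup>2) ` {1..?s}) + card ((\<lambda>m. m\<^sup>2 * aprimedivisor m) ` {1..?s})"
    by (rule card_Un_le)
  also have "... \<le> ?s + ?s" by (intro add_mono) (auto intro: order_trans[OF card_image_le])
  finally have "real (card {d. primepow d \<and> \<not> prime d \<and> real d \<le> y}) \<le> 2 * real ?s" by linarith
  also have "... \<le> 2 * sqrt y" using that by auto
  finally show ?thesis .
qed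

text \<open>\<open>psi\<close> counts every prime power up to \<open>y\<close> with weight at most
  ln y. The proper powers number at most 2 sqrt y, which half of the lower bound y / (12 ln y)
  absorbs.\<close>

lemma pi_ge:
  obtains Y0 where "Y0 > 1" "\<And>y. y \<ge> Y0 \<Longrightarrow> real (card (primes_le y)) \<ge> y / (24 * ln y)"
proof -
  have "eventually (\<lambda>y::real. 2 * sqrt y \<le> y / (24 * ln y)) at_top"
    by real_asymp
  then obtain Y where Y: "\<And>y::real. y \<ge> Y \<Longrightarrow> 2 * sqrt y \<le> y / (24 * ln y)"
    by (auto simp: eventually_at_top_linorder)
  show ?thesis
  proof (rule that[of "max Y 4"])
    show "max Y 4 > 1" by simp
    fix y :: real assume y: "y \<ge> max Y 4"
    let ?N = "nat \<lfloor>y\<rfloor>"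
    have N: "real ?N \<ge> y - 1" "?N \<ge> 2" using y by linarith+
    have "y / 12 \<le> real ?N / 6" using N(1) y by linarith
    also have "... \<le> psi ?N" using psi_ge[OF N(2)] by simp
    also have "... = (\<Sum>d\<in>{d\<in>{1..?N}. primepow d}. mangoldt d)"
      unfolding psi_def by (rule sum.mono_neutral_right) (auto simp: mangoldt_def)
    also have "... \<le> (\<Sum>d\<in>{d\<in>{1..?N}. primepow d}. ln y)"
    proof (rule sum_mono)
      fix d assume d: "d \<in> {d\<in>{1..?N}. primepow d}"
      have "real d \<le> y" using d y by (auto simp: le_nat_iff le_floor_iff)
      moreover have "mangoldt d \<le> ln (real d)" using d by (intro mangoldt_le) auto
      moreover have "ln (real d) \<le> ln y" using d calculation(1) by (subst ln_le_cancel_iff) auto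
      ultimately show "mangoldt d \<le> ln y" by linarith
    qed
    also have "... = real (card {d\<in>{1..?N}. primepow d}) * ln y" by simp
    also have "... \<le> (real (card (primes_le y)) + 2 * sqrt y) * ln y"
    proof (intro mult_right_mono)
      have fin: "finite {d. primepow d \<and> \<not> prime d \<and> real d \<le> y}"
        by (rule finite_subset[OF _ finite_nat_real_le[of y]]) auto
      have "card {d\<in>{1..?N}. primepow d} \<le> card (primes_le y \<union> {d. primepow d \<and> \<not> prime d \<and> real d \<le> y})"
        using y fin by (intro card_mono) (auto simp: le_nat_iff le_floor_iff)
      also have "... \<le> card (primes_le y) + card {d. primepow d \<and> \<not> prime d \<and> real d \<le> y}" by (rule card_Un_le)
      finally show "real (card {d\<in>{1..?N}. primepow d}) \<le> real (card (primes_le y)) + 2 * sqrt y"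
        using card_nonprime_primepow_le[of y] y by linarith
    qed (use y in auto)
    finally have "y / (12 * ln y) \<le> real (card (primes_le y)) + 2 * sqrt y"
      using y by (simp add: field_simps)
    moreover have "2 * sqrt y \<le> y / (24 * ln y)" using Y y by auto
    moreover have "y / (12 * ln y) = 2 * (y / (24 * ln y))" by simp
    ultimately show "real (card (primes_le y)) \<ge> y / (24 * ln y)" by linarith
  qed
qed

section \<open>Dirichlet convolution and real characters\<close>

abbreviation fivl :: "real \<Rightarrow> real \<Rightarrow> nat set" where "fivl X Y \<equiv> {nat \<lfloor>X\<rfloor><..nat \<lfloor>Y\<rfloor>}"
definition ivl :: "real \<Rightarrow> nat set" where "ivl Y = {1..nat \<lfloor>Y\<rfloor>}"

lemma mem_ivl: "n \<in> ivl Y \<longleftrightarrow> 1 \<le> n \<and> real n \<le> Y"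
proof (cases "Y \<ge> 0")
  case True
  then show ?thesis by (auto simp: ivl_def le_nat_iff le_floor_iff)
next
  case False
  then show ?thesis by (auto simp: ivl_def)
qed

lemma finite_ivl [simp, intro]: "finite (ivl Y)"
  by (simp add: ivl_def)

lemma card_ivl_le: "Y \<ge> 0 \<Longrightarrow> real (card (ivl Y)) \<le> Y"
  by (simp add: ivl_def)

lemma ivl_mono: "Y \<le> Z \<Longrightarrow> ivl Y \<subseteq> ivl Z"
  by (auto simp: mem_ivl)

lemma div_dvd_self: "d dvd n \<Longrightarrow> n div d dvd (n::nat)"
  by (metis dvd_div_mult_self dvd_triv_left)

lemma div_pos_of_dvd: "d dvd n \<Longrightarrow> n > 0 \<Longrightarrow> n div d > (0::nat)"
  by (meson div_dvd_self dvd_pos_nat)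

lemma sum_divisors_ivl:
  fixes G :: "nat \<Rightarrow> nat \<Rightarrow> real"
  shows "(\<Sum>n\<in>ivl Y. \<Sum>d | d dvd n. G d (n div d)) = (\<Sum>a\<in>ivl Y. \<Sum>b\<in>ivl (Y / real a). G a b)"
proof -
  have fin: "finite {d. d dvd n}" if "n \<in> ivl Y" for n
    using that by (intro finite_divisors_nat) (auto simp: mem_ivl)
  have "(\<Sum>n\<in>ivl Y. \<Sum>d | d dvd n. G d (n div d)) = (\<Sum>(n,d)\<in>(SIGMA n:ivl Y. {d. d dvd n}). G d (n div d))"
    using fin by (subst sum.Sigma) auto
  also have "... = (\<Sum>(a,b)\<in>(SIGMA a:ivl Y. ivl (Y / real a)). G a b)"
  proof (rule sum.reindex_bij_witness[where i = "\<lambda>(a,b). (a * b, a)" and j = "\<lambda>(n,d). (d, n div d)"], goal_cases)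
    case (2 x)
    then obtain n d where x: "x = (n,d)" "n \<in> ivl Y" "d dvd n" by auto
    then have n: "n \<ge> 1" "real n \<le> Y" "d \<le> n" "d \<ge> 1" by (auto simp: mem_ivl dvd_imp_le Suc_le_eq intro: Nat.gr0I)
    have "real (n div d) = real n / real d" using x by (simp add: real_of_nat_div)
    moreover have "n div d \<ge> 1" using n x div_pos_of_dvd[of d n] by simp
    ultimately show ?case using x n by (auto simp: mem_ivl divide_right_mono)
  next
    case (4 x)
    then obtain a b where x: "x = (a,b)" "a \<in> ivl Y" "b \<in> ivl (Y / real a)" by auto
    then have "real (a * b) \<le> Y" by (auto simp: mem_ivl field_simps)
    then show ?case using x by (auto simp: mem_ivl)
  qed (auto simp: mem_ivl)
  also have "... = (\<Sum>a\<in>ivl Y. \<Sum>b\<in>ivl (Y / real a). G a b)"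
    by (subst sum.Sigma) auto
  finally show ?thesis .
qed

lemma ivl_dvd: "e > 0 \<Longrightarrow> {n \<in> ivl Y. e dvd n} = (\<lambda>m. e * m) ` ivl (Y / real e)"
  by (auto simp: mem_ivl field_simps intro!: image_eqI elim!: dvdE intro: Nat.gr0I)

lemma sum_ivl_dvd:
  fixes f :: "nat \<Rightarrow> real"
  assumes "e > 0"
  shows "(\<Sum>n | n \<in> ivl Y \<and> e dvd n. f n) = (\<Sum>m\<in>ivl (Y / real e). f (e * m))"
  unfolding ivl_dvd[OF assms] using assms by (subst sum.reindex) (auto simp: inj_on_def)

definition conv :: "(nat \<Rightarrow> real) \<Rightarrow> (nat \<Rightarrow> real) \<Rightarrow> nat \<Rightarrow> real" where
  "conv f g n = (\<Sum>d | d dvd n. f d * g (n div d))"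

definition multf :: "(nat \<Rightarrow> real) \<Rightarrow> bool" where
  "multf f \<longleftrightarrow> f 1 = 1 \<and> (\<forall>a b. a > 0 \<longrightarrow> b > 0 \<longrightarrow> coprime a b \<longrightarrow> f (a * b) = f a * f b)"

lemma multfD: "multf f \<Longrightarrow> a > 0 \<Longrightarrow> b > 0 \<Longrightarrow> coprime a b \<Longrightarrow> f (a * b) = f a * f b"
  by (simp add: multf_def)

lemma multf_1: "multf f \<Longrightarrow> f (Suc 0) = 1"
  by (simp add: multf_def)

text \<open>Splitting off a full prime power leaves a coprime cofactor, which is the situation
  multiplicativity can use; relations between multiplicative functions then need checking at prime
  powers only.\<close>

lemma prime_power_induct [consumes 1, case_names one step]:
  assumes "n > 0" "P (1::nat)"
    "\<And>p k n. prime p \<Longrightarrow> k > 0 \<Longrightarrow> n > 0 \<Longrightarrow> coprime (p ^ k) n \<Longrightarrow> P n \<Longrightarrow> P (p ^ k * n)"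
  shows "P n"
  using assms(1)
proof (induction n rule: less_induct)
  case (less n)
  show ?case
  proof (cases "n = 1")
    case False
    then obtain p where p: "prime p" "p dvd n" using prime_factor_nat by blast
    obtain m where m: "n = p ^ multiplicity p n * m" "\<not> p dvd m"
      using multiplicity_decompose'[of n p] less.prems p by (metis not_prime_unit gr_implies_not0)
    have k: "multiplicity p n > 0" using p less.prems by (simp add: prime_multiplicity_gt_zero_iff)
    have m0: "m > 0" using m less.prems by (metis gr0I mult_0_right)
    have "p ^ multiplicity p n > 1" using p k by (metis one_less_power prime_gt_1_nat)
    then have "m < n" using m(1) m0 by (metis mult_less_cancel2 nat_mult_1)
    moreover have "coprime (p ^ multiplicity p n) m" using p m by (metis coprime_power_left_iff prime_imp_coprime)
    ultimately show ?thesis using assms(3)[OF p(1) k m0] less.IH m0 m(1) by metis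
  qed (use assms in auto)
qed

lemma multf_eqI:
  assumes "multf f" "multf g" "\<And>p k. prime p \<Longrightarrow> k > 0 \<Longrightarrow> f (p ^ k) = g (p ^ k)" "n > 0"
  shows "f n = g n"
  using assms(4)
proof (induction n rule: prime_power_induct)
  case (step p k n)
  then show ?case using assms(1-3) by (simp add: multfD prime_gt_0_nat)
qed (use assms in \<open>auto simp: multf_def\<close>)

lemma multf_abs_le:
  assumes "multf f" "multf g" "\<And>p k. prime p \<Longrightarrow> k > 0 \<Longrightarrow> \<bar>f (p ^ k)\<bar> \<le> g (p ^ k)" "n > 0"
  shows "\<bar>f n\<bar> \<le> g n"
  using assms(4)
proof (induction n rule: prime_power_induct)
  case (step p k n)
  then show ?case using assms(1,2) assms(3)[of p k]
    by (simp add: multfD prime_gt_0_nat abs_mult mult_mono')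
qed (use assms in \<open>auto simp: multf_def\<close>)

lemma multf_nonneg:
  assumes "multf g" "\<And>p k. prime p \<Longrightarrow> k > 0 \<Longrightarrow> 0 \<le> g (p ^ k)" "n > 0"
  shows "0 \<le> g n"
  using assms(3)
proof (induction n rule: prime_power_induct)
  case (step p k n)
  then show ?case using assms(1,2) by (simp add: multfD prime_gt_0_nat)
qed (use assms in \<open>auto simp: multf_def\<close>)

text \<open>Coprimality makes the decomposition of a divisor unique: its two parts are its gcds with
  \<open>a\<close> and with \<open>b\<close>.\<close>

lemma sum_divisors_coprime:
  fixes F :: "nat \<Rightarrow> real"
  assumes "a > 0" "b > 0" "coprime a b"
  shows "(\<Sum>d | d dvd a * b. F d) = (\<Sum>d | d dvd a. \<Sum>e | e dvd b. F (d * e))"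
proof -
  have g: "gcd (d * e) a = d \<and> gcd (d * e) b = e" if "d dvd a" "e dvd b" for d e
  proof -
    have "coprime a e" using coprime_divisors[OF dvd_refl that(2)] assms(3) by simp
    moreover have "coprime b d" using coprime_divisors[OF that(1) dvd_refl] assms(3) by (simp add: coprime_commute)
    ultimately show ?thesis using that gcd_mult_left_right_cancel[of a e d] gcd_mult_left_left_cancel[of b d e]
      by (simp add: gcd_nat.absorb1)
  qed
  have "(\<Sum>d | d dvd a. \<Sum>e | e dvd b. F (d * e)) = (\<Sum>(d,e)\<in>{d. d dvd a} \<times> {e. e dvd b}. F (d * e))"
    by (rule sum.cartesian_product)
  also have "... = (\<Sum>d | d dvd a * b. F d)"
  proof (rule sum.reindex_bij_witness[where i = "\<lambda>d. (gcd d a, gcd d b)" and j = "\<lambda>(d,e). d * e"], goal_cases)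
    case (1 x)
    then obtain d e where x: "x = (d,e)" "d dvd a" "e dvd b" by auto
    then show ?case using g[of d e] by simp
  next
    case (3 d)
    then obtain d1 d2 where "d = d1 * d2" "d1 dvd a" "d2 dvd b" using division_decomp[of d a b] by auto
    then show ?case using g[of d1 d2] by simp
  qed (auto intro: mult_dvd_mono)
  finally show ?thesis ..
qed

lemma multf_conv:
  assumes "multf f" "multf g"
  shows "multf (conv f g)"
  unfolding multf_def
proof (intro conjI allI impI)
  show "conv f g 1 = 1" using assms by (simp add: conv_def multf_def)
  fix a b :: nat assume ab: "a > 0" "b > 0" "coprime a b"
  have "conv f g (a * b) = (\<Sum>d | d dvd a. \<Sum>e | e dvd b. f (d * e) * g (a * b div (d * e)))"
    unfolding conv_def using ab by (rule sum_divisors_coprime)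
  also have "... = (\<Sum>d | d dvd a. \<Sum>e | e dvd b. (f d * g (a div d)) * (f e * g (b div e)))"
  proof (intro sum.cong refl)
    fix d e assume "d \<in> {d. d dvd a}" "e \<in> {e. e dvd b}"
    then have de: "d dvd a" "e dvd b" by auto
    then have pos: "d > 0" "e > 0" "a div d > 0" "b div e > 0" using ab div_pos_of_dvd dvd_pos_nat by blast+
    have "a * b div (d * e) = (a div d) * (b div e)" using de by (simp add: div_mult_div_if_dvd)
    moreover have "coprime d e" using de ab(3) coprime_divisors by blast
    moreover have "coprime (a div d) (b div e)" using de ab(3) by (meson coprime_divisors div_dvd_self)
    ultimately show "f (d * e) * g (a * b div (d * e)) = (f d * g (a div d)) * (f e * g (b div e))"
      using assms pos by (simp add: multfD)
  qed
  also have "... = conv f g a * conv f g b" by (simp add: conv_def sum_product)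
  finally show "conv f g (a * b) = conv f g a * conv f g b" .
qed

text \<open>Both sides run over the ordered factorisations of \<open>n\<close> into three factors;
  this is the associativity of \<open>conv\<close>.\<close>

lemma sum_divisors_swap:
  fixes F :: "nat \<Rightarrow> nat \<Rightarrow> nat \<Rightarrow> real"
  assumes "n > 0"
  shows "(\<Sum>d | d dvd n. \<Sum>e | e dvd d. F e (d div e) (n div d))
       = (\<Sum>e | e dvd n. \<Sum>f | f dvd n div e. F e f (n div e div f))"
proof -
  have fin: "finite {d. d dvd m}" if "m dvd n" for m using that assms by (intro finite_divisors_nat) (auto intro: dvd_pos_nat)
  have "(\<Sum>d | d dvd n. \<Sum>e | e dvd d. F e (d div e) (n div d)) =
        (\<Sum>(d,e)\<in>(SIGMA d:{d. d dvd n}. {e. e dvd d}). F e (d div e) (n div d))"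
    using fin by (subst sum.Sigma) auto
  also have "... = (\<Sum>(e,f)\<in>(SIGMA e:{e. e dvd n}. {f. f dvd n div e}). F e f (n div e div f))"
  proof (rule sum.reindex_bij_witness[where i = "\<lambda>(e,f). (e * f, e)" and j = "\<lambda>(d,e). (e, d div e)"], goal_cases)
    case (2 x)
    then obtain d e where x: "x = (d,e)" "d dvd n" "e dvd d" by auto
    then show ?case by (auto intro: dvd_trans div_dvd_div[THEN iffD2])
  next
    case (4 x)
    then obtain e f where x: "x = (e,f)" "e dvd n" "f dvd n div e" by auto
    then have "e * f dvd n" using assms by (metis dvd_mult_div_cancel mult_dvd_mono dvd_refl)
    then show ?case using x by auto
  next
    case (3 x)
    then show ?case using assms by (auto dest: dvd_pos_nat)
  next
    case (5 x)
    then obtain d e where x: "x = (d,e)" "d dvd n" "e dvd d" by auto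
    then have "n div e div (d div e) = n div d" by (metis div_mult2_eq dvd_mult_div_cancel)
    then show ?case using x by simp
  qed auto
  also have "... = (\<Sum>e | e dvd n. \<Sum>f | f dvd n div e. F e f (n div e div f))"
    using fin assms by (subst sum.Sigma) (auto intro!: finite_divisors_nat div_pos_of_dvd)
  finally show ?thesis .
qed

lemma conv_assoc: "n > 0 \<Longrightarrow> conv (conv f g) h n = conv f (conv g h) n"
  unfolding conv_def
  using sum_divisors_swap[of n "\<lambda>e k l. f e * g k * h l"]
  by (simp add: sum_distrib_left sum_distrib_right mult.assoc)

lemma conv_cong:
  "(\<And>d. d dvd n \<Longrightarrow> f d = f' d) \<Longrightarrow> (\<And>d. d dvd n \<Longrightarrow> g d = g' d) \<Longrightarrow> conv f g n = conv f' g' n"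
  unfolding conv_def by (intro sum.cong refl) (simp add: div_dvd_self)

lemma conv_one_mangoldt: "n > 0 \<Longrightarrow> conv (\<lambda>_. 1) mangoldt n = ln (real n)"
proof -
  assume n: "n > 0"
  have "conv (\<lambda>_. 1) mangoldt n = (\<Sum>d | d dvd n. mangoldt (n div d))" by (simp add: conv_def)
  also have "... = (\<Sum>d | d dvd n. mangoldt d)"
    by (rule sum.reindex_bij_witness[where i = "\<lambda>d. n div d" and j = "\<lambda>d. n div d"])
       (use n in \<open>auto simp: div_div_eq_right dvd_div_eq_mult\<close>)
  also have "... = ln (real n)" using mangoldt_sum[of n, where ?'a = real] n by simp
  finally show ?thesis .
qed

lemma sum_divisors_prime_power:
  fixes F :: "nat \<Rightarrow> real"
  assumes "prime p"
  shows "(\<Sum>d | d dvd p ^ k. F d) = (\<Sum>i\<le>k. F (p ^ i))"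
proof -
  have "{d. d dvd p ^ k} = (\<lambda>i. p ^ i) ` {..k}"
    using assms by (auto simp: divides_primepow_nat)
  moreover have "inj_on (\<lambda>i. p ^ i) {..k}"
    using assms by (auto simp: inj_on_def dest: prime_power_inj)
  ultimately show ?thesis by (simp add: sum.reindex)
qed

lemma conv_prime_power:
  assumes "prime p"
  shows "conv f g (p ^ k) = (\<Sum>i\<le>k. f (p ^ i) * g (p ^ (k - i)))"
  unfolding conv_def sum_divisors_prime_power[OF assms]
  using assms by (intro sum.cong refl) (auto simp: power_diff)

section \<open>Partial summation and sums of periodic functions\<close>

lemma abel_identity:
  fixes c \<phi> :: "nat \<Rightarrow> real"
  assumes "m \<le> N"
  shows "(\<Sum>n\<in>{m<..N}. c n * \<phi> n) = (\<Sum>n\<in>{m<..N}. c n) * \<phi> N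
          + (\<Sum>k\<in>{m..<N}. (\<Sum>n\<in>{m<..k}. c n) * (\<phi> k - \<phi> (Suc k)))"
  using assms
proof (induction N rule: dec_induct)
  case (step N)
  have "{m<..Suc N} = insert (Suc N) {m<..N}" using step by auto
  then show ?case using step by (simp add: algebra_simps)
qed simp

lemma abel_dec:
  fixes c \<phi> :: "nat \<Rightarrow> real"
  assumes "\<And>k. m \<le> k \<Longrightarrow> k \<le> N \<Longrightarrow> \<bar>\<Sum>n\<in>{m<..k}. c n\<bar> \<le> S"
    and "\<And>n. m < n \<Longrightarrow> n < N \<Longrightarrow> \<phi> (Suc n) \<le> \<phi> n" and "\<phi> N \<ge> 0" and "m < N"
  shows "\<bar>\<Sum>n\<in>{m<..N}. c n * \<phi> n\<bar> \<le> S * \<phi> (Suc m)"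
proof -
  \<comment> \<open>The value at \<open>m\<close> does not occur on the left. Setting it to
    \<open>\<phi> (Suc m)\<close> makes the first difference vanish, so that the bound telescopes to
    \<open>\<phi> (Suc m)\<close>.\<close>
  let ?\<psi> = "\<lambda>n. if n = m then \<phi> (Suc m) else \<phi> n"
  have S0: "S \<ge> 0" using assms(1)[of m] assms(4) by force
  have "(\<Sum>n\<in>{m<..N}. c n * \<phi> n) = (\<Sum>n\<in>{m<..N}. c n * ?\<psi> n)" by (intro sum.cong) auto
  also have "... = (\<Sum>n\<in>{m<..N}. c n) * ?\<psi> N
          + (\<Sum>k\<in>{m..<N}. (\<Sum>n\<in>{m<..k}. c n) * (?\<psi> k - ?\<psi> (Suc k)))"
    using assms by (intro abel_identity) auto
  finally have eq: "(\<Sum>n\<in>{m<..N}. c n * \<phi> n) = ..." .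
  have "\<bar>\<Sum>n\<in>{m<..N}. c n * \<phi> n\<bar> \<le> \<bar>(\<Sum>n\<in>{m<..N}. c n) * ?\<psi> N\<bar>
     + (\<Sum>k\<in>{m..<N}. \<bar>(\<Sum>n\<in>{m<..k}. c n) * (?\<psi> k - ?\<psi> (Suc k))\<bar>)"
    unfolding eq by (rule order_trans[OF abs_triangle_ineq]) (intro add_left_mono sum_abs)
  also have "... \<le> S * ?\<psi> N + (\<Sum>k\<in>{m..<N}. S * (?\<psi> k - ?\<psi> (Suc k)))"
  proof (intro add_mono sum_mono)
    show "\<bar>(\<Sum>n\<in>{m<..N}. c n) * ?\<psi> N\<bar> \<le> S * ?\<psi> N"
      using assms(1)[of N] assms(3,4) by (auto simp: abs_mult intro!: mult_right_mono)
    fix k assume k: "k \<in> {m..<N}"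
    have "?\<psi> k - ?\<psi> (Suc k) \<ge> 0" using assms(2)[of k] k by auto
    then show "\<bar>(\<Sum>n\<in>{m<..k}. c n) * (?\<psi> k - ?\<psi> (Suc k))\<bar> \<le> S * (?\<psi> k - ?\<psi> (Suc k))"
      unfolding abs_mult using assms(1)[of k] k by (simp only: abs_of_nonneg) (intro mult_right_mono, auto)
  qed
  also have "... = S * ?\<psi> N + S * (?\<psi> m - ?\<psi> N)"
    using assms(4) sum_Suc_diff'[of m N "\<lambda>k. - ?\<psi> k"] by (simp add: sum_distrib_left[symmetric])
  also have "... = S * \<phi> (Suc m)" by (simp add: algebra_simps)
  finally show ?thesis .
qed

text \<open>The function \<open>\<phi> N - \<phi> n\<close> decreases in \<open>n\<close>, so
  \<open>abel_dec\<close> applies to it; the constant \<open>\<phi> N\<close> contributes the other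
  half of the factor 2.\<close>

lemma abel_inc:
  fixes c \<phi> :: "nat \<Rightarrow> real"
  assumes "\<And>k. m \<le> k \<Longrightarrow> k \<le> N \<Longrightarrow> \<bar>\<Sum>n\<in>{m<..k}. c n\<bar> \<le> S"
    and "\<And>n. m < n \<Longrightarrow> n < N \<Longrightarrow> \<phi> n \<le> \<phi> (Suc n)" and "\<phi> (Suc m) \<ge> 0" and "m < N"
  shows "\<bar>\<Sum>n\<in>{m<..N}. c n * \<phi> n\<bar> \<le> 2 * S * \<phi> N"
proof -
  have S0: "S \<ge> 0" using assms(1)[of m] assms(4) by force
  have mono: "\<phi> n \<le> \<phi> N" if "m < n" "n \<le> N" for n
    using that(2,1) by (induction n rule: inc_induct) (use assms(2) in \<open>auto intro: order_trans\<close>)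
  have "\<bar>\<Sum>n\<in>{m<..N}. c n * (\<phi> N - \<phi> n)\<bar> \<le> S * (\<phi> N - \<phi> (Suc m))"
    using assms by (intro abel_dec) auto
  moreover have "(\<Sum>n\<in>{m<..N}. c n * (\<phi> N - \<phi> n)) = (\<Sum>n\<in>{m<..N}. c n) * \<phi> N - (\<Sum>n\<in>{m<..N}. c n * \<phi> n)"
    by (simp add: algebra_simps sum_subtractf sum_distrib_left)
  moreover have "\<bar>(\<Sum>n\<in>{m<..N}. c n) * \<phi> N\<bar> \<le> S * \<phi> N"
    using assms(1)[of N] assms(3,4) mono[of "Suc m"] by (auto simp: abs_mult intro!: mult_mono)
  moreover have "S * (\<phi> N - \<phi> (Suc m)) \<le> S * \<phi> N" using assms(3) S0 by (intro mult_left_mono) auto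
  ultimately show ?thesis by linarith
qed

text \<open>A full period sums to zero, so every initial sum equals one over less than a period, and
  an interval is a difference of two initial sums.\<close>

lemma periodic_sum_bound:
  fixes f :: "nat \<Rightarrow> real"
  assumes per: "\<And>n. f (n + q) = f n" and z: "(\<Sum>n<q. f n) = 0" and q: "q > 0" and "(\<Sum>n<q. \<bar>f n\<bar>) \<le> S"
  shows "\<bar>\<Sum>n\<in>{a<..b}. f n\<bar> \<le> 2 * S"
proof -
  define F where "F = (\<lambda>N. \<Sum>n<N. f n)"
  have F: "F (N + q) = F N" for N
    by (induction N) (use z per in \<open>auto simp: F_def\<close>)
  have F': "F (N + k * q) = F N" for N k
    by (induction k) (use F in \<open>auto simp: add.assoc[symmetric] add.commute[of q] add.left_commute\<close>)
  have Fb: "\<bar>F N\<bar> \<le> S" for N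
  proof -
    have "F N = F (N mod q)" using F'[of "N mod q" "N div q"] by simp
    also have "\<bar>...\<bar> \<le> (\<Sum>n<N mod q. \<bar>f n\<bar>)" unfolding F_def by (rule sum_abs)
    also have "... \<le> (\<Sum>n<q. \<bar>f n\<bar>)" using q by (intro sum_mono2) (auto intro: less_trans[OF _ mod_less_divisor])
    finally show ?thesis using assms(4) by linarith
  qed
  show ?thesis
  proof (cases "a \<le> b")
    case True
    then have "{..<Suc b} = {..<Suc a} \<union> {a<..b}" by auto
    moreover have "(\<Sum>n\<in>{..<Suc a} \<union> {a<..b}. f n) = F (Suc a) + (\<Sum>n\<in>{a<..b}. f n)"
      unfolding F_def by (rule sum.union_disjoint) auto
    ultimately have "(\<Sum>n\<in>{a<..b}. f n) = F (Suc b) - F (Suc a)" by (simp add: F_def)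
    then show ?thesis using Fb[of "Suc a"] Fb[of "Suc b"] by linarith
  next
    case False
    then show ?thesis using Fb[of 0] by simp
  qed
qed

text \<open>Multiplication by a unit permutes the residues modulo \<open>q\<close>.\<close>

lemma sum_mult_residues:
  fixes f :: "nat \<Rightarrow> real"
  assumes per: "\<And>n. f (n + q) = f n" and q: "q > 0" and t: "coprime t q"
  shows "(\<Sum>n<q. f (t * n)) = (\<Sum>n<q. f n)"
proof -
  have per': "f (n + k * q) = f n" for n k
    by (induction k) (use per in \<open>auto simp: add.assoc[symmetric] add.commute[of q] add.left_commute\<close>)
  have fmod: "f n = f (n mod q)" for n using per'[of "n mod q" "n div q"] by simp
  have inj: "inj_on (\<lambda>n. (t * n) mod q) {..<q}"
  proof (rule inj_onI)
    fix m n assume mn: "m \<in> {..<q}" "n \<in> {..<q}" "(t * m) mod q = (t * n) mod q"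
    then have "[t * m = t * n] (mod q)" by (simp add: cong_def)
    then have "[m = n] (mod q)" using t by (simp add: cong_mult_lcancel_nat)
    then show "m = n" using mn by (simp add: cong_def)
  qed
  then have img: "(\<lambda>n. (t * n) mod q) ` {..<q} = {..<q}"
    using q by (intro endo_inj_surj) auto
  have "(\<Sum>n<q. f (t * n)) = (\<Sum>n<q. f ((t * n) mod q))" using fmod by (intro sum.cong) auto
  also have "... = (\<Sum>n\<in>(\<lambda>n. (t * n) mod q) ` {..<q}. f n)" using inj by (simp add: sum.reindex)
  finally show ?thesis by (simp add: img)
qed

text \<open>A real non-principal character restricted to the natural numbers. Non-principality is
  encoded as \<open>sum_chi\<close>, the form in which it bounds all partial sums of
  \<open>ch\<close>.\<close>

locale rchar =
  fixes q :: nat and ch :: "nat \<Rightarrow> real"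
  assumes q1: "q > 1"
    and per: "ch (n + q) = ch n"
    and chi_mult: "ch (m * n) = ch m * ch n"
    and chi_vals: "ch n \<in> {-1, 0, 1}"
    and chi_zero_iff: "ch n = 0 \<longleftrightarrow> \<not> coprime n q"
    and sum_chi: "(\<Sum>n<q. ch n) = 0"
begin

abbreviation phq :: real where "phq \<equiv> real (totient q)"

lemma chi_abs_le: "\<bar>ch n\<bar> \<le> 1" using chi_vals[of n] by auto
lemma chi_1: "ch 1 = 1" using chi_mult[of 1 1] chi_zero_iff[of 1] chi_vals[of 1] by auto
lemma chi_Suc0 [simp]: "ch (Suc 0) = 1" using chi_1 by simp
lemma chi_power: "ch (n ^ k) = ch n ^ k" by (induction k) (auto simp: chi_mult chi_1)
lemma multf_chi: "multf ch" by (auto simp: multf_def chi_mult chi_1)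
lemma chi_0 [simp]: "ch 0 = 0" using chi_zero_iff[of 0] q1 by auto

lemma chi_cong: "[m = n] (mod q) \<Longrightarrow> ch m = ch n"
proof -
  have per': "ch (n + k * q) = ch n" for n k
    by (induction k) (use per in \<open>auto simp: add.assoc[symmetric] add.commute[of q] add.left_commute\<close>)
  have "ch n = ch (n mod q)" for n using per'[of "n mod q" "n div q"] by simp
  then show "[m = n] (mod q) \<Longrightarrow> ch m = ch n" by (metis cong_def)
qed

lemma sum_chi_bound: "\<bar>\<Sum>n\<in>{a<..b}. ch n\<bar> \<le> 2 * real q"
proof (rule periodic_sum_bound[where q = q])
  show "(\<Sum>n<q. \<bar>ch n\<bar>) \<le> real q"
    using sum_bounded_above[of "{..<q}" "\<lambda>n. \<bar>ch n\<bar>" 1] chi_abs_le by simp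
qed (use per sum_chi q1 in auto)

definition lam :: "nat \<Rightarrow> real" where "lam n = (\<Sum>d | d dvd n. ch d)"

lemma lam_conv: "lam = conv ch (\<lambda>_. 1)" by (auto simp: lam_def conv_def)

lemma multf_lam: "multf lam"
  unfolding lam_conv by (rule multf_conv[OF multf_chi]) (simp add: multf_def)

lemma lam_1 [simp]: "lam (Suc 0) = 1" using multf_1[OF multf_lam] .
lemma lam_0 [simp]: "lam 0 = 0" by (simp add: lam_def)

lemma lam_prime_power: "prime p \<Longrightarrow> lam (p ^ k) = (\<Sum>i\<le>k. ch p ^ i)"
  by (simp add: lam_def sum_divisors_prime_power chi_power)

lemma lam_prime: "prime p \<Longrightarrow> lam p = 1 + ch p"
  using lam_prime_power[of p 1] by simp

lemma lam_prime_power_cases: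
  assumes "prime p"
  shows "lam (p ^ k) = (if ch p = 1 then real k + 1 else if ch p = 0 then 1 else if even k then 1 else 0)"
proof -
  consider "ch p = 1" | "ch p = 0" | "ch p = -1" using chi_vals[of p] by auto
  then show ?thesis
  proof cases
    case 2
    then have "(\<Sum>i\<le>k. ch p ^ i) = (\<Sum>i\<in>{0}. ch p ^ i)" by (intro sum.mono_neutral_right) auto
    then show ?thesis using 2 assms by (simp add: lam_prime_power)
  next
    case 3
    have "(\<Sum>i\<le>k. (-1) ^ i) = (if even k then 1 else (0::real))" by (induction k) auto
    then show ?thesis using 3 assms by (simp add: lam_prime_power)
  qed (use assms in \<open>simp add: lam_prime_power\<close>)
qed

lemma lam_nonneg [simp]: "lam n \<ge> 0"
proof (cases "n > 0")
  case True
  then show ?thesis by (rule multf_nonneg[OF multf_lam, rotated]) (auto simp: lam_prime_power_cases)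
qed auto

text \<open>All exponents of a square are even, and then every local factor of \<open>lam\<close> is
  at least 1. These squares are what keeps \<open>L1\<close> away from 0.\<close>

lemma lam_square_ge: "m > 0 \<Longrightarrow> lam (m\<^sup>2) \<ge> 1"
proof (induction m rule: prime_power_induct)
  case (step p k n)
  have "coprime ((p ^ k)\<^sup>2) (n\<^sup>2)" using step by (simp add: coprime_power_left_iff coprime_power_right_iff)
  then have "lam ((p ^ k * n)\<^sup>2) = lam ((p ^ k)\<^sup>2) * lam (n\<^sup>2)"
    using step by (simp add: power_mult_distrib multfD[OF multf_lam] prime_gt_0_nat)
  moreover have "lam ((p ^ k)\<^sup>2) \<ge> 1"
    using step by (simp add: power_mult[symmetric] lam_prime_power_cases)
  ultimately show ?case using step.IH mult_mono[of 1 "lam ((p ^ k)\<^sup>2)" 1 "lam (n\<^sup>2)"] by simp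
qed simp

lemma lam_le: "lam n \<le> real n"
proof -
  have "lam n \<le> (\<Sum>d | d dvd n. 1)" unfolding lam_def using chi_abs_le by (intro sum_mono) (auto simp: abs_le_iff)
  also have "... = real (card {d. d dvd n})" by simp
  also have "... \<le> real n"
  proof (cases "n = 0")
    case False
    then have "card {d. d dvd n} \<le> card {1..n}" by (intro card_mono) (auto simp: dvd_imp_le Suc_le_eq intro: Nat.gr0I)
    then show ?thesis by simp
  qed simp
  finally show ?thesis .
qed

text \<open>The Euler factor of \<open>lam\<close> at \<open>p\<close> is the inverse of the
  quadratic 1 - (1 + ch p) x + ch p x^2, so its coefficients satisfy a recurrence of order two. It
  reduces \<open>lam\<close> on the multiples of \<open>p\<close> to \<open>lam\<close>
  itself.\<close>

lemma lam_hecke: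
  assumes "prime p" "m > 0"
  shows "lam (p * m) = lam p * lam m - ch p * (if p dvd m then lam (m div p) else 0)"
proof -
  obtain k m' where km: "m = p ^ k * m'" "\<not> p dvd m'"
    using multiplicity_decompose'[of m p] assms by (metis not_prime_unit gr_implies_not0)
  have cop: "coprime (p ^ i) m'" for i using assms km by (metis coprime_power_left_iff prime_imp_coprime)
  have pos: "p > 0" "m' > 0" using assms km by (auto simp: prime_gt_0_nat intro: Nat.gr0I)
  have l: "lam (p ^ i * m') = lam (p ^ i) * lam m'" for i
    using cop[of i] pos by (simp add: multfD[OF multf_lam])
  have rec: "lam (p ^ Suc (Suc j)) = lam p * lam (p ^ Suc j) - ch p * lam (p ^ j)" for j
  proof -
    have "ch p \<in> {-1,0,1}" by (rule chi_vals)
    then show ?thesis unfolding lam_prime_power_cases[OF assms(1)] lam_prime[OF assms(1)] by auto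
  qed
  show ?thesis
  proof (cases k)
    case 0
    then have "lam (p * m) = lam p * lam m" using km l[of 1] by simp
    then show ?thesis using km 0 by simp
  next
    case (Suc j)
    have "m div p = p ^ j * m'" using km Suc pos by (simp add: mult.assoc)
    moreover have "p * m = p ^ Suc (Suc j) * m'" using km Suc by simp
    moreover have "p dvd m" using km Suc by simp
    moreover have "lam m = lam (p ^ Suc j) * lam m'" unfolding km(1) Suc by (rule l)
    ultimately have "lam (p * m) = lam (p ^ Suc (Suc j)) * lam m'" "lam m = lam (p ^ Suc j) * lam m'"
      "(if p dvd m then lam (m div p) else 0) = lam (p ^ j) * lam m'"
      using l by presburger+
    then show ?thesis unfolding rec by (simp add: algebra_simps del: power_Suc)
  qed
qed

text \<open>\<open>nu\<close> is the Dirichlet inverse of \<open>lam\<close>, built from its local Euler factors.\<close>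

definition nup :: "nat \<Rightarrow> nat \<Rightarrow> real" where
  "nup p k = (if k = 0 then 1 else if k = 1 then - (1 + ch p) else if k = 2 then ch p else 0)"

definition nu :: "nat \<Rightarrow> real" where
  "nu n = (\<Prod>p\<in>prime_factors n. nup p (multiplicity p n))"

lemma multf_nu: "multf nu"
  unfolding multf_def
proof (intro conjI allI impI)
  fix a b :: nat assume ab: "a > 0" "b > 0" "coprime a b"
  have pf: "prime_factors (a * b) = prime_factors a \<union> prime_factors b"
    using ab by (intro prime_factors_product) auto
  have disj: "prime_factors a \<inter> prime_factors b = {}"
    using ab(3) by (auto simp: prime_factors_dvd dest: coprime_common_divisor not_prime_unit) 
  have 1: "multiplicity p (a * b) = multiplicity p a" if "p \<in> prime_factors a" for p
  proof -
    have "\<not> p dvd b" using that disj ab by (auto simp: prime_factors_dvd)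
    then have "multiplicity p b = 0" by (rule not_dvd_imp_multiplicity_0)
    moreover have "prime_elem p" using that by auto
    ultimately show ?thesis using ab by (subst prime_elem_multiplicity_mult_distrib) auto
  qed
  have 2: "multiplicity p (a * b) = multiplicity p b" if "p \<in> prime_factors b" for p
  proof -
    have "\<not> p dvd a" using that disj ab by (auto simp: prime_factors_dvd)
    then have "multiplicity p a = 0" by (rule not_dvd_imp_multiplicity_0)
    moreover have "prime_elem p" using that by auto
    ultimately show ?thesis using ab by (subst prime_elem_multiplicity_mult_distrib) auto
  qed
  show "nu (a * b) = nu a * nu b"
    unfolding nu_def pf using disj 1 2 by (subst prod.union_disjoint) auto
qed (simp add: nu_def)

lemma nu_prime_power: "prime p \<Longrightarrow> nu (p ^ k) = nup p k"
  by (cases "k = 0") (auto simp: nu_def nup_def prime_factorization_prime_power)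

text \<open>\<open>nup\<close> vanishes beyond exponent 2, so at a higher prime power only three
  terms are left, and their sum vanishes by \<open>lam_hecke\<close>.\<close>

lemma conv_nu_lam: "n > 0 \<Longrightarrow> conv nu lam n = (if n = 1 then 1 else 0)"
proof (rule multf_eqI[OF multf_conv[OF multf_nu multf_lam]])
  show "multf (\<lambda>n. if n = 1 then 1 else 0)" by (auto simp: multf_def)
  fix p k :: nat assume pk: "prime p" "k > 0"
  have "p ^ k \<noteq> 1" using pk by (metis one_less_power prime_gt_1_nat less_irrefl)
  have "conv nu lam (p ^ k) = (\<Sum>i\<le>k. nup p i * lam (p ^ (k - i)))"
    using pk by (simp add: conv_prime_power nu_prime_power)
  also have "... = 0"
  proof (cases "k = 1")
    case True
    then show ?thesis using pk by (simp add: nup_def lam_prime)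
  next
    case False
    then have j: "k = Suc (Suc (k - 2))" using pk by simp
    define j where "j = k - 2"
    note j = j[folded j_def]
    have "(\<Sum>i\<le>k. nup p i * lam (p ^ (k - i))) = (\<Sum>i\<in>{0,1,2}. nup p i * lam (p ^ (k - i)))"
      by (intro sum.mono_neutral_right) (use j in \<open>auto simp: nup_def\<close>)
    also have "... = lam (p * p ^ Suc j) - (lam p * lam (p ^ Suc j) - ch p * lam (p ^ j))"
    proof -
      have "k - 1 = Suc j" "k - 2 = j" "p ^ k = p * p ^ Suc j" using j by auto
      then show ?thesis using pk(1) by (simp add: nup_def lam_prime algebra_simps)
    qed
    also have "... = 0"
    proof -
      have p0: "p > 0" using pk(1) by (rule prime_gt_0_nat)
      then have "p ^ Suc j div p = p ^ j" "p dvd p ^ Suc j" "p ^ Suc j > 0" by simp_all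
      then show ?thesis using lam_hecke[OF pk(1), of "p ^ Suc j"] by (simp del: power_Suc)
    qed
    finally show ?thesis .
  qed
  finally show "conv nu lam (p ^ k) = (if p ^ k = 1 then 1 else 0)" using \<open>p ^ k \<noteq> 1\<close> by simp
qed

text \<open>A comparison at prime powers suffices. The bound lets the tail of the truncated identity
  be majorised with the nonnegative weight \<open>conv lam lam\<close>.\<close>

lemma abs_nu_le: "n > 0 \<Longrightarrow> \<bar>nu n\<bar> \<le> lam n"
proof (rule multf_abs_le[OF multf_nu multf_lam])
  fix p k :: nat assume pk: "prime p" "k > 0"
  have "ch p \<in> {-1,0,1}" by (rule chi_vals)
  then show "\<bar>nu (p ^ k)\<bar> \<le> lam (p ^ k)"
    unfolding nu_prime_power[OF pk(1)] lam_prime_power_cases[OF pk(1)] nup_def by auto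
qed

text \<open>The coefficients of -zeta'(s) L(s, chi), which is zeta(s) L(s, chi) times -zeta'(s) /
  zeta(s).\<close>

definition lamp :: "nat \<Rightarrow> real" where "lamp = conv ch (\<lambda>n. ln (real n))"

lemma lamp_eq: "n > 0 \<Longrightarrow> lamp n = conv lam mangoldt n"
proof -
  assume n: "n > 0"
  have "lamp n = conv ch (conv (\<lambda>_. 1) mangoldt) n"
    unfolding lamp_def using n by (intro conv_cong) (auto simp: conv_one_mangoldt dvd_pos_nat)
  then show ?thesis using n by (simp add: conv_assoc lam_conv)
qed

definition nuB :: "real \<Rightarrow> nat \<Rightarrow> real" where "nuB B b = (if real b \<le> B then nu b else 0)"
definition cB :: "real \<Rightarrow> nat \<Rightarrow> real" where "cB B = conv (nuB B) lam"

text \<open>All divisors of such an \<open>n\<close> survive the cutoff in \<open>nuB\<close>, so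
  the full inverse relation \<open>conv_nu_lam\<close> applies.\<close>

lemma cB_small: "n > 0 \<Longrightarrow> real n \<le> B \<Longrightarrow> cB B n = (if n = 1 then 1 else 0)"
proof -
  assume n: "n > 0" "real n \<le> B"
  have "cB B n = conv nu lam n"
    unfolding cB_def using n by (intro conv_cong) (auto simp: nuB_def dest!: dvd_imp_le)
  then show ?thesis using n by (simp add: conv_nu_lam)
qed

lemma abs_cB_le: "n > 0 \<Longrightarrow> \<bar>cB B n\<bar> \<le> conv lam lam n"
  unfolding cB_def conv_def
proof (rule order_trans[OF sum_abs], rule sum_mono)
  fix d assume "n > 0" "d \<in> {d. d dvd n}"
  then have "d > 0" by (auto intro: dvd_pos_nat)
  then have "\<bar>nuB B d\<bar> \<le> lam d" using abs_nu_le by (auto simp: nuB_def)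
  then show "\<bar>nuB B d * lam (n div d)\<bar> \<le> lam d * lam (n div d)"
    by (simp add: abs_mult mult_right_mono)
qed

text \<open>
  This is \<open>mangoldt = nu * lamp\<close> with \<open>nu\<close> cut off at \<open>B\<close>. The first term is equidistributed in progressions; the
  second is supported on multiples of integers \<open>N > B\<close> with \<open>lam\<close>-weight, which an exceptional zero makes rare.
\<close>

lemma truncated_identity:
  assumes "n > 0" "B \<ge> 1"
  shows "mangoldt n = conv (nuB B) lamp n - (\<Sum>N | N dvd n \<and> real N > B. cB B N * mangoldt (n div N))"
proof -
  have fin: "finite {d. d dvd n}" using assms by (intro finite_divisors_nat)
  have "conv (nuB B) lamp n = conv (nuB B) (conv lam mangoldt) n"
    using assms by (intro conv_cong refl lamp_eq) (auto intro: dvd_pos_nat)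
  also have "... = conv (cB B) mangoldt n" using assms by (simp add: conv_assoc cB_def)
  also have "... = (\<Sum>N | N dvd n \<and> \<not> real N > B. cB B N * mangoldt (n div N))
                 + (\<Sum>N | N dvd n \<and> real N > B. cB B N * mangoldt (n div N))"
    unfolding conv_def using fin by (subst sum.union_disjoint[symmetric]) (auto intro!: sum.cong)
  also have "(\<Sum>N | N dvd n \<and> \<not> real N > B. cB B N * mangoldt (n div N)) = (\<Sum>N\<in>{1}. cB B N * mangoldt (n div N))"
    using assms fin cB_small by (intro sum.mono_neutral_right) (auto intro: dvd_pos_nat)
  also have "... = mangoldt n" using cB_small[of 1 B] assms by simp
  finally show ?thesis by simp
qed

end

lemma less_nat_floor_iff: "S \<ge> 0 \<Longrightarrow> nat \<lfloor>S\<rfloor> < a \<longleftrightarrow> S < real a"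
  by (metis le_nat_floor le_nat_iff not_le of_nat_0_le_iff of_nat_floor order_trans of_nat_le_iff)

section \<open>The value at 1 and the sum of the divisor twist\<close>

lemma mem_nat_floor_ivl: "0 \<le> S \<Longrightarrow> a \<in> fivl S Z \<longleftrightarrow> S < real a \<and> real a \<le> Z"
proof -
  assume S: "0 \<le> S"
  have "a \<le> nat \<lfloor>Z\<rfloor> \<longleftrightarrow> real a \<le> Z" if "S < real a"
    using mem_ivl[of a Z] that S by (auto simp: ivl_def)
  then show ?thesis using less_nat_floor_iff[OF S, of a] by auto
qed

text \<open>Dirichlet's hyperbola method: a > sqrt Y forces b \<le> sqrt Y. In both sums on the
  right the outer variable stays up to sqrt Y, while the inner one fills an interval in which
  cancellation can be used.\<close>

lemma hyperbola:
  fixes G :: "nat \<Rightarrow> nat \<Rightarrow> real"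
  assumes Y: "Y \<ge> 0"
  shows "(\<Sum>a\<in>ivl Y. \<Sum>b\<in>ivl (Y / real a). G a b) =
     (\<Sum>a\<in>ivl (sqrt Y). \<Sum>b\<in>ivl (Y / real a). G a b)
   + (\<Sum>b\<in>ivl (sqrt Y). \<Sum>a\<in>fivl (sqrt Y) (Y / real b). G a b)"
proof -
  have S0: "sqrt Y \<ge> 0" using Y by simp
  have SY: "sqrt Y * sqrt Y = Y" using Y by simp
  have le: "x \<le> Y" if "1 \<le> x" "x \<le> sqrt Y" for x
  proof -
    have "x * 1 \<le> sqrt Y * sqrt Y" using that by (intro mult_mono) linarith+
    then show ?thesis using SY by simp
  qed
  have split: "ivl Y = ivl (sqrt Y) \<union> {a\<in>ivl Y. sqrt Y < real a}"
    using le by (auto simp: mem_ivl)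
  have "(\<Sum>a\<in>{a\<in>ivl Y. sqrt Y < real a}. \<Sum>b\<in>ivl (Y / real a). G a b)
     = (\<Sum>(a,b)\<in>(SIGMA a:{a\<in>ivl Y. sqrt Y < real a}. ivl (Y / real a)). G a b)"
    by (subst sum.Sigma) auto
  also have "... = (\<Sum>(b,a)\<in>(SIGMA b:ivl (sqrt Y). fivl (sqrt Y) (Y / real b)). G a b)"
  proof (rule sum.reindex_bij_witness[where i = "\<lambda>(b,a). (a,b)" and j = "\<lambda>(a,b). (b,a)"], goal_cases)
    case (2 x)
    then obtain a b where x: "x = (a,b)" "1 \<le> a" "real a \<le> Y" "sqrt Y < real a" "1 \<le> b" "real b \<le> Y / real a"
      by (auto simp: mem_ivl)
    have ab: "real a * real b \<le> Y" using x by (simp add: field_simps)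
    have "real b \<le> sqrt Y"
    proof (rule ccontr)
      assume "\<not> real b \<le> sqrt Y"
      then have "sqrt Y * sqrt Y < real a * real b" using x S0 by (intro mult_strict_mono') auto
      then show False using ab SY by simp
    qed
    then show ?case using x ab S0 by (auto simp: mem_ivl mem_nat_floor_ivl field_simps simp del: greaterThanAtMost_iff)
  next
    case (4 x)
    then obtain a b where x: "x = (b,a)" "1 \<le> b" "real b \<le> sqrt Y" "sqrt Y < real a" "real a \<le> Y / real b"
      using S0 by (auto simp: mem_ivl mem_nat_floor_ivl simp del: greaterThanAtMost_iff)
    have ab: "real a * real b \<le> Y" using x by (simp add: field_simps)
    have a1: "a \<ge> 1" using x S0 by (cases a) auto
    have "real a * 1 \<le> real a * real b" using x by (intro mult_left_mono) auto
    then have "real a \<le> Y" using ab by linarith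
    then show ?case using x ab a1 by (auto simp: mem_ivl field_simps)
  qed auto
  also have "... = (\<Sum>b\<in>ivl (sqrt Y). \<Sum>a\<in>fivl (sqrt Y) (Y / real b). G a b)"
    by (subst sum.Sigma) auto
  finally have 2: "(\<Sum>a\<in>{a\<in>ivl Y. sqrt Y < real a}. \<Sum>b\<in>ivl (Y / real a). G a b) = ..." .
  have "(\<Sum>a\<in>ivl Y. \<Sum>b\<in>ivl (Y / real a). G a b) =
     (\<Sum>a\<in>ivl (sqrt Y). \<Sum>b\<in>ivl (Y / real a). G a b)
     + (\<Sum>a\<in>{a\<in>ivl Y. sqrt Y < real a}. \<Sum>b\<in>ivl (Y / real a). G a b)"
    by (subst split, rule sum.union_disjoint) (auto simp: mem_ivl)
  then show ?thesis using 2 by simp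
qed

text \<open>By the mean value theorem the quotient is (b - a) x^(-s) for some \<open>x\<close>
  between \<open>a\<close> and \<open>b\<close>.\<close>

lemma powr_diff_bounds:
  fixes a b s :: real
  assumes "0 < a" "a \<le> b" "s > 0" "s \<noteq> 1"
  shows "(b - a) * b powr (-s) \<le> (b powr (1 - s) - a powr (1 - s)) / (1 - s)"
    and "(b powr (1 - s) - a powr (1 - s)) / (1 - s) \<le> (b - a) * a powr (-s)"
proof -
  have "\<exists>x. a \<le> x \<and> x \<le> b \<and> (b powr (1 - s) - a powr (1 - s)) / (1 - s) = (b - a) * x powr (-s)"
  proof (cases "a = b")
    case False
    have "\<exists>x>a. x < b \<and> b powr (1 - s) / (1 - s) - a powr (1 - s) / (1 - s) = (b - a) * x powr (-s)"
    proof (intro MVT2)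
      fix x assume "a \<le> x" "x \<le> b"
      then have "((\<lambda>x. x powr (1 - s) / (1 - s)) has_real_derivative ((1 - s) * x powr (1 - s - 1) / (1 - s))) (at x)"
        using assms by (intro DERIV_cdivide has_real_derivative_powr) auto
      then show "((\<lambda>x. x powr (1 - s) / (1 - s)) has_real_derivative x powr (-s)) (at x)" using assms by simp
    qed (use assms False in auto)
    then show ?thesis by (auto simp: diff_divide_distrib intro: less_imp_le)
  qed auto
  then obtain x where x: "a \<le> x" "x \<le> b" "(b powr (1 - s) - a powr (1 - s)) / (1 - s) = (b - a) * x powr (-s)" by blast
  have "b powr (-s) \<le> x powr (-s)" "x powr (-s) \<le> a powr (-s)"
    using x assms by (auto intro!: powr_mono2')
  then show "(b - a) * b powr (-s) \<le> (b powr (1 - s) - a powr (1 - s)) / (1 - s)"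
    "(b powr (1 - s) - a powr (1 - s)) / (1 - s) \<le> (b - a) * a powr (-s)"
    unfolding x(3) using assms by (auto intro!: mult_left_mono)
qed

text \<open>\<open>Z\<close> plays the role of zeta(s). It is the limit of the decreasing sequence
  \<open>A\<close>, and \<open>A M\<close> exceeds it by at most M^(-s) because \<open>A M\<close> -
  M^(-s) increases.\<close>

lemma zeta_partial:
  fixes s :: real
  assumes s: "s > 0" "s \<noteq> 1"
  obtains Z where "\<bar>Z\<bar> \<le> 2 + 1 / \<bar>1 - s\<bar>"
    "\<And>t. t \<ge> 1 \<Longrightarrow> \<bar>(\<Sum>m\<in>ivl t. real m powr (-s)) - t powr (1 - s) / (1 - s) - Z\<bar> \<le> 2 * 2 powr s * t powr (-s)"
proof -
  define A where "A = (\<lambda>M::nat. (\<Sum>m=1..M. real m powr (-s)) - real M powr (1 - s) / (1 - s))"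
  have step: "A (Suc M) \<le> A M" "A M - real M powr (-s) \<le> A (Suc M) - real (Suc M) powr (-s)" if "M \<ge> 1" for M
    using powr_diff_bounds[of "real M" "real (Suc M)" s] s that
    by (auto simp: A_def diff_divide_distrib)
  have mono: "A N \<le> A M" "A M - real M powr (-s) \<le> A N - real N powr (-s)" if "1 \<le> M" "M \<le> N" for M N
  proof -
    show "A N \<le> A M" using that(2)
    proof (induction N rule: dec_induct)
      case (step N)
      then show ?case using \<open>1 \<le> M\<close> \<open>\<And>M. M \<ge> 1 \<Longrightarrow> A (Suc M) \<le> A M\<close>[of N] by simp
    qed simp
    show "A M - real M powr (-s) \<le> A N - real N powr (-s)" using that(2)
    proof (induction N rule: dec_induct)
      case (step N)
      then show ?case using \<open>1 \<le> M\<close> \<open>\<And>M. M \<ge> 1 \<Longrightarrow> A M - real M powr (-s) \<le> A (Suc M) - real (Suc M) powr (-s)\<close>[of N] by simp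
    qed simp
  qed
  have low: "A 1 - 1 \<le> A N" if "N \<ge> 1" for N
  proof -
    have "A 1 - 1 \<le> A N - real N powr (-s)" using mono(2)[of 1 N] that by simp
    moreover have "real N powr (-s) \<ge> 0" by simp
    ultimately show ?thesis by linarith
  qed
  have "decseq (\<lambda>n. A (Suc n))" by (auto simp: decseq_Suc_iff intro: step)
  then obtain Z where Z: "(\<lambda>n. A (Suc n)) \<longlonglongrightarrow> Z" "\<And>n. Z \<le> A (Suc n)"
    using decseq_convergent[of "\<lambda>n. A (Suc n)" "A 1 - 1"] low by auto
  have up: "A M - real M powr (-s) \<le> Z" if "M \<ge> 1" for M
  proof (rule LIMSEQ_le_const[OF Z(1)], intro exI[of _ M] allI impI)
    fix n assume "M \<le> n"
    then have "A M - real M powr (-s) \<le> A (Suc n) - real (Suc n) powr (-s)" using that by (intro mono) auto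
    then show "A M - real M powr (-s) \<le> A (Suc n)" by (smt (verit) powr_ge_zero)
  qed
  have A1: "A 1 = 1 - 1 / (1 - s)" by (simp add: A_def)
  show ?thesis
  proof (rule that[of Z])
    define v where "v = 1 / (1 - s)"
    have "Z \<le> 1 - v" "1 - v - 1 \<le> Z" using Z(2)[of 0] up[of 1] A1 by (simp_all add: v_def)
    moreover have "\<bar>v\<bar> = 1 / \<bar>1 - s\<bar>" by (simp add: v_def)
    ultimately show "\<bar>Z\<bar> \<le> 2 + 1 / \<bar>1 - s\<bar>" by linarith
    fix t :: real assume t: "t \<ge> 1"
    define M where "M = nat \<lfloor>t\<rfloor>"
    have M: "M \<ge> 1" "real M \<le> t" "t < real M + 1" using t unfolding M_def by linarith+
    have iv: "ivl t = {1..M}" by (simp add: ivl_def M_def)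
    have "(t powr (1 - s) - real M powr (1 - s)) / (1 - s) \<le> (t - real M) * real M powr (-s)"
      "(t - real M) * t powr (-s) \<le> (t powr (1 - s) - real M powr (1 - s)) / (1 - s)"
      using powr_diff_bounds[of "real M" t s] s M by auto
    moreover have "(t - real M) * real M powr (-s) \<le> 1 * real M powr (-s)" using M by (intro mult_right_mono) auto
    moreover have "(t - real M) * t powr (-s) \<ge> 0" using M by simp
    ultimately have d: "0 \<le> t powr (1 - s) / (1 - s) - real M powr (1 - s) / (1 - s)"
       "t powr (1 - s) / (1 - s) - real M powr (1 - s) / (1 - s) \<le> real M powr (-s)"
      by (simp_all add: diff_divide_distrib)
    have "Z \<le> A M" "A M - real M powr (-s) \<le> Z" using Z(2)[of "M - 1"] up[of M] M by simp_all
    then have "\<bar>(\<Sum>m\<in>ivl t. real m powr (-s)) - t powr (1 - s) / (1 - s) - Z\<bar> \<le> 2 * real M powr (-s)"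
      unfolding iv A_def using d by linarith
    \<comment> \<open>The integer part \<open>M\<close> of \<open>t\<close> can be almost as small
      as t / 2, which explains the factor 2^s.\<close>
    also have "real M powr (-s) \<le> (t / 2) powr (-s)"
    proof -
      have "real M \<ge> 1" using M(1) by simp
      then have "t / 2 \<le> real M" using M by linarith
      then show ?thesis using t s by (intro powr_mono2') auto
    qed
    also have "(t / 2) powr (-s) = 2 powr s * t powr (-s)" using t by (simp add: powr_divide powr_minus field_simps)
    finally show "\<bar>(\<Sum>m\<in>ivl t. real m powr (-s)) - t powr (1 - s) / (1 - s) - Z\<bar> \<le> 2 * 2 powr s * t powr (-s)"
      by simp
  qed
qed

section \<open>A lower bound for L(1, chi) by Monsky's method\<close>

lemma geom_ge: "(\<Sum>i<n. (y\<^sup>2) ^ i) \<ge> real n * y ^ (n - 1)" if "y \<ge> (0::real)"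
proof -
  \<comment> \<open>Reversing the order pairs i with n - 1 - i. Paired terms are squares of numbers
    with product y^(n-1), so the arithmetic-geometric mean inequality applies to each pair.\<close>
  have "2 * (\<Sum>i<n. (y\<^sup>2) ^ i) = (\<Sum>i<n. (y\<^sup>2) ^ i) + (\<Sum>i<n. (y\<^sup>2) ^ (n - 1 - i))"
    using sum.nat_diff_reindex[of "\<lambda>i. (y\<^sup>2) ^ i" n] by simp
  also have "... = (\<Sum>i<n. (y ^ i)\<^sup>2 + (y ^ (n - 1 - i))\<^sup>2)"
    by (simp add: sum.distrib power_mult[symmetric] mult.commute)
  also have "... \<ge> (\<Sum>i<n. 2 * y ^ (n - 1))"
  proof (rule sum_mono)
    fix i assume "i \<in> {..<n}"
    then have "y ^ (n - 1) = y ^ i * y ^ (n - 1 - i)" by (simp add: power_add[symmetric])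
    then show "2 * y ^ (n - 1) \<le> (y ^ i)\<^sup>2 + (y ^ (n - 1 - i))\<^sup>2"
      using sum_squares_bound[of "y ^ i" "y ^ (n - 1 - i)"] by simp
  qed
  finally show ?thesis by simp
qed

lemma geom_sum_from1: "y \<noteq> 1 \<Longrightarrow> (\<Sum>j=1..k. y ^ j) = y / (1 - y) - y ^ Suc k / (1 - y)" for y :: real
proof (induction k)
  case (Suc k)
  have "c - c / (1 - y) = - (y * c) / (1 - y)" for c using Suc.prems by (simp add: field_simps)
  from this[of "y ^ Suc k"] show ?case using Suc by simp
qed simp

lemma frac_le_inverse: "v > 0 \<Longrightarrow> c > 0 \<Longrightarrow> u * c \<le> v \<Longrightarrow> u / v \<le> 1 / (c::real)"
  by (simp add: field_simps)

text \<open>Dividing out 1 - x turns the claim into x^n / (S n S (n + 1)) \<le> 1 / (n (n + 1)) for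
  the geometric sums \<open>S\<close>. With y = sqrt x, \<open>geom_ge\<close> bounds these sums
  below by n y^(n-1) and (n + 1) y^n, and y^(2n-1) \<ge> x^n.\<close>

lemma monsky_decreasing:
  fixes x :: real
  assumes x: "0 < x" "x < 1" and n: "n \<ge> 1"
  shows "1 / (real (Suc n) * (1 - x)) - x ^ Suc n / (1 - x ^ Suc n) \<le> 1 / (real n * (1 - x)) - x ^ n / (1 - x ^ n)"
proof -
  define y where "y = sqrt x"
  have y: "y \<ge> 0" "y\<^sup>2 = x" "y \<le> 1" using x by (auto simp: y_def)
  define S where "S = (\<lambda>n. \<Sum>i<n. x ^ i)"
  have S: "1 - x ^ n = (1 - x) * S n" for n unfolding S_def by (rule one_diff_power_eq)
  have Spos: "S n > 0" "S (Suc n) > 0" using S[of n] S[of "Suc n"] x n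
    by (metis diff_gt_0_iff_gt power_Suc_less_one power_strict_decreasing zero_less_mult_pos less_le_trans not_one_le_zero one_le_power zero_less_one power_0 neq0_conv Suc_le_eq One_nat_def zero_less_Suc)+
  have SS: "S (Suc n) = 1 + x * S n" by (simp add: S_def sum.lessThan_Suc_shift sum_distrib_left del: sum.lessThan_Suc)
  have "real n * real (Suc n) * x ^ n \<le> real n * real (Suc n) * (y ^ (n - 1) * y ^ n)"
  proof (intro mult_left_mono)
    have "x ^ n = y ^ n * y ^ n" unfolding y(2)[symmetric] by (simp add: power_mult_distrib power2_eq_square)
    also have "... \<le> y ^ (n - 1) * y ^ n" using y by (intro mult_right_mono power_decreasing) auto
    finally show "x ^ n \<le> y ^ (n - 1) * y ^ n" .
  qed auto
  also have "... = (real n * y ^ (n - 1)) * (real (Suc n) * y ^ (Suc n - 1))" by simp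
  also have "... \<le> S n * S (Suc n)"
    unfolding S_def y(2)[symmetric] using y by (intro mult_mono geom_ge sum_nonneg) auto
  finally have key: "x ^ n / (S n * S (Suc n)) \<le> 1 / (real n * real (Suc n))"
    using Spos n by (intro frac_le_inverse) (auto simp: mult_ac)
  have "x ^ n / S n - x ^ Suc n / S (Suc n) = x ^ n * (S (Suc n) - x * S n) / (S n * S (Suc n))"
    using Spos by (simp add: field_simps)
  also have "... = x ^ n / (S n * S (Suc n))" by (simp add: SS)
  also have "... \<le> 1 / real n - 1 / real (Suc n)" using key n by (simp add: field_simps)
  finally have "1 / real (Suc n) - x ^ Suc n / S (Suc n) \<le> 1 / real n - x ^ n / S n" by simp
  then have le: "(1 / real (Suc n) - x ^ Suc n / S (Suc n)) / (1 - x) \<le> (1 / real n - x ^ n / S n) / (1 - x)"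
    using x by (intro divide_right_mono) auto
  have e: "(1 / real m - x ^ m / S m) / (1 - x) = 1 / (real m * (1 - x)) - x ^ m / (1 - x ^ m)" for m
    unfolding S by (simp add: diff_divide_distrib mult.commute)
  show ?thesis using le unfolding e .
qed

context rchar
begin

lemma chi_powr_tail:
  assumes "s > 0"
  shows "\<bar>\<Sum>n\<in>{m<..N}. ch n * real n powr (-s)\<bar> \<le> 2 * real q * real (Suc m) powr (-s)"
proof (cases "m < N")
  case True
  then show ?thesis
    using assms by (intro abel_dec sum_chi_bound) (auto intro!: powr_mono2')
qed (use q1 in auto)

text \<open>L(s, chi) on the positive real axis. For s \<le> 1 convergence rests on the bounded
  partial sums of \<open>ch\<close>; the link with the analytic continuation is
  \<open>dirichlet_L_eq_Lser\<close>.\<close>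

definition Lser :: "real \<Rightarrow> real" where
  "Lser s = (\<Sum>n. ch (Suc n) * real (Suc n) powr (-s))"

lemma Lser_sums_tail:
  assumes s: "s > 0"
  shows "(\<lambda>n. ch (Suc n) * real (Suc n) powr (-s)) sums Lser s"
    and "\<bar>Lser s - (\<Sum>n\<in>{0<..N}. ch n * real n powr (-s))\<bar> \<le> 2 * real q * real (Suc N) powr (-s)"
proof -
  let ?f = "\<lambda>n. ch (Suc n) * real (Suc n) powr (-s)"
  have re: "sum ?f {m..<n} = (\<Sum>n\<in>{m<..n}. ch n * real n powr (-s))" for m n
    by (rule sum.reindex_bij_witness[where i = "\<lambda>k. k - 1" and j = Suc]) auto
  have lim: "(\<lambda>m. 2 * real q * real (Suc m) powr (-s)) \<longlonglongrightarrow> 0"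
    using s by real_asymp
  have summ: "summable ?f"
    unfolding summable_Cauchy
  proof (intro allI impI)
    fix e :: real assume "e > 0"
    then obtain M where M: "\<And>m. m \<ge> M \<Longrightarrow> 2 * real q * real (Suc m) powr (-s) < e"
      using order_tendstoD(2)[OF lim] unfolding eventually_sequentially by blast
    then show "\<exists>N. \<forall>m\<ge>N. \<forall>n. norm (sum ?f {m..<n}) < e"
      using chi_powr_tail[OF s] unfolding re real_norm_def by (meson le_less_trans)
  qed
  then show sums: "?f sums Lser s" unfolding Lser_def by (rule summable_sums)
  have L: "(\<lambda>M. \<Sum>n<M. ?f n) \<longlonglongrightarrow> Lser s" using sums by (simp add: sums_def)
  show "\<bar>Lser s - (\<Sum>n\<in>{0<..N}. ch n * real n powr (-s))\<bar> \<le> 2 * real q * real (Suc N) powr (-s)"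
  proof (rule LIMSEQ_le_const2)
    show "(\<lambda>M. \<bar>(\<Sum>n<M. ?f n) - (\<Sum>n\<in>{0<..N}. ch n * real n powr (-s))\<bar>) \<longlonglongrightarrow> \<bar>Lser s - (\<Sum>n\<in>{0<..N}. ch n * real n powr (-s))\<bar>"
      by (intro tendsto_intros L)
    show "\<exists>M0. \<forall>M\<ge>M0. \<bar>(\<Sum>n<M. ?f n) - (\<Sum>n\<in>{0<..N}. ch n * real n powr (-s))\<bar> \<le> 2 * real q * real (Suc N) powr (-s)"
    proof (intro exI[of _ N] allI impI)
      fix M assume M: "M \<ge> N"
      have "(\<Sum>n<M. ?f n) = (\<Sum>n\<in>{0<..M}. ch n * real n powr (-s))" using re[of 0 M] by (simp add: atLeast0LessThan)
      also have "... = (\<Sum>n\<in>{0<..N}. ch n * real n powr (-s)) + (\<Sum>n\<in>{N<..M}. ch n * real n powr (-s))"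
        using M by (subst sum.union_disjoint[symmetric]) (auto intro!: sum.cong)
      finally show "\<bar>(\<Sum>n<M. ?f n) - (\<Sum>n\<in>{0<..N}. ch n * real n powr (-s))\<bar> \<le> 2 * real q * real (Suc N) powr (-s)"
        using chi_powr_tail[OF s, of N M] by simp
    qed
  qed
qed

lemma Lser_ivl:
  assumes "s > 0" "S \<ge> 1"
  shows "\<bar>Lser s - (\<Sum>n\<in>ivl S. ch n * real n powr (-s))\<bar> \<le> 2 * real q * S powr (-s)"
proof -
  have "ivl S = {0<..nat \<lfloor>S\<rfloor>}" by (auto simp: ivl_def)
  moreover have "real (Suc (nat \<lfloor>S\<rfloor>)) powr (-s) \<le> S powr (-s)"
    using assms by (intro powr_mono2') linarith+
  then have "2 * real q * real (Suc (nat \<lfloor>S\<rfloor>)) powr (-s) \<le> 2 * real q * S powr (-s)"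
    by (intro mult_left_mono) auto
  ultimately show ?thesis using Lser_sums_tail(2)[OF assms(1), of "nat \<lfloor>S\<rfloor>"] by simp
qed

definition L1 :: real where "L1 = Lser 1"

lemma L1_ivl:
  assumes "S \<ge> 1"
  shows "\<bar>L1 - (\<Sum>n\<in>ivl S. ch n / real n)\<bar> \<le> 2 * real q / S"
proof -
  have "(\<Sum>n\<in>ivl S. ch n * real n powr (-1)) = (\<Sum>n\<in>ivl S. ch n / real n)"
    by (intro sum.cong refl) (auto simp: mem_ivl powr_minus divide_inverse)
  moreover have "S powr (-1) = 1 / S" using assms by (simp add: powr_minus divide_inverse)
  ultimately show ?thesis using Lser_ivl[of 1 S] assms by (simp add: L1_def)
qed

text \<open>The Lambert series of \<open>ch\<close> is the power series with coefficients
  \<open>lam\<close>. Its terms ch n x^n / (1 - x^n) are compared with ch n / (n (1 - x)), whose sum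
  is governed by \<open>L1\<close>. The differences \<open>b n\<close> decrease from 1, so partial
  summation bounds their contribution by 2 q. The last term on the right pays for cutting off the
  series at \<open>N\<close>.\<close>

lemma monsky_bound:
  assumes x: "0 < x" "x < 1" and N: "N \<ge> 1"
  shows "(\<Sum>m\<in>ivl (real N). lam m * x ^ m) \<le> (L1 + 2 * real q / real N) / (1 - x) + 2 * real q + real N * x ^ N / (1 - x)"
proof -
  define b where "b = (\<lambda>n::nat. 1 / (real n * (1 - x)) - x ^ n / (1 - x ^ n))"
  have iv: "ivl (real N) = {0<..N}" by (auto simp: ivl_def)
  have xn: "x ^ n < 1" if "n \<ge> 1" for n using x that by (intro power_less_one_iff[THEN iffD2]) auto
  have b0: "b n \<ge> 0" if "n \<ge> 1" for n
  proof -
    have "real n * x ^ n * (1 - x) \<le> 1 - x ^ n"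
    proof -
      have "real n * x ^ n = (\<Sum>i<n. x ^ n)" by simp
      also have "... \<le> (\<Sum>i<n. x ^ i)" using x by (intro sum_mono power_decreasing) auto
      finally have "real n * x ^ n * (1 - x) \<le> (\<Sum>i<n. x ^ i) * (1 - x)" using x by (intro mult_right_mono) auto
      also have "... = 1 - x ^ n" by (simp add: one_diff_power_eq mult.commute)
      finally show ?thesis .
    qed
    moreover have "u / v \<le> 1 / c" if "v > 0" "c > 0" "u * c \<le> v" for u v c :: real
      using that by (simp add: field_simps)
    from this[of "1 - x ^ n" "real n * (1 - x)" "x ^ n"]
    have "x ^ n * (real n * (1 - x)) \<le> 1 - x ^ n \<Longrightarrow> x ^ n / (1 - x ^ n) \<le> 1 / (real n * (1 - x))"
      using xn[OF that] x that by simp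
    ultimately show ?thesis by (simp add: b_def mult_ac)
  qed
  have "\<bar>\<Sum>n\<in>{0<..N}. ch n * b n\<bar> \<le> 2 * real q * b (Suc 0)"
    using N monsky_decreasing[OF x] by (intro abel_dec sum_chi_bound b0) (auto simp: b_def simp del: power_Suc of_nat_Suc)
  moreover have "b (Suc 0) = 1" using x by (simp add: b_def field_simps)
  ultimately have 1: "\<bar>\<Sum>n\<in>{0<..N}. ch n * b n\<bar> \<le> 2 * real q" by simp
  have "(\<Sum>m\<in>ivl (real N). lam m * x ^ m) = (\<Sum>m\<in>ivl (real N). \<Sum>d | d dvd m. ch d * x ^ (d * (m div d)))"
    unfolding lam_def sum_distrib_right by (intro sum.cong refl) auto
  also have "... = (\<Sum>n\<in>ivl (real N). \<Sum>j\<in>ivl (real N / real n). ch n * x ^ (n * j))"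
    by (rule sum_divisors_ivl)
  also have "... \<le> (\<Sum>n\<in>ivl (real N). ch n * (x ^ n / (1 - x ^ n)) + x ^ N / (1 - x))"
  proof (rule sum_mono)
    fix n assume n: "n \<in> ivl (real N)"
    then have n1: "n \<ge> 1" "n \<le> N" by (auto simp: mem_ivl)
    define J where "J = N div n"
    have iv': "ivl (real N / real n) = {1..J}" by (simp add: ivl_def J_def floor_divide_of_nat_eq)
    have y: "x ^ n < 1" "x ^ n > 0" using xn n1 x by auto
    have gs: "(\<Sum>j=1..k. (x ^ n) ^ j) = x ^ n / (1 - x ^ n) - (x ^ n) ^ Suc k / (1 - x ^ n)" for k
      using y by (intro geom_sum_from1) auto
    have "x ^ n / (1 - x ^ n) - (\<Sum>j\<in>ivl (real N / real n). x ^ (n * j)) = (x ^ n) ^ Suc J / (1 - x ^ n)"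
      unfolding iv' using gs[of J] by (simp add: power_mult)
    moreover have "(x ^ n) ^ Suc J / (1 - x ^ n) \<le> x ^ N / (1 - x)"
    proof (intro frac_le)
      have "N \<le> n * Suc J" unfolding J_def using n1 by (metis dividend_less_times_div less_imp_le mult_Suc_right add.commute not_one_le_zero neq0_conv)
      then show "(x ^ n) ^ Suc J \<le> x ^ N" unfolding power_mult[symmetric] using x by (intro power_decreasing) auto
      show "1 - x \<le> 1 - x ^ n" using power_decreasing[of 1 n x] n1 x by simp
    qed (use x in auto)
    moreover have "(x ^ n) ^ Suc J / (1 - x ^ n) \<ge> 0" using y by simp
    ultimately have R: "\<bar>(\<Sum>j\<in>ivl (real N / real n). x ^ (n * j)) - x ^ n / (1 - x ^ n)\<bar> \<le> x ^ N / (1 - x)" by linarith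
    have "ch n * ((\<Sum>j\<in>ivl (real N / real n). x ^ (n * j)) - x ^ n / (1 - x ^ n)) \<le> x ^ N / (1 - x)"
    proof -
      have "\<bar>ch n * ((\<Sum>j\<in>ivl (real N / real n). x ^ (n * j)) - x ^ n / (1 - x ^ n))\<bar> \<le> 1 * (x ^ N / (1 - x))"
        unfolding abs_mult by (intro mult_mono R chi_abs_le) auto
      then show ?thesis by linarith
    qed
    then show "(\<Sum>j\<in>ivl (real N / real n). ch n * x ^ (n * j)) \<le> ch n * (x ^ n / (1 - x ^ n)) + x ^ N / (1 - x)"
      by (simp add: algebra_simps sum_distrib_left)
  qed
  also have "... = (\<Sum>n\<in>ivl (real N). ch n / real n) / (1 - x) - (\<Sum>n\<in>{0<..N}. ch n * b n) + real N * (x ^ N / (1 - x))"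
    unfolding iv by (simp add: sum.distrib b_def sum_subtractf sum_divide_distrib algebra_simps)
  also have "... \<le> (L1 + 2 * real q / real N) / (1 - x) + 2 * real q + real N * (x ^ N / (1 - x))"
  proof -
    have "(\<Sum>n\<in>ivl (real N). ch n / real n) \<le> L1 + 2 * real q / real N" using L1_ivl[of "real N"] N by (simp add: abs_le_iff)
    then have "(\<Sum>n\<in>ivl (real N). ch n / real n) / (1 - x) \<le> (L1 + 2 * real q / real N) / (1 - x)"
      using x by (intro divide_right_mono) auto
    then show ?thesis using 1 by linarith
  qed
  finally show ?thesis by simp
qed

lemma L1_ge: "L1 \<ge> 1 / (64 * real q)"
proof -
  \<comment> \<open>With x = 1 - 1 / (2 M^2) each square up to M^2 contributes at least 1/2, so the
    left side is at least M / 2, against 2 M^2 L1 + 2 q on the right in the limit of large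
    \<open>N\<close>. The choice M = 8 q makes M / 2 twice the term 2 q.\<close>
  define M where "M = 8 * q"
  define x where "x = 1 - 1 / (2 * (real M)\<^sup>2)"
  have M: "real M \<ge> 1" using q1 by (simp add: M_def)
  have "(real M)\<^sup>2 \<ge> 1" using M by (rule one_le_power)
  then have g: "2 * (real M)\<^sup>2 > 1" by linarith
  then have p: "0 < 2 * (real M)\<^sup>2" by linarith
  have "1 / (2 * (real M)\<^sup>2) < 1" "1 / (2 * (real M)\<^sup>2) > 0"
    using g p divide_less_eq_1_pos[OF p, of 1] divide_pos_pos[OF zero_less_one p] by blast+
  then have x: "0 < x" "x < 1" by (auto simp: x_def)
  have ix: "1 / (1 - x) = 2 * (real M)\<^sup>2" by (simp add: x_def)
  have "1 / 2 \<le> 1 + real (M\<^sup>2) * (- 1 / (2 * (real M)\<^sup>2))" using M by simp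
  also have "... \<le> (1 + (- 1 / (2 * (real M)\<^sup>2))) ^ (M\<^sup>2)"
    using x by (intro Bernoulli_inequality) (auto simp: x_def)
  finally have xM: "x ^ (M\<^sup>2) \<ge> 1 / 2" by (simp add: x_def)
  have ge: "real M / 2 \<le> (L1 + 2 * real q / real N) / (1 - x) + 2 * real q + real N * x ^ N / (1 - x)" if N: "N \<ge> M\<^sup>2" for N
  proof -
    have N1: "N \<ge> 1" using N M by (metis One_nat_def Suc_leI le_trans less_le_trans nat_zero_less_power_iff of_nat_1 of_nat_le_iff zero_less_one)
    have "real M / 2 = (\<Sum>j\<in>{1..M}. 1 / 2)" by simp
    also have "... \<le> (\<Sum>j\<in>{1..M}. lam (j\<^sup>2) * x ^ (j\<^sup>2))"
    proof (rule sum_mono)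
      fix j assume j: "j \<in> {1..M}"
      have "x ^ (M\<^sup>2) \<le> x ^ (j\<^sup>2)" using x j by (intro power_decreasing power_mono) auto
      then have "1 / 2 \<le> x ^ (j\<^sup>2)" using xM by linarith
      moreover have "1 * x ^ (j\<^sup>2) \<le> lam (j\<^sup>2) * x ^ (j\<^sup>2)" using lam_square_ge[of j] j x by (intro mult_right_mono) auto
      ultimately show "1 / 2 \<le> lam (j\<^sup>2) * x ^ (j\<^sup>2)" by linarith
    qed
    also have "... = (\<Sum>m\<in>(\<lambda>j. j\<^sup>2) ` {1..M}. lam m * x ^ m)"
      by (subst sum.reindex) (auto simp: inj_on_def)
    also have "... \<le> (\<Sum>m\<in>ivl (real N). lam m * x ^ m)"
    proof (rule sum_mono2)
      show "(\<lambda>j. j\<^sup>2) ` {1..M} \<subseteq> ivl (real N)"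
      proof
        fix m assume "m \<in> (\<lambda>j. j\<^sup>2) ` {1..M}"
        then obtain j where j: "m = j\<^sup>2" "1 \<le> j" "j \<le> M" by auto
        then have "m \<le> M\<^sup>2" by (simp add: power_mono)
        then have "m \<le> N" using N by (rule le_trans)
        moreover have "m \<ge> 1" using j by simp
        ultimately show "m \<in> ivl (real N)" unfolding mem_ivl by simp
      qed
    qed (use x in auto)
    also have "... \<le> (L1 + 2 * real q / real N) / (1 - x) + 2 * real q + real N * x ^ N / (1 - x)"
      using x N1 by (rule monsky_bound)
    finally show ?thesis .
  qed
  have t1: "(\<lambda>N. 2 * real q / real N) \<longlonglongrightarrow> 0" by real_asymp
  have t2: "(\<lambda>N. real N * x ^ N) \<longlonglongrightarrow> 0" using x by (intro powser_times_n_limit_0) auto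
  have x1: "1 - x \<noteq> 0" using x by simp
  have "(\<lambda>N. (L1 + 2 * real q / real N) / (1 - x) + 2 * real q + real N * x ^ N / (1 - x)) \<longlonglongrightarrow> (L1 + 0) / (1 - x) + 2 * real q + 0 / (1 - x)"
    by (rule tendsto_add[OF tendsto_add[OF tendsto_divide[OF tendsto_add[OF tendsto_const t1] tendsto_const x1] tendsto_const] tendsto_divide[OF t2 tendsto_const x1]])
  then have "real M / 2 \<le> (L1 + 0) / (1 - x) + 2 * real q + 0 / (1 - x)"
    using ge by (intro LIMSEQ_le_const) blast+
  also have "... = L1 * (1 / (1 - x)) + 2 * real q" by simp
  also have "... = 2 * (real M)\<^sup>2 * L1 + 2 * real q" unfolding ix by simp
  finally have "4 * real q \<le> 128 * (real q)\<^sup>2 * L1 + 2 * real q" by (simp add: M_def power2_eq_square)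
  then have "real q * 2 \<le> real q * (128 * real q * L1)" by (simp add: power2_eq_square)
  then have "2 \<le> 128 * real q * L1" using q1 by (metis mult_le_cancel_left_pos of_nat_0_less_iff less_trans zero_less_one)
  then show ?thesis using q1 by (simp add: field_simps)
qed

lemma L1_pos: "L1 > 0"
proof -
  have "1 / (64 * real q) > 0" using q1 by simp
  then show ?thesis using L1_ge by linarith
qed

lemma L1_le: "L1 \<le> 3 * real q"
proof -
  have "ivl 1 = {1}" by (auto simp: ivl_def)
  then have "\<bar>L1 - 1\<bar> \<le> 2 * real q" using L1_ivl[of 1] by simp
  then show ?thesis using q1 by linarith
qed

section \<open>Sums of \<open>lam\<close> and the effect of a zero\<close>

lemma card_ivl_approx: "Z \<ge> 0 \<Longrightarrow> \<bar>real (card (ivl Z)) - Z\<bar> \<le> 1"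
  unfolding ivl_def by simp linarith

lemma lam_sum_ivl:
  "(\<Sum>n\<in>ivl Y. F n * lam n) = (\<Sum>a\<in>ivl Y. \<Sum>b\<in>ivl (Y / real a). F (a * b) * ch a)"
proof -
  have "(\<Sum>n\<in>ivl Y. F n * lam n) = (\<Sum>n\<in>ivl Y. \<Sum>d | d dvd n. F (d * (n div d)) * ch d)"
    unfolding lam_def sum_distrib_left by (intro sum.cong refl) auto
  also have "... = (\<Sum>a\<in>ivl Y. \<Sum>b\<in>ivl (Y / real a). F (a * b) * ch a)"
    by (rule sum_divisors_ivl)
  finally show ?thesis .
qed

text \<open>Hyperbola method: for a \<le> sqrt Y the number of \<open>b\<close> is Y / a + O(1),
  which gives the main term; for a > sqrt Y the character sum over \<open>a\<close> is at most 2
  q.\<close>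

lemma sum_lam_approx:
  assumes Y: "Y \<ge> 1"
  shows "\<bar>(\<Sum>n\<in>ivl Y. lam n) - L1 * Y\<bar> \<le> 5 * real q * sqrt Y"
proof -
  define S where "S = sqrt Y"
  have S: "S \<ge> 1" "S * S = Y" using Y by (auto simp: S_def)
  have "(\<Sum>n\<in>ivl Y. lam n) = (\<Sum>n\<in>ivl Y. 1 * lam n)" by simp
  also have "... = (\<Sum>a\<in>ivl S. \<Sum>b\<in>ivl (Y / real a). ch a)
    + (\<Sum>b\<in>ivl S. \<Sum>a\<in>fivl S (Y / real b). ch a)"
    using Y unfolding lam_sum_ivl S_def by (subst hyperbola) auto
  finally have eq: "(\<Sum>n\<in>ivl Y. lam n) = ..." .
  have "\<bar>(\<Sum>b\<in>ivl S. \<Sum>a\<in>fivl S (Y / real b). ch a)\<bar> \<le> (\<Sum>b\<in>ivl S. 2 * real q)"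
    by (rule order_trans[OF sum_abs]) (intro sum_mono sum_chi_bound)
  also have "... \<le> S * (2 * real q)" using card_ivl_le[of S] S by (simp add: mult_right_mono)
  finally have 2: "\<bar>(\<Sum>b\<in>ivl S. \<Sum>a\<in>fivl S (Y / real b). ch a)\<bar> \<le> S * (2 * real q)" .
  have "\<bar>(\<Sum>a\<in>ivl S. \<Sum>b\<in>ivl (Y / real a). ch a) - (\<Sum>a\<in>ivl S. Y * (ch a / real a))\<bar>
      \<le> (\<Sum>a\<in>ivl S. \<bar>(\<Sum>b\<in>ivl (Y / real a). ch a) - Y * (ch a / real a)\<bar>)"
    unfolding sum_subtractf[symmetric] by (rule sum_abs)
  also have "... \<le> (\<Sum>a\<in>ivl S. 1)"
  proof (rule sum_mono)
    fix a assume "a \<in> ivl S"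
    have "\<bar>(\<Sum>b\<in>ivl (Y / real a). ch a) - Y * (ch a / real a)\<bar> = \<bar>ch a\<bar> * \<bar>real (card (ivl (Y / real a))) - Y / real a\<bar>"
      by (simp add: abs_mult[symmetric] algebra_simps)
    also have "... \<le> 1 * 1" using Y by (intro mult_mono chi_abs_le card_ivl_approx) auto
    finally show "\<bar>(\<Sum>b\<in>ivl (Y / real a). ch a) - Y * (ch a / real a)\<bar> \<le> 1" by simp
  qed
  also have "... \<le> S" using card_ivl_le[of S] S by simp
  finally have 1: "\<bar>(\<Sum>a\<in>ivl S. \<Sum>b\<in>ivl (Y / real a). ch a) - Y * (\<Sum>a\<in>ivl S. ch a / real a)\<bar> \<le> S"
    by (simp add: sum_distrib_left)
  have "\<bar>Y * (\<Sum>a\<in>ivl S. ch a / real a) - Y * L1\<bar> = Y * \<bar>L1 - (\<Sum>a\<in>ivl S. ch a / real a)\<bar>"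
    using Y by (simp add: abs_mult right_diff_distrib[symmetric] abs_minus_commute)
  also have "... \<le> Y * (2 * real q / S)" using Y S L1_ivl[of S] by (intro mult_left_mono) auto
  also have "... = 2 * real q * S" using S by (simp add: field_simps flip: S(2))
  finally have 3: "\<bar>Y * (\<Sum>a\<in>ivl S. ch a / real a) - Y * L1\<bar> \<le> 2 * real q * S" .
  have "S * 1 \<le> S * real q" using S q1 by (intro mult_left_mono) auto
  then have "S + 2 * real q * S + S * (2 * real q) \<le> 5 * real q * S" by (simp add: algebra_simps)
  then show ?thesis unfolding eq S_def[symmetric] using 1 2 3 by (simp add: mult.commute)
qed

text \<open>Beyond this point errors are dominated by \<open>L1\<close>, of which only
  \<open>L1\<close> \<ge> 1 / (64 q) is known. The eighth power serves \<open>H_lower\<close>, whose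
  error decays like Y^(-1/8), and 1408 = 11 * 128 fits the constant there.\<close>

definition Q0 :: real where "Q0 = (1408 * (real q)\<^sup>2) ^ 8"

lemma Q0_ge: "1408 * (real q)\<^sup>2 \<le> Q0" "Q0 \<ge> 1408" "1 \<le> Q0" "(1408 * (real q)\<^sup>2)\<^sup>2 \<le> Q0" "real q \<le> Q0"
proof -
  have "real q * real q \<ge> 1 * 1" using q1 by (intro mult_mono) auto
  then have 1: "1408 * (real q)\<^sup>2 \<ge> 1408" by (simp add: power2_eq_square)
  then show 2: "1408 * (real q)\<^sup>2 \<le> Q0" unfolding Q0_def by (intro self_le_power) auto
  then show "Q0 \<ge> 1408" "1 \<le> Q0" using 1 by linarith+
  show "(1408 * (real q)\<^sup>2)\<^sup>2 \<le> Q0" unfolding Q0_def using 1 by (intro power_increasing) auto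
  have "real q \<le> (real q)\<^sup>2" using q1 by (intro self_le_power) auto
  then show "real q \<le> Q0" using 2 by linarith
qed

lemma sum_lam_upper:
  assumes "Y \<ge> Q0"
  shows "(\<Sum>n\<in>ivl Y. lam n) \<le> 2 * L1 * Y"
proof -
  have Y: "Y \<ge> 1" using assms Q0_ge by linarith
  have "1408 * (real q)\<^sup>2 = sqrt ((1408 * (real q)\<^sup>2)\<^sup>2)" by (subst real_sqrt_abs) simp
  also have "... \<le> sqrt Y" using assms Q0_ge(4) by (intro real_sqrt_le_mono) linarith
  finally have sY: "1408 * (real q)\<^sup>2 \<le> sqrt Y" .
  have "5 * real q = (1 / (64 * real q)) * (320 * (real q)\<^sup>2)" using q1 by (simp add: power2_eq_square)
  also have "... \<le> L1 * sqrt Y"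
  proof (rule mult_mono)
    have "0 \<le> (real q)\<^sup>2" by simp
    then show "320 * (real q)\<^sup>2 \<le> sqrt Y" using sY by linarith
  qed (use L1_ge L1_pos in auto)
  finally have "5 * real q * sqrt Y \<le> L1 * sqrt Y * sqrt Y" by (intro mult_right_mono) (use Y in auto)
  also have "... = L1 * Y" using Y by simp
  finally show ?thesis using sum_lam_approx[OF Y] by linarith
qed

text \<open>Every dyadic interval beyond \<open>Q0\<close> contributes at most 4 L1 by
  \<open>sum_lam_upper\<close>, and O(ln Y) of them cover the range.\<close>

lemma sum_lam_log_upper:
  assumes X: "X \<ge> Q0" and XY: "X \<le> Y"
  shows "(\<Sum>n | n \<in> ivl Y \<and> X < real n. lam n / real n) \<le> 16 * L1 * ln Y"
proof -
  have X1: "X \<ge> 1408" using X Q0_ge by linarith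
  have ind: "(\<Sum>n | n \<in> ivl (2 ^ k * X) \<and> X < real n. lam n / real n) \<le> 4 * L1 * real k" for k
  proof (induction k)
    case 0
    have "{n. n \<in> ivl X \<and> X < real n} = {}" by (auto simp: mem_ivl)
    then show ?case by (simp only: power_0 mult_1 sum.empty)
  next
    case (Suc k)
    let ?Z = "2 ^ k * X"
    have Z: "?Z \<ge> X" using X1 mult_right_mono[of 1 "2 ^ k" X] by simp
    have sub: "{n. n \<in> ivl (2 ^ Suc k * X) \<and> X < real n} \<subseteq> {n. n \<in> ivl ?Z \<and> X < real n} \<union> {n. n \<in> ivl (2 * ?Z) \<and> ?Z < real n}"
      by (auto simp: mem_ivl mult.assoc)
    have "(\<Sum>n | n \<in> ivl (2 ^ Suc k * X) \<and> X < real n. lam n / real n)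
        \<le> (\<Sum>n\<in>{n. n \<in> ivl ?Z \<and> X < real n} \<union> {n. n \<in> ivl (2 * ?Z) \<and> ?Z < real n}. lam n / real n)"
      by (rule sum_mono2[OF _ sub]) auto
    also have "... \<le> (\<Sum>n | n \<in> ivl ?Z \<and> X < real n. lam n / real n) + (\<Sum>n | n \<in> ivl (2 * ?Z) \<and> ?Z < real n. lam n / real n)"
      by (subst sum.union_inter[symmetric]) (auto intro!: sum_nonneg)
    also have "(\<Sum>n | n \<in> ivl (2 * ?Z) \<and> ?Z < real n. lam n / real n) \<le> (\<Sum>n | n \<in> ivl (2 * ?Z) \<and> ?Z < real n. lam n / ?Z)"
      using Z X1 by (intro sum_mono divide_left_mono mult_pos_pos) (auto simp: mem_ivl)
    also have "... \<le> (\<Sum>n\<in>ivl (2 * ?Z). lam n / ?Z)" using Z X1 by (intro sum_mono2) auto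
    also have "... = (\<Sum>n\<in>ivl (2 * ?Z). lam n) / ?Z" by (simp add: sum_divide_distrib)
    also have "... \<le> (2 * L1 * (2 * ?Z)) / ?Z"
    proof (intro divide_right_mono sum_lam_upper)
      show "Q0 \<le> 2 * ?Z" "0 \<le> ?Z" using Z X X1 by linarith+
    qed
    also have "... = 4 * L1" using Z X1 by simp
    finally show ?case using Suc.IH by (simp add: algebra_simps)
  qed
  define k where "k = nat \<lceil>log 2 Y\<rceil>"
  have Y: "Y \<ge> 1408" using X1 XY by linarith
  have lg: "log 2 Y \<ge> 0" using Y by simp
  have "Y = 2 powr (log 2 Y)" using Y by simp
  also have "... \<le> 2 powr (real k)" using lg by (intro powr_mono) (auto simp: k_def)
  also have "... = 2 ^ k" by (simp add: powr_realpow)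
  also have "... \<le> 2 ^ k * X" using X1 by simp
  finally have Yk: "Y \<le> 2 ^ k * X" .
  have "(\<Sum>n | n \<in> ivl Y \<and> X < real n. lam n / real n) \<le> (\<Sum>n | n \<in> ivl (2 ^ k * X) \<and> X < real n. lam n / real n)"
    using Yk by (intro sum_mono2) (auto simp: mem_ivl)
  also have "... \<le> 4 * L1 * real k" by (rule ind)
  also have "... \<le> 4 * L1 * (4 * ln Y)"
  proof (intro mult_left_mono)
    have l2: "ln 2 \<ge> (2/3 :: real)" using ln2_ge_two_thirds by simp
    have "real k \<le> log 2 Y + 1" using lg by (simp add: k_def)
    moreover have "log 2 Y \<le> 3/2 * ln Y"
    proof -
      have "ln Y / ln 2 \<le> ln Y / (2/3)" using l2 Y by (intro divide_left_mono) auto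
      then show ?thesis by (simp add: log_def)
    qed
    moreover have "ln Y \<ge> 2/3" using order_trans[OF l2, of "ln Y"] Y by simp
    ultimately show "real k \<le> 4 * ln Y" by linarith
  qed (use L1_pos in auto)
  finally show ?thesis by simp
qed

lemma sum_inv_sqrt_le: "(\<Sum>b=1..M. real b powr (-(1/2))) \<le> 2 * sqrt (real M)"
proof (induction M)
  case (Suc M)
  have "real (Suc M) powr (-(1/2)) = 1 / sqrt (real (Suc M))"
    by (simp add: powr_minus_divide powr_half_sqrt)
  moreover have "1 / sqrt (real (Suc M)) \<le> 2 * (sqrt (real (Suc M)) - sqrt (real M))"
  proof -
    let ?a = "sqrt (real (Suc M))" and ?b = "sqrt (real M)"
    have ab: "?b \<le> ?a" "?a > 0" "?b \<ge> 0" by auto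
    have "(x - y) * (x + y) = x * x - y * y" for x y :: real by (simp add: algebra_simps)
    from this[of ?a ?b] have "(?a - ?b) * (?a + ?b) = 1" by simp
    moreover have "(?a - ?b) * (?a + ?b) \<le> (?a - ?b) * (2 * ?a)" using ab by (intro mult_left_mono) linarith+
    ultimately have "1 \<le> (2 * (?a - ?b)) * ?a" by linarith
    then show ?thesis using pos_divide_le_eq[OF ab(2), of 1] by blast
  qed
  ultimately show ?case using Suc.IH by simp
qed simp

text \<open>A truncated form of zeta(s) L(s, chi): the pole of zeta produces the term with
  \<open>L1\<close>, and \<open>Z\<close> stands for zeta(s). At a zero of L only the polar term is
  left. The errors of the hyperbola method are negative powers of \<open>Y\<close> for s >
  1/2.\<close>

lemma lam_powr_sum:
  assumes s: "s > 1/2" "s \<noteq> 1"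
  obtains Z where "\<bar>Z\<bar> \<le> 2 + 1 / \<bar>1 - s\<bar>"
   "\<And>Y. Y \<ge> 1 \<Longrightarrow> \<bar>(\<Sum>n\<in>ivl Y. real n powr (-s) * lam n) - Y powr (1 - s) / (1 - s) * L1 - Z * Lser s\<bar>
      \<le> Y powr (1 - s) / \<bar>1 - s\<bar> * (2 * real q / sqrt Y) + \<bar>Z\<bar> * (2 * real q * sqrt Y powr (-s))
        + 2 * 2 powr s * sqrt Y powr (1 - 2 * s) + 4 * real q * sqrt Y powr (1/2 - s)"
proof -
  have s0: "s > 0" using s by simp
  obtain Z where Z: "\<bar>Z\<bar> \<le> 2 + 1 / \<bar>1 - s\<bar>"
    "\<And>t. t \<ge> 1 \<Longrightarrow> \<bar>(\<Sum>m\<in>ivl t. real m powr (-s)) - t powr (1 - s) / (1 - s) - Z\<bar> \<le> 2 * 2 powr s * t powr (-s)"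
    using zeta_partial[OF s0 s(2)] by blast
  show ?thesis
  proof (rule that[OF Z(1)])
    fix Y :: real assume Y: "Y \<ge> 1"
    define S where "S = sqrt Y"
    have S: "S \<ge> 1" "S * S = Y" using Y by (auto simp: S_def)
    have SY: "S \<le> Y" using S mult_left_mono[of 1 S S] by simp
    have SYp: "Y powr r = S powr (2 * r)" for r using S by (simp add: powr_mult[symmetric] flip: S(2)) (simp add: powr_mult powr_add[symmetric])
    let ?A = "\<Sum>a\<in>ivl S. ch a * real a powr (-s) * (\<Sum>b\<in>ivl (Y / real a). real b powr (-s))"
    let ?B = "\<Sum>b\<in>ivl S. real b powr (-s) * (\<Sum>a\<in>fivl S (Y / real b). ch a * real a powr (-s))"
    have "(\<Sum>n\<in>ivl Y. real n powr (-s) * lam n) = ?A + ?B"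
      using Y unfolding lam_sum_ivl S_def by (subst hyperbola) (auto simp: powr_mult sum_distrib_left mult_ac)
    moreover have "\<bar>?B\<bar> \<le> 4 * real q * S powr (1/2 - s)"
    proof -
      have "\<bar>?B\<bar> \<le> (\<Sum>b\<in>ivl S. real b powr (-(1/2)) * (2 * real q * S powr (-s)))"
      proof (rule order_trans[OF sum_abs], rule sum_mono)
        fix b assume b: "b \<in> ivl S"
        have "\<bar>\<Sum>a\<in>fivl S (Y / real b). ch a * real a powr (-s)\<bar> \<le> 2 * real q * real (Suc (nat \<lfloor>S\<rfloor>)) powr (-s)"
          by (rule chi_powr_tail[OF s0])
        also have "... \<le> 2 * real q * S powr (-s)" using S s0 by (intro mult_left_mono powr_mono2') linarith+
        finally have 1: "\<bar>\<Sum>a\<in>fivl S (Y / real b). ch a * real a powr (-s)\<bar> \<le> 2 * real q * S powr (-s)" .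
        have "real b powr (-s) \<le> real b powr (-(1/2))" using s b by (intro powr_mono) (auto simp: mem_ivl)
        with 1 show "\<bar>real b powr (-s) * (\<Sum>a\<in>fivl S (Y / real b). ch a * real a powr (-s))\<bar> \<le> real b powr (-(1/2)) * (2 * real q * S powr (-s))"
          unfolding abs_mult by (intro mult_mono) auto
      qed
      also have "... = (\<Sum>b\<in>ivl S. real b powr (-(1/2))) * (2 * real q * S powr (-s))" by (simp add: sum_distrib_right)
      also have "... \<le> (2 * sqrt S) * (2 * real q * S powr (-s))"
      proof (intro mult_right_mono)
        have "(\<Sum>b\<in>ivl S. real b powr (-(1/2))) \<le> 2 * sqrt (real (nat \<lfloor>S\<rfloor>))" unfolding ivl_def by (rule sum_inv_sqrt_le)
        also have "... \<le> 2 * sqrt S" using S by simp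
        finally show "(\<Sum>b\<in>ivl S. real b powr (-(1/2))) \<le> 2 * sqrt S" .
      qed auto
      also have "... = 4 * real q * (S powr (1/2) * S powr (-s))" using S by (simp add: powr_half_sqrt)
      also have "... = 4 * real q * S powr (1/2 - s)" by (simp add: powr_add[symmetric])
      finally show ?thesis .
    qed
    moreover have "\<bar>?A - (Y powr (1 - s) / (1 - s) * (\<Sum>a\<in>ivl S. ch a / real a) + Z * (\<Sum>a\<in>ivl S. ch a * real a powr (-s)))\<bar>
        \<le> 2 * 2 powr s * S powr (1 - 2 * s)"
    proof -
      have "Y powr (1 - s) / (1 - s) * (\<Sum>a\<in>ivl S. ch a / real a) + Z * (\<Sum>a\<in>ivl S. ch a * real a powr (-s))
          = (\<Sum>a\<in>ivl S. ch a * real a powr (-s) * ((Y / real a) powr (1 - s) / (1 - s) + Z))"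
      proof -
        have "ch a * real a powr (-s) * ((Y / real a) powr (1 - s) / (1 - s)) = Y powr (1 - s) / (1 - s) * (ch a / real a)" if "a \<in> ivl S" for a
        proof -
          have a: "real a \<ge> 1" using that by (auto simp: mem_ivl)
          have "real a powr (-s) / real a powr (1 - s) = real a powr (-s - (1 - s))" by (rule powr_diff[symmetric])
          also have "... = real a powr (-1)" by simp
          also have "... = 1 / real a" using a by (simp add: powr_minus divide_inverse)
          finally have "real a powr (-s) / real a powr (1 - s) = 1 / real a" .
          moreover have "real a powr (-s) * (Y / real a) powr (1 - s) = Y powr (1 - s) * (real a powr (-s) / real a powr (1 - s))"
            using a Y by (simp add: powr_divide)
          ultimately have "real a powr (-s) * (Y / real a) powr (1 - s) = Y powr (1 - s) / real a" by simp
          then show ?thesis by (simp add: field_simps)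
        qed
        then show ?thesis by (simp add: distrib_left sum.distrib sum_distrib_left sum_divide_distrib mult_ac)
      qed
      then have "\<bar>?A - (Y powr (1 - s) / (1 - s) * (\<Sum>a\<in>ivl S. ch a / real a) + Z * (\<Sum>a\<in>ivl S. ch a * real a powr (-s)))\<bar>
        = \<bar>\<Sum>a\<in>ivl S. ch a * real a powr (-s) * ((\<Sum>b\<in>ivl (Y / real a). real b powr (-s)) - (Y / real a) powr (1 - s) / (1 - s) - Z)\<bar>"
        by (simp add: sum_subtractf[symmetric] algebra_simps)
      also have "... \<le> (\<Sum>a\<in>ivl S. 2 * 2 powr s * Y powr (-s))"
      proof (rule order_trans[OF sum_abs], rule sum_mono)
        fix a assume a: "a \<in> ivl S"
        then have a1: "real a \<ge> 1" "real a \<le> Y" using SY by (auto simp: mem_ivl)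
        have "\<bar>(\<Sum>b\<in>ivl (Y / real a). real b powr (-s)) - (Y / real a) powr (1 - s) / (1 - s) - Z\<bar> \<le> 2 * 2 powr s * (Y / real a) powr (-s)"
          using a1 by (intro Z(2)) (simp add: field_simps)
        then have "\<bar>ch a * real a powr (-s) * ((\<Sum>b\<in>ivl (Y / real a). real b powr (-s)) - (Y / real a) powr (1 - s) / (1 - s) - Z)\<bar>
          \<le> (1 * real a powr (-s)) * (2 * 2 powr s * (Y / real a) powr (-s))"
          unfolding abs_mult using chi_abs_le[of a] by (intro mult_mono) auto
        also have "... = 2 * 2 powr s * Y powr (-s)" using a1 Y by (simp add: powr_divide)
        finally show "\<bar>ch a * real a powr (-s) * ((\<Sum>b\<in>ivl (Y / real a). real b powr (-s)) - (Y / real a) powr (1 - s) / (1 - s) - Z)\<bar> \<le> 2 * 2 powr s * Y powr (-s)" .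
      qed
      also have "... = real (card (ivl S)) * (2 * 2 powr s * Y powr (-s))" by simp
      also have "... \<le> S * (2 * 2 powr s * Y powr (-s))" using card_ivl_le[of S] S by (intro mult_right_mono) auto
      also have "... = 2 * 2 powr s * (S powr 1 * S powr (2 * (-s)))" using S unfolding SYp by simp
      also have "... = 2 * 2 powr s * S powr (1 - 2 * s)" unfolding powr_add[symmetric] by simp
      finally show ?thesis .
    qed
    moreover have "\<bar>Y powr (1 - s) / (1 - s) * (\<Sum>a\<in>ivl S. ch a / real a) - Y powr (1 - s) / (1 - s) * L1\<bar> \<le> Y powr (1 - s) / \<bar>1 - s\<bar> * (2 * real q / S)"
    proof -
      have "\<bar>Y powr (1 - s) / (1 - s) * (\<Sum>a\<in>ivl S. ch a / real a) - Y powr (1 - s) / (1 - s) * L1\<bar> = Y powr (1 - s) / \<bar>1 - s\<bar> * \<bar>L1 - (\<Sum>a\<in>ivl S. ch a / real a)\<bar>"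
      proof -
        have "\<bar>u * A - u * L\<bar> = \<bar>u\<bar> * \<bar>L - A\<bar>" for u A L :: real
          by (simp add: right_diff_distrib[symmetric] abs_mult abs_minus_commute)
        moreover have "\<bar>Y powr (1 - s) / (1 - s)\<bar> = Y powr (1 - s) / \<bar>1 - s\<bar>" by simp
        ultimately show ?thesis by metis
      qed
      also have "... \<le> Y powr (1 - s) / \<bar>1 - s\<bar> * (2 * real q / S)" using S L1_ivl by (intro mult_left_mono) auto
      finally show ?thesis .
    qed
    moreover have "\<bar>Z * (\<Sum>a\<in>ivl S. ch a * real a powr (-s)) - Z * Lser s\<bar> \<le> \<bar>Z\<bar> * (2 * real q * S powr (-s))"
      unfolding right_diff_distrib[symmetric] abs_mult using Lser_ivl[OF s0 S(1)] by (intro mult_left_mono) (auto simp: abs_minus_commute)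
    ultimately show "\<bar>(\<Sum>n\<in>ivl Y. real n powr (-s) * lam n) - Y powr (1 - s) / (1 - s) * L1 - Z * Lser s\<bar>
      \<le> Y powr (1 - s) / \<bar>1 - s\<bar> * (2 * real q / sqrt Y) + \<bar>Z\<bar> * (2 * real q * sqrt Y powr (-s))
        + 2 * 2 powr s * sqrt Y powr (1 - 2 * s) + 4 * real q * sqrt Y powr (1/2 - s)"
      unfolding S_def[symmetric] by linarith
  qed
qed

text \<open>The term n = 1 keeps the sum of lam n n^(-s) at least 1, whereas at a zero everything in
  \<open>lam_powr_sum\<close> would tend to 0.\<close>

lemma Lser_nonzero_gt1:
  assumes "s > 1"
  shows "Lser s \<noteq> 0"
proof
  assume 0: "Lser s = 0"
  obtain Z where Z: "\<And>Y. Y \<ge> 1 \<Longrightarrow> \<bar>(\<Sum>n\<in>ivl Y. real n powr (-s) * lam n) - Y powr (1 - s) / (1 - s) * L1 - Z * Lser s\<bar>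
      \<le> Y powr (1 - s) / \<bar>1 - s\<bar> * (2 * real q / sqrt Y) + \<bar>Z\<bar> * (2 * real q * sqrt Y powr (-s))
        + 2 * 2 powr s * sqrt Y powr (1 - 2 * s) + 4 * real q * sqrt Y powr (1/2 - s)"
    using lam_powr_sum[of s] assms by auto
  let ?R = "\<lambda>Y. \<bar>Y powr (1 - s) / (1 - s) * L1\<bar> + Y powr (1 - s) / \<bar>1 - s\<bar> * (2 * real q / sqrt Y) + \<bar>Z\<bar> * (2 * real q * sqrt Y powr (-s))
        + 2 * 2 powr s * sqrt Y powr (1 - 2 * s) + 4 * real q * sqrt Y powr (1/2 - s)"
  have sq: "filterlim (sqrt :: real \<Rightarrow> real) at_top at_top" by (rule sqrt_at_top)
  have "(?R \<longlongrightarrow> \<bar>0 / (1 - s) * L1\<bar> + 0 / \<bar>1 - s\<bar> * 0 + \<bar>Z\<bar> * (2 * real q * 0) + 2 * 2 powr s * 0 + 4 * real q * 0) at_top"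
    using assms by (intro tendsto_intros tendsto_neg_powr sq filterlim_ident tendsto_divide_0[OF tendsto_const] filterlim_at_top_imp_at_infinity) auto
  then have "(?R \<longlongrightarrow> 0) at_top" by simp
  then have "eventually (\<lambda>Y. ?R Y < 1) at_top" by (rule order_tendstoD) simp
  moreover have "eventually (\<lambda>Y. Y \<ge> (1::real)) at_top" by (rule eventually_ge_at_top)
  ultimately have "eventually (\<lambda>Y::real. False) at_top"
  proof eventually_elim
    case (elim Y)
    have "(\<Sum>n\<in>{1}. real n powr (-s) * lam n) \<le> (\<Sum>n\<in>ivl Y. real n powr (-s) * lam n)"
      using elim by (intro sum_mono2) (auto simp: mem_ivl)
    then have "1 \<le> (\<Sum>n\<in>ivl Y. real n powr (-s) * lam n)" by simp
    moreover have "\<bar>x - u - Z * 0\<bar> \<le> a + b + c + d \<Longrightarrow> \<bar>u\<bar> + a + b + c + d < 1 \<Longrightarrow> 1 \<le> x \<Longrightarrow> False" for x u a b c d :: real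
      by simp
    ultimately show False using Z[OF elim(2), unfolded 0] elim(1) by blast
  qed
  then show False by simp
qed

definition H :: "real \<Rightarrow> real" where "H Y = (\<Sum>n\<in>ivl Y. lam n / real n)"

text \<open>At the zero, \<open>lam_powr_sum\<close> leaves Y^(1-b) L1 / (1 - b) up to a small
  error. Since n^(-b) \<le> Y^(1-b) / n for n \<le> Y, passing to \<open>H\<close> cancels the
  factor Y^(1-b). The hypothesis \<open>small\<close> keeps this factor below e, so the errors stay
  below half of the main term.\<close>

lemma H_lower:
  assumes b: "3/4 \<le> b" "b < 1" "Lser b = 0" and Y: "Y \<ge> Q0" and small: "(1 - b) * ln Y \<le> 1"
  shows "H Y \<ge> L1 / (2 * (1 - b))"
proof -
  obtain Z where Z: "\<bar>Z\<bar> \<le> 2 + 1 / \<bar>1 - b\<bar>"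
   "\<And>Y. Y \<ge> 1 \<Longrightarrow> \<bar>(\<Sum>n\<in>ivl Y. real n powr (-b) * lam n) - Y powr (1 - b) / (1 - b) * L1 - Z * Lser b\<bar>
      \<le> Y powr (1 - b) / \<bar>1 - b\<bar> * (2 * real q / sqrt Y) + \<bar>Z\<bar> * (2 * real q * sqrt Y powr (-b))
        + 2 * 2 powr b * sqrt Y powr (1 - 2 * b) + 4 * real q * sqrt Y powr (1/2 - b)"
    using lam_powr_sum[of b] b by auto
  define S where "S = sqrt Y"
  define T where "T = 1 / (1 - b)"
  have Y1: "Y \<ge> 1408" using Y Q0_ge by linarith
  have S: "S \<ge> 1" using Y1 by (simp add: S_def)
  have T4: "T \<ge> 4" unfolding T_def using b by (simp add: field_simps)
  define P where "P = Y powr (1 - b)"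
  have "P = exp ((1 - b) * ln Y)" using Y1 by (simp add: P_def powr_def)
  also have "... \<le> exp 1" using small by simp
  also have "... \<le> 3" by (rule exp_le)
  finally have P3: "P \<le> 3" .
  have P1: "P \<ge> 1" unfolding P_def using Y1 b by (intro ge_one_powr_ge_zero) auto
  define e where "e = S powr (-1/4)"
  have e0: "e \<ge> 0" by (simp add: e_def)
  have pw: "S powr r \<le> e" if "r \<le> -1/4" for r unfolding e_def using S that by (intro powr_mono) auto
  have "1 / S = S powr (-1)" using S by (simp add: powr_minus divide_inverse)
  then have iS: "1 / S \<le> e" using pw[of "-1"] by simp
  have q1': "real q \<ge> 1" using q1 by simp
  have "\<bar>(\<Sum>n\<in>ivl Y. real n powr (-b) * lam n) - P * T * L1\<bar>
      \<le> P * T * (2 * real q * (1 / S)) + \<bar>Z\<bar> * (2 * real q * S powr (-b)) + 2 * 2 powr b * S powr (1 - 2 * b) + 4 * real q * S powr (1/2 - b)"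
    using Z(2)[of Y] Y1 b unfolding P_def T_def S_def by (simp add: abs_of_pos)
  also have "... \<le> 3 * T * (2 * real q * e) + (3/2 * T) * (2 * real q * e) + 2 * 2 * e + 4 * real q * e"
  proof (intro add_mono mult_mono)
    show "P \<le> 3" by fact
    have "1 / \<bar>1 - b\<bar> = T" using b by (simp add: T_def)
    then show "\<bar>Z\<bar> \<le> 3/2 * T" using Z(1) T4 by linarith
    have "2 powr b \<le> 2 powr (1::real)" using b by (intro powr_mono) auto
    then show "2 powr b \<le> 2" by simp
  qed (use S b T4 iS pw e0 q1' in auto)
  also have "... \<le> 11 * T * real q * e"
  proof -
    have "4 * e \<le> T * real q * e" using T4 q1' e0 mult_mono[of 4 T 1 "real q"] by (intro mult_right_mono) auto
    moreover have "4 * real q * e \<le> T * real q * e" using T4 q1' e0 by (intro mult_right_mono) auto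
    moreover have "3 * T * (2 * real q * e) + (3/2 * T) * (2 * real q * e) = 9 * (T * real q * e)" by simp
    ultimately show ?thesis by linarith
  qed
  also have "... \<le> T * L1 / 2"
  proof -
    have "1408 * (real q)\<^sup>2 = ((1408 * (real q)\<^sup>2) ^ 8) powr (1/8)"
    proof -
      have "(c ^ 8) powr (1/8) = c" if "c > 0" for c :: real
        using that by (simp add: powr_realpow[symmetric] powr_powr del: powr_numeral)
      from this[of "1408 * (real q)\<^sup>2"] show ?thesis using q1 by simp
    qed
    also have "... \<le> Y powr (1/8)" using Y unfolding Q0_def by (intro powr_mono2) auto
    also have "... = S powr (1/4)" using Y1 by (simp add: S_def powr_half_sqrt[symmetric] powr_powr)
    finally have ge: "1408 * (real q)\<^sup>2 \<le> S powr (1/4)" .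
    have e: "e = 1 / S powr (1/4)" by (simp add: e_def powr_minus_divide)
    have pos: "1408 * (real q)\<^sup>2 > 0" using q1 by simp
    have "e \<le> 1 / (1408 * (real q)\<^sup>2)" unfolding e using ge pos by (intro divide_left_mono mult_pos_pos) auto
    then have "11 * real q * e \<le> 11 * real q * (1 / (1408 * (real q)\<^sup>2))" by (intro mult_left_mono) auto
    also have "... = 1 / (64 * real q) / 2" using q1 by (simp add: power2_eq_square)
    also have "... \<le> L1 / 2" using L1_ge by simp
    finally have "T * (11 * real q * e) \<le> T * (L1 / 2)" using T4 by (intro mult_left_mono) auto
    then show ?thesis by (simp add: mult_ac)
  qed
  finally have "(\<Sum>n\<in>ivl Y. real n powr (-b) * lam n) \<ge> P * T * L1 - T * L1 / 2" by linarith
  moreover have "P * (T * L1) \<ge> 1 * (T * L1)" using P1 T4 L1_pos by (intro mult_right_mono) auto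
  ultimately have lo: "(\<Sum>n\<in>ivl Y. real n powr (-b) * lam n) \<ge> P * (T * L1 / 2)" by (simp add: mult_ac)
  have "(\<Sum>n\<in>ivl Y. real n powr (-b) * lam n) \<le> (\<Sum>n\<in>ivl Y. P * (lam n / real n))"
  proof (rule sum_mono)
    fix n assume n: "n \<in> ivl Y"
    then have n1: "real n \<ge> 1" "real n \<le> Y" by (auto simp: mem_ivl)
    have "real n powr (-b) = real n powr ((1 - b) + (-1))" by simp
    also have "... = real n powr (1 - b) * real n powr (-1)" by (rule powr_add)
    also have "... = real n powr (1 - b) / real n" using n1 by (simp add: powr_minus divide_inverse)
    also have "... \<le> P / real n" unfolding P_def using n1 b by (intro divide_right_mono powr_mono2) auto
    finally have "real n powr (-b) * lam n \<le> P / real n * lam n" by (intro mult_right_mono) auto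
    then show "real n powr (-b) * lam n \<le> P * (lam n / real n)" by simp
  qed
  also have "... = P * H Y" by (simp add: H_def sum_distrib_left)
  finally have "P * (T * L1 / 2) \<le> P * H Y" using lo by linarith
  then have "T * L1 / 2 \<le> H Y" using P1 by simp
  then show ?thesis by (simp add: T_def mult.commute)
qed

lemma H_le: "Y \<ge> 0 \<Longrightarrow> H Y \<le> Y"
proof -
  assume Y: "Y \<ge> 0"
  have "H Y \<le> (\<Sum>n\<in>ivl Y. 1)" unfolding H_def
    using lam_le by (intro sum_mono) (auto simp: mem_ivl divide_le_eq_1)
  also have "... \<le> Y" using card_ivl_le[OF Y] by simp
  finally show ?thesis .
qed

text \<open>\<open>H Q0\<close> is at most \<open>Q0\<close> trivially and at least L1 / (2 (1 - b))
  by \<open>H_lower\<close>, so \<open>L1_ge\<close> bounds 1 - b below. Outside the range of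
  \<open>H_lower\<close> the gap 1 - b already exceeds 1/4 or 1 / ln Q0.\<close>

lemma zero_gap:
  assumes b: "b < 1" "Lser b = 0" "b > 0"
  shows "1 - b \<ge> 1 / (128 * real q * Q0)"
proof -
  have q: "real q \<ge> 1" using q1 by simp
  have Q: "Q0 \<ge> 1408" by (rule Q0_ge)
  have "1 * Q0 \<le> (128 * real q) * Q0" using q Q by (intro mult_right_mono) auto
  then have big: "Q0 \<le> 128 * real q * Q0" by simp
  consider "b < 3/4" | "b \<ge> 3/4" "(1 - b) * ln Q0 \<le> 1" | "(1 - b) * ln Q0 > 1" by linarith
  then show ?thesis
  proof cases
    case 1
    have "1 / (128 * real q * Q0) \<le> 1 / 4" by (rule frac_le) (use big Q in linarith)+
    then show ?thesis using 1 by linarith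
  next
    case 2
    have "L1 / (2 * (1 - b)) \<le> H Q0" using 2 b by (intro H_lower) auto
    also have "... \<le> Q0" using Q by (intro H_le) auto
    finally have "L1 \<le> Q0 * (2 * (1 - b))" using b by (simp add: pos_divide_le_eq)
    then have "1 / (64 * real q) \<le> Q0 * (2 * (1 - b))" using L1_ge by linarith
    then show ?thesis using q Q by (simp add: field_simps)
  next
    case 3
    have "ln Q0 \<le> Q0" using ln_le_minus_one[of Q0] Q by linarith
    then have "(1 - b) * ln Q0 \<le> (1 - b) * (128 * real q * Q0)" using b big by (intro mult_left_mono) auto
    then have "1 \<le> (1 - b) * (128 * real q * Q0)" using 3 by linarith
    then show ?thesis using q Q by (simp add: pos_divide_le_eq)
  qed
qed

section \<open>\<open>lam\<close> in residue classes\<close>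

lemma residue_sum:
  assumes "coprime u q"
  shows "(\<Sum>n<q. of_bool [n * u = a] (mod q) :: real) = 1"
proof -
  have "(\<Sum>n<q. of_bool [u * n = a] (mod q) :: real) = (\<Sum>n<q. of_bool [n = a] (mod q))"
    by (rule sum_mult_residues[where f = "\<lambda>n. of_bool [n = a] (mod q)"]) (use q1 assms in \<open>auto simp: cong_def\<close>)
  also have "... = (\<Sum>n\<in>{a mod q}. 1)"
    using q1 by (intro sum.mono_neutral_cong_right) (auto simp: cong_def)
  finally show ?thesis by (simp add: mult.commute)
qed

text \<open>Subtracting 1 / q leaves a periodic function of mean zero whose absolute sum over a
  period is at most 2, hence partial sums up to 4; rounding the ends of the interval costs one more.
  The error does not grow with \<open>q\<close>.\<close>

lemma residue_count:
  assumes u: "coprime u q" and S: "0 \<le> S" "S \<le> Z"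
  shows "\<bar>(\<Sum>n\<in>fivl S Z. of_bool [n * u = a] (mod q)) - (Z - S) / real q\<bar> \<le> 5"
proof -
  have q: "real q \<ge> 1" using q1 by simp
  let ?f = "\<lambda>n. of_bool [n * u = a] (mod q) - 1 / real q :: real"
  have "(\<Sum>n<q. \<bar>?f n\<bar>) \<le> (\<Sum>n<q. of_bool [n * u = a] (mod q) + 1 / real q)"
    by (intro sum_mono) (auto simp: abs_le_iff)
  also have "... = 2" using q1 by (simp add: sum.distrib residue_sum[OF u])
  finally have "(\<Sum>n<q. \<bar>?f n\<bar>) \<le> 2" .
  moreover have "(\<Sum>n<q. ?f n) = 0" unfolding sum_subtractf residue_sum[OF u] using q1 by simp
  moreover have "?f (n + q) = ?f n" for n by (simp add: cong_def add_mult_distrib)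
  ultimately have "\<bar>\<Sum>n\<in>fivl S Z. ?f n\<bar> \<le> 2 * 2"
    using q1 by (intro periodic_sum_bound[where q = q]) simp_all
  moreover have "(\<Sum>n\<in>fivl S Z. ?f n) = (\<Sum>n\<in>fivl S Z. of_bool [n * u = a] (mod q)) - real (nat \<lfloor>Z\<rfloor> - nat \<lfloor>S\<rfloor>) / real q"
    by (simp add: sum_subtractf)
  moreover have "\<bar>real (nat \<lfloor>Z\<rfloor> - nat \<lfloor>S\<rfloor>) / real q - (Z - S) / real q\<bar> \<le> 1"
  proof -
    have "nat \<lfloor>S\<rfloor> \<le> nat \<lfloor>Z\<rfloor>" using S by (intro nat_mono floor_mono)
    then have "\<bar>real (nat \<lfloor>Z\<rfloor> - nat \<lfloor>S\<rfloor>) - (Z - S)\<bar> \<le> 1" using S by (simp add: of_nat_diff) linarith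
    then have "\<bar>real (nat \<lfloor>Z\<rfloor> - nat \<lfloor>S\<rfloor>) - (Z - S)\<bar> / real q \<le> 1 / 1" using q by (intro frac_le) auto
    then show ?thesis by (simp add: diff_divide_distrib[symmetric])
  qed
  ultimately show ?thesis by linarith
qed

lemma residue_count_ivl:
  assumes u: "coprime u q" and Z: "0 \<le> Z"
  shows "\<bar>(\<Sum>n\<in>ivl Z. of_bool [n * u = a] (mod q)) - Z / real q\<bar> \<le> 5"
proof -
  have "ivl Z = fivl (0::real) Z" by (auto simp: ivl_def)
  then show ?thesis using residue_count[OF u, of 0 Z a] Z by simp
qed

text \<open>Hyperbola method with n = l m. For l \<le> sqrt Y prime to q the class fixes
  \<open>m\<close> modulo \<open>q\<close>; for m \<le> sqrt Y it fixes \<open>l\<close>, and then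
  ch l = ch a ch t ch m. So the second part repeats the first with the factor ch a ch t. As classes
  are counted within O(1), the error is free of \<open>q\<close>.\<close>

lemma lam_progression:
  assumes a: "coprime a q" and t: "coprime t q" and Y: "Y \<ge> 0"
  shows "\<bar>(\<Sum>n\<in>ivl Y. of_bool [n * t = a] (mod q) * lam n) - Y / real q * L1 * (1 + ch a * ch t)\<bar> \<le> 20 * sqrt Y"
proof (cases "Y < 1")
  case True
  then have "ivl Y = {}" by (auto simp: mem_ivl)
  moreover have "\<bar>Y / real q * L1 * (1 + ch a * ch t)\<bar> \<le> 20 * sqrt Y"
  proof -
    have "\<bar>ch a * ch t\<bar> \<le> 1" unfolding abs_mult using mult_mono[OF chi_abs_le[of a] chi_abs_le[of t]] by simp
    then have "\<bar>1 + ch a * ch t\<bar> \<le> 2" by linarith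
    then have "\<bar>Y / real q * L1 * (1 + ch a * ch t)\<bar> \<le> (Y / real q * (3 * real q)) * 2"
      unfolding abs_mult using Y L1_le L1_pos by (intro mult_mono) auto
    also have "... = 6 * (sqrt Y * sqrt Y)" using q1 Y by simp
    also have "... \<le> 6 * (sqrt Y * 1)" using True Y by (intro mult_left_mono) auto
    finally show ?thesis using real_sqrt_ge_zero[OF Y] by linarith
  qed
  ultimately show ?thesis by simp
next
  case False
  define S where "S = sqrt Y"
  have S: "S \<ge> 1" "S * S = Y" using False by (auto simp: S_def)
  have q: "real q \<ge> 1" using q1 by simp
  let ?A = "\<Sum>l\<in>ivl S. ch l * (\<Sum>m\<in>ivl (Y / real l). of_bool [m * (l * t) = a] (mod q))"
  let ?B = "\<Sum>m\<in>ivl S. (\<Sum>l\<in>fivl S (Y / real m). of_bool [l * (m * t) = a] (mod q) * ch l)"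
  have eq: "(\<Sum>n\<in>ivl Y. of_bool [n * t = a] (mod q) * lam n) = ?A + ?B"
    using Y unfolding lam_sum_ivl S_def by (subst hyperbola) (auto simp: sum_distrib_left mult_ac)
  have A: "\<bar>?A - Y / real q * (\<Sum>l\<in>ivl S. ch l / real l)\<bar> \<le> 5 * S"
  proof -
    have "?A - Y / real q * (\<Sum>l\<in>ivl S. ch l / real l)
      = (\<Sum>l\<in>ivl S. ch l * ((\<Sum>m\<in>ivl (Y / real l). of_bool [m * (l * t) = a] (mod q)) - (Y / real l) / real q))"
      by (simp add: sum_subtractf sum_distrib_left algebra_simps)
    also have "\<bar>...\<bar> \<le> (\<Sum>l\<in>ivl S. 5)"
    proof (rule order_trans[OF sum_abs], rule sum_mono)
      fix l assume l: "l \<in> ivl S"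
      show "\<bar>ch l * ((\<Sum>m\<in>ivl (Y / real l). of_bool [m * (l * t) = a] (mod q)) - (Y / real l) / real q)\<bar> \<le> 5"
      proof (cases "coprime l q")
        case True
        then have "\<bar>(\<Sum>m\<in>ivl (Y / real l). of_bool [m * (l * t) = a] (mod q)) - (Y / real l) / real q\<bar> \<le> 5"
          using t Y by (intro residue_count_ivl) auto
        then have "\<bar>ch l\<bar> * \<bar>(\<Sum>m\<in>ivl (Y / real l). of_bool [m * (l * t) = a] (mod q)) - (Y / real l) / real q\<bar> \<le> 1 * 5"
          by (intro mult_mono chi_abs_le) auto
        then show ?thesis unfolding abs_mult by linarith
      qed (use chi_zero_iff[of l] in auto)
    qed
    also have "... \<le> 5 * S" using card_ivl_le[of S] S by simp
    finally show ?thesis .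
  qed
  \<comment> \<open>Here \<open>l\<close> starts beyond sqrt Y and not at 1; the sum with S / q
    accounts for the missing piece and is bounded in \<open>C\<close>.\<close>
  have B: "\<bar>?B - ch a * ch t * (Y / real q * (\<Sum>m\<in>ivl S. ch m / real m) - S / real q * (\<Sum>m\<in>ivl S. ch m))\<bar> \<le> 5 * S"
  proof -
    have gen: "sum G (ivl S) - ch a * ch t * (Y / real q * (\<Sum>m\<in>ivl S. ch m / real m) - S / real q * (\<Sum>m\<in>ivl S. ch m))
      = (\<Sum>m\<in>ivl S. G m - ch a * ch t * ch m * ((Y / real m - S) / real q))" for G
      by (simp add: sum_subtractf sum.distrib sum_distrib_left sum_divide_distrib algebra_simps diff_divide_distrib)
    have "?B - ch a * ch t * (Y / real q * (\<Sum>m\<in>ivl S. ch m / real m) - S / real q * (\<Sum>m\<in>ivl S. ch m))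
      = (\<Sum>m\<in>ivl S. (\<Sum>l\<in>fivl S (Y / real m). of_bool [l * (m * t) = a] (mod q) * ch l) - ch a * ch t * ch m * ((Y / real m - S) / real q))"
      by (rule gen)
    also have "\<bar>...\<bar> \<le> (\<Sum>m\<in>ivl S. 5)"
    proof (rule order_trans[OF sum_abs], rule sum_mono)
      fix m assume m: "m \<in> ivl S"
      have mS: "real m \<ge> 1" "real m \<le> S" using m by (auto simp: mem_ivl)
      show "\<bar>(\<Sum>l\<in>fivl S (Y / real m). of_bool [l * (m * t) = a] (mod q) * ch l) - ch a * ch t * ch m * ((Y / real m - S) / real q)\<bar> \<le> 5"
      proof (cases "coprime m q")
        case True
        have c: "of_bool [l * (m * t) = a] (mod q) * ch l = ch a * ch t * ch m * of_bool [l * (m * t) = a] (mod q)" for l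
        proof (cases "[l * (m * t) = a] (mod q)")
          case c: True
          have "ch a = ch l * (ch m * ch t)" using chi_cong[OF c] by (simp add: chi_mult)
          moreover have "ch m * ch m = 1" "ch t * ch t = 1" using True t chi_vals[of m] chi_vals[of t] chi_zero_iff[of m] chi_zero_iff[of t] by auto
          ultimately have "ch a * ch t * ch m = ch l" by (simp add: mult_ac)
          then show ?thesis using c by simp
        qed simp
        have "S \<le> Y / real m" using mS S by (simp add: field_simps flip: S(2)) 
        then have "\<bar>(\<Sum>l\<in>fivl S (Y / real m). of_bool [l * (m * t) = a] (mod q)) - (Y / real m - S) / real q\<bar> \<le> 5"
          using True t S by (intro residue_count) auto
        moreover have "\<bar>ch a * ch t * ch m\<bar> \<le> 1 * 1 * 1" unfolding abs_mult by (intro mult_mono chi_abs_le) auto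
        ultimately have "\<bar>ch a * ch t * ch m\<bar> * \<bar>(\<Sum>l\<in>fivl S (Y / real m). of_bool [l * (m * t) = a] (mod q)) - (Y / real m - S) / real q\<bar> \<le> 1 * 5"
          by (intro mult_mono) auto
        then show ?thesis unfolding c sum_distrib_left[symmetric] right_diff_distrib[symmetric] abs_mult by simp
      next
        case False
        have "\<not> [l * (m * t) = a] (mod q)" for l
        proof
          assume "[l * (m * t) = a] (mod q)"
          then have "coprime (l * (m * t)) q" using a by (metis cong_imp_coprime cong_sym coprime_commute)
          then show False using False by simp
        qed
        then show ?thesis using chi_zero_iff[of m] False by simp
      qed
    qed
    also have "... \<le> 5 * S" using card_ivl_le[of S] S by simp
    finally show ?thesis .
  qed
  have L: "\<bar>Y / real q * (\<Sum>l\<in>ivl S. ch l / real l) - Y / real q * L1\<bar> \<le> 2 * S"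
  proof -
    have "\<bar>Y / real q * (\<Sum>l\<in>ivl S. ch l / real l) - Y / real q * L1\<bar> = Y / real q * \<bar>L1 - (\<Sum>l\<in>ivl S. ch l / real l)\<bar>"
    proof -
      have "\<bar>u * A - u * L\<bar> = u * \<bar>L - A\<bar>" if "u \<ge> 0" for u A L :: real
        using that by (simp add: right_diff_distrib[symmetric] abs_mult abs_minus_commute)
      moreover have "Y / real q \<ge> 0" using Y by simp
      ultimately show ?thesis by blast
    qed
    also have "... \<le> Y / real q * (2 * real q / S)" using Y S L1_ivl[of S] by (intro mult_left_mono) auto
    also have "... = 2 * S" using S q by (simp add: field_simps flip: S(2))
    finally show ?thesis .
  qed
  have C: "\<bar>S / real q * (\<Sum>m\<in>ivl S. ch m)\<bar> \<le> 2 * S"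
  proof -
    have "ivl S = {0<..nat \<lfloor>S\<rfloor>}" by (auto simp: ivl_def)
    then have "\<bar>S / real q * (\<Sum>m\<in>ivl S. ch m)\<bar> \<le> S / real q * (2 * real q)"
      unfolding abs_mult using S sum_chi_bound by (intro mult_mono) auto
    then show ?thesis using q by simp
  qed
  define k where "k = ch a * ch t"
  have k: "\<bar>k\<bar> \<le> 1" unfolding k_def abs_mult using mult_mono[OF chi_abs_le[of a] chi_abs_le[of t]] by simp
  have "?A + ?B - Y / real q * L1 * (1 + k)
     = (?A - Y / real q * (\<Sum>l\<in>ivl S. ch l / real l))
      + (?B - k * (Y / real q * (\<Sum>m\<in>ivl S. ch m / real m) - S / real q * (\<Sum>m\<in>ivl S. ch m)))
      + (1 + k) * (Y / real q * (\<Sum>l\<in>ivl S. ch l / real l) - Y / real q * L1)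
      - k * (S / real q * (\<Sum>m\<in>ivl S. ch m))"
    by (simp add: algebra_simps add_divide_distrib)
  moreover have "\<bar>(1 + k) * (Y / real q * (\<Sum>l\<in>ivl S. ch l / real l) - Y / real q * L1)\<bar> \<le> 2 * (2 * S)"
    unfolding abs_mult using k by (intro mult_mono L) auto
  moreover have "\<bar>k * (S / real q * (\<Sum>m\<in>ivl S. ch m))\<bar> \<le> 1 * (2 * S)"
    unfolding abs_mult[of k] by (intro mult_mono C k) auto
  ultimately have "\<bar>?A + ?B - Y / real q * L1 * (1 + k)\<bar> \<le> 20 * S"
    using A B[folded k_def] S by linarith
  then show ?thesis unfolding eq k_def[symmetric] S_def[symmetric] .
qed

text \<open>Induction over \<open>E\<close> by \<open>lam_hecke\<close>, which replaces
  \<open>t\<close> by p t and by p p t. The coefficients, of size at most 2 and 1, triple the error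
  at each prime; the main terms combine to the local factor because ch p is 1 or -1.\<close>

lemma lam_progression_dvd:
  assumes "finite E" "\<And>p. p \<in> E \<Longrightarrow> prime p \<and> \<not> p dvd q"
    and a: "coprime a q" and t: "coprime t q" and Y: "Y \<ge> 0"
  shows "\<bar>(\<Sum>b\<in>ivl Y. of_bool [b * \<Prod>E * t = a] (mod q) * lam (\<Prod>E * b))
           - Y / real q * L1 * (1 + ch a * ch t) * (\<Prod>p\<in>E. lam p - ch p / real p)\<bar> \<le> 20 * 3 ^ card E * sqrt Y"
  using assms(1,2) t Y
proof (induction E arbitrary: t Y rule: finite_induct)
  case empty
  then show ?case using lam_progression[OF a] by simp
next
  case (insert p E)
  let ?e = "\<Prod>E"
  have p: "prime p" "\<not> p dvd q" and pos: "p > 0" using insert.prems(1)[of p] by (auto simp: prime_gt_0_nat)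
  have cp: "coprime p q" using p by (simp add: prime_imp_coprime)
  have pe: "\<not> p dvd ?e"
  proof
    assume "p dvd ?e"
    then obtain r where "r \<in> E" "p dvd r" using p insert.hyps(1) by (auto simp: prime_dvd_prod_iff)
    then show False using insert p by (metis insertI2 primes_dvd_imp_eq)
  qed
  have e0: "?e > 0" using insert by (intro prod_pos) (auto simp: prime_gt_0_nat)
  define D where "D = (\<lambda>Y t. \<Sum>b\<in>ivl Y. of_bool [b * ?e * t = a] (mod q) * lam (?e * b))"
  define \<alpha> where "\<alpha> = (\<Prod>p\<in>E. lam p - ch p / real p)"
  have "(\<Sum>b\<in>ivl Y. of_bool [b * \<Prod>(insert p E) * t = a] (mod q) * lam (\<Prod>(insert p E) * b))
     = (\<Sum>b\<in>ivl Y. lam p * (of_bool [b * ?e * (p * t) = a] (mod q) * lam (?e * b))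
          - (if p dvd b then ch p * (of_bool [(b div p) * ?e * (p * p * t) = a] (mod q) * lam (?e * (b div p))) else 0))"
  proof (intro sum.cong refl)
    fix b assume "b \<in> ivl Y"
    then have b: "b > 0" by (auto simp: mem_ivl)
    have "p dvd ?e * b \<longleftrightarrow> p dvd b" using p pe by (simp add: prime_dvd_mult_iff)
    then have "lam (p * (?e * b)) = lam p * lam (?e * b) - ch p * (if p dvd b then lam (?e * (b div p)) else 0)"
      using lam_hecke[OF p(1), of "?e * b"] b e0 by (auto simp: div_mult_swap)
    note hecke = this
    have X1: "b * \<Prod>(insert p E) * t = b * ?e * (p * t)" using insert.hyps by simp
    have X2: "\<Prod>(insert p E) * b = p * (?e * b)" using insert.hyps by simp
    define Bb where "Bb = (of_bool [b * ?e * (p * t) = a] (mod q) :: real)"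
    have X3: "of_bool [(b div p) * ?e * (p * p * t) = a] (mod q) = Bb" if "p dvd b"
    proof -
      have "(b div p) * ?e * (p * p * t) = b * ?e * (p * t)" using that pos by (auto elim!: dvdE)
      then show ?thesis by (simp only: Bb_def)
    qed
    show "of_bool [b * \<Prod>(insert p E) * t = a] (mod q) * lam (\<Prod>(insert p E) * b)
     = lam p * (of_bool [b * ?e * (p * t) = a] (mod q) * lam (?e * b))
          - (if p dvd b then ch p * (of_bool [(b div p) * ?e * (p * p * t) = a] (mod q) * lam (?e * (b div p))) else 0)"
      unfolding X1 X2 hecke Bb_def[symmetric]
      by (cases "p dvd b") (simp_all add: X3 right_diff_distrib)
  qed
  also have "... = lam p * D Y (p * t) - (\<Sum>b | b \<in> ivl Y \<and> p dvd b. ch p * (of_bool [(b div p) * ?e * (p * p * t) = a] (mod q) * lam (?e * (b div p))))"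
    unfolding sum_subtractf D_def sum_distrib_left
    by (rule arg_cong2[of _ _ _ _ "(-)"], rule refl, subst sum.inter_filter[symmetric], simp, rule refl)
  also have "(\<Sum>b | b \<in> ivl Y \<and> p dvd b. ch p * (of_bool [(b div p) * ?e * (p * p * t) = a] (mod q) * lam (?e * (b div p))))
      = ch p * D (Y / real p) (p * p * t)"
    by (subst sum_ivl_dvd[OF pos], unfold D_def sum_distrib_left, intro sum.cong refl) (use pos in simp)
  finally have eq: "(\<Sum>b\<in>ivl Y. of_bool [b * \<Prod>(insert p E) * t = a] (mod q) * lam (\<Prod>(insert p E) * b))
     = lam p * D Y (p * t) - ch p * D (Y / real p) (p * p * t)" .
  have I1: "\<bar>D Y (p * t) - Y / real q * L1 * (1 + ch a * ch (p * t)) * \<alpha>\<bar> \<le> 20 * 3 ^ card E * sqrt Y"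
    unfolding D_def \<alpha>_def using insert cp by (intro insert.IH) auto
  have I2: "\<bar>D (Y / real p) (p * p * t) - (Y / real p) / real q * L1 * (1 + ch a * ch (p * p * t)) * \<alpha>\<bar> \<le> 20 * 3 ^ card E * sqrt (Y / real p)"
    unfolding D_def \<alpha>_def using insert cp pos by (intro insert.IH) auto
  have "sqrt (Y / real p) \<le> sqrt Y" using insert.prems(3) pos by (intro real_sqrt_le_mono) (simp add: divide_le_eq mult_le_cancel_left1)
  then have I2': "\<bar>D (Y / real p) (p * p * t) - (Y / real p) / real q * L1 * (1 + ch a * ch (p * p * t)) * \<alpha>\<bar> \<le> 20 * 3 ^ card E * sqrt Y"
    by (intro order_trans[OF I2] mult_left_mono) auto
  have chp: "ch p = 1 \<or> ch p = -1" using chi_vals[of p] chi_zero_iff[of p] cp by auto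
  have main: "Y / real q * L1 * (1 + ch a * ch t) * (\<Prod>p\<in>insert p E. lam p - ch p / real p)
     = lam p * (Y / real q * L1 * (1 + ch a * ch (p * t)) * \<alpha>) - ch p * ((Y / real p) / real q * L1 * (1 + ch a * ch (p * p * t)) * \<alpha>)"
  proof -
    have pr: "(\<Prod>p\<in>insert p E. lam p - ch p / real p) = (lam p - ch p * (1 / real p)) * \<alpha>"
      using insert.hyps by (simp add: \<alpha>_def)
    have Yp: "Y / real p / real q = Y / real q * (1 / real p)" by simp
    have "M * L * (1 + k * l) * ((1 + c - c * i) * A) =
        (1 + c) * (M * L * (1 + k * (c * l)) * A) - c * (M * i * L * (1 + k * (c * c * l)) * A)"
      if "c = 1 \<or> c = -1" for M L k l c i A :: real
      using that by (elim disjE) (simp_all add: algebra_simps)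
    then show ?thesis unfolding pr Yp chi_mult lam_prime[OF p(1)] using chp by blast
  qed
  have lp: "\<bar>lam p\<bar> \<le> 2" using chp lam_prime[OF p(1)] by auto
  have A1: "\<bar>lam p * (D Y (p * t) - Y / real q * L1 * (1 + ch a * ch (p * t)) * \<alpha>)\<bar> \<le> 2 * (20 * 3 ^ card E * sqrt Y)"
    unfolding abs_mult[of "lam p"] by (intro mult_mono lp I1) auto
  have A2: "\<bar>ch p * (D (Y / real p) (p * p * t) - (Y / real p) / real q * L1 * (1 + ch a * ch (p * p * t)) * \<alpha>)\<bar> \<le> 1 * (20 * 3 ^ card E * sqrt Y)"
    unfolding abs_mult[of "ch p"] by (intro mult_mono chi_abs_le I2') auto
  have "\<bar>lam p * (D Y (p * t) - Y / real q * L1 * (1 + ch a * ch (p * t)) * \<alpha>)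
      - ch p * (D (Y / real p) (p * p * t) - (Y / real p) / real q * L1 * (1 + ch a * ch (p * p * t)) * \<alpha>)\<bar> \<le> 3 * (20 * 3 ^ card E * sqrt Y)"
  proof -
    have "\<bar>x\<bar> \<le> 2 * c \<Longrightarrow> \<bar>y\<bar> \<le> 1 * c \<Longrightarrow> \<bar>x - y\<bar> \<le> 3 * c" for x y c :: real by linarith
    then show ?thesis using A1 A2 by blast
  qed
  moreover have "3 * (20 * 3 ^ card E * sqrt Y) = 20 * 3 ^ card (insert p E) * sqrt Y" using insert.hyps by simp
  moreover have "l * (x - u) - c * (y - v) = l * x - c * y - (l * u - c * v)" for l x u c y v :: real
    by (simp add: algebra_simps)
  ultimately show ?case unfolding eq main by metis
qed

end

section \<open>Brun-type sieve weights\<close>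

lemma sum_Pow_card:
  fixes F :: "nat \<Rightarrow> real"
  assumes "finite A"
  shows "(\<Sum>E\<in>Pow A. F (card E)) = (\<Sum>k\<le>card A. real (card A choose k) * F k)"
proof -
  have "(\<Sum>E\<in>Pow A. F (card E)) = (\<Sum>k\<le>card A. \<Sum>E\<in>{E\<in>Pow A. card E = k}. F (card E))"
    using assms by (intro sum.group[symmetric]) (auto intro: card_mono)
  also have "... = (\<Sum>k\<le>card A. real (card A choose k) * F k)"
  proof (intro sum.cong refl)
    fix k
    have "{E\<in>Pow A. card E = k} = {E. E \<subseteq> A \<and> card E = k}" by auto
    then have "card {E\<in>Pow A. card E = k} = card A choose k" using n_subsets[OF assms, of k] by simp
    then show "(\<Sum>E\<in>{E\<in>Pow A. card E = k}. F (card E)) = real (card A choose k) * F k" by simp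
  qed
  finally show ?thesis .
qed

lemma sum_Pow_card_le:
  fixes F :: "nat \<Rightarrow> real"
  assumes "finite A"
  shows "(\<Sum>E\<in>Pow A. if card E \<le> r then F (card E) else 0) = (\<Sum>k\<le>r. real (card A choose k) * F k)"
proof -
  have "(\<Sum>E\<in>Pow A. if card E \<le> r then F (card E) else 0) = (\<Sum>k\<le>card A. real (card A choose k) * (if k \<le> r then F k else 0))"
    using sum_Pow_card[OF assms, of "\<lambda>k. if k \<le> r then F k else 0"] by simp
  also have "... = (\<Sum>k\<in>{..card A} \<inter> {..r}. real (card A choose k) * F k)"
    by (subst sum.inter_restrict) (auto intro!: sum.cong)
  also have "... = (\<Sum>k\<le>r. real (card A choose k) * F k)"
    by (rule sum.mono_neutral_left) (auto simp: binomial_eq_0)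
  finally show ?thesis .
qed

text \<open>Truncating an alternating sum of binomial coefficients at level r leaves one binomial
  coefficient with sign (-1)^r. An even \<open>r\<close> thus gives a nonnegative majorant of the
  indicator of \<open>A = {}\<close>.\<close>

lemma brun_sum:
  assumes "finite A" "even r"
  shows "(\<Sum>E\<in>Pow A. if card E \<le> r then (-1) ^ card E else (0::real)) = (if A = {} then 1 else real ((card A - 1) choose r))"
proof -
  have "(\<Sum>E\<in>Pow A. if card E \<le> r then (-1) ^ card E else (0::real)) = (\<Sum>k\<le>r. real (card A choose k) * (-1) ^ k)"
    by (rule sum_Pow_card_le[OF assms(1)])
  also have "... = (\<Sum>k\<le>r. (real (card A) gchoose k) * (-1) ^ k)" by (simp add: binomial_gbinomial)
  also have "... = (real (card A) - 1 gchoose r)" using assms(2) by (subst gbinomial_sum_lower_neg) simp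
  also have "... = (if A = {} then 1 else real ((card A - 1) choose r))"
  proof (cases "A = {}")
    case True
    \<comment> \<open>For empty \<open>A\<close> the upper index is -1, and -1 over r is (-1)^r,
      which is 1 for even \<open>r\<close>.\<close>
    have "(-1::real) gchoose r = (-1) ^ r * (real r gchoose r)" using gbinomial_minus[of "1::real" r] by simp
    then show ?thesis using True assms(2) by (simp add: binomial_gbinomial[symmetric])
  next
    case False
    then have "card A \<ge> 1" using assms(1) by (simp add: Suc_le_eq card_gt_0_iff)
    then have "real (card A) - 1 = real (card A - 1)" by (simp add: of_nat_diff)
    then have "real (card A) - 1 gchoose r = real ((card A - 1) choose r)" by (simp only: binomial_gbinomial)
    then show ?thesis using False by (simp only: if_False)
  qed
  finally show ?thesis .
qed

lemma prod_one_plus: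
  fixes h :: "'a \<Rightarrow> real"
  assumes "finite R"
  shows "(\<Sum>E\<in>Pow R. \<Prod>p\<in>E. h p) = (\<Prod>p\<in>R. 1 + h p)"
  using prod_add[OF assms, of "\<lambda>p. h p" "\<lambda>_. 1"] by (simp add: add.commute)

lemma prod_one_plus_le_exp:
  fixes h :: "'a \<Rightarrow> real"
  assumes "\<And>p. p \<in> R \<Longrightarrow> h p \<ge> 0"
  shows "(\<Prod>p\<in>R. 1 + h p) \<le> exp (\<Sum>p\<in>R. h p)"
proof (cases "finite R")
  case True
  have "(\<Prod>p\<in>R. 1 + h p) \<le> (\<Prod>p\<in>R. exp (h p))"
    using assms by (intro prod_mono) (auto intro: add_nonneg_nonneg)
  then show ?thesis using True by (simp add: exp_sum)
qed auto

text \<open>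
  For \<open>m = 0\<close> these are the coefficients of the pure Brun sieve of level \<open>r\<close>. If \<open>m > 0\<close> sieving primes divide a fixed
  cofactor, Vandermonde's identity turns the coefficients into the majorant \<open>(m + \<omega>(n)) choose r\<close>.
\<close>

definition aco :: "nat \<Rightarrow> nat \<Rightarrow> nat \<Rightarrow> real" where
  "aco r m k = (if k \<le> r then (if m = 0 then (-1) ^ k else real (m choose (r - k))) else 0)"

text \<open>One term e^j (m choose j) is at most the whole binomial sum (e + 1)^m, and e + 1 \<le>
  4.\<close>

lemma binomial_le_exp: "real (m choose j) \<le> exp (- real j) * 4 ^ m"
proof (cases "j \<le> m")
  case True
  have "real (m choose j) * exp 1 ^ j \<le> (\<Sum>k\<le>m. real (m choose k) * exp 1 ^ k)"
    using True by (intro member_le_sum) auto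
  also have "... = (exp 1 + 1) ^ m" by (subst binomial_ring) simp
  also have "... \<le> 4 ^ m" using exp_le by (intro power_mono) auto
  finally show ?thesis by (simp add: exp_minus exp_of_nat_mult[symmetric] field_simps)
qed (simp add: binomial_eq_0)

text \<open>Rankin's trick: exp (card E - r) is at least 1 on the sets lost by truncation, so the
  loss is at most exp (- r) T with T \<le> exp (3 \<Gamma>). Since the product V of the 1 - g p is
  at least exp (- 4 \<Gamma>), a constant M \<ge> exp (7 \<Gamma>) turns the loss into a relative
  one. For m > 0, \<open>binomial_le_exp\<close> supplies the same factor exp (card E - r).\<close>

lemma aco_main_bound:
  fixes g :: "nat \<Rightarrow> real" and M \<Gamma> :: real
  assumes "finite R" and g: "\<And>p. p \<in> R \<Longrightarrow> 0 \<le> g p \<and> g p \<le> 3/4"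
    and \<Gamma>: "(\<Sum>p\<in>R. g p) \<le> \<Gamma>" and M: "M \<ge> exp (7 * \<Gamma>)" "M \<ge> 4"
  shows "\<bar>\<Sum>E\<in>Pow R. aco r m (card E) * (\<Prod>p\<in>E. g p)\<bar>
     \<le> (\<Prod>p\<in>R. 1 - g p) * (of_bool (m = 0) + M * exp (- real r) * M ^ m)"
proof -
  define V where "V = (\<Prod>p\<in>R. 1 - g p)"
  define T where "T = (\<Sum>E\<in>Pow R. exp (real (card E)) * (\<Prod>p\<in>E. g p))"
  have finE: "finite E" if "E \<in> Pow R" for E using that assms(1) by (auto intro: finite_subset)
  have gE: "(\<Prod>p\<in>E. g p) \<ge> 0" if "E \<in> Pow R" for E using that g by (intro prod_nonneg) auto
  have "T = (\<Sum>E\<in>Pow R. \<Prod>p\<in>E. exp 1 * g p)"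
    unfolding T_def using finE by (intro sum.cong refl) (simp add: prod.distrib exp_of_nat_mult[symmetric])
  also have "... = (\<Prod>p\<in>R. 1 + exp 1 * g p)" by (rule prod_one_plus[OF assms(1)])
  also have "... \<le> exp (\<Sum>p\<in>R. exp 1 * g p)" using g by (intro prod_one_plus_le_exp) auto
  also have "... \<le> exp (3 * \<Gamma>)"
  proof -
    have s0: "(\<Sum>p\<in>R. g p) \<ge> 0" using g by (intro sum_nonneg) auto
    have "(\<Sum>p\<in>R. exp 1 * g p) = exp 1 * (\<Sum>p\<in>R. g p)" by (simp add: sum_distrib_left)
    also have "... \<le> 3 * \<Gamma>" using exp_le \<Gamma> s0 by (intro mult_mono) auto
    finally show ?thesis by simp
  qed
  finally have T: "T \<le> exp (3 * \<Gamma>)" .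
  have V: "V \<ge> exp (- 4 * \<Gamma>)"
  proof -
    have "exp (- 4 * \<Gamma>) \<le> exp (\<Sum>p\<in>R. - (4 * g p))" using \<Gamma> by (simp add: sum_negf sum_distrib_left[symmetric])
    also have "... = (\<Prod>p\<in>R. exp (- (4 * g p)))" by (rule exp_sum[OF assms(1)])
    also have "... \<le> V" unfolding V_def
    proof (intro prod_mono conjI)
      fix p assume p: "p \<in> R"
      have "1 \<le> (1 - g p) * (1 + 4 * g p)"
      proof -
        have "(1 - g p) * (1 + 4 * g p) = 1 + g p * (3 - 4 * g p)" by (simp add: algebra_simps)
        moreover have "g p * (3 - 4 * g p) \<ge> 0" using g[OF p] by (intro mult_nonneg_nonneg) auto
        ultimately show ?thesis by linarith
      qed
      also have "... \<le> (1 - g p) * exp (4 * g p)" using g[OF p] by (intro mult_left_mono) auto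
      finally have "1 \<le> (1 - g p) * exp (4 * g p)" .
      then show "exp (- (4 * g p)) \<le> 1 - g p" by (simp add: exp_minus field_simps)
    qed auto
    finally show ?thesis .
  qed
  have V0: "V > 0" using V exp_gt_zero[of "- 4 * \<Gamma>"] by linarith
  have key: "exp (3 * \<Gamma>) \<le> V * M"
  proof -
    have "exp (3 * \<Gamma>) = exp (- 4 * \<Gamma>) * exp (7 * \<Gamma>)" by (simp add: exp_add[symmetric])
    also have "... \<le> V * M" using V M V0 by (intro mult_mono) auto
    finally show ?thesis .
  qed
  show ?thesis
  proof (cases "m = 0")
    case True
    have "(\<Sum>E\<in>Pow R. aco r m (card E) * (\<Prod>p\<in>E. g p))
        = (\<Sum>E\<in>Pow R. \<Prod>p\<in>E. - g p) - (\<Sum>E\<in>Pow R. (if card E \<le> r then 0 else (-1) ^ card E) * (\<Prod>p\<in>E. g p))"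
      unfolding sum_subtractf[symmetric] using finE True
      by (intro sum.cong refl) (auto simp: aco_def prod_uminus)
    also have "(\<Sum>E\<in>Pow R. \<Prod>p\<in>E. - g p) = V" using prod_one_plus[OF assms(1), of "\<lambda>p. - g p"] by (simp add: V_def)
    finally have eq: "(\<Sum>E\<in>Pow R. aco r m (card E) * (\<Prod>p\<in>E. g p)) = V - (\<Sum>E\<in>Pow R. (if card E \<le> r then 0 else (-1) ^ card E) * (\<Prod>p\<in>E. g p))" .
    have "\<bar>\<Sum>E\<in>Pow R. (if card E \<le> r then 0 else (-1) ^ card E) * (\<Prod>p\<in>E. g p)\<bar> \<le> (\<Sum>E\<in>Pow R. exp (- real r) * (exp (real (card E)) * (\<Prod>p\<in>E. g p)))"
    proof (rule order_trans[OF sum_abs], rule sum_mono)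
      fix E assume E: "E \<in> Pow R"
      show "\<bar>(if card E \<le> r then 0 else (-1) ^ card E) * (\<Prod>p\<in>E. g p)\<bar> \<le> exp (- real r) * (exp (real (card E)) * (\<Prod>p\<in>E. g p))"
      proof (cases "card E \<le> r")
        case False
        have "1 * (\<Prod>p\<in>E. g p) \<le> exp (real (card E) - real r) * (\<Prod>p\<in>E. g p)"
          using False gE[OF E] by (intro mult_right_mono) auto
        also have "exp (real (card E) - real r) = exp (- real r) * exp (real (card E))" by (simp add: exp_add[symmetric])
        finally show ?thesis using False gE[OF E] by (simp add: abs_mult mult_ac)
      qed (use gE[OF E] in auto)
    qed
    also have "... = exp (- real r) * T" by (simp add: T_def sum_distrib_left)
    also have "... \<le> exp (- real r) * (V * M)" using T key by (intro mult_left_mono) auto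
    finally have "\<bar>\<Sum>E\<in>Pow R. aco r m (card E) * (\<Prod>p\<in>E. g p)\<bar> \<le> V + exp (- real r) * (V * M)"
      unfolding eq using V0 by linarith
    then show ?thesis unfolding V_def[symmetric] using True by (simp add: algebra_simps)
  next
    case False
    have "\<bar>\<Sum>E\<in>Pow R. aco r m (card E) * (\<Prod>p\<in>E. g p)\<bar> \<le> (\<Sum>E\<in>Pow R. exp (- real r) * 4 ^ m * (exp (real (card E)) * (\<Prod>p\<in>E. g p)))"
    proof (rule order_trans[OF sum_abs], rule sum_mono)
      fix E assume E: "E \<in> Pow R"
      have "aco r m (card E) \<le> exp (- real r) * 4 ^ m * exp (real (card E))"
      proof (cases "card E \<le> r")
        case True
        then have "real (m choose (r - card E)) \<le> exp (- (real r - real (card E))) * 4 ^ m"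
          using binomial_le_exp[of m "r - card E"] by (simp add: of_nat_diff)
        also have "exp (- (real r - real (card E))) = exp (- real r) * exp (real (card E))" by (simp add: exp_add[symmetric])
        finally show ?thesis using True False by (simp add: aco_def mult_ac)
      qed (simp add: aco_def)
      moreover have "aco r m (card E) \<ge> 0" using False by (simp add: aco_def)
      ultimately show "\<bar>aco r m (card E) * (\<Prod>p\<in>E. g p)\<bar> \<le> exp (- real r) * 4 ^ m * (exp (real (card E)) * (\<Prod>p\<in>E. g p))"
        using gE[OF E] mult_right_mono[of "aco r m (card E)" "exp (- real r) * 4 ^ m * exp (real (card E))" "\<Prod>p\<in>E. g p"]
        by (simp add: abs_mult mult.assoc)
    qed
    also have "... = exp (- real r) * 4 ^ m * T" by (simp add: T_def sum_distrib_left)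
    also have "... \<le> exp (- real r) * M ^ m * (V * M)"
      using T key M T_def gE by (intro mult_mono power_mono) (auto intro!: sum_nonneg)
    finally show ?thesis unfolding V_def[symmetric] using False by (simp add: mult_ac)
  qed
qed

text \<open>The number of k-sets is at most (card R)^k \<le> (r choose k) (card R)^k for k \<le> r,
  and the binomial theorem adds these up. The 3 is the growth of the error per prime in
  \<open>lam_progression_dvd\<close>.\<close>

lemma aco_count_bound:
  assumes "finite R"
  shows "(\<Sum>E\<in>Pow R. \<bar>aco r m (card E)\<bar> * 3 ^ card E) \<le> 2 ^ m * (1 + 3 * real (card R)) ^ r"
proof -
  have "(\<Sum>E\<in>Pow R. \<bar>aco r m (card E)\<bar> * 3 ^ card E) \<le> (\<Sum>E\<in>Pow R. if card E \<le> r then 2 ^ m * 3 ^ card E else 0)"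
  proof (rule sum_mono)
    fix E
    have "\<bar>aco r m (card E)\<bar> \<le> 2 ^ m" if "card E \<le> r"
    proof (cases "m = 0")
      case False
      have "real (m choose (r - card E)) \<le> real (2 ^ m)" using binomial_le_pow2 by (intro of_nat_mono)
      then show ?thesis using False that by (simp add: aco_def)
    qed (use that in \<open>simp add: aco_def\<close>)
    then show "\<bar>aco r m (card E)\<bar> * 3 ^ card E \<le> (if card E \<le> r then 2 ^ m * 3 ^ card E else 0)"
      by (auto simp: aco_def)
  qed
  also have "... = (\<Sum>k\<le>r. real (card R choose k) * (2 ^ m * 3 ^ k))"
    by (rule sum_Pow_card_le[OF assms])
  also have "... \<le> (\<Sum>k\<le>r. 2 ^ m * (real (r choose k) * (3 * real (card R)) ^ k * 1 ^ (r - k)))"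
  proof (rule sum_mono)
    fix k assume "k \<in> {..r}"
    then have "1 \<le> real (r choose k)" using zero_less_binomial[of k r] by (simp add: Suc_le_eq)
    moreover have "real (card R choose k) \<le> real (card R) ^ k"
      using binomial_le_pow[of k "card R"] by (cases "k \<le> card R") (simp_all add: binomial_eq_0 flip: of_nat_power)
    ultimately have "1 * real (card R choose k) \<le> real (r choose k) * real (card R) ^ k" by (intro mult_mono) auto
    then have "real (card R choose k) * (2 ^ m * 3 ^ k) \<le> (real (r choose k) * real (card R) ^ k) * (2 ^ m * 3 ^ k)"
      by (intro mult_right_mono) auto
    then show "real (card R choose k) * (2 ^ m * 3 ^ k) \<le> 2 ^ m * (real (r choose k) * (3 * real (card R)) ^ k * 1 ^ (r - k))"
      by (simp add: power_mult_distrib mult_ac)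
  qed
  also have "... = 2 ^ m * (3 * real (card R) + 1) ^ r"
    unfolding sum_distrib_left[symmetric] by (subst binomial_ring[symmetric]) simp
  finally show ?thesis by (simp add: add.commute)
qed

text \<open>A block weight is a sum over sets of primes of the block that divide \<open>n\<close>.
  The induction opens one block at a time and collects the chosen primes in \<open>E0\<close>, which
  is why the claim is made for every \<open>E0\<close> from the blocks with index at least
  \<open>j\<close>. Disjoint blocks keep products and cardinalities compatible.\<close>

lemma sieve_sum:
  fixes F g :: "nat \<Rightarrow> real" and R :: "nat \<Rightarrow> nat set" and a :: "nat \<Rightarrow> nat \<Rightarrow> real"
  assumes fin: "finite A" and finR: "\<And>i. finite (R i)" and disj: "\<And>i j. i \<noteq> j \<Longrightarrow> R i \<inter> R j = {}"
    and dist: "\<And>E. finite E \<Longrightarrow> E \<subseteq> (\<Union>i<J. R i) \<Longrightarrow>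
        \<bar>(\<Sum>n | n \<in> A \<and> (\<forall>p\<in>E. p dvd n). F n) - X * (\<Prod>p\<in>E. g p)\<bar> \<le> Er * 3 ^ card E"
    and "j \<le> J" and "finite E0" and "E0 \<subseteq> (\<Union>i\<in>{j..<J}. R i)"
  shows "\<bar>(\<Sum>n | n \<in> A \<and> (\<forall>p\<in>E0. p dvd n). F n * (\<Prod>i<j. \<Sum>E\<in>Pow (R i \<inter> {p. p dvd n}). a i (card E)))
     - X * (\<Prod>p\<in>E0. g p) * (\<Prod>i<j. \<Sum>E\<in>Pow (R i). a i (card E) * (\<Prod>p\<in>E. g p))\<bar>
     \<le> Er * 3 ^ card E0 * (\<Prod>i<j. \<Sum>E\<in>Pow (R i). \<bar>a i (card E)\<bar> * 3 ^ card E)"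
  using assms(5-7)
proof (induction j arbitrary: E0)
  case 0
  then show ?case using dist[of E0] by (simp add: atLeast0LessThan)
next
  case (Suc j)
  define W where "W = (\<lambda>n. F n * (\<Prod>i<j. \<Sum>E\<in>Pow (R i \<inter> {p. p dvd n}). a i (card E)))"
  define G where "G = (\<Prod>i<j. \<Sum>E\<in>Pow (R i). a i (card E) * (\<Prod>p\<in>E. g p))"
  define B where "B = (\<Prod>i<j. \<Sum>E\<in>Pow (R i). \<bar>a i (card E)\<bar> * 3 ^ card E)"
  have jJ: "j < J" using Suc.prems by simp
  have dE: "E0 \<inter> E = {}" if "E \<in> Pow (R j)" for E
  proof -
    have "x \<notin> E" if x0: "x \<in> E0" for x
    proof -
      have "x \<in> (\<Union>i\<in>{Suc j..<J}. R i)" using x0 Suc.prems(3) by blast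
      then obtain i where "i \<in> {Suc j..<J}" "x \<in> R i" by blast
      then have "i \<noteq> j" by simp
      then have "x \<notin> R j" using disj[of i j] \<open>x \<in> R i\<close> by blast
      then show ?thesis using \<open>E \<in> Pow (R j)\<close> by auto
    qed
    then show ?thesis by auto
  qed
  have finE: "finite E" if "E \<in> Pow (R j)" for E using that finR by (auto intro: finite_subset)
  have IH: "\<bar>(\<Sum>n | n \<in> A \<and> (\<forall>p\<in>E0 \<union> E. p dvd n). W n) - X * (\<Prod>p\<in>E0 \<union> E. g p) * G\<bar> \<le> Er * 3 ^ card (E0 \<union> E) * B"
    if "E \<in> Pow (R j)" for E
    unfolding W_def G_def B_def
  proof (rule Suc.IH)
    have "(\<Union>i\<in>{Suc j..<J}. R i) \<subseteq> (\<Union>i\<in>{j..<J}. R i)" by (rule UN_mono) auto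
    moreover have "R j \<subseteq> (\<Union>i\<in>{j..<J}. R i)" using jJ by auto
    ultimately show "E0 \<union> E \<subseteq> (\<Union>i\<in>{j..<J}. R i)" using that Suc.prems(3) by auto
  qed (use Suc.prems finE[OF that] in auto)
  have "(\<Sum>n | n \<in> A \<and> (\<forall>p\<in>E0. p dvd n). F n * (\<Prod>i<Suc j. \<Sum>E\<in>Pow (R i \<inter> {p. p dvd n}). a i (card E)))
     = (\<Sum>n | n \<in> A \<and> (\<forall>p\<in>E0. p dvd n). \<Sum>E\<in>Pow (R j \<inter> {p. p dvd n}). a j (card E) * W n)"
    by (simp add: W_def sum_distrib_right sum_distrib_left mult_ac)
  also have "... = (\<Sum>n | n \<in> A \<and> (\<forall>p\<in>E0. p dvd n). \<Sum>E\<in>Pow (R j). if (\<forall>p\<in>E. p dvd n) then a j (card E) * W n else 0)"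
    using finR by (intro sum.cong refl sum.mono_neutral_cong_left) auto
  also have "... = (\<Sum>E\<in>Pow (R j). \<Sum>n | n \<in> A \<and> (\<forall>p\<in>E0. p dvd n). if (\<forall>p\<in>E. p dvd n) then a j (card E) * W n else 0)"
    by (rule sum.swap)
  also have "... = (\<Sum>E\<in>Pow (R j). a j (card E) * (\<Sum>n | n \<in> A \<and> (\<forall>p\<in>E0 \<union> E. p dvd n). W n))"
    using fin unfolding sum_distrib_left by (intro sum.cong refl sum.mono_neutral_cong_right) auto
  finally have eq: "(\<Sum>n | n \<in> A \<and> (\<forall>p\<in>E0. p dvd n). F n * (\<Prod>i<Suc j. \<Sum>E\<in>Pow (R i \<inter> {p. p dvd n}). a i (card E)))
     = (\<Sum>E\<in>Pow (R j). a j (card E) * (\<Sum>n | n \<in> A \<and> (\<forall>p\<in>E0 \<union> E. p dvd n). W n))" .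
  have "X * (\<Prod>p\<in>E0. g p) * (\<Prod>i<Suc j. \<Sum>E\<in>Pow (R i). a i (card E) * (\<Prod>p\<in>E. g p))
     = (\<Sum>E\<in>Pow (R j). a j (card E) * (X * (\<Prod>p\<in>E0. g p) * (\<Prod>p\<in>E. g p) * G))"
    by (simp add: G_def sum_distrib_right sum_distrib_left mult_ac)
  also have "... = (\<Sum>E\<in>Pow (R j). a j (card E) * (X * (\<Prod>p\<in>E0 \<union> E. g p) * G))"
    using dE finE Suc.prems(2) by (intro sum.cong refl) (simp add: prod.union_disjoint mult.assoc)
  finally have eq2: "X * (\<Prod>p\<in>E0. g p) * (\<Prod>i<Suc j. \<Sum>E\<in>Pow (R i). a i (card E) * (\<Prod>p\<in>E. g p)) = ..." .
  have "\<bar>(\<Sum>E\<in>Pow (R j). a j (card E) * (\<Sum>n | n \<in> A \<and> (\<forall>p\<in>E0 \<union> E. p dvd n). W n)) - (\<Sum>E\<in>Pow (R j). a j (card E) * (X * (\<Prod>p\<in>E0 \<union> E. g p) * G))\<bar>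
     \<le> (\<Sum>E\<in>Pow (R j). \<bar>a j (card E)\<bar> * (Er * 3 ^ card (E0 \<union> E) * B))"
    unfolding sum_subtractf[symmetric]
  proof (rule order_trans[OF sum_abs], rule sum_mono)
    fix E assume E: "E \<in> Pow (R j)"
    show "\<bar>a j (card E) * (\<Sum>n | n \<in> A \<and> (\<forall>p\<in>E0 \<union> E. p dvd n). W n) - a j (card E) * (X * (\<Prod>p\<in>E0 \<union> E. g p) * G)\<bar>
       \<le> \<bar>a j (card E)\<bar> * (Er * 3 ^ card (E0 \<union> E) * B)"
      unfolding right_diff_distrib[symmetric] abs_mult by (intro mult_left_mono IH[OF E]) auto
  qed
  also have "... = (\<Sum>E\<in>Pow (R j). \<bar>a j (card E)\<bar> * (Er * (3 ^ card E0 * 3 ^ card E) * B))"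
    using dE finE Suc.prems(2) by (intro sum.cong refl) (simp add: card_Un_disjoint power_add)
  also have "... = Er * 3 ^ card E0 * (\<Prod>i<Suc j. \<Sum>E\<in>Pow (R i). \<bar>a i (card E)\<bar> * 3 ^ card E)"
    by (simp add: B_def sum_distrib_right sum_distrib_left mult_ac)
  finally show ?case unfolding eq eq2 .
qed

section \<open>Sums over integers composed of given primes\<close>

definition PS :: "nat set \<Rightarrow> real \<Rightarrow> nat set" where
  "PS P Y = {n\<in>ivl Y. prime_factors n \<subseteq> P}"

lemma finite_PS [simp, intro]: "finite (PS P Y)" by (simp add: PS_def)

lemma PS_pos: "n \<in> PS P Y \<Longrightarrow> n > 0" by (simp add: PS_def mem_ivl)

lemma prime_factors_split:
  fixes n :: nat
  assumes "n > 0"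
  obtains a b where "n = a * b" "a > 0" "b > 0" "coprime a b" "prime_factors a = prime_factors n \<inter> P" "prime_factors b = prime_factors n - P"
proof -
  have "\<exists>a b. n = a * b \<and> a > 0 \<and> b > 0 \<and> coprime a b \<and> prime_factors a = prime_factors n \<inter> P \<and> prime_factors b = prime_factors n - P"
    using assms
  proof (induction n rule: prime_power_induct)
    case one
    then show ?case by (intro exI[of _ 1]) auto
  next
    case (step p k n)
    then obtain a b where ab: "n = a * b" "a > 0" "b > 0" "coprime a b" "prime_factors a = prime_factors n \<inter> P" "prime_factors b = prime_factors n - P" by blast
    have p0: "p > 0" using step by (simp add: prime_gt_0_nat)
    have pk: "prime_factors (p ^ k) = {p}" using step.hyps(1,2) by (simp add: prime_factorization_prime_power)
    have pfx: "prime_factors (p ^ k * x) = insert p (prime_factors x)" if "x > 0" for x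
      using prime_factors_product[of "p ^ k" x] that p0 pk by simp
    have pf: "prime_factors (p ^ k * n) = insert p (prime_factors n)" using step.hyps(3) by (rule pfx)
    have ca: "coprime (p ^ k) a" "coprime (p ^ k) b" using step.hyps(4) ab(1) by auto
    have pa: "prime_factors (p ^ k * a) = insert p (prime_factors a)" "prime_factors (p ^ k * b) = insert p (prime_factors b)"
      using pfx ab(2,3) by blast+
    show ?case
    proof (cases "p \<in> P")
      case True
      have "p ^ k * n = (p ^ k * a) * b \<and> p ^ k * a > 0 \<and> b > 0 \<and> coprime (p ^ k * a) b \<and> prime_factors (p ^ k * a) = prime_factors (p ^ k * n) \<inter> P \<and> prime_factors b = prime_factors (p ^ k * n) - P"
        using True ab ca p0 unfolding pf pa by auto
      then show ?thesis by blast
    next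
      case False
      have "p ^ k * n = a * (p ^ k * b) \<and> a > 0 \<and> p ^ k * b > 0 \<and> coprime a (p ^ k * b) \<and> prime_factors a = prime_factors (p ^ k * n) \<inter> P \<and> prime_factors (p ^ k * b) = prime_factors (p ^ k * n) - P"
        using False ab ca p0 unfolding pf pa by (auto simp: coprime_commute)
      then show ?thesis by blast
    qed
  qed
  then show ?thesis using that by blast
qed

text \<open>Each \<open>n\<close> has a coprime splitting into a part with primes in
  \<open>P\<close> and a part with primes outside \<open>P\<close>. The resulting map into pairs is
  injective, and nonnegativity allows the remaining pairs to be added.\<close>

lemma multf_sum_split:
  assumes f: "multf f" "\<And>n. f n \<ge> 0"
  shows "(\<Sum>n\<in>PS (P \<union> P') Y. f n) \<le> (\<Sum>a\<in>PS P Y. f a) * (\<Sum>b\<in>PS P' Y. f b)"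
proof -
  have "\<forall>n\<in>PS (P \<union> P') Y. \<exists>x. n = fst x * snd x \<and> x \<in> PS P Y \<times> PS P' Y \<and> coprime (fst x) (snd x)"
  proof
    fix n assume n: "n \<in> PS (P \<union> P') Y"
    then obtain a b where ab: "n = a * b" "a > 0" "b > 0" "coprime a b" "prime_factors a = prime_factors n \<inter> P" "prime_factors b = prime_factors n - P"
      using prime_factors_split[OF PS_pos[OF n], of P] by blast
    have "a \<le> n" "b \<le> n" using ab by auto
    then have "real a \<le> Y" "real b \<le> Y" using n by (auto simp: PS_def mem_ivl)
    then show "\<exists>x. n = fst x * snd x \<and> x \<in> PS P Y \<times> PS P' Y \<and> coprime (fst x) (snd x)"
      using ab n by (intro exI[of _ "(a,b)"]) (auto simp: PS_def mem_ivl)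
  qed
  then obtain \<phi> where \<phi>: "\<And>n. n \<in> PS (P \<union> P') Y \<Longrightarrow> n = fst (\<phi> n) * snd (\<phi> n) \<and> \<phi> n \<in> PS P Y \<times> PS P' Y \<and> coprime (fst (\<phi> n)) (snd (\<phi> n))"
    by metis
  have inj: "inj_on \<phi> (PS (P \<union> P') Y)" by (rule inj_onI) (metis \<phi>)
  have "(\<Sum>n\<in>PS (P \<union> P') Y. f n) = (\<Sum>n\<in>PS (P \<union> P') Y. f (fst (\<phi> n)) * f (snd (\<phi> n)))"
  proof (intro sum.cong refl)
    fix n assume n: "n \<in> PS (P \<union> P') Y"
    have "fst (\<phi> n) > 0" "snd (\<phi> n) > 0" using \<phi>[OF n] by (auto simp: mem_Times_iff dest: PS_pos)
    then have "f (fst (\<phi> n) * snd (\<phi> n)) = f (fst (\<phi> n)) * f (snd (\<phi> n))" using \<phi>[OF n] multfD[OF f(1)] by blast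
    moreover have "f n = f (fst (\<phi> n) * snd (\<phi> n))" using \<phi>[OF n] by (intro arg_cong[where f = f]) blast
    ultimately show "f n = f (fst (\<phi> n)) * f (snd (\<phi> n))" by (simp only:)
  qed
  also have "... = (\<Sum>x\<in>\<phi> ` PS (P \<union> P') Y. f (fst x) * f (snd x))" using inj by (simp add: sum.reindex)
  also have "... \<le> (\<Sum>x\<in>PS P Y \<times> PS P' Y. f (fst x) * f (snd x))"
  proof (rule sum_mono2)
    show "\<phi> ` PS (P \<union> P') Y \<subseteq> PS P Y \<times> PS P' Y" using \<phi> by blast
  qed (use f(2) in auto)
  also have "... = (\<Sum>a\<in>PS P Y. f a) * (\<Sum>b\<in>PS P' Y. f b)"
    by (simp add: sum_product sum.cartesian_product case_prod_beta)
  finally show ?thesis .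
qed

text \<open>The converse direction of \<open>multf_sum_split\<close>: elements of \<open>A\<close>
  and \<open>B\<close> are coprime, a product determines its two factors, and so the pairs embed
  into \<open>C\<close>.\<close>

lemma multf_sum_merge:
  assumes f: "multf f" "\<And>n. f n \<ge> 0"
    and "finite C" and A: "finite A" "\<And>n. n \<in> A \<Longrightarrow> n > 0 \<and> prime_factors n \<subseteq> P" and B: "finite B" "\<And>n. n \<in> B \<Longrightarrow> n > 0 \<and> prime_factors n \<inter> P = {}"
    and C: "\<And>a b. a \<in> A \<Longrightarrow> b \<in> B \<Longrightarrow> a * b \<in> C"
  shows "(\<Sum>a\<in>A. f a) * (\<Sum>b\<in>B. f b) \<le> (\<Sum>n\<in>C. f n)"
proof -
  have cop: "coprime a b" if ab: "a \<in> A" "b \<in> B" for a b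
  proof (rule ccontr)
    assume "\<not> coprime a b"
    then have "gcd a b \<noteq> 1" using coprime_iff_gcd_eq_1 by blast
    then obtain p where "prime p" "p dvd gcd a b" using prime_factor_nat by blast
    then have p: "prime p" "p dvd a" "p dvd b" by simp_all
    have "p \<in> prime_factors a" using A(2)[OF ab(1)] p by (intro prime_factorsI) simp_all
    moreover have "p \<in> prime_factors b" using B(2)[OF ab(2)] p by (intro prime_factorsI) simp_all
    ultimately show False using A(2)[OF ab(1)] B(2)[OF ab(2)] by blast
  qed
  have inj: "inj_on (\<lambda>(a,b). a * b) (A \<times> B)"
  proof (rule inj_onI, clarsimp)
    fix a b a' b' assume h: "a \<in> A" "b \<in> B" "a' \<in> A" "b' \<in> B" "a * b = a' * b'"
    have "a dvd a' * b'" using h by (metis dvd_triv_left)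
    then have "a dvd a'" using cop[OF h(1) h(4)] by (simp add: coprime_dvd_mult_left_iff)
    have "a' dvd a * b" using h by (metis dvd_triv_left)
    then have "a' dvd a" using cop[OF h(3) h(2)] by (simp add: coprime_dvd_mult_left_iff)
    then have "a = a'" using \<open>a dvd a'\<close> by (simp add: dvd_antisym)
    then show "a = a' \<and> b = b'" using h A(2)[OF h(3)] by simp
  qed
  have "(\<Sum>a\<in>A. f a) * (\<Sum>b\<in>B. f b) = (\<Sum>x\<in>A \<times> B. f (fst x) * f (snd x))"
    by (simp add: sum_product sum.cartesian_product case_prod_beta)
  also have "... = (\<Sum>x\<in>A \<times> B. f (case x of (a,b) \<Rightarrow> a * b))"
    using A B cop f(1) by (intro sum.cong refl) (auto simp: multfD)
  also have "... = (\<Sum>n\<in>(\<lambda>(a,b). a * b) ` (A \<times> B). f n)" using inj by (simp add: sum.reindex o_def)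
  also have "... \<le> (\<Sum>n\<in>C. f n)" using C f(2) assms(3) by (intro sum_mono2) auto
  finally show ?thesis .
qed

text \<open>The Euler product is built up one prime at a time by \<open>multf_sum_split\<close>; the
  bound \<open>c p\<close> must hold for all truncations because the exponents are cut by
  \<open>Y\<close>.\<close>

lemma multf_sum_euler:
  assumes f: "multf f" "\<And>n. f n \<ge> 0" and "finite P" "\<And>p. p \<in> P \<Longrightarrow> prime p"
    and c: "\<And>p K. p \<in> P \<Longrightarrow> (\<Sum>k\<le>K. f (p ^ k)) \<le> c p"
  shows "(\<Sum>n\<in>PS P Y. f n) \<le> (\<Prod>p\<in>P. c p)"
  using assms(3-5)
proof (induction P rule: finite_induct)
  case empty
  have "(\<Sum>n\<in>PS {} Y. f n) \<le> (\<Sum>n\<in>{1}. f n)"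
    by (rule sum_mono2) (auto simp: PS_def mem_ivl f prime_factorization_empty_iff)
  then show ?case using multf_1[OF f(1)] by simp
next
  case (insert p P)
  have p: "prime p" using insert by simp
  have "(\<Sum>n\<in>PS (insert p P) Y. f n) = (\<Sum>n\<in>PS ({p} \<union> P) Y. f n)" by simp
  also have "... \<le> (\<Sum>a\<in>PS {p} Y. f a) * (\<Sum>b\<in>PS P Y. f b)" by (rule multf_sum_split[OF f])
  also have "... \<le> c p * (\<Prod>p\<in>P. c p)"
  proof (rule mult_mono)
    have "PS {p} Y \<subseteq> (\<lambda>k. p ^ k) ` {..nat \<lfloor>Y\<rfloor>}"
    proof
      fix n assume n: "n \<in> PS {p} Y"
      then have n0: "n > 0" by (rule PS_pos)
      have "n = (\<Prod>r\<in>prime_factors n. r ^ multiplicity r n)" using n0 by (simp add: prime_factorization_nat)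
      also have "... = (\<Prod>r\<in>{p}. r ^ multiplicity r n)"
        using n p by (intro prod.mono_neutral_left) (auto simp: PS_def prime_factors_multiplicity)
      finally have e: "n = p ^ multiplicity p n" by simp
      have "multiplicity p n < 2 ^ multiplicity p n" by (rule less_exp)
      also have "... \<le> p ^ multiplicity p n" using prime_ge_2_nat[OF p] by (rule power_mono) simp
      finally have "multiplicity p n \<le> n" using e by simp
      then have "multiplicity p n \<le> nat \<lfloor>Y\<rfloor>" using n by (auto simp: PS_def ivl_def)
      then show "n \<in> (\<lambda>k. p ^ k) ` {..nat \<lfloor>Y\<rfloor>}" using e by blast
    qed
    then have "(\<Sum>a\<in>PS {p} Y. f a) \<le> (\<Sum>a\<in>(\<lambda>k. p ^ k) ` {..nat \<lfloor>Y\<rfloor>}. f a)" by (intro sum_mono2) (auto simp: f)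
    also have "... = (\<Sum>k\<le>nat \<lfloor>Y\<rfloor>. f (p ^ k))"
      using p by (subst sum.reindex) (auto simp: inj_on_def dest: prime_power_inj)
    also have "... \<le> c p" using insert by auto
    finally show "(\<Sum>a\<in>PS {p} Y. f a) \<le> c p" .
    show "(\<Sum>b\<in>PS P Y. f b) \<le> (\<Prod>p\<in>P. c p)" using insert by auto
    have "0 \<le> (\<Sum>k\<le>0. f (p ^ k))" using f(2) by simp
    also have "... \<le> c p" by (rule insert.prems(2)) simp
    finally show "0 \<le> c p" .
  qed (auto intro!: sum_nonneg f)
  finally show ?case using insert.hyps by simp
qed

text \<open>
  The sieving range is cut into the dyadic blocks \<open>Rg\<close>, with truncation level \<open>rr i\<close> on the \<open>i\<close>-th block; \<open>rho\<close> is the product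
  of the resulting nonnegative weights, \<open>kap\<close> bounds the effect of a fixed cofactor and \<open>hh\<close> separates the factors
  of a product in \<open>kap\<close>. The constant \<open>Mc\<close> only has to be large enough for all blocks at once.
\<close>

definition wr :: "real \<Rightarrow> nat \<Rightarrow> real" where "wr w i = w powr (1 / 2 ^ i)"
definition Rg :: "nat \<Rightarrow> real \<Rightarrow> nat \<Rightarrow> nat set" where
  "Rg q w i = {p. prime p \<and> \<not> p dvd q \<and> wr w (Suc i) < real p \<and> real p \<le> wr w i}"
definition Jn :: "real \<Rightarrow> nat" where "Jn w = (LEAST j. wr w j < 2)"
definition rr :: "nat \<Rightarrow> nat" where "rr i = 2 * (i + 1)"
definition om :: "nat \<Rightarrow> real \<Rightarrow> nat \<Rightarrow> nat \<Rightarrow> nat" where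
  "om q w i n = card (Rg q w i \<inter> {p. p dvd n})"
definition Mc :: nat where "Mc = nat \<lceil>exp (280::real)\<rceil>"
definition brun :: "nat \<Rightarrow> real \<Rightarrow> nat \<Rightarrow> nat \<Rightarrow> nat \<Rightarrow> real" where
  "brun q w i m n = (\<Sum>E\<in>Pow (Rg q w i \<inter> {p. p dvd n}). aco (rr i) m (card E))"
definition rho :: "nat \<Rightarrow> real \<Rightarrow> nat \<Rightarrow> real" where
  "rho q w n = (\<Prod>i<Jn w. brun q w i 0 n)"
definition kapf :: "nat \<Rightarrow> nat \<Rightarrow> real" where
  "kapf i m = of_bool (m = 0) + real Mc * exp (- real (rr i)) * real Mc ^ m"
definition kap :: "nat \<Rightarrow> real \<Rightarrow> nat \<Rightarrow> real" where
  "kap q w n = (\<Prod>i<Jn w. kapf i (om q w i n))"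
definition xi :: "nat \<Rightarrow> real" where "xi i = real Mc * exp (- real (i + 1))"
definition hh :: "nat \<Rightarrow> real \<Rightarrow> nat \<Rightarrow> real" where
  "hh q w n = (\<Prod>i<Jn w. xi i * real Mc ^ om q w i n + of_bool (om q w i n = 0))"

section \<open>Size of the sieving blocks and of their weights\<close>

lemma Mc_ge: "real Mc \<ge> exp 280" "real Mc \<ge> 4" "Mc > 0"
proof -
  show 1: "real Mc \<ge> exp 280" unfolding Mc_def by (simp add: of_nat_ceiling)
  have "exp (280::real) \<ge> 1 + 280" by (rule exp_ge_add_one_self)
  then show "real Mc \<ge> 4" using 1 by linarith
  then show "Mc > 0" by (intro Nat.gr0I) auto
qed

lemma wr_0 [simp]: "w \<ge> 2 \<Longrightarrow> wr w 0 = w" by (simp add: wr_def)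

lemma wr_mono: "w \<ge> 2 \<Longrightarrow> i \<le> j \<Longrightarrow> wr w j \<le> wr w i"
  unfolding wr_def by (intro powr_mono divide_left_mono power_increasing) auto

lemma wr_Suc: "w \<ge> 2 \<Longrightarrow> wr w (Suc i) = sqrt (wr w i)"
  unfolding wr_def by (simp add: powr_half_sqrt[symmetric] powr_powr mult.commute)

lemma Jn_props:
  assumes "w \<ge> 2"
  shows "wr w (Jn w) < 2" "\<And>i. i < Jn w \<Longrightarrow> wr w i \<ge> 2"
proof -
  have "\<exists>j. wr w j < 2"
  proof -
    have "((\<lambda>j::nat. w powr (1 / 2 ^ j)) \<longlonglongrightarrow> w powr 0)"
      by (intro tendsto_intros) (use assms in \<open>auto intro!: LIMSEQ_divide_realpow_zero\<close>)
    then have "eventually (\<lambda>j. wr w j < 2) sequentially"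
      unfolding wr_def using assms by (intro order_tendstoD(2)) auto
    then show ?thesis by (auto simp: eventually_sequentially)
  qed
  then show "wr w (Jn w) < 2" unfolding Jn_def by (rule LeastI_ex)
  show "\<And>i. i < Jn w \<Longrightarrow> wr w i \<ge> 2" unfolding Jn_def using not_less_Least by (metis not_le)
qed

lemma finite_Rg [simp, intro]: "finite (Rg q w i)"
  by (rule finite_subset[OF _ finite_primes_le[of "wr w i"]]) (auto simp: Rg_def)

lemma Rg_disj:
  assumes "w \<ge> 2" "i \<noteq> j"
  shows "Rg q w i \<inter> Rg q w j = {}"
proof -
  have "Rg q w i \<inter> Rg q w j = {}" if "i < j" for i j
    using wr_mono[OF assms(1), of "Suc i" j] that by (auto simp: Rg_def)
  then show ?thesis using assms(2) by (metis inf_commute neqE)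
qed

text \<open>The block is the one before the first index \<open>k\<close> with \<open>wr w k\<close>
  < p; such an index exists because \<open>wr w (Jn w)\<close> < 2 \<le> p.\<close>

lemma Rg_cover:
  assumes w: "w \<ge> 2" and p: "prime p" "\<not> p dvd q" "real p \<le> w"
  shows "\<exists>i<Jn w. p \<in> Rg q w i"
proof -
  have p2: "real p \<ge> 2" using prime_ge_2_nat[OF p(1)] by simp
  define k where "k = (LEAST k. wr w k < real p)"
  have ex: "wr w (Jn w) < real p" using Jn_props(1)[OF w] p2 by linarith
  have k1: "wr w k < real p" unfolding k_def by (rule LeastI[of "\<lambda>k. wr w k < real p", OF ex])
  have kJ: "k \<le> Jn w" unfolding k_def by (rule Least_le[of "\<lambda>k. wr w k < real p", OF ex])
  have "k \<noteq> 0"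
  proof
    assume "k = 0"
    then show False using k1 p(3) w by simp
  qed
  then obtain i where i: "k = Suc i" by (cases k) auto
  have "\<not> wr w i < real p" using i unfolding k_def by (intro not_less_Least) simp
  then show ?thesis using p k1 i kJ by (intro exI[of _ i]) (auto simp: Rg_def)
qed

lemma Rg_Union:
  assumes w: "w \<ge> 2"
  shows "(\<Union>i<Jn w. Rg q w i) = {p. prime p \<and> \<not> p dvd q \<and> real p \<le> w}"
proof
  show "(\<Union>i<Jn w. Rg q w i) \<subseteq> {p. prime p \<and> \<not> p dvd q \<and> real p \<le> w}"
  proof
    fix p assume "p \<in> (\<Union>i<Jn w. Rg q w i)"
    then obtain i where "p \<in> Rg q w i" by blast
    then show "p \<in> {p. prime p \<and> \<not> p dvd q \<and> real p \<le> w}"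
      using wr_mono[OF w, of 0 i] w by (simp add: Rg_def)
  qed
  show "{p. prime p \<and> \<not> p dvd q \<and> real p \<le> w} \<subseteq> (\<Union>i<Jn w. Rg q w i)"
    using Rg_cover[OF w] by blast
qed

lemma card_Rg_le: "w \<ge> 2 \<Longrightarrow> real (card (Rg q w i)) \<le> wr w i"
proof -
  assume w: "w \<ge> 2"
  have "card (Rg q w i) \<le> card (ivl (wr w i))"
    by (intro card_mono) (auto simp: Rg_def mem_ivl prime_ge_Suc_0_nat)
  moreover have "real (card (ivl (wr w i))) \<le> wr w i" by (rule card_ivl_le) (simp add: wr_def)
  ultimately show ?thesis by linarith
qed

text \<open>On (sqrt x, x] every prime has ln p \<ge> ln x / 2, so Mertens' bound gives 2 + 12 / ln
  x \<le> 20, as ln x \<ge> 2/3. Doubled for densities g p \<le> 2 / p this is the 40 behind the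
  exponent 280 = 7 * 40 in \<open>Mc\<close>.\<close>

lemma sum_inverse_Rg_le:
  assumes w: "w \<ge> 2" and i: "i < Jn w"
  shows "(\<Sum>p\<in>Rg q w i. 1 / real p) \<le> 20"
proof -
  define x where "x = wr w i"
  have x: "x \<ge> 2" unfolding x_def using Jn_props(2)[OF w i] .
  have lx: "ln x \<ge> 2/3" using x ln2_ge_two_thirds ln_le_cancel_iff[of 2 x] by linarith
  define N where "N = nat \<lfloor>x\<rfloor>"
  have N: "N \<ge> 1" "real N \<le> x" using x unfolding N_def by linarith+
  have "(ln x / 2) * (\<Sum>p\<in>Rg q w i. 1 / real p) = (\<Sum>p\<in>Rg q w i. (ln x / 2) * (1 / real p))" by (simp add: sum_distrib_left)
  also have "... \<le> (\<Sum>p\<in>Rg q w i. mangoldt p / real p)"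
  proof (rule sum_mono)
    fix p assume p: "p \<in> Rg q w i"
    then have "prime p" "sqrt x < real p" using wr_Suc[OF w] by (auto simp: Rg_def x_def)
    then have "ln (sqrt x) \<le> ln (real p)" using x by (intro ln_mono) auto
    then have "ln x / 2 \<le> mangoldt p" using \<open>prime p\<close> x by (simp add: ln_sqrt)
    then have "(ln x / 2) / real p \<le> mangoldt p / real p" by (intro divide_right_mono) auto
    then show "(ln x / 2) * (1 / real p) \<le> mangoldt p / real p" by simp
  qed
  also have "... \<le> (\<Sum>d=1..N. mangoldt d / real d)"
    by (intro sum_mono2) (auto simp: Rg_def N_def x_def le_nat_floor mangoldt_nonneg prime_ge_Suc_0_nat)
  also have "... \<le> ln (real N) + 6" by (rule mertens_upper[OF N(1)])
  also have "... \<le> ln x + 6" using N by simp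
  also have "... \<le> (ln x / 2) * 20" using lx by simp
  finally show ?thesis using lx by (simp add: mult_le_cancel_left)
qed

lemma sum_arith_geom: "(\<Sum>i<J. real (i + 1) / 2 ^ i) \<le> 4"
proof -
  have "(\<Sum>i<J. real (i + 1) / 2 ^ i) = 4 - (2 * real J + 4) / 2 ^ J" for J
  proof (induction J)
    case (Suc J)
    have "4 - (2 * x + 4) / c + (x + 1) / c = 4 - (2 * (x + 1) + 4) / (2 * c)" if "c > 0" for x c :: real
      using that by (simp add: field_simps)
    from this[of "2 ^ J" "real J"] Suc.IH show ?case by (simp add: add.commute)
  qed simp
  then show ?thesis by simp
qed

text \<open>The linear growth of \<open>rr\<close> loses against the repeated square roots in
  \<open>wr\<close>: the exponent is 2 c times the sum of (i + 1) / 2^i, which is at most 4. So the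
  sieve remainder stays a fixed power of w.\<close>

lemma prod_wr_le:
  assumes w: "w \<ge> 2"
  shows "(\<Prod>i<J. wr w i ^ (c * rr i)) \<le> w ^ (8 * c)"
proof -
  have w0: "w > 0" using w by simp
  have "(\<Prod>i<J. wr w i ^ (c * rr i)) = (\<Prod>i<J. w powr (2 * real c * (real (i + 1) / 2 ^ i)))"
  proof (intro prod.cong refl)
    fix i
    have "wr w i ^ (c * rr i) = (w powr (1 / 2 ^ i)) powr real (c * rr i)"
      using w0 by (subst powr_realpow) (auto simp: wr_def)
    also have "... = w powr (2 * real c * (real (i + 1) / 2 ^ i))" by (simp add: powr_powr rr_def field_simps)
    finally show "wr w i ^ (c * rr i) = w powr (2 * real c * (real (i + 1) / 2 ^ i))" .
  qed
  also have "... = w powr (\<Sum>i<J. 2 * real c * (real (i + 1) / 2 ^ i))" using w0 by (simp add: powr_sum)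
  also have "... = w powr (2 * real c * (\<Sum>i<J. real (i + 1) / 2 ^ i))" by (simp add: sum_distrib_left)
  also have "... \<le> w powr (2 * real c * 4)" using w sum_arith_geom by (intro powr_mono mult_left_mono) auto
  also have "... = w powr real (8 * c)" by simp
  also have "... = w ^ (8 * c)" using w0 by (rule powr_realpow)
  finally show ?thesis .
qed

lemma brun_zero_eq:
  "brun q w i 0 n = (if om q w i n = 0 then 1 else real ((om q w i n - 1) choose rr i))"
proof -
  have "brun q w i 0 n = (\<Sum>E\<in>Pow (Rg q w i \<inter> {p. p dvd n}). if card E \<le> rr i then (-1) ^ card E else (0::real))"
    unfolding brun_def by (intro sum.cong refl) (simp add: aco_def)
  also have "... = (if Rg q w i \<inter> {p. p dvd n} = {} then 1 else real ((card (Rg q w i \<inter> {p. p dvd n}) - 1) choose rr i))"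
    by (rule brun_sum) (auto simp: rr_def)
  finally show ?thesis by (auto simp: om_def)
qed

lemma brun_nonneg: "brun q w i 0 n \<ge> 0" by (simp add: brun_zero_eq)
lemma rho_nonneg: "rho q w n \<ge> 0" unfolding rho_def by (intro prod_nonneg) (auto simp: brun_nonneg)
lemma kapf_nonneg: "kapf i m \<ge> 0" by (simp add: kapf_def)
lemma kap_nonneg: "kap q w n \<ge> 0" unfolding kap_def by (intro prod_nonneg) (auto simp: kapf_nonneg)
lemma hh_nonneg: "hh q w n \<ge> 0" unfolding hh_def by (intro prod_nonneg) (auto simp: xi_def)

lemma rho_large_prime:
  assumes "w \<ge> 2" "prime p" "real p > w"
  shows "rho q w p = 1"
proof -
  have "om q w i p = 0" for i
  proof -
    have "x \<notin> Rg q w i" if "x dvd p" for x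
    proof
      assume "x \<in> Rg q w i"
      then have "prime x" "real x \<le> wr w i" by (auto simp: Rg_def)
      then have "x = p" using that assms(2) by (simp add: primes_dvd_imp_eq)
      then show False using \<open>real x \<le> wr w i\<close> wr_mono[OF assms(1), of 0 i] assms by simp
    qed
    then have "Rg q w i \<inter> {x. x dvd p} = {}" by auto
    then show ?thesis by (simp add: om_def)
  qed
  then show ?thesis by (simp add: rho_def brun_zero_eq)
qed

lemma om_mult_le: "om q w i (a * b) \<le> om q w i a + om q w i b"
proof -
  have "Rg q w i \<inter> {p. p dvd a * b} \<subseteq> (Rg q w i \<inter> {p. p dvd a}) \<union> (Rg q w i \<inter> {p. p dvd b})"
    by (auto simp: Rg_def prime_dvd_mult_iff)
  then have "om q w i (a * b) \<le> card ((Rg q w i \<inter> {p. p dvd a}) \<union> (Rg q w i \<inter> {p. p dvd b}))"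
    unfolding om_def by (intro card_mono) auto
  also have "... \<le> om q w i a + om q w i b" unfolding om_def by (rule card_Un_le)
  finally show ?thesis .
qed

lemma om_mult_ge: "om q w i a \<le> om q w i (a * b)"
  unfolding om_def by (intro card_mono) auto

lemma om_mult_ge': "om q w i b \<le> om q w i (a * b)"
  unfolding om_def by (intro card_mono) auto

text \<open>The product b t has at most as many sieving primes as \<open>b\<close> and
  \<open>t\<close> together. Vandermonde's identity then expresses the majorant by sets of primes
  dividing \<open>b\<close> alone, so that \<open>b\<close> can still be sieved.\<close>

lemma brun_mult_le: "brun q w i 0 (b * t) \<le> brun q w i (om q w i t) b"
proof (cases "om q w i t = 0")
  case True
  then have "Rg q w i \<inter> {p. p dvd t} = {}" by (simp add: om_def)
  then have "Rg q w i \<inter> {p. p dvd b * t} = Rg q w i \<inter> {p. p dvd b}"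
    by (auto simp: Rg_def prime_dvd_mult_iff)
  then show ?thesis using True by (simp add: brun_def)
next
  case False
  then have bt: "om q w i (b * t) \<noteq> 0" using om_mult_ge'[of q w i t b] by simp
  have "brun q w i 0 (b * t) = real ((om q w i (b * t) - 1) choose rr i)" using bt by (simp add: brun_zero_eq)
  also have "... \<le> real ((om q w i b + om q w i t) choose rr i)"
    using om_mult_le[of q w i b t] by (intro of_nat_mono binomial_right_mono) simp
  also have "... = (\<Sum>k\<le>rr i. real (om q w i b choose k) * real (om q w i t choose (rr i - k)))"
    by (simp flip: vandermonde)
  also have "... = (\<Sum>E\<in>Pow (Rg q w i \<inter> {p. p dvd b}). if card E \<le> rr i then real (om q w i t choose (rr i - card E)) else 0)"
    unfolding om_def[of q w i b] by (rule sum_Pow_card_le[symmetric]) simp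
  also have "... = brun q w i (om q w i t) b" unfolding brun_def using False by (intro sum.cong refl) (simp add: aco_def)
  finally show ?thesis .
qed

lemma rho_mult_le: "rho q w (b * t) \<le> (\<Prod>i<Jn w. brun q w i (om q w i t) b)"
  unfolding rho_def by (intro prod_mono) (auto simp: brun_nonneg brun_mult_le)

lemma rho_le_kap: "rho q w n \<le> kap q w n"
  unfolding rho_def kap_def
proof (intro prod_mono conjI brun_nonneg)
  fix i
  show "brun q w i 0 n \<le> kapf i (om q w i n)"
  proof (cases "om q w i n = 0")
    case False
    have "brun q w i 0 n \<le> real (om q w i n choose rr i)"
      using False by (simp add: brun_zero_eq binomial_right_mono)
    also have "... \<le> exp (- real (rr i)) * 4 ^ om q w i n" by (rule binomial_le_exp)
    also have "... \<le> exp (- real (rr i)) * real Mc ^ om q w i n"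
      using Mc_ge by (intro mult_left_mono power_mono) auto
    also have "... \<le> real Mc * (exp (- real (rr i)) * real Mc ^ om q w i n)"
      using Mc_ge mult_right_mono[of 1 "real Mc" "exp (- real (rr i)) * real Mc ^ om q w i n"] by simp
    finally show ?thesis using False by (simp add: kapf_def mult.assoc)
  qed (simp add: brun_zero_eq kapf_def)
qed

lemma exp_rr: "exp (- real (rr i)) = exp (- real (i + 1)) * exp (- real (i + 1))"
  by (simp add: rr_def exp_add[symmetric])

text \<open>As \<open>rr i\<close> = 2 (i + 1), the factor exp (- rr i) splits into two equal
  factors, one for each of \<open>a\<close> and \<open>b\<close>; the powers of \<open>Mc\<close>
  split because \<open>om\<close> is subadditive. Blocks meeting neither number account for the
  summand 1 in \<open>kapf\<close>.\<close>

lemma kap_le_hh_mult: "kap q w (a * b) \<le> hh q w a * hh q w b"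
proof -
  have "kap q w (a * b) \<le> (\<Prod>i<Jn w. (xi i * real Mc ^ om q w i a + of_bool (om q w i a = 0)) * (xi i * real Mc ^ om q w i b + of_bool (om q w i b = 0)))"
    unfolding kap_def
  proof (intro prod_mono conjI kapf_nonneg)
    fix i
    let ?M = "real Mc" and ?e = "exp (- real (i + 1))"
    define k l m where "k = om q w i a" and "l = om q w i b" and "m = om q w i (a * b)"
    have klm: "m \<le> k + l" "k \<le> m" "l \<le> m" unfolding k_def l_def m_def by (rule om_mult_le om_mult_ge om_mult_ge')+
    have M: "?M \<ge> 1" using Mc_ge by simp
    have e: "?e > 0" "?e \<le> 1" by auto
    have x: "xi i \<ge> ?e" using M e by (simp add: xi_def mult_le_cancel_right1)
    have p: "?M ^ j \<ge> 1" for j using M by (rule one_le_power)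
    have base: "?M * exp (- real (rr i)) * ?M ^ m \<le> (xi i * ?M ^ k) * (xi i * ?M ^ l)"
    proof -
      have "?M * exp (- real (rr i)) * ?M ^ m \<le> (?M * ?M) * (?e * ?e) * ?M ^ (k + l)"
        unfolding exp_rr using M klm(1) e by (intro mult_mono power_increasing) auto
      also have "... = (xi i * ?M ^ k) * (xi i * ?M ^ l)" by (simp add: xi_def power_add mult_ac)
      finally show ?thesis .
    qed
    have x0: "xi i * ?M ^ j \<ge> 0" for j by (simp add: xi_def)
    have "kapf i m \<le> (xi i * ?M ^ k + of_bool (k = 0)) * (xi i * ?M ^ l + of_bool (l = 0))"
    proof (cases "m = 0")
      case True
      then have "k = 0" "l = 0" using klm by auto
      then have "(xi i * ?M ^ k + of_bool (k = 0)) * (xi i * ?M ^ l + of_bool (l = 0)) = (xi i * ?M ^ k) * (xi i * ?M ^ l) + 2 * xi i + 1"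
        by (simp add: algebra_simps)
      moreover have "xi i \<ge> 0" by (simp add: xi_def)
      ultimately show ?thesis using base True by (simp add: kapf_def)
    next
      case False
      have "(xi i * ?M ^ k) * (xi i * ?M ^ l) \<le> (xi i * ?M ^ k + of_bool (k = 0)) * (xi i * ?M ^ l + of_bool (l = 0))"
        using x0 by (intro mult_mono) (auto intro: add_nonneg_nonneg)
      then show ?thesis using base False by (simp add: kapf_def)
    qed
    then show "kapf i (om q w i (a * b)) \<le> (xi i * real Mc ^ om q w i a + of_bool (om q w i a = 0)) * (xi i * real Mc ^ om q w i b + of_bool (om q w i b = 0))"
      by (simp add: k_def l_def m_def)
  qed
  then show ?thesis by (simp add: hh_def prod.distrib)
qed

lemma kap_le_hh: "kap q w n \<le> hh q w n"
  unfolding kap_def hh_def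
proof (intro prod_mono conjI kapf_nonneg)
  fix i
  have "exp (- real (rr i)) \<le> exp (- real (i + 1))" by (simp add: rr_def)
  then have "real Mc * exp (- real (rr i)) * real Mc ^ om q w i n \<le> real Mc * exp (- real (i + 1)) * real Mc ^ om q w i n"
    by (intro mult_right_mono mult_left_mono) auto
  then show "kapf i (om q w i n) \<le> xi i * real Mc ^ om q w i n + of_bool (om q w i n = 0)"
    by (simp add: kapf_def xi_def)
qed

text \<open>A prime power has one prime only, which lies in at most one block and raises the count
  there by at most one.\<close>

lemma kap_primepow_le:
  assumes "w \<ge> 2" "primepow d"
  shows "kap q w (n * d) \<le> (real Mc)\<^sup>2 * kap q w n"
proof -
  obtain p k where pk: "prime p" "k > 0" "d = p ^ k" using assms(2) by (auto simp: primepow_def)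
  define c where "c = (\<lambda>i. if p \<in> Rg q w i then (real Mc)\<^sup>2 else 1)"
  have M: "real Mc \<ge> 4" by (rule Mc_ge)
  have M2: "real Mc \<le> (real Mc)\<^sup>2" "(real Mc)\<^sup>2 \<ge> 1" using M by (intro self_le_power one_le_power; simp)+
  have "kap q w (n * d) \<le> (\<Prod>i<Jn w. c i * kapf i (om q w i n))"
    unfolding kap_def
  proof (intro prod_mono conjI kapf_nonneg)
    fix i
    let ?e = "real Mc * exp (- real (rr i))"
    have dv: "x dvd n * d \<longleftrightarrow> x dvd n \<or> x = p" if "x \<in> Rg q w i" for x
    proof -
      have "prime x" using that by (auto simp: Rg_def)
      then show ?thesis using pk by (auto simp: prime_dvd_mult_iff prime_dvd_power_iff primes_dvd_imp_eq dest: prime_dvd_power)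
    qed
    show "kapf i (om q w i (n * d)) \<le> c i * kapf i (om q w i n)"
    proof (cases "p \<in> Rg q w i")
      case False
      then have "Rg q w i \<inter> {x. x dvd n * d} = Rg q w i \<inter> {x. x dvd n}" using dv by auto
      then show ?thesis using False by (simp add: om_def c_def)
    next
      case True
      have "Rg q w i \<inter> {x. x dvd n * d} \<subseteq> insert p (Rg q w i \<inter> {x. x dvd n})" using dv by auto
      then have "om q w i (n * d) \<le> card (insert p (Rg q w i \<inter> {x. x dvd n}))" unfolding om_def by (intro card_mono) auto
      also have "... \<le> Suc (om q w i n)" unfolding om_def by (simp add: card_insert_if)
      finally have le: "om q w i (n * d) \<le> Suc (om q w i n)" .
      have ge: "om q w i n \<le> om q w i (n * d)" by (rule om_mult_ge)
      have e0: "?e \<ge> 0" by simp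
      show ?thesis
      proof (cases "om q w i (n * d) = 0")
        case z: True
        then have "om q w i n = 0" using ge by simp
        moreover have "1 * kapf i 0 \<le> (real Mc)\<^sup>2 * kapf i 0" using M2 kapf_nonneg by (intro mult_right_mono) auto
        ultimately show ?thesis using z True by (simp add: c_def)
      next
        case nz: False
        have "kapf i (om q w i (n * d)) = ?e * real Mc ^ om q w i (n * d)" using nz by (simp add: kapf_def)
        also have "... \<le> ?e * real Mc ^ Suc (om q w i n)" using le M e0 by (intro mult_left_mono power_increasing) auto
        also have "... = real Mc * (?e * real Mc ^ om q w i n)" by simp
        also have "... \<le> (real Mc)\<^sup>2 * kapf i (om q w i n)" using M2 e0 by (intro mult_mono) (auto simp: kapf_def)
        finally show ?thesis using True by (simp add: c_def)
      qed
    qed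
  qed
  also have "... = (\<Prod>i<Jn w. c i) * kap q w n" by (simp add: prod.distrib kap_def)
  also have "... \<le> (real Mc)\<^sup>2 * kap q w n"
  proof (intro mult_right_mono kap_nonneg)
    show "(\<Prod>i<Jn w. c i) \<le> (real Mc)\<^sup>2"
    proof (cases "\<exists>i<Jn w. p \<in> Rg q w i")
      case True
      then obtain i where i: "i < Jn w" "p \<in> Rg q w i" by blast
      have "c j = 1" if "j \<noteq> i" for j using Rg_disj[OF assms(1) that, of q] i by (auto simp: c_def)
      then have "(\<Prod>i<Jn w. c i) = (\<Prod>j\<in>{i}. c j)" using i by (intro prod.mono_neutral_right) auto
      then show ?thesis using i by (simp add: c_def)
    next
      case False
      then have "(\<Prod>i<Jn w. c i) = 1" by (intro prod.neutral) (auto simp: c_def)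
      then show ?thesis using M2 by simp
    qed
  qed
  finally show ?thesis .
qed

lemma sum_exp_le: "(\<Sum>i<J. exp (- real (i + 1))) \<le> 1"
proof -
  have e: "exp (-1::real) \<le> 1/2" using exp_ge_add_one_self[of "1::real"] by (simp add: exp_minus field_simps)
  have "(\<Sum>i<J. exp (- real (i + 1))) \<le> 1 - (1/2::real) ^ J"
  proof (induction J)
    case (Suc J)
    have "exp (- real (J + 1)) = exp (real (J + 1) * (-1))" by simp
    also have "... = exp (-1) ^ (J + 1)" by (rule exp_of_nat_mult)
    also have "... \<le> (1/2) ^ (J + 1)" using e by (intro power_mono) auto
    finally show ?case using Suc.IH by simp
  qed simp
  moreover have "(1/2::real) ^ J \<ge> 0" by simp
  ultimately show ?thesis by linarith
qed

lemma prod_kapf_zero_le: "(\<Prod>i<J. kapf i 0) \<le> exp (real Mc)"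
proof -
  have "(\<Prod>i<J. kapf i 0) = (\<Prod>i<J. 1 + real Mc * exp (- real (rr i)))" by (simp add: kapf_def)
  also have "... \<le> exp (\<Sum>i<J. real Mc * exp (- real (rr i)))" by (rule prod_one_plus_le_exp) simp
  also have "... \<le> exp (real Mc * 1)"
  proof -
    have "(\<Sum>i<J. real Mc * exp (- real (rr i))) = real Mc * (\<Sum>i<J. exp (- real (rr i)))" by (simp add: sum_distrib_left)
    also have "... \<le> real Mc * (\<Sum>i<J. exp (- real (i + 1)))"
      by (intro mult_left_mono sum_mono) (auto simp: rr_def)
    also have "... \<le> real Mc * 1" using sum_exp_le by (intro mult_left_mono) auto
    finally show ?thesis by simp
  qed
  finally show ?thesis by simp
qed

lemma kap_one_le: "kap q w (Suc 0) \<le> exp (real Mc)"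
proof -
  have "om q w i (Suc 0) = 0" for i by (auto simp: om_def Rg_def)
  then show ?thesis using prod_kapf_zero_le by (simp add: kap_def)
qed

lemma prod_primes_dvd_iff:
  assumes "finite E" "\<And>p. p \<in> E \<Longrightarrow> prime (p::nat)"
  shows "(\<forall>p\<in>E. p dvd n) \<longleftrightarrow> \<Prod>E dvd n"
proof
  assume "\<forall>p\<in>E. p dvd n"
  with assms show "\<Prod>E dvd n"
  proof (induction E rule: finite_induct)
    case (insert p E)
    have "coprime p (\<Prod>E)"
      using insert by (intro prod_coprime_right) (metis insertI1 insertI2 primes_coprime)
    then show ?case using insert by (auto intro: divides_mult)
  qed simp
next
  assume "\<Prod>E dvd n"
  then show "\<forall>p\<in>E. p dvd n" using assms(1) by (meson dvd_prodI dvd_trans)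
qed

text \<open>A block with upper end x \<ge> 2 contributes (4 x)^rr \<le> x^(3 rr) from the count and
  at most x^(2 rr) to offset exp (- rr) in \<open>kapf\<close>. The exponent 5 rr becomes w^40 by
  \<open>prod_wr_le\<close>.\<close>

lemma sieve_count_bound:
  assumes w: "w \<ge> 2"
  shows "(\<Prod>i<Jn w. \<Sum>E\<in>Pow (Rg q w i). \<bar>aco (rr i) (om q w i t) (card E)\<bar> * 3 ^ card E) \<le> w ^ 40 * kap q w t"
proof -
  define J where "J = Jn w"
  define R where "R = Rg q w"
  define a where "a = (\<lambda>i. aco (rr i) (om q w i t))"
    have "(\<Prod>i<J. \<Sum>E\<in>Pow (R i). \<bar>a i (card E)\<bar> * 3 ^ card E) \<le> (\<Prod>i<J. wr w i ^ (5 * rr i) * kapf i (om q w i t))"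
    proof (intro prod_mono conjI sum_nonneg mult_nonneg_nonneg)
      fix i assume i: "i \<in> {..<J}"
      then have x: "wr w i \<ge> 2" using Jn_props(2)[OF w] by (simp add: J_def)
      let ?x = "wr w i" and ?m = "om q w i t"
      have "(\<Sum>E\<in>Pow (R i). \<bar>a i (card E)\<bar> * 3 ^ card E) \<le> 2 ^ ?m * (1 + 3 * real (card (R i))) ^ rr i"
        unfolding a_def by (rule aco_count_bound) (simp add: R_def)
      also have "... \<le> 2 ^ ?m * (?x ^ 3) ^ rr i"
      proof (intro mult_left_mono power_mono)
        have "1 + 3 * real (card (R i)) \<le> 1 + 3 * ?x" using card_Rg_le[OF w] by (simp add: R_def)
        also have "... \<le> 4 * ?x" using x by simp
        also have "... \<le> (?x * ?x) * ?x" using x mult_mono[of 2 ?x 2 ?x] by (intro mult_right_mono) auto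
        finally show "1 + 3 * real (card (R i)) \<le> ?x ^ 3" by (simp add: power3_eq_cube)
      qed auto
      also have "2 ^ ?m \<le> exp (real (rr i)) * kapf i ?m"
      proof -
        have M: "real Mc \<ge> 2" "real Mc \<ge> 1" using Mc_ge by simp_all
        have "2 ^ ?m \<le> real Mc ^ ?m" using M by (intro power_mono) auto
        also have "... \<le> real Mc * real Mc ^ ?m" using M mult_right_mono[of 1 "real Mc" "real Mc ^ ?m"] by simp
        also have "... = exp (real (rr i)) * (real Mc * exp (- real (rr i)) * real Mc ^ ?m)" by (simp add: exp_minus)
        also have "... \<le> exp (real (rr i)) * kapf i ?m" by (intro mult_left_mono) (auto simp: kapf_def)
        finally show ?thesis .
      qed
      also have "exp (real (rr i)) \<le> (?x ^ 2) ^ rr i"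
      proof -
        have "exp (real (rr i)) = exp 1 ^ rr i" by (simp add: exp_of_nat_mult[symmetric])
        also have "... \<le> (?x ^ 2) ^ rr i"
        proof (rule power_mono)
          have "(2::real) ^ 2 \<le> ?x ^ 2" using x by (intro power_mono) auto
          then show "exp 1 \<le> ?x ^ 2" using exp_le by simp
        qed simp
        finally show ?thesis .
      qed
      finally show "(\<Sum>E\<in>Pow (R i). \<bar>a i (card E)\<bar> * 3 ^ card E) \<le> ?x ^ (5 * rr i) * kapf i ?m"
        using kapf_nonneg x by (simp add: power_mult[symmetric] power_add[symmetric] mult_ac mult_right_mono)
    qed auto
    also have "... = (\<Prod>i<J. wr w i ^ (5 * rr i)) * kap q w t" by (simp add: prod.distrib kap_def J_def)
    also have "... \<le> w ^ (8 * 5) * kap q w t" using prod_wr_le[OF w] by (intro mult_right_mono kap_nonneg)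
    finally show ?thesis by (simp add: J_def R_def a_def)
qed

text \<open>\<open>brun_mult_le\<close> takes the cofactor \<open>t\<close> out of the weights, so
  they expand by \<open>sieve_sum\<close>; \<open>aco_main_bound\<close> evaluates each block with
  \<Gamma> = 40. All dependence on \<open>t\<close> ends up in \<open>kap\<close>.\<close>

lemma sieve_upper:
  fixes F g :: "nat \<Rightarrow> real"
  assumes w: "w \<ge> 2" and F: "\<And>n. F n \<ge> 0" and X: "X \<ge> 0" and Er: "Er \<ge> 0" and fin: "finite A"
    and g: "\<And>p. prime p \<Longrightarrow> \<not> p dvd q \<Longrightarrow> 0 \<le> g p \<and> g p \<le> 3/4 \<and> g p \<le> 2 / real p"
    and dist: "\<And>E. finite E \<Longrightarrow> E \<subseteq> {p. prime p \<and> \<not> p dvd q \<and> real p \<le> w} \<Longrightarrow>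
        \<bar>(\<Sum>n | n \<in> A \<and> \<Prod>E dvd n. F n) - X * (\<Prod>p\<in>E. g p)\<bar> \<le> Er * 3 ^ card E"
  shows "(\<Sum>n\<in>A. F n * rho q w (n * t)) \<le> kap q w t * (X * (\<Prod>p | prime p \<and> \<not> p dvd q \<and> real p \<le> w. 1 - g p) + Er * w ^ 40)"
proof -
  define J where "J = Jn w"
  define R where "R = Rg q w"
  define a where "a = (\<lambda>i. aco (rr i) (om q w i t))"
  have "(\<Sum>n\<in>A. F n * rho q w (n * t)) \<le> (\<Sum>n\<in>A. F n * (\<Prod>i<J. \<Sum>E\<in>Pow (R i \<inter> {p. p dvd n}). a i (card E)))"
    using rho_mult_le[of q w _ t] F unfolding J_def R_def a_def brun_def by (intro sum_mono mult_left_mono) auto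
  also have "... \<le> X * (\<Prod>i<J. \<Sum>E\<in>Pow (R i). a i (card E) * (\<Prod>p\<in>E. g p)) + Er * (\<Prod>i<J. \<Sum>E\<in>Pow (R i). \<bar>a i (card E)\<bar> * 3 ^ card E)"
  proof -
    have "\<bar>(\<Sum>n | n \<in> A \<and> (\<forall>p\<in>{}. p dvd n). F n * (\<Prod>i<J. \<Sum>E\<in>Pow (R i \<inter> {p. p dvd n}). a i (card E)))
     - X * (\<Prod>p\<in>{}. g p) * (\<Prod>i<J. \<Sum>E\<in>Pow (R i). a i (card E) * (\<Prod>p\<in>E. g p))\<bar>
     \<le> Er * 3 ^ card ({}::nat set) * (\<Prod>i<J. \<Sum>E\<in>Pow (R i). \<bar>a i (card E)\<bar> * 3 ^ card E)"
    proof (rule sieve_sum[where J = J])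
      show "\<And>i. finite (R i)" "\<And>i j. i \<noteq> j \<Longrightarrow> R i \<inter> R j = {}" unfolding R_def using Rg_disj[OF w] by auto
      fix E assume E: "finite E" "E \<subseteq> (\<Union>i<J. R i)"
      then have E': "E \<subseteq> {p. prime p \<and> \<not> p dvd q \<and> real p \<le> w}" using Rg_Union[OF w] by (simp add: J_def R_def)
      then have "(\<forall>p\<in>E. p dvd n) \<longleftrightarrow> \<Prod>E dvd n" for n using E(1) by (intro prod_primes_dvd_iff) auto
      then show "\<bar>(\<Sum>n | n \<in> A \<and> (\<forall>p\<in>E. p dvd n). F n) - X * (\<Prod>p\<in>E. g p)\<bar> \<le> Er * 3 ^ card E"
        using dist[OF E(1) E'] by simp
    qed (use fin in auto)
    then show ?thesis by simp
  qed
  also have "... \<le> X * ((\<Prod>p | prime p \<and> \<not> p dvd q \<and> real p \<le> w. 1 - g p) * kap q w t) + Er * (w ^ 40 * kap q w t)"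
  proof (intro add_mono mult_left_mono X Er)
    have gR: "0 \<le> g p \<and> g p \<le> 3/4" if "p \<in> R i" for p i using that g by (auto simp: R_def Rg_def)
    have "(\<Prod>i<J. \<Sum>E\<in>Pow (R i). a i (card E) * (\<Prod>p\<in>E. g p)) \<le> \<bar>\<Prod>i<J. \<Sum>E\<in>Pow (R i). a i (card E) * (\<Prod>p\<in>E. g p)\<bar>" by simp
    also have "... = (\<Prod>i<J. \<bar>\<Sum>E\<in>Pow (R i). a i (card E) * (\<Prod>p\<in>E. g p)\<bar>)" by (simp add: abs_prod)
    also have "... \<le> (\<Prod>i<J. (\<Prod>p\<in>R i. 1 - g p) * kapf i (om q w i t))"
    proof (intro prod_mono conjI abs_ge_zero)
      fix i assume i: "i \<in> {..<J}"
      have "(\<Sum>p\<in>R i. g p) \<le> (\<Sum>p\<in>R i. 2 * (1 / real p))"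
        using g by (intro sum_mono) (auto simp: R_def Rg_def)
      also have "... = 2 * (\<Sum>p\<in>R i. 1 / real p)" by (simp add: sum_distrib_left)
      also have "... \<le> 2 * 20" unfolding R_def using i J_def w by (intro mult_left_mono sum_inverse_Rg_le) auto
      finally show "\<bar>\<Sum>E\<in>Pow (R i). a i (card E) * (\<Prod>p\<in>E. g p)\<bar> \<le> (\<Prod>p\<in>R i. 1 - g p) * kapf i (om q w i t)"
        unfolding a_def kapf_def using gR Mc_ge by (intro aco_main_bound[where \<Gamma> = 40]) (auto simp: R_def)
    qed
    also have "... = (\<Prod>i<J. \<Prod>p\<in>R i. 1 - g p) * kap q w t" by (simp add: prod.distrib kap_def J_def)
    also have "(\<Prod>i<J. \<Prod>p\<in>R i. 1 - g p) = (\<Prod>p\<in>(\<Union>i<J. R i). 1 - g p)"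
      unfolding R_def using Rg_disj[OF w] by (intro prod.UNION_disjoint[symmetric]) auto
    also have "(\<Union>i<J. R i) = {p. prime p \<and> \<not> p dvd q \<and> real p \<le> w}" using Rg_Union[OF w] by (simp add: J_def R_def)
    finally show "(\<Prod>i<J. \<Sum>E\<in>Pow (R i). a i (card E) * (\<Prod>p\<in>E. g p)) \<le> (\<Prod>p | prime p \<and> \<not> p dvd q \<and> real p \<le> w. 1 - g p) * kap q w t" .
    show "(\<Prod>i<J. \<Sum>E\<in>Pow (R i). \<bar>a i (card E)\<bar> * 3 ^ card E) \<le> w ^ 40 * kap q w t"
      unfolding J_def R_def a_def by (rule sieve_count_bound[OF w])
  qed
  also have "... = kap q w t * (X * (\<Prod>p | prime p \<and> \<not> p dvd q \<and> real p \<le> w. 1 - g p) + Er * w ^ 40)"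
    by (simp add: algebra_simps)
  finally show ?thesis .
qed

text \<open>The product of the local sums over primes up to w dominates the sum of \<open>f\<close>
  up to w. Read backwards, this bounds the sieve density by the inverse of that sum; the primes
  dividing \<open>q\<close> leave the factor q / phi(q).\<close>

lemma euler_product_bound:
  fixes f g :: "nat \<Rightarrow> real"
  assumes w: "real q \<le> w" and q: "q > 0" and f: "multf f" "\<And>n. f n \<ge> 0"
    and g: "\<And>p. prime p \<Longrightarrow> \<not> p dvd q \<Longrightarrow> g p < 1"
    and c1: "\<And>p K. prime p \<Longrightarrow> \<not> p dvd q \<Longrightarrow> (\<Sum>k\<le>K. f (p ^ k)) \<le> 1 / (1 - g p)"
    and c2: "\<And>p K. prime p \<Longrightarrow> p dvd q \<Longrightarrow> (\<Sum>k\<le>K. f (p ^ k)) \<le> 1 / (1 - 1 / real p)"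
  shows "(\<Prod>p | prime p \<and> \<not> p dvd q \<and> real p \<le> w. 1 - g p) * (\<Sum>n\<in>ivl w. f n) \<le> real q / real (totient q)"
proof -
  let ?A = "{p. prime p \<and> \<not> p dvd q \<and> real p \<le> w}"
  have finA: "finite ?A" by (rule finite_subset[OF _ finite_primes_le[of w]]) auto
  have pq: "prime_factors q = {p. prime p \<and> p dvd q}" using q by (auto simp: prime_factors_dvd)
  have "ivl w = PS (?A \<union> prime_factors q) w"
  proof -
    have "prime_factors n \<subseteq> ?A \<union> prime_factors q" if "n \<in> ivl w" for n
    proof
      fix p assume p: "p \<in> prime_factors n"
      then have "p \<le> n" using that by (auto simp: mem_ivl intro!: dvd_imp_le)
      then have "real p \<le> w" using that by (auto simp: mem_ivl)
      then show "p \<in> ?A \<union> prime_factors q" using p pq by auto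
    qed
    then show ?thesis by (auto simp: PS_def)
  qed
  then have "(\<Sum>n\<in>ivl w. f n) = (\<Sum>n\<in>PS (?A \<union> prime_factors q) w. f n)" by (rule sum.cong) simp
  also have "... \<le> (\<Prod>p\<in>?A \<union> prime_factors q. if p dvd q then 1 / (1 - 1 / real p) else 1 / (1 - g p))"
  proof (rule multf_sum_euler[OF f])
    show "finite (?A \<union> prime_factors q)" using finA by simp
    fix p assume p: "p \<in> ?A \<union> prime_factors q"
    then show pp: "prime p" by auto
    fix K show "(\<Sum>k\<le>K. f (p ^ k)) \<le> (if p dvd q then 1 / (1 - 1 / real p) else 1 / (1 - g p))"
      using c1[OF pp] c2[OF pp] by simp
  qed
  also have "... = (\<Prod>p\<in>?A. if p dvd q then 1 / (1 - 1 / real p) else 1 / (1 - g p)) * (\<Prod>p\<in>prime_factors q. if p dvd q then 1 / (1 - 1 / real p) else 1 / (1 - g p))"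
  proof (rule prod.union_disjoint[OF finA])
    show "?A \<inter> prime_factors q = {}" unfolding pq by auto
  qed simp
  also have "(\<Prod>p\<in>?A. if p dvd q then 1 / (1 - 1 / real p) else 1 / (1 - g p)) = (\<Prod>p\<in>?A. 1 / (1 - g p))" by (intro prod.cong) auto
  also have "(\<Prod>p\<in>prime_factors q. if p dvd q then 1 / (1 - 1 / real p) else 1 / (1 - g p)) = (\<Prod>p\<in>prime_factors q. 1 / (1 - 1 / real p))"
    using pq by (intro prod.cong) auto
  also have "... = real q / real (totient q)"
    using totient_formula2[of q] q by (simp add: prod_dividef)
  finally have le: "(\<Sum>n\<in>ivl w. f n) \<le> (\<Prod>p\<in>?A. 1 / (1 - g p)) * (real q / real (totient q))" .
  have pos: "(\<Prod>p\<in>?A. 1 - g p) > 0" using g by (intro prod_pos) auto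
  have "(\<Prod>p\<in>?A. 1 - g p) * (\<Sum>n\<in>ivl w. f n) \<le> (\<Prod>p\<in>?A. 1 - g p) * ((\<Prod>p\<in>?A. 1 / (1 - g p)) * (real q / real (totient q)))"
    using le pos by (intro mult_left_mono) auto
  also have "... = ((\<Prod>p\<in>?A. 1 - g p) * (\<Prod>p\<in>?A. 1 / (1 - g p))) * (real q / real (totient q))" by (simp only: mult.assoc)
  also have "(\<Prod>p\<in>?A. 1 - g p) * (\<Prod>p\<in>?A. 1 / (1 - g p)) = 1"
  proof -
    have "(1 - g p) * (1 / (1 - g p)) = 1" if "p \<in> ?A" for p using that g[of p] by simp
    then show ?thesis unfolding prod.distrib[symmetric] by (rule prod.neutral[OF ballI])
  qed
  finally show ?thesis by simp
qed

lemma multf_inverse: "multf (\<lambda>n. 1 / real n)" by (auto simp: multf_def)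

lemma geom_partial_le: "0 \<le> x \<Longrightarrow> x < 1 \<Longrightarrow> (\<Sum>k\<le>K. x ^ k) \<le> 1 / (1 - x)" for x :: real
  by (simp add: sum_gp0 divide_right_mono)

lemma prime_inverse_le: "prime p \<Longrightarrow> 1 / real p \<le> 1/2" "prime p \<Longrightarrow> 1 / real p > 0"
  using prime_ge_2_nat[of p] by (auto simp: field_simps prime_gt_0_nat)

lemma sieve_density_le:
  assumes w: "w \<ge> 2" "real q \<le> w" and q: "q > 0"
  shows "(\<Prod>p | prime p \<and> \<not> p dvd q \<and> real p \<le> w. 1 - 1 / real p) \<le> real q / real (totient q) / ln w"
proof -
  have "(\<Prod>p | prime p \<and> \<not> p dvd q \<and> real p \<le> w. 1 - 1 / real p) * (\<Sum>n\<in>ivl w. 1 / real n) \<le> real q / real (totient q)"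
  proof (rule euler_product_bound[OF w(2) q multf_inverse])
    have "(\<Sum>k\<le>K. 1 / real (p ^ k)) \<le> 1 / (1 - 1 / real p)" if "prime p" for p K
      using geom_partial_le[of "1 / real p" K] prime_inverse_le[OF that] by (simp add: power_one_over)
    then show "\<And>p K. prime p \<Longrightarrow> \<not> p dvd q \<Longrightarrow> (\<Sum>k\<le>K. 1 / real (p ^ k)) \<le> 1 / (1 - 1 / real p)"
      "\<And>p K. prime p \<Longrightarrow> p dvd q \<Longrightarrow> (\<Sum>k\<le>K. 1 / real (p ^ k)) \<le> 1 / (1 - 1 / real p)" by blast+
    fix p :: nat assume "prime p"
    then show "1 / real p < 1" using prime_inverse_le(1)[of p] by linarith
  qed auto
  moreover have "(\<Sum>n\<in>ivl w. 1 / real n) \<ge> ln w"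
  proof -
    have "ln w \<le> ln (real (nat \<lfloor>w\<rfloor>) + 1)" using w by (intro ln_mono) linarith+
    also have "... \<le> harm (nat \<lfloor>w\<rfloor>)" using ln_le_harm[of "nat \<lfloor>w\<rfloor>"] by (simp add: add.commute)
    also have "... = (\<Sum>n\<in>ivl w. 1 / real n)" by (simp add: harm_def ivl_def divide_inverse)
    finally show ?thesis .
  qed
  moreover have "(\<Prod>p | prime p \<and> \<not> p dvd q \<and> real p \<le> w. 1 - 1 / real p) \<ge> 0"
  proof (rule prod_nonneg)
    fix p assume "p \<in> {p. prime p \<and> \<not> p dvd q \<and> real p \<le> w}"
    then show "0 \<le> 1 - 1 / real p" using prime_inverse_le(1)[of p] by simp
  qed
  ultimately have "(\<Prod>p | prime p \<and> \<not> p dvd q \<and> real p \<le> w. 1 - 1 / real p) * ln w \<le> real q / real (totient q)"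
    by (meson mult_left_mono order_trans)
  moreover have "ln w > 0" using w by simp
  ultimately show ?thesis by (subst pos_le_divide_eq)
qed

section \<open>Sieve bounds in residue classes\<close>

context rchar
begin

lemma totient_pos: "phq \<ge> 1" "phq \<le> real q"
  using q1 by (simp_all add: totient_le Suc_le_eq)

lemma prod_primes_coprime:
  assumes "finite E" "\<And>p. p \<in> E \<Longrightarrow> prime p \<and> \<not> p dvd q"
  shows "coprime (\<Prod>E) q" "\<Prod>E > 0"
proof -
  show "coprime (\<Prod>E) q" using assms by (intro prod_coprime_left) (auto simp: prime_imp_coprime)
  show "\<Prod>E > 0" using assms by (intro prod_pos) (auto simp: prime_gt_0_nat)
qed

lemma sieve_residue_class:
  assumes w: "w \<ge> 2" "real q \<le> w" and t: "coprime t q" and Y: "Y \<ge> 0"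
  shows "(\<Sum>n\<in>ivl Y. of_bool [n * t = a] (mod q) * rho q w n) \<le> exp (real Mc) * (Y / (phq * ln w) + 5 * w ^ 40)"
proof -
  let ?V = "\<Prod>p | prime p \<and> \<not> p dvd q \<and> real p \<le> w. 1 - 1 / real p"
  have "(\<Sum>n\<in>ivl Y. of_bool [n * t = a] (mod q) * rho q w (n * Suc 0)) \<le> kap q w (Suc 0) * (Y / real q * ?V + 5 * w ^ 40)"
  proof (rule sieve_upper[OF w(1)])
    fix p :: nat assume p: "prime p"
    have "1 / real p \<le> 2 / real p" by (rule divide_right_mono) auto
    then show "0 \<le> 1 / real p \<and> 1 / real p \<le> 3 / 4 \<and> 1 / real p \<le> 2 / real p"
      using prime_inverse_le[OF p] by (intro conjI) linarith+
  next
    fix E :: "nat set" assume E: "finite E" "E \<subseteq> {p. prime p \<and> \<not> p dvd q \<and> real p \<le> w}"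
    have e: "coprime (\<Prod>E) q" "\<Prod>E > 0" using E prod_primes_coprime[of E] by auto
    have "(\<Sum>n | n \<in> ivl Y \<and> \<Prod>E dvd n. of_bool [n * t = a] (mod q) :: real) = (\<Sum>m\<in>ivl (Y / real (\<Prod>E)). of_bool [m * (\<Prod>E * t) = a] (mod q))"
      by (subst sum_ivl_dvd[OF e(2)]) (simp add: mult_ac)
    moreover have "\<bar>(\<Sum>m\<in>ivl (Y / real (\<Prod>E)). of_bool [m * (\<Prod>E * t) = a] (mod q)) - (Y / real (\<Prod>E)) / real q\<bar> \<le> 5"
    proof -
      have "0 \<le> Y / real (\<Prod>E)" using Y by (intro divide_nonneg_nonneg of_nat_0_le_iff)
      then show ?thesis using e t by (intro residue_count_ivl) simp_all
    qed
    moreover have "Y / real q * (\<Prod>p\<in>E. 1 / real p) = (Y / real (\<Prod>E)) / real q" by (simp add: prod_dividef)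
    moreover have "5 * (1::real) \<le> 5 * 3 ^ card E" by (intro mult_left_mono one_le_power) auto
    ultimately show "\<bar>(\<Sum>n | n \<in> ivl Y \<and> \<Prod>E dvd n. of_bool [n * t = a] (mod q)) - Y / real q * (\<Prod>p\<in>E. 1 / real p)\<bar> \<le> 5 * 3 ^ card E"
      by linarith
  qed (use Y in auto)
  also have "... \<le> exp (real Mc) * (Y / real q * (real q / phq / ln w) + 5 * w ^ 40)"
  proof -
    have V0: "?V \<ge> 0"
    proof (rule prod_nonneg)
      fix p assume "p \<in> {p. prime p \<and> \<not> p dvd q \<and> real p \<le> w}"
      then show "0 \<le> 1 - 1 / real p" using prime_inverse_le(1)[of p] by simp
    qed
    have "Y / real q * ?V \<ge> 0" using V0 Y by (intro mult_nonneg_nonneg) auto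
    then show ?thesis
      using w q1 Y by (intro mult_mono add_mono kap_one_le mult_left_mono sieve_density_le) auto
  qed
  also have "Y / real q * (real q / phq / ln w) = Y / (phq * ln w)" using q1 by simp
  finally show ?thesis by simp
qed

definition cBT :: real where "cBT = 9000 * exp (real Mc)"

lemma cBT_pos: "cBT > 0" by (simp add: cBT_def)

lemma power_chain:
  fixes w :: real
  assumes "w \<ge> 1" "sqrt Y \<ge> w ^ 41" "m \<le> 41"
  shows "w ^ m \<le> sqrt Y"
  using power_increasing[OF assms(3,1)] assms(2) by linarith

text \<open>Beyond w the weight \<open>rho\<close> is 1 at primes, so the sieve bound can be used
  with ln Y in front. Y \<le> w^1000 keeps ln Y / ln w bounded; Y \<ge> w^82 gives sqrt Y \<ge>
  w^41, which absorbs the remainder 5 w^40, the proper prime powers and the d \<le> w.\<close>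

lemma brun_titchmarsh:
  assumes w: "w \<ge> 2" "real q \<le> w" and t: "coprime t q" and Y: "w ^ 82 \<le> Y" "Y \<le> w ^ 1000"
  shows "(\<Sum>d\<in>ivl Y. of_bool [d * t = a] (mod q) * mangoldt d) \<le> cBT * (Y / phq)"
proof -
  define \<phi> where "\<phi> = phq"
  have ph: "1 \<le> \<phi>" "\<phi> \<le> w" using totient_pos w by (auto simp: \<phi>_def)
  have "(w ^ 41)\<^sup>2 \<le> Y" using Y(1) by (simp add: power_mult[symmetric])
  then have sY: "sqrt Y \<ge> w ^ 41" using w by (intro real_le_rsqrt)
  have w1: "w \<ge> 1" using w by simp
  have Y1: "Y \<ge> 1" using Y one_le_power[OF w1, of 82] by linarith
  have sYY: "sqrt Y * sqrt Y = Y" using Y1 by simp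
  define e where "e = exp (real Mc)"
  have e1: "e \<ge> 1" by (simp add: e_def)
  have lw: "ln w > 0" "ln w \<le> w" using w ln_le_minus_one[of w] by (auto simp: le_diff_eq)
  have "ln Y \<le> ln (w ^ 1000)" using Y Y1 by (intro ln_mono) auto
  then have lY: "ln Y \<le> 1000 * ln w" using w by (simp add: ln_realpow)
  have lY0: "ln Y \<ge> 0" using Y1 by simp
  let ?f = "\<lambda>d. of_bool [d * t = a] (mod q) :: real"
  let ?B = "{d. primepow d \<and> \<not> prime d \<and> real d \<le> Y} \<union> ivl w"
  have fin: "finite {d. primepow d \<and> \<not> prime d \<and> real d \<le> Y}"
    by (rule finite_subset[OF _ finite_nat_real_le[of Y]]) auto
  have "(\<Sum>d\<in>ivl Y. ?f d * mangoldt d) \<le> (\<Sum>d\<in>ivl Y. ln Y * (?f d * rho q w d) + of_bool (d \<in> ?B) * ln Y)"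
  proof (rule sum_mono)
    fix d assume d: "d \<in> ivl Y"
    have m: "mangoldt d \<le> ln Y"
    proof -
      have "mangoldt d \<le> ln (real d)" using d by (intro mangoldt_le) (auto simp: mem_ivl)
      also have "... \<le> ln Y" using d by (intro ln_mono) (auto simp: mem_ivl)
      finally show ?thesis .
    qed
    have r0: "ln Y * (?f d * rho q w d) \<ge> 0" using lY0 rho_nonneg by simp
    consider "d \<in> ?B" | "\<not> primepow d" "d \<notin> ?B" | "prime d" "real d > w" "d \<notin> ?B"
      using d by (cases "d \<in> ?B"; cases "primepow d") (auto simp: mem_ivl not_le)
    then show "?f d * mangoldt d \<le> ln Y * (?f d * rho q w d) + of_bool (d \<in> ?B) * ln Y"
    proof cases
      case 1
      have "?f d * mangoldt d \<le> 1 * ln Y" using m mangoldt_nonneg[of d] lY0 by (intro mult_mono) auto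
      then show ?thesis using 1 r0 by simp
    next
      case 2
      then show ?thesis using r0 by (simp add: mangoldt_def)
    next
      case 3
      then show ?thesis using rho_large_prime[OF w(1) 3(1,2)] mult_left_mono[OF m, of "?f d"] by (simp add: mult.commute)
    qed
  qed
  also have "... = ln Y * (\<Sum>d\<in>ivl Y. ?f d * rho q w d) + (\<Sum>d\<in>ivl Y. of_bool (d \<in> ?B)) * ln Y"
    by (simp only: sum.distrib sum_distrib_left sum_distrib_right)
  also have "... \<le> ln Y * (e * (Y / (\<phi> * ln w) + 5 * w ^ 40)) + (2 * sqrt Y + w) * ln Y"
  proof (intro add_mono mult_left_mono mult_right_mono lY0)
    show "(\<Sum>d\<in>ivl Y. ?f d * rho q w d) \<le> e * (Y / (\<phi> * ln w) + 5 * w ^ 40)"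
      unfolding e_def \<phi>_def using w t Y1 by (intro sieve_residue_class) auto
    have "(\<Sum>d\<in>ivl Y. of_bool (d \<in> ?B) :: real) = real (card (ivl Y \<inter> ?B))"
      by (simp add: sum.inter_restrict[symmetric] of_bool_def flip: sum.inter_filter) (simp add: Int_def)
    also have "... \<le> real (card ?B)" using fin by (intro of_nat_mono card_mono) auto
    also have "... \<le> real (card {d. primepow d \<and> \<not> prime d \<and> real d \<le> Y}) + real (card (ivl w))"
      by (subst of_nat_add[symmetric], rule of_nat_mono, rule card_Un_le)
    also have "... \<le> 2 * sqrt Y + w" using Y1 w by (intro add_mono card_nonprime_primepow_le card_ivl_le) auto
    finally show "(\<Sum>d\<in>ivl Y. of_bool (d \<in> ?B) :: real) \<le> 2 * sqrt Y + w" .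
  qed
  also have "... = ln Y * (e * (Y / (\<phi> * ln w))) + ln Y * (5 * e * w ^ 40 + 2 * sqrt Y + w)" by (simp add: algebra_simps)
  also have "... \<le> 1000 * e * (Y / \<phi>) + 8000 * e * (Y / \<phi>)"
  proof (rule add_mono)
    have "ln Y * (e * (Y / (\<phi> * ln w))) \<le> (1000 * ln w) * (e * (Y / (\<phi> * ln w)))"
      using lY e1 Y1 ph lw by (intro mult_right_mono) auto
    also have "... = 1000 * e * (Y / \<phi>)" using lw w by simp
    finally show "ln Y * (e * (Y / (\<phi> * ln w))) \<le> 1000 * e * (Y / \<phi>)" .
    have s0: "sqrt Y \<ge> 0" using Y1 by simp
    have "5 * e * w ^ 40 + 2 * sqrt Y + w \<le> 5 * e * sqrt Y + 2 * sqrt Y + sqrt Y"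
      using power_chain[OF w1 sY, of 40] power_chain[OF w1 sY, of 1] e1 by (intro add_mono mult_left_mono) auto
    also have "... \<le> 5 * e * sqrt Y + 3 * (e * sqrt Y)" using e1 s0 mult_right_mono[of 1 e "sqrt Y"] by simp
    also have "... = 8 * e * sqrt Y" by simp
    finally have "ln Y * (5 * e * w ^ 40 + 2 * sqrt Y + w) \<le> (1000 * w) * (8 * e * sqrt Y)"
      using lY lw lY0 w1 e1 s0 by (intro mult_mono) (auto intro!: add_nonneg_nonneg mult_nonneg_nonneg)
    also have "... = 8000 * e * (w * sqrt Y)" by simp
    also have "... \<le> 8000 * e * (Y / \<phi>)"
    proof (intro mult_left_mono)
      have "\<phi> * (w * sqrt Y) \<le> w * (w * sqrt Y)" using ph w1 s0 by (intro mult_right_mono) auto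
      also have "... = w ^ 2 * sqrt Y" by (simp add: power2_eq_square)
      also have "... \<le> sqrt Y * sqrt Y" using power_chain[OF w1 sY, of 2] s0 by (intro mult_right_mono) auto
      finally show "w * sqrt Y \<le> Y / \<phi>" using ph sYY by (simp add: pos_le_divide_eq mult.commute)
    qed (use e1 in auto)
    finally show "ln Y * (5 * e * w ^ 40 + 2 * sqrt Y + w) \<le> 8000 * e * (Y / \<phi>)" .
  qed
  also have "... = cBT * (Y / \<phi>)" by (simp add: cBT_def e_def)
  finally show ?thesis by (simp add: \<phi>_def)
qed

text \<open>The density of \<open>lam\<close> on the multiples of \<open>p\<close>, read off from
  \<open>lam_progression_dvd\<close>; 1 - gl p is the inverse Euler factor of \<open>lam\<close> at
  s = 1.\<close>

definition gl :: "nat \<Rightarrow> real" where "gl p = (lam p - ch p / real p) / real p"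

lemma one_minus_gl: "prime p \<Longrightarrow> 1 - gl p = (1 - 1 / real p) * (1 - ch p / real p)"
  by (simp add: gl_def lam_prime field_simps prime_gt_0_nat)

lemma gl_bounds:
  assumes "prime p" "\<not> p dvd q"
  shows "0 \<le> gl p" "gl p \<le> 3/4" "gl p \<le> 2 / real p"
proof -
  define x where "x = 1 / real p"
  have x: "x > 0" "x \<le> 1/2" unfolding x_def using prime_inverse_le[OF assms(1)] by auto
  have "coprime p q" using assms by (simp add: prime_imp_coprime)
  then have c: "ch p = 1 \<or> ch p = -1" using chi_vals[of p] chi_zero_iff[of p] by auto
  have g: "gl p = (1 + ch p - ch p * x) * x" by (simp add: gl_def lam_prime[OF assms(1)] x_def)
  have xx: "x * x \<ge> 0" "x * x \<le> (1/2) * x" using x by (auto intro!: mult_right_mono)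
  have h: "(1/2 - x) * (3/2 - x) \<ge> 0" using x by (intro mult_nonneg_nonneg) auto
  have "0 \<le> gl p \<and> gl p \<le> 3/4 \<and> gl p \<le> 2 * x"
    using c
  proof
    assume "ch p = 1"
    then have "gl p = 2 * x - x * x" by (simp add: g algebra_simps)
    moreover have "(1/2 - x) * (3/2 - x) = 3/4 - 2 * x + x * x" by (simp add: field_simps)
    ultimately show ?thesis using h xx x by linarith
  next
    assume "ch p = -1"
    then have "gl p = x * x" by (simp add: g)
    then show ?thesis using xx x by linarith
  qed
  then show "0 \<le> gl p" "gl p \<le> 3/4" "gl p \<le> 2 / real p" by (simp_all add: x_def)
qed

lemma multf_lam_over: "multf (\<lambda>n. lam n / real n)"
  using multf_lam by (auto simp: multf_def)

text \<open>By the recurrence of \<open>lam\<close>, multiplying the partial sum by (1 - x)(1 - c x)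
  leaves 1 and two boundary terms whose total is not positive.\<close>

lemma lam_euler_factor:
  assumes "prime p"
  shows "(\<Sum>k\<le>K. lam (p ^ k) / real (p ^ k)) \<le> 1 / ((1 - 1 / real p) * (1 - ch p / real p))"
proof -
  define x where "x = 1 / real p"
  define c where "c = ch p"
  have x: "x > 0" "x \<le> 1/2" unfolding x_def using prime_inverse_le[OF assms] by auto
  have c: "c \<in> {-1,0,1}" unfolding c_def by (rule chi_vals)
  define l where "l = (\<lambda>k. lam (p ^ k))"
  have l0: "l k \<ge> 0" for k by (simp add: l_def)
  have rec: "l (Suc (Suc k)) = (1 + c) * l (Suc k) - c * l k" for k
    using lam_hecke[OF assms, of "p ^ Suc k"] assms by (simp add: l_def c_def lam_prime prime_gt_0_nat)
  have id: "(1 - x) * (1 - c * x) * (\<Sum>k\<le>K. l k * x ^ k) = 1 - l (Suc K) * x ^ Suc K + c * l K * x ^ Suc (Suc K)" for K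
  proof (induction K)
    case 0
    have "l 0 = 1" "l (Suc 0) = 1 + c" by (simp_all add: l_def lam_prime[OF assms] c_def)
    then show ?case by (simp add: algebra_simps)
  next
    case (Suc K)
    have "(1 - x) * (1 - c * x) * (\<Sum>k\<le>Suc K. l k * x ^ k) = (1 - l (Suc K) * x ^ Suc K + c * l K * x ^ Suc (Suc K)) + (1 - x) * (1 - c * x) * (l (Suc K) * x ^ Suc K)"
      using Suc.IH by (simp add: algebra_simps)
    also have "... = 1 - l (Suc (Suc K)) * x ^ Suc (Suc K) + c * l (Suc K) * x ^ Suc (Suc (Suc K))"
      unfolding rec by (simp add: algebra_simps)
    finally show ?case .
  qed
  have "c * l K * x ^ Suc (Suc K) \<le> l (Suc K) * x ^ Suc K"
  proof -
    have "c * l K * x \<le> l (Suc K)"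
    proof (cases "c = 1")
      case True
      then have "l K = real K + 1" "l (Suc K) = real K + 2" using lam_prime_power_cases[OF assms] by (simp_all add: l_def c_def)
      moreover have "(real K + 1) * x \<le> (real K + 1) * 1" using x by (intro mult_left_mono) auto
      moreover have "(real K + 1) * 1 \<le> real K + 2" by simp
      ultimately have "(real K + 1) * x \<le> real K + 2" "l K = real K + 1" "l (Suc K) = real K + 2" by (blast intro: order_trans)+
      then have "l K * x \<le> l (Suc K)" by (simp only:)
      then show ?thesis using True by simp
    next
      case False
      then have "c * (l K * x) \<le> 0" using c l0 x by (intro mult_nonpos_nonneg) auto
      then show ?thesis using l0[of "Suc K"] by (simp add: mult.assoc)
    qed
    then have "(c * l K * x) * x ^ Suc K \<le> l (Suc K) * x ^ Suc K" using x by (intro mult_right_mono) auto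
    then show ?thesis by (simp add: mult_ac)
  qed
  then have "(1 - x) * (1 - c * x) * (\<Sum>k\<le>K. l k * x ^ k) \<le> 1" unfolding id by simp
  moreover have "(1 - x) * (1 - c * x) > 0"
  proof -
    have "c * x \<le> 1/2" using c x by auto
    then show ?thesis using x by (intro mult_pos_pos) auto
  qed
  ultimately have "(\<Sum>k\<le>K. l k * x ^ k) \<le> 1 / ((1 - x) * (1 - c * x))" by (simp add: pos_le_divide_eq mult.commute)
  then show ?thesis by (simp add: l_def x_def c_def power_one_over divide_inverse power_inverse)
qed

lemma lam_density_le:
  assumes w: "real q \<le> w"
  shows "(\<Prod>p | prime p \<and> \<not> p dvd q \<and> real p \<le> w. 1 - gl p) * H w \<le> real q / phq"
  unfolding H_def
proof (rule euler_product_bound[OF w])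
  fix p K :: nat assume p: "prime p"
  show "gl p < 1" if "\<not> p dvd q" using gl_bounds[OF p that] by simp
  show "(\<Sum>k\<le>K. lam (p ^ k) / real (p ^ k)) \<le> 1 / (1 - gl p)"
    using lam_euler_factor[OF p] one_minus_gl[OF p] by simp
  assume "p dvd q"
  then have "\<not> coprime p q" using p by (metis coprime_absorb_left not_prime_unit)
  then have "ch p = 0" using chi_zero_iff by simp
  then show "(\<Sum>k\<le>K. lam (p ^ k) / real (p ^ k)) \<le> 1 / (1 - 1 / real p)"
    using lam_euler_factor[OF p, of K] by simp
qed (use q1 multf_lam_over in auto)

text \<open>(C + 1)^k is the sum of C^(card S) over the subsets \<open>S\<close> of \<open>k\<close>
  primes. For each \<open>S\<close> split n = a b so that \<open>a\<close> carries the primes in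
  \<open>S\<close>: the weight \<open>C\<close> goes to \<open>a\<close> and the weight 1 to
  \<open>b\<close>, and n > X forces one of them beyond sqrt X.\<close>

lemma TC_Suc:
  fixes P :: "nat set" and C Y X :: real
  defines "f \<equiv> \<lambda>n. lam n / real n"
  defines "om' \<equiv> \<lambda>n. card (prime_factors n)"
  defines "T \<equiv> \<lambda>C X. \<Sum>n | n \<in> PS P Y \<and> X < real n. f n * C ^ om' n"
  assumes C: "C \<ge> 0" and X: "X \<ge> 0"
  shows "T (C + 1) X \<le> T C (sqrt X) * T 1 0 + T C 0 * T 1 (sqrt X)"
proof -
  have f0: "f n \<ge> 0" for n by (simp add: f_def)
  have mf: "multf f" unfolding f_def by (rule multf_lam_over)
  let ?N = "{n. n \<in> PS P Y \<and> X < real n}"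
  let ?D = "SIGMA n:?N. Pow (prime_factors n)"
  let ?G = "{(a,b). a \<in> PS P Y \<and> b \<in> PS P Y \<and> (sqrt X < real a \<or> sqrt X < real b)}"
  have "\<forall>x\<in>?D. \<exists>y. fst x = fst y * snd y \<and> y \<in> ?G \<and> coprime (fst y) (snd y) \<and> prime_factors (fst y) = snd x"
  proof
    fix x assume "x \<in> ?D"
    then obtain n S where x: "x = (n,S)" "n \<in> PS P Y" "X < real n" "S \<subseteq> prime_factors n" by auto
    obtain a b where ab: "n = a * b" "a > 0" "b > 0" "coprime a b" "prime_factors a = prime_factors n \<inter> S" "prime_factors b = prime_factors n - S"
      using prime_factors_split[OF PS_pos[OF x(2)], of S] by blast
    have "a \<le> n" "b \<le> n" using ab by auto
    then have "real a \<le> Y" "real b \<le> Y" using x by (auto simp: PS_def mem_ivl)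
    then have P: "a \<in> PS P Y" "b \<in> PS P Y" using ab x by (auto simp: PS_def mem_ivl)
    have "sqrt X < real a \<or> sqrt X < real b"
    proof (rule ccontr)
      assume "\<not> (sqrt X < real a \<or> sqrt X < real b)"
      then have "real a * real b \<le> sqrt X * sqrt X" using X by (intro mult_mono) auto
      then show False using x ab X by simp
    qed
    moreover have "prime_factors a = S" using ab(5) x(4) by auto
    ultimately show "\<exists>y. fst x = fst y * snd y \<and> y \<in> ?G \<and> coprime (fst y) (snd y) \<and> prime_factors (fst y) = snd x"
      using P ab(1,4) x(1) by (intro exI[of _ "(a,b)"]) simp
  qed
  from bchoice[OF this] obtain \<psi> where "\<forall>x\<in>?D. fst x = fst (\<psi> x) * snd (\<psi> x) \<and> \<psi> x \<in> ?G \<and> coprime (fst (\<psi> x)) (snd (\<psi> x)) \<and> prime_factors (fst (\<psi> x)) = snd x"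
    by (rule exE)
  note \<psi> = bspec[OF this]
  have inj: "inj_on \<psi> ?D"
  proof (rule inj_onI)
    fix u v assume uv: "u \<in> ?D" "v \<in> ?D" "\<psi> u = \<psi> v"
    have "fst u = fst v" using conjunct1[OF \<psi>[OF uv(1)]] conjunct1[OF \<psi>[OF uv(2)]] uv(3) by simp
    moreover have "snd u = snd v" using \<psi>[OF uv(1)] \<psi>[OF uv(2)] uv(3) by metis
    ultimately show "u = v" by (rule prod_eqI)
  qed
  have finG: "finite ?G" by (rule finite_subset[of _ "PS P Y \<times> PS P Y"]) auto
  define F where "F = (\<lambda>y. f (fst y) * C ^ om' (fst y) * f (snd y))"
  have F0: "F y \<ge> 0" for y using C f0 by (simp add: F_def)
  have "T (C + 1) X = (\<Sum>n\<in>?N. \<Sum>S\<in>Pow (prime_factors n). f n * C ^ card S)"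
  proof -
    have "(C + 1) ^ om' n = (\<Sum>S\<in>Pow (prime_factors n). C ^ card S)" for n
      using prod_one_plus[of "prime_factors n" "\<lambda>_. C"] by (simp add: om'_def add.commute)
    then show ?thesis by (simp add: T_def sum_distrib_left)
  qed
  also have "... = (\<Sum>x\<in>?D. f (fst x) * C ^ card (snd x))"
    by (subst sum.Sigma) (auto simp: case_prod_beta)
  also have "... = (\<Sum>x\<in>?D. F (\<psi> x))"
  proof (intro sum.cong refl)
    fix x assume x: "x \<in> ?D"
    obtain u v where uv: "\<psi> x = (u, v)" by (cases "\<psi> x")
    have h: "fst x = u * v" "u \<in> PS P Y" "v \<in> PS P Y" "coprime u v" "prime_factors u = snd x" using \<psi>[OF x] uv by auto
    have "f (fst x) = f u * f v" unfolding h(1) by (rule multfD[OF mf PS_pos[OF h(2)] PS_pos[OF h(3)] h(4)])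
    then show "f (fst x) * C ^ card (snd x) = F (\<psi> x)" using h(5) uv by (simp add: F_def om'_def)
  qed
  also have "... = (\<Sum>y\<in>\<psi> ` ?D. F y)" using inj by (simp add: sum.reindex)
  also have "... \<le> (\<Sum>y\<in>?G. F y)"
  proof (rule sum_mono2[OF finG])
    show "\<psi> ` ?D \<subseteq> ?G"
    proof (rule image_subsetI)
      fix x assume "x \<in> ?D"
      from conjunct1[OF conjunct2[OF \<psi>[OF this]]] show "\<psi> x \<in> ?G" .
    qed
  qed (rule F0)
  also have "... \<le> (\<Sum>y\<in>({n. n \<in> PS P Y \<and> sqrt X < real n} \<times> {n. n \<in> PS P Y \<and> 0 < real n}) \<union> ({n. n \<in> PS P Y \<and> 0 < real n} \<times> {n. n \<in> PS P Y \<and> sqrt X < real n}). F y)"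
    by (rule sum_mono2) (auto simp: F0 dest: PS_pos)
  also have "... \<le> (\<Sum>y\<in>{n. n \<in> PS P Y \<and> sqrt X < real n} \<times> {n. n \<in> PS P Y \<and> 0 < real n}. F y) + (\<Sum>y\<in>{n. n \<in> PS P Y \<and> 0 < real n} \<times> {n. n \<in> PS P Y \<and> sqrt X < real n}. F y)"
    by (subst sum.union_inter[symmetric]) (auto intro!: sum_nonneg F0)
  also have "... = T C (sqrt X) * T 1 0 + T C 0 * T 1 (sqrt X)"
    by (simp add: T_def F_def sum_product sum.cartesian_product case_prod_beta)
  finally show ?thesis .
qed

end

text \<open>The setting in which the zero is felt: w is the sieving level, and (1 - b) ln y \<le> 1
  for y = w^1000. The exponent 2^Mc pays for the iteration of \<open>TC_Suc\<close>, each use of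
  which replaces a threshold by its square root.\<close>

locale siegel = rchar +
  fixes b w :: real
  assumes b: "3/4 \<le> b" "b < 1" "Lser b = 0"
    and w_large: "w \<ge> Q0 ^ (2 ^ Mc)"
    and b_small: "(1 - b) * (1000 * ln w) \<le> 1"
begin

lemma w_ge: "w \<ge> Q0" "w \<ge> 1408" "w \<ge> 2" "w \<ge> 1" "real q \<le> w" "2560 * (real q)\<^sup>2 * Q0 \<le> w"
proof -
  have "Q0 ^ 1 \<le> Q0 ^ (2 ^ Mc)" using Q0_ge by (intro power_increasing) auto
  then show 1: "w \<ge> Q0" using w_large by simp
  then show "w \<ge> 1408" "w \<ge> 2" "w \<ge> 1" "real q \<le> w" using Q0_ge by linarith+
  have "4 \<le> Mc" using Mc_ge(2) by simp
  also have "Mc < 2 ^ Mc" by (rule less_exp)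
  finally have "(4::nat) \<le> 2 ^ Mc" by simp
  then have "Q0 ^ 4 \<le> Q0 ^ (2 ^ Mc)" using Q0_ge by (intro power_increasing) auto
  moreover have "2560 * (real q)\<^sup>2 * Q0 \<le> Q0 ^ 4"
  proof -
    have "2560 * (real q)\<^sup>2 \<le> 2 * Q0" using Q0_ge(1) zero_le_power2[of "real q"] by linarith
    also have "... \<le> Q0 * Q0" using Q0_ge by (intro mult_right_mono) auto
    finally have "2560 * (real q)\<^sup>2 * Q0 \<le> Q0 * Q0 * Q0" using Q0_ge by (intro mult_right_mono) auto
    also have "... = Q0 ^ 3" by (simp add: power3_eq_cube)
    also have "... \<le> Q0 ^ 4" using Q0_ge by (intro power_increasing) auto
    finally show ?thesis .
  qed
  ultimately show "2560 * (real q)\<^sup>2 * Q0 \<le> w" using w_large by linarith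
qed

definition y :: real where "y = w ^ 1000"

lemma ln_y: "ln y = 1000 * ln w" using w_ge by (simp add: y_def ln_realpow)

lemma H_w: "H w \<ge> L1 / (2 * (1 - b))"
proof (rule H_lower[OF b w_ge(1)])
  have "0 \<le> (1 - b) * ln w" using b w_ge by (intro mult_nonneg_nonneg) auto
  then show "(1 - b) * ln w \<le> 1" using b_small by simp
qed

lemma H_w_pos: "H w > 0"
proof -
  have "L1 / (2 * (1 - b)) > 0" using L1_pos b by simp
  then show ?thesis using H_w by linarith
qed

text \<open>Only this ratio of the unknown L(1, chi) enters the sieve bounds.\<close>

lemma L1_over_H: "L1 / H w \<le> 2 * (1 - b)"
proof -
  have "L1 \<le> H w * (2 * (1 - b))" using H_w b by (simp add: pos_divide_le_eq)
  then show ?thesis using H_w_pos by (simp add: pos_divide_le_eq mult.commute)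
qed

text \<open>By \<open>zero_gap\<close> the distance 1 - b is at least a negative power of
  \<open>q\<close>, and w exceeds the inverse; so a saved factor w can be traded for 1 - b.\<close>

lemma gap_w: "1 / (1 - b) * real q * 20 \<le> w" 
proof -
  have q: "real q \<ge> 1" using q1 by simp
  have "1 - b \<ge> 1 / (128 * real q * Q0)" using zero_gap[OF b(2,3)] b by simp
  then have "1 / (1 - b) \<le> 1 / (1 / (128 * real q * Q0))" using q Q0_ge b by (intro divide_left_mono mult_pos_pos) auto
  then have "1 / (1 - b) * real q * 20 \<le> (128 * real q * Q0) * real q * 20" using q by (intro mult_right_mono) auto
  also have "... = 2560 * (real q)\<^sup>2 * Q0" by (simp add: power2_eq_square)
  also have "... \<le> w" by (rule w_ge)
  finally show ?thesis .
qed

lemma tiny: "Y \<ge> w ^ 82 \<Longrightarrow> 20 * sqrt Y * w ^ 40 \<le> (1 - b) * (Y / phq)"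
proof -
  assume Y: "Y \<ge> w ^ 82"
  have w1: "w \<ge> 1" by (rule w_ge)
  have "(w ^ 41)\<^sup>2 \<le> Y" using Y by (simp add: power_mult[symmetric])
  then have sY: "sqrt Y \<ge> w ^ 41" by (intro real_le_rsqrt)
  have Y0: "Y \<ge> 0" using Y one_le_power[OF w1, of 82] by linarith
  have ph: "phq > 0" using totient_pos by linarith
  have "20 * phq / (1 - b) \<le> 1 / (1 - b) * real q * 20" using b totient_pos by (simp add: divide_right_mono)
  then have "20 * phq / (1 - b) \<le> w" using gap_w by linarith
  then have k: "20 * phq \<le> w * (1 - b)" using b by (simp add: pos_divide_le_eq)
  have "(20 * phq) * (sqrt Y * w ^ 40) \<le> (w * (1 - b)) * (sqrt Y * w ^ 40)"
    using k Y0 w1 by (intro mult_right_mono) auto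
  also have "... = (1 - b) * (sqrt Y * w ^ 41)" by (simp add: power_Suc[symmetric] mult_ac del: power_Suc)
  also have "... \<le> (1 - b) * (sqrt Y * sqrt Y)" using b sY Y0 by (intro mult_left_mono) auto
  also have "... = (1 - b) * Y" using Y0 by simp
  finally show ?thesis using ph by (simp add: pos_le_divide_eq mult_ac)
qed

text \<open>The mass of \<open>lam\<close> in the class is at most about 2 L1 Y / q, and sifting
  multiplies it by at most q / (phi(q) H w). So L1 / H w \<le> 2 (1 - b) appears where an ordinary
  sieve gives 1 / ln w; \<open>tiny\<close> covers the remainder.\<close>

lemma lam_sieve:
  assumes t: "coprime t q" and a: "coprime a q" and Y: "Y \<ge> w ^ 82"
  shows "(\<Sum>n\<in>ivl Y. of_bool [n * t = a] (mod q) * lam n * rho q w (n * t)) \<le> 9 * ((1 - b) * (Y / phq)) * kap q w t"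
proof -
  have Y0: "Y \<ge> 0" using Y one_le_power[OF w_ge(4), of 82] by linarith
  define X where "X = Y / real q * L1 * (1 + ch a * ch t)"
  have k: "\<bar>ch a * ch t\<bar> \<le> 1" unfolding abs_mult using mult_mono[OF chi_abs_le[of a] chi_abs_le[of t]] by simp
  have X0: "X \<ge> 0" unfolding X_def using k Y0 L1_pos by (intro mult_nonneg_nonneg) auto
  let ?V = "\<Prod>p | prime p \<and> \<not> p dvd q \<and> real p \<le> w. 1 - gl p"
  have S1: "(\<Sum>n\<in>ivl Y. of_bool [n * t = a] (mod q) * lam n * rho q w (n * t)) \<le> kap q w t * (X * ?V + (20 * sqrt Y) * w ^ 40)"
  proof (rule sieve_upper[OF w_ge(3)])
    fix E :: "nat set" assume E: "finite E" "E \<subseteq> {p. prime p \<and> \<not> p dvd q \<and> real p \<le> w}"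
    have e: "coprime (\<Prod>E) q" "\<Prod>E > 0" using E prod_primes_coprime[of E] by auto
    define e' where "e' = \<Prod>E"
    have "(\<Sum>n | n \<in> ivl Y \<and> \<Prod>E dvd n. of_bool [n * t = a] (mod q) * lam n) = (\<Sum>m\<in>ivl (Y / real (\<Prod>E)). of_bool [m * \<Prod>E * t = a] (mod q) * lam (\<Prod>E * m))"
      by (subst sum_ivl_dvd[OF e(2)], intro sum.cong refl) (simp only: mult.commute[of "\<Prod>E"])
    moreover have "\<bar>(\<Sum>m\<in>ivl (Y / real (\<Prod>E)). of_bool [m * \<Prod>E * t = a] (mod q) * lam (\<Prod>E * m))
           - (Y / real (\<Prod>E)) / real q * L1 * (1 + ch a * ch t) * (\<Prod>p\<in>E. lam p - ch p / real p)\<bar> \<le> 20 * 3 ^ card E * sqrt (Y / real (\<Prod>E))"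
    proof -
      have "0 \<le> Y / real (\<Prod>E)" using Y0 by (intro divide_nonneg_nonneg of_nat_0_le_iff)
      then show ?thesis using E a t by (intro lam_progression_dvd) auto
    qed
    moreover have "(Y / real (\<Prod>E)) / real q * L1 * (1 + ch a * ch t) * (\<Prod>p\<in>E. lam p - ch p / real p) = X * (\<Prod>p\<in>E. gl p)"
      by (simp add: gl_def prod_dividef X_def)
    moreover have "20 * 3 ^ card E * sqrt (Y / real (\<Prod>E)) \<le> 20 * 3 ^ card E * sqrt Y"
    proof (intro mult_left_mono real_sqrt_le_mono)
      have "real (\<Prod>E) \<ge> 1" using e(2) by (simp only: real_of_nat_ge_one_iff Suc_leI)
      then show "Y / real (\<Prod>E) \<le> Y" using Y0 divide_left_mono[of 1 "real (\<Prod>E)" Y] by simp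
    qed auto
    ultimately show "\<bar>(\<Sum>n | n \<in> ivl Y \<and> \<Prod>E dvd n. of_bool [n * t = a] (mod q) * lam n) - X * (\<Prod>p\<in>E. gl p)\<bar> \<le> 20 * sqrt Y * 3 ^ card E"
      by (simp only: mult_ac)
  qed (use X0 gl_bounds Y0 in \<open>auto intro!: mult_nonneg_nonneg\<close>)
  have S2: "X * ?V + (20 * sqrt Y) * w ^ 40 \<le> 8 * ((1 - b) * (Y / phq)) + (1 - b) * (Y / phq)"
  proof (rule add_mono[OF _ tiny[OF Y]])
    have V: "?V \<le> real q / phq / H w"
      using lam_density_le[OF w_ge(5)] H_w_pos by (subst pos_le_divide_eq)
    have "X \<le> Y / real q * L1 * 2" unfolding X_def using k Y0 L1_pos by (intro mult_left_mono) auto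
    then have "X * ?V \<le> (Y / real q * L1 * 2) * (real q / phq / H w)"
      using V X0 H_w_pos by (intro mult_mono) (auto intro!: prod_nonneg dest: gl_bounds(2))
    also have "... = 2 * (Y / phq) * (L1 / H w)" using q1 by simp
    also have "... \<le> 2 * (Y / phq) * (2 * (1 - b))" using L1_over_H Y0 by (intro mult_left_mono) auto
    also have "... = 4 * ((1 - b) * (Y / phq))" by (simp only: mult_ac)
    also have "... \<le> 8 * ((1 - b) * (Y / phq))"
      using Y0 b by (intro mult_right_mono mult_nonneg_nonneg divide_nonneg_nonneg) auto
    finally show "X * ?V \<le> 8 * ((1 - b) * (Y / phq))" .
  qed
  have "kap q w t * (8 * Z + Z) = 9 * Z * kap q w t" for Z by (simp add: algebra_simps)
  then show ?thesis using order_trans[OF S1 mult_left_mono[OF S2 kap_nonneg]] by (simp only:)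
qed

section \<open>Scarcity of \<open>lam\<close> on sifted integers\<close>

definition bigP :: "nat set" where "bigP = {p. prime p \<and> real p > w}"
definition RI :: "nat set \<Rightarrow> nat set" where "RI I = (\<Union>i\<in>I. Rg q w i)"
text \<open>The 64 collects 16 from \<open>sum_lam_log_upper\<close>, 2 from ln (y w) \<le> 2 ln y
  and 2 from \<open>L1_over_H\<close>.\<close>

definition dlt :: real where "dlt = 64 * ((1 - b) * ln y)"

lemma dlt_bounds: "dlt \<ge> 0" "dlt \<le> 64"
proof -
  have "ln w \<ge> 0" using w_ge by simp
  then show "dlt \<ge> 0" unfolding dlt_def ln_y using b by (intro mult_nonneg_nonneg) auto
  show "dlt \<le> 64" unfolding dlt_def ln_y using b_small by linarith
qed

lemma y_ge: "w \<le> y" "y \<ge> 1"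
proof -
  show "w \<le> y" unfolding y_def using w_ge by (intro self_le_power) auto
  then show "y \<ge> 1" using w_ge by linarith
qed

text \<open>Since gl p \<le> 3/4, 1 / (1 - gl p) \<le> exp (4 gl p). With gl p \<le> 2 / p and at
  most 20 for the sum of 1 / p over a block, each block costs exp 160.\<close>

lemma RI_sum_le:
  assumes I: "I \<subseteq> {..<Jn w}"
  shows "(\<Sum>n\<in>PS (RI I) Y. lam n / real n) \<le> exp 160 ^ card I"
proof -
  have finI: "finite I" using I finite_subset by blast
  have prm: "prime p \<and> \<not> p dvd q" if "p \<in> Rg q w i" for p i using that by (auto simp: Rg_def)
  have "(\<Sum>n\<in>PS (RI I) Y. lam n / real n) \<le> (\<Prod>p\<in>RI I. 1 / (1 - gl p))"
  proof (rule multf_sum_euler[OF multf_lam_over])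
    show "finite (RI I)" unfolding RI_def using finI by auto
    fix p assume "p \<in> RI I"
    then show pp: "prime p" using prm by (auto simp: RI_def)
    fix K show "(\<Sum>k\<le>K. lam (p ^ k) / real (p ^ k)) \<le> 1 / (1 - gl p)"
      using lam_euler_factor[OF pp] one_minus_gl[OF pp] by simp
  qed simp
  also have "... = (\<Prod>i\<in>I. \<Prod>p\<in>Rg q w i. 1 / (1 - gl p))"
    unfolding RI_def using finI Rg_disj[OF w_ge(3)] by (intro prod.UNION_disjoint) auto
  also have "... \<le> (\<Prod>i\<in>I. exp 160)"
  proof (rule prod_mono)
    fix i assume i: "i \<in> I"
    have g: "0 \<le> gl p \<and> gl p \<le> 3/4 \<and> gl p \<le> 2 / real p" if "p \<in> Rg q w i" for p
      using gl_bounds prm[OF that] by auto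
    have "0 \<le> (\<Prod>p\<in>Rg q w i. 1 / (1 - gl p))" using g by (intro prod_nonneg) fastforce
    moreover have "(\<Prod>p\<in>Rg q w i. 1 / (1 - gl p)) \<le> (\<Prod>p\<in>Rg q w i. exp (4 * gl p))"
    proof (rule prod_mono)
      fix p assume p: "p \<in> Rg q w i"
      have "(1 - gl p) * (1 + 4 * gl p) = 1 + gl p * (3 - 4 * gl p)" by (simp add: algebra_simps)
      moreover have "gl p * (3 - 4 * gl p) \<ge> 0" using g[OF p] by (intro mult_nonneg_nonneg) auto
      ultimately have "1 \<le> (1 - gl p) * (1 + 4 * gl p)" by linarith
      also have "... \<le> (1 - gl p) * exp (4 * gl p)" using g[OF p] by (intro mult_left_mono) auto
      finally have "1 / (1 - gl p) \<le> exp (4 * gl p)" using g[OF p] by (simp add: pos_divide_le_eq mult.commute)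
      moreover have "0 \<le> 1 / (1 - gl p)" using g[OF p] by simp
      ultimately show "0 \<le> 1 / (1 - gl p) \<and> 1 / (1 - gl p) \<le> exp (4 * gl p)" by simp
    qed
    moreover have "(\<Prod>p\<in>Rg q w i. exp (4 * gl p)) = exp (\<Sum>p\<in>Rg q w i. 4 * gl p)" by (simp add: exp_sum)
    moreover have "(\<Sum>p\<in>Rg q w i. 4 * gl p) \<le> (\<Sum>p\<in>Rg q w i. 8 * (1 / real p))"
    proof (rule sum_mono)
      fix p assume "p \<in> Rg q w i"
      then have "4 * gl p \<le> 4 * (2 / real p)" using g by (intro mult_left_mono) auto
      then show "4 * gl p \<le> 8 * (1 / real p)" by simp
    qed
    moreover have "(\<Sum>p\<in>Rg q w i. 8 * (1 / real p)) \<le> 8 * 20"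
      unfolding sum_distrib_left[symmetric] using i I w_ge by (intro mult_left_mono sum_inverse_Rg_le) auto
    ultimately show "0 \<le> (\<Prod>p\<in>Rg q w i. 1 / (1 - gl p)) \<and> (\<Prod>p\<in>Rg q w i. 1 / (1 - gl p)) \<le> exp 160"
      by (smt (verit) exp_le_cancel_iff)
  qed
  also have "... = exp 160 ^ card I" by simp
  finally show ?thesis .
qed

text \<open>
  Multiplying by \<open>H w\<close> gives, up to the Euler factors of the blocks in \<open>I\<close>, part of a sum of \<open>lam n / n\<close> of size
  \<open>O(L1 ln y)\<close>, whereas \<open>H w\<close> is at least \<open>L1 / (2 (1 - b))\<close>: the unknown size of \<open>L1\<close> cancels.
\<close>

lemma rough_log_sum:
  assumes I: "I \<subseteq> {..<Jn w}" and X: "Q0 \<le> X" "X \<le> y"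
  shows "(\<Sum>n | n \<in> PS (RI I \<union> bigP) y \<and> X < real n. lam n / real n) \<le> exp 160 ^ card I * dlt"
proof -
  let ?f = "\<lambda>n. lam n / real n"
  let ?P' = "{p. prime p \<and> p \<notin> RI I \<union> bigP}"
  have "H w = (\<Sum>n\<in>PS (RI I \<union> ?P') w. ?f n)"
  proof -
    have "p \<in> RI I \<union> ?P'" if "n \<in> ivl w" "p \<in> prime_factors n" for n p
    proof -
      have "p \<le> n" using that by (auto simp: mem_ivl intro!: dvd_imp_le)
      then have "real p \<le> w" using that(1) by (auto simp: mem_ivl)
      then show ?thesis using that(2) by (auto simp: bigP_def)
    qed
    then have "ivl w = PS (RI I \<union> ?P') w" by (auto simp: PS_def)
    then show ?thesis by (simp add: H_def)
  qed
  also have "... \<le> (\<Sum>n\<in>PS (RI I) w. ?f n) * (\<Sum>n\<in>PS ?P' w. ?f n)"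
    by (rule multf_sum_split[OF multf_lam_over]) simp
  also have "... \<le> exp 160 ^ card I * (\<Sum>n\<in>PS ?P' w. ?f n)"
    by (intro mult_right_mono RI_sum_le[OF I] sum_nonneg) auto
  finally have Hle: "H w \<le> exp 160 ^ card I * (\<Sum>n\<in>PS ?P' w. ?f n)" .
  let ?T = "\<Sum>n | n \<in> PS (RI I \<union> bigP) y \<and> X < real n. ?f n"
  have T0: "?T \<ge> 0" by (intro sum_nonneg) auto
  have "?T * (\<Sum>n\<in>PS ?P' w. ?f n) \<le> (\<Sum>n | n \<in> ivl (y * w) \<and> X < real n. ?f n)"
  proof (rule multf_sum_merge[OF multf_lam_over, where P = "RI I \<union> bigP"])
    show "n > 0 \<and> prime_factors n \<inter> (RI I \<union> bigP) = {}" if "n \<in> PS ?P' w" for n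
      using that by (auto simp: PS_def mem_ivl)
    fix a c assume ac: "a \<in> {n. n \<in> PS (RI I \<union> bigP) y \<and> X < real n}" "c \<in> PS ?P' w"
    then have h: "1 \<le> real a" "real a \<le> y" "1 \<le> real c" "real c \<le> w" "X < real a" by (auto simp: PS_def mem_ivl)
    have "real a * real c \<le> y * w" using h by (intro mult_mono) auto
    moreover have "real a * 1 \<le> real a * real c" using h by (intro mult_left_mono) auto
    moreover from this have "X < real a * real c" using h by linarith
    ultimately show "a * c \<in> {n. n \<in> ivl (y * w) \<and> X < real n}" using h by (simp add: mem_ivl)
  qed (auto simp: PS_def mem_ivl)
  also have "... \<le> 16 * L1 * ln (y * w)"
  proof (rule sum_lam_log_upper[OF X(1)])
    have "y * 1 \<le> y * w" using y_ge w_ge by (intro mult_left_mono) auto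
    then show "X \<le> y * w" using X by simp
  qed
  also have "... \<le> 16 * L1 * (2 * ln y)"
  proof (intro mult_left_mono)
    have "ln (y * w) = ln y + ln w" using y_ge w_ge by (simp add: ln_mult)
    moreover have "ln w \<le> ln y" using y_ge w_ge by (intro ln_mono) auto
    ultimately show "ln (y * w) \<le> 2 * ln y" by simp
  qed (use L1_pos in auto)
  finally have m: "?T * (\<Sum>n\<in>PS ?P' w. ?f n) \<le> 32 * L1 * ln y" by simp
  have "?T * H w \<le> ?T * (exp 160 ^ card I * (\<Sum>n\<in>PS ?P' w. ?f n))" using Hle T0 by (rule mult_left_mono)
  also have "... = exp 160 ^ card I * (?T * (\<Sum>n\<in>PS ?P' w. ?f n))" by (simp only: mult_ac)
  also have "... \<le> exp 160 ^ card I * (32 * L1 * ln y)" using m by (intro mult_left_mono) auto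
  finally have "?T \<le> exp 160 ^ card I * (32 * L1 * ln y) / H w" using H_w_pos by (subst pos_le_divide_eq)
  also have "... = exp 160 ^ card I * (32 * ln y * (L1 / H w))" by simp
  also have "... \<le> exp 160 ^ card I * (32 * ln y * (2 * (1 - b)))"
    using L1_over_H y_ge by (intro mult_left_mono) auto
  also have "... = exp 160 ^ card I * dlt" by (simp add: dlt_def mult_ac)
  finally show ?thesis .
qed

text \<open>An integer whose prime factors all exceed w is 1 or exceeds w itself, so these integers
  give at most 1 + dlt \<le> 65.\<close>

lemma rough_log_sum_all:
  assumes I: "I \<subseteq> {..<Jn w}"
  shows "(\<Sum>n\<in>PS (RI I \<union> bigP) y. lam n / real n) \<le> 65 * exp 160 ^ card I"
proof -
  let ?f = "\<lambda>n. lam n / real n"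
  have "(\<Sum>n\<in>PS bigP y. ?f n) \<le> (\<Sum>n\<in>{1} \<union> {n. n \<in> PS (RI {} \<union> bigP) y \<and> w < real n}. ?f n)"
  proof (rule sum_mono2)
    show "PS bigP y \<subseteq> {1} \<union> {n. n \<in> PS (RI {} \<union> bigP) y \<and> w < real n}"
    proof
      fix n assume n: "n \<in> PS bigP y"
      show "n \<in> {1} \<union> {n. n \<in> PS (RI {} \<union> bigP) y \<and> w < real n}"
      proof (cases "n = 1")
        case False
        then obtain p where p: "prime p" "p dvd n" using prime_factor_nat by blast
        have n0: "n > 0" using n by (rule PS_pos)
        then have "p \<in> prime_factors n" using p by (auto simp: prime_factors_dvd)
        then have "real p > w" using n by (auto simp: PS_def bigP_def)
        moreover have "p \<le> n" using p n0 by (auto intro: dvd_imp_le)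
        ultimately have "w < real n" by linarith
        then show ?thesis using n by (auto simp: PS_def RI_def)
      qed simp
    qed
  qed auto
  also have "... \<le> 1 + (\<Sum>n | n \<in> PS (RI {} \<union> bigP) y \<and> w < real n. ?f n)"
    using w_ge by (subst sum.union_disjoint) auto
  also have "... \<le> 1 + exp 160 ^ card ({}::nat set) * dlt"
    using w_ge y_ge by (intro add_left_mono rough_log_sum) auto
  also have "... \<le> 65" using dlt_bounds by simp
  finally have big: "(\<Sum>n\<in>PS bigP y. ?f n) \<le> 65" .
  have "(\<Sum>n\<in>PS (RI I \<union> bigP) y. ?f n) \<le> (\<Sum>n\<in>PS (RI I) y. ?f n) * (\<Sum>n\<in>PS bigP y. ?f n)"
    by (rule multf_sum_split[OF multf_lam_over]) simp
  also have "... \<le> exp 160 ^ card I * 65" using big by (intro mult_mono RI_sum_le[OF I] sum_nonneg) auto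
  finally show ?thesis by simp
qed

text \<open>Induction on \<open>C\<close> by \<open>TC_Suc\<close>. With 130 = 2 * 65 the two terms
  of the recursion add up to the next power of \<open>U\<close>; in the second bound each step adds
  one more copy of the scarce sum, whence the factor \<open>C\<close>.\<close>

lemma rough_log_sum_omega:
  assumes I: "I \<subseteq> {..<Jn w}" and C: "C \<ge> 1"
  defines "U \<equiv> 130 * exp 160 ^ card I"
  defines "T \<equiv> \<lambda>C X. \<Sum>n | n \<in> PS (RI I \<union> bigP) y \<and> X < real n. lam n / real n * real C ^ card (prime_factors n)"
  shows "T C 0 \<le> U ^ C" and "\<And>X. Q0 ^ (2 ^ C) \<le> X \<Longrightarrow> X \<le> y \<Longrightarrow> T C X \<le> real C * dlt * U ^ C"
proof -
  have U1: "U \<ge> 1"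
  proof -
    have "exp (160::real) ^ card I \<ge> 1" by (intro one_le_power) simp
    then show ?thesis unfolding U_def by linarith
  qed
  have T0: "T C X \<ge> 0" for C X unfolding T_def by (intro sum_nonneg) auto
  have base0: "T 1 0 \<le> U / 2"
  proof -
    have "{n. n \<in> PS (RI I \<union> bigP) y \<and> 0 < real n} = PS (RI I \<union> bigP) y" by (auto dest: PS_pos)
    then show ?thesis using rough_log_sum_all[OF I] by (simp add: T_def U_def)
  qed
  have base1: "T 1 X \<le> U * dlt" if "Q0 \<le> X" "X \<le> y" for X
  proof -
    have "T 1 X \<le> exp 160 ^ card I * dlt" unfolding T_def using rough_log_sum[OF I that] by simp
    also have "... \<le> U * dlt" unfolding U_def using dlt_bounds by (intro mult_right_mono) auto
    finally show ?thesis .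
  qed
  have step: "T (Suc C) X \<le> T C (sqrt X) * T 1 0 + T C 0 * T 1 (sqrt X)" if "X \<ge> 0" for C X
    using TC_Suc[of "real C" X "RI I \<union> bigP" y] that by (simp add: T_def add.commute)
  have sq: "sqrt X \<le> y" if "X \<le> y" "1 \<le> X" for X
  proof -
    have "sqrt X * 1 \<le> sqrt X * sqrt X" using that by (intro mult_left_mono) auto
    then show ?thesis using that by simp
  qed
  have "T C 0 \<le> U ^ C \<and> (\<forall>X. Q0 ^ (2 ^ C) \<le> X \<longrightarrow> X \<le> y \<longrightarrow> T C X \<le> real C * dlt * U ^ C)"
    using C
  proof (induction C rule: dec_induct)
    case base
    have "Q0 \<le> Q0 ^ (2 ^ 1)" using Q0_ge by (intro self_le_power) auto
    then have "T 1 X \<le> U * dlt" if "Q0 ^ (2 ^ 1) \<le> X" "X \<le> y" for X using that by (intro base1) linarith+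
    then show ?case using base0 U1 by (simp add: mult.commute)
  next
    case (step C)
    note st = \<open>\<And>X C. X \<ge> 0 \<Longrightarrow> T (Suc C) X \<le> T C (sqrt X) * T 1 0 + T C 0 * T 1 (sqrt X)\<close>
    have Z: "T (Suc C) 0 \<le> U ^ Suc C"
    proof -
      have "T (Suc C) 0 \<le> T C 0 * T 1 0 + T C 0 * T 1 0" using st[of 0 C] by simp
      also have "... \<le> U ^ C * (U / 2) + U ^ C * (U / 2)"
        using step.IH U1 T0 by (intro add_mono mult_mono base0) auto
      finally show ?thesis by simp
    qed
    moreover have "T (Suc C) X \<le> real (Suc C) * dlt * U ^ Suc C" if X: "Q0 ^ (2 ^ Suc C) \<le> X" "X \<le> y" for X
    proof -
      have Q1: "Q0 ^ (2 ^ C) \<ge> 1" "Q0 \<le> Q0 ^ (2 ^ C)" using Q0_ge by (auto intro!: one_le_power self_le_power)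
      have "(Q0 ^ (2 ^ C))\<^sup>2 \<le> X" using X(1) by (simp add: power_mult[symmetric] mult.commute)
      then have s: "Q0 ^ (2 ^ C) \<le> sqrt X" by (intro real_le_rsqrt)
      have "1 * 1 \<le> Q0 ^ (2 ^ C) * Q0 ^ (2 ^ C)" using Q1 by (intro mult_mono) auto
      then have X1: "X \<ge> 1" using \<open>(Q0 ^ (2 ^ C))\<^sup>2 \<le> X\<close> by (simp add: power2_eq_square)
      have sy: "sqrt X \<le> y" using sq X(2) X1 by blast
      have "T (Suc C) X \<le> T C (sqrt X) * T 1 0 + T C 0 * T 1 (sqrt X)" using X1 by (intro st) auto
      also have "... \<le> (real C * dlt * U ^ C) * U + U ^ C * (U * dlt)"
        using step.IH s sy Q1 U1 dlt_bounds T0 base0 by (intro add_mono mult_mono base1) auto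
      also have "... = real (Suc C) * dlt * U ^ Suc C" by (simp add: algebra_simps)
      finally show ?thesis .
    qed
    ultimately show ?case by blast
  qed
  then show "T C 0 \<le> U ^ C" and "\<And>X. Q0 ^ (2 ^ C) \<le> X \<Longrightarrow> X \<le> y \<Longrightarrow> T C X \<le> real C * dlt * U ^ C" by blast+
qed

definition cS :: real where "cS = 130 ^ Mc * exp (exp 160 ^ Mc * real Mc)"

text \<open>Expand the product \<open>hh\<close>, with \<open>I\<close> the blocks where the summand
  with \<open>xi\<close> is taken. The other blocks have no prime dividing \<open>n\<close>, so
  \<open>n\<close> is composed of primes from the blocks in \<open>I\<close> and primes above w. The
  bound costs exp (160 Mc) per block of \<open>I\<close>, but \<open>xi\<close> decays
  geometrically, and the sum over all \<open>I\<close> becomes a bounded product.\<close>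

lemma hh_sum_bound:
  assumes B: "\<And>I. I \<subseteq> {..<Jn w} \<Longrightarrow>
     (\<Sum>n | n \<in> PS (RI I \<union> bigP) y \<and> X < real n. lam n / real n * real Mc ^ card (prime_factors n)) \<le> c * (130 * exp 160 ^ card I) ^ Mc"
    and c: "c \<ge> 0"
  shows "(\<Sum>n | n \<in> ivl y \<and> coprime n q \<and> X < real n. lam n / real n * hh q w n) \<le> c * cS"
proof -
  define J where "J = Jn w"
  let ?N = "{n. n \<in> ivl y \<and> coprime n q \<and> X < real n}"
  have M1: "real Mc \<ge> 1" using Mc_ge by simp
  have xi0: "xi i \<ge> 0" for i by (simp add: xi_def)
  have "(\<Sum>n\<in>?N. lam n / real n * hh q w n) \<le> (\<Sum>n\<in>?N. \<Sum>I\<in>Pow {..<J}. (\<Prod>i\<in>I. xi i) * (if n \<in> PS (RI I \<union> bigP) y then lam n / real n * real Mc ^ card (prime_factors n) else 0))"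
  proof (rule sum_mono)
    fix n assume n: "n \<in> ?N"
    have n0: "n > 0" using n by (auto simp: mem_ivl)
    have "hh q w n = (\<Sum>I\<in>Pow {..<J}. (\<Prod>i\<in>I. xi i * real Mc ^ om q w i n) * (\<Prod>i\<in>{..<J} - I. of_bool (om q w i n = 0)))"
      unfolding hh_def J_def by (rule prod_add) simp
    also have "... \<le> (\<Sum>I\<in>Pow {..<J}. (\<Prod>i\<in>I. xi i) * (if n \<in> PS (RI I \<union> bigP) y then real Mc ^ card (prime_factors n) else 0))"
    proof (rule sum_mono)
      fix I assume I: "I \<in> Pow {..<J}"
      then have finI: "finite I" by (auto intro: finite_subset)
      show "(\<Prod>i\<in>I. xi i * real Mc ^ om q w i n) * (\<Prod>i\<in>{..<J} - I. of_bool (om q w i n = 0)) \<le> (\<Prod>i\<in>I. xi i) * (if n \<in> PS (RI I \<union> bigP) y then real Mc ^ card (prime_factors n) else 0)"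
      proof (cases "\<forall>i\<in>{..<J} - I. om q w i n = 0")
        case True
        have "p \<in> RI I \<union> bigP" if p: "p \<in> prime_factors n" for p
        proof (cases "real p \<le> w")
          case le: True
          have "\<not> p dvd q"
          proof
            assume "p dvd q"
            moreover have "p dvd n" "prime p" using p by auto
            moreover have "coprime n q" using n by simp
            ultimately show False using coprime_common_divisor[of n q p] not_prime_unit by blast
          qed
          then obtain i where i: "i < J" "p \<in> Rg q w i" using Rg_cover[OF w_ge(3), of p q] le p J_def by auto
          have "p \<in> Rg q w i \<inter> {x. x dvd n}" using i p by auto
          then have "om q w i n \<noteq> 0" unfolding om_def by (metis card_0_eq empty_iff finite_Int finite_Rg)
          then have "i \<in> I" using True i(1) by (metis DiffI lessThan_iff)
          then show ?thesis using i by (auto simp: RI_def)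
        qed (use p in \<open>auto simp: bigP_def\<close>)
        then have nP: "n \<in> PS (RI I \<union> bigP) y" using n by (auto simp: PS_def)
        have "(\<Sum>i\<in>I. om q w i n) \<le> card (prime_factors n)"
        proof -
          have "(\<Sum>i\<in>I. om q w i n) = card (\<Union>i\<in>I. Rg q w i \<inter> {x. x dvd n})"
            unfolding om_def using finI Rg_disj[OF w_ge(3)] by (intro card_UN_disjoint[symmetric]) blast+
          also have "... \<le> card (prime_factors n)" using n0 by (intro card_mono) (auto simp: Rg_def prime_factors_dvd)
          finally show ?thesis .
        qed
        then have "real Mc ^ (\<Sum>i\<in>I. om q w i n) \<le> real Mc ^ card (prime_factors n)" using M1 by (intro power_increasing)
        then have "(\<Prod>i\<in>I. xi i) * real Mc ^ (\<Sum>i\<in>I. om q w i n) \<le> (\<Prod>i\<in>I. xi i) * real Mc ^ card (prime_factors n)"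
          using xi0 by (intro mult_left_mono prod_nonneg) auto
        then show ?thesis using True nP by (simp add: prod.distrib power_sum)
      next
        case False
        then have z: "(\<Prod>i\<in>{..<J} - I. of_bool (om q w i n = 0) :: real) = 0" by (intro prod_zero) auto
        show ?thesis unfolding z mult_zero_right using xi0 by (auto intro!: mult_nonneg_nonneg prod_nonneg)
      qed
    qed
    finally have "lam n / real n * hh q w n \<le> lam n / real n * (\<Sum>I\<in>Pow {..<J}. (\<Prod>i\<in>I. xi i) * (if n \<in> PS (RI I \<union> bigP) y then real Mc ^ card (prime_factors n) else 0))"
      by (intro mult_left_mono) auto
    also have "... = (\<Sum>I\<in>Pow {..<J}. (\<Prod>i\<in>I. xi i) * (if n \<in> PS (RI I \<union> bigP) y then lam n / real n * real Mc ^ card (prime_factors n) else 0))"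
      unfolding sum_distrib_left by (intro sum.cong refl) auto
    finally show "lam n / real n * hh q w n \<le> ..." .
  qed
  also have "... = (\<Sum>I\<in>Pow {..<J}. (\<Prod>i\<in>I. xi i) * (\<Sum>n\<in>?N. if n \<in> PS (RI I \<union> bigP) y then lam n / real n * real Mc ^ card (prime_factors n) else 0))"
    by (subst sum.swap) (simp add: sum_distrib_left)
  also have "... \<le> (\<Sum>I\<in>Pow {..<J}. (\<Prod>i\<in>I. xi i) * (c * (130 * exp 160 ^ card I) ^ Mc))"
  proof (intro sum_mono mult_left_mono prod_nonneg)
    fix I assume I: "I \<in> Pow {..<J}"
    have "(\<Sum>n\<in>?N. if n \<in> PS (RI I \<union> bigP) y then lam n / real n * real Mc ^ card (prime_factors n) else 0)
      \<le> (\<Sum>n | n \<in> PS (RI I \<union> bigP) y \<and> X < real n. lam n / real n * real Mc ^ card (prime_factors n))"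
      by (subst sum.inter_filter[symmetric], simp, rule sum_mono2) (auto simp: PS_def)
    also have "... \<le> c * (130 * exp 160 ^ card I) ^ Mc" using I by (intro B) (auto simp: J_def)
    finally show "(\<Sum>n\<in>?N. if n \<in> PS (RI I \<union> bigP) y then lam n / real n * real Mc ^ card (prime_factors n) else 0) \<le> c * (130 * exp 160 ^ card I) ^ Mc" .
  qed (auto simp: xi0)
  also have "... = c * 130 ^ Mc * (\<Sum>I\<in>Pow {..<J}. \<Prod>i\<in>I. xi i * exp 160 ^ Mc)"
    unfolding sum_distrib_left
    by (intro sum.cong refl) (simp add: prod.distrib power_mult_distrib power_mult[symmetric] mult_ac)
  also have "(\<Sum>I\<in>Pow {..<J}. \<Prod>i\<in>I. xi i * exp 160 ^ Mc) = (\<Prod>i<J. 1 + xi i * exp 160 ^ Mc)" by (rule prod_one_plus) simp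
  also have "... \<le> exp (\<Sum>i<J. xi i * exp 160 ^ Mc)" using xi0 by (intro prod_one_plus_le_exp) auto
  also have "(\<Sum>i<J. xi i * exp 160 ^ Mc) \<le> exp 160 ^ Mc * real Mc"
  proof -
    have "(\<Sum>i<J. xi i * exp 160 ^ Mc) = exp 160 ^ Mc * real Mc * (\<Sum>i<J. exp (- real (i + 1)))"
      unfolding xi_def sum_distrib_left by (intro sum.cong refl) (simp only: mult_ac)
    also have "... \<le> exp 160 ^ Mc * real Mc * 1" using sum_exp_le by (intro mult_left_mono) auto
    finally show ?thesis by simp
  qed
  finally show ?thesis using c by (simp add: cS_def mult_left_mono mult.assoc)
qed

lemma hh_sum_all: "(\<Sum>n | n \<in> ivl y \<and> coprime n q. lam n / real n * hh q w n) \<le> cS"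
proof -
  have "(\<Sum>n | n \<in> ivl y \<and> coprime n q \<and> 0 < real n. lam n / real n * hh q w n) \<le> 1 * cS"
    using rough_log_sum_omega(1)[of _ Mc] Mc_ge by (intro hh_sum_bound) auto
  moreover have "{n. n \<in> ivl y \<and> coprime n q \<and> 0 < real n} = {n. n \<in> ivl y \<and> coprime n q}" by (auto simp: mem_ivl)
  ultimately show ?thesis by simp
qed

lemma hh_sum_tail: "(\<Sum>n | n \<in> ivl y \<and> coprime n q \<and> w < real n. lam n / real n * hh q w n) \<le> real Mc * dlt * cS"
proof (rule hh_sum_bound)
  fix I assume "I \<subseteq> {..<Jn w}"
  then show "(\<Sum>n | n \<in> PS (RI I \<union> bigP) y \<and> w < real n. lam n / real n * real Mc ^ card (prime_factors n)) \<le> real Mc * dlt * (130 * exp 160 ^ card I) ^ Mc"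
    using rough_log_sum_omega(2)[of I Mc w] Mc_ge w_large y_ge by auto
qed (use dlt_bounds in auto)

end

section \<open>Primes in progressions in the presence of an exceptional zero\<close>

lemma sum_floor_dvd:
  fixes h :: "nat \<Rightarrow> real"
  assumes "f > 0" "0 \<le> S"
  shows "(\<Sum>l | l \<in> fivl S Z \<and> f dvd l. h l) = (\<Sum>l\<in>fivl (S / real f) (Z / real f). h (f * l))"
proof -
  have "{l. l \<in> fivl S Z \<and> f dvd l} = (\<lambda>l. f * l) ` fivl (S / real f) (Z / real f)"
  proof -
    have S': "0 \<le> S / real f" using assms by simp
    have "l \<in> fivl (S / real f) (Z / real f) \<longleftrightarrow> f * l \<in> fivl S Z" for l
      unfolding mem_nat_floor_ivl[OF S'] mem_nat_floor_ivl[OF assms(2)] using assms(1) by (simp add: field_simps)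
    then show ?thesis by (auto elim!: dvdE simp del: greaterThanAtMost_iff)
  qed
  then show ?thesis using assms by (simp add: sum.reindex inj_on_def)
qed

lemma dvd_mult_iff_quotient:
  fixes e u k :: nat
  assumes "e > 0"
  shows "e dvd u * k \<longleftrightarrow> e div gcd e u dvd k"
proof -
  define g where "g = gcd e u"
  have g: "g > 0" using assms by (simp add: g_def)
  obtain e' u' where eu: "e = e' * g" "u = u' * g" "coprime e' u'"
    using gcd_coprime_exists[of e u] g unfolding g_def by auto
  have "e dvd u * k \<longleftrightarrow> e' * g dvd (u' * k) * g" using eu by (simp add: mult_ac)
  also have "... \<longleftrightarrow> e' dvd u' * k" using g by simp
  also have "... \<longleftrightarrow> e' dvd k" using eu(3) by (simp add: coprime_dvd_mult_right_iff)
  also have "e' = e div g" using eu g by simp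
  finally show ?thesis by (simp add: g_def)
qed

context rchar
begin

text \<open>
  \<open>Ka a\<close> is the indicator of the class of \<open>a\<close> minus its projection to the span of the principal character and \<open>ch\<close>.
\<close>

definition Ka :: "nat \<Rightarrow> nat \<Rightarrow> real" where
  "Ka a n = of_bool [n = a] (mod q) - (1 + ch a * ch n) * of_bool (coprime n q) / phq"

lemma coprime_per: "coprime (n + q) q \<longleftrightarrow> coprime n q"
  using chi_zero_iff[of "n + q"] chi_zero_iff[of n] per[of n] by simp

lemma Ka_per: "Ka a (n + q) = Ka a n"
  using per[of n] coprime_per[of n] by (simp add: Ka_def cong_def)

lemma sum_coprime: "(\<Sum>n<q. of_bool (coprime n q) :: real) = phq"
proof -
  have "(\<Sum>n<q. of_bool (coprime n q) :: real) = real (card {n. n < q \<and> coprime n q})"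
    by (simp add: of_bool_def sum.If_cases Int_def)
  also have "{n. n < q \<and> coprime n q} = totatives q"
    using q1 by (auto simp: totatives_def intro!: Nat.gr0I le_neq_trans)
  finally show ?thesis by (simp add: totient_def)
qed

lemma ch_coprime: "ch n * of_bool (coprime n q) = ch n" "ch n * ch n = of_bool (coprime n q)"
  using chi_vals[of n] chi_zero_iff[of n] by auto

lemma Ka_sums:
  assumes a: "coprime a q"
  shows "(\<Sum>n<q. Ka a n) = 0" "(\<Sum>n<q. ch n * Ka a n) = 0" "(\<Sum>n<q. \<bar>Ka a n\<bar>) \<le> 3"
proof -
  define \<phi> where "\<phi> = phq"
  have ph: "\<phi> \<noteq> 0" using totient_pos by (simp add: \<phi>_def)
  have res: "(\<Sum>n<q. of_bool [n = a] (mod q) :: real) = 1" using residue_sum[of 1 a] by simp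
  have "(\<Sum>n<q. Ka a n) = (\<Sum>n<q. of_bool [n = a] (mod q) - (of_bool (coprime n q) / \<phi> + ch a / \<phi> * ch n))"
    unfolding Ka_def \<phi>_def[symmetric] using ch_coprime(1)
    by (intro sum.cong refl) (simp add: add_divide_distrib distrib_right mult.assoc)
  also have "... = 1 - (\<phi> / \<phi> + ch a / \<phi> * 0)"
    unfolding sum_subtractf sum.distrib sum_divide_distrib[symmetric] sum_distrib_left[symmetric] sum_chi res sum_coprime \<phi>_def ..
  finally show "(\<Sum>n<q. Ka a n) = 0" using ph by simp
  have "ch n * of_bool [n = a] (mod q) = ch a * of_bool [n = a] (mod q)" for n using chi_cong[of n a] by auto
  then have "(\<Sum>n<q. ch n * Ka a n) = (\<Sum>n<q. ch a * of_bool [n = a] (mod q) - (ch n / \<phi> + ch a / \<phi> * of_bool (coprime n q)))"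
  proof (intro sum.cong refl)
    fix n
    have "c * ((1 + k * c) * B / \<phi>) = c / \<phi> + k / \<phi> * B" if "c * B = c" "c * c = B" for c k B :: real
    proof -
      have "c * ((1 + k * c) * B / \<phi>) = (c * B + k * c * (c * B)) / \<phi>" by (simp add: algebra_simps)
      also have "... = (c + k * (c * c)) / \<phi>" unfolding that(1) by (simp only: mult.assoc)
      finally show ?thesis unfolding that(2) by (simp add: add_divide_distrib)
    qed
    from this[OF ch_coprime[of n], of "ch a"]
    show "ch n * Ka a n = ch a * of_bool [n = a] (mod q) - (ch n / \<phi> + ch a / \<phi> * of_bool (coprime n q))"
      using \<open>\<And>n. ch n * of_bool [n = a] (mod q) = ch a * of_bool [n = a] (mod q)\<close>
      unfolding Ka_def \<phi>_def[symmetric] right_diff_distrib by (simp only:)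
  qed
  also have "... = ch a * 1 - (0 / \<phi> + ch a / \<phi> * \<phi>)"
    unfolding sum_subtractf sum.distrib sum_divide_distrib[symmetric] sum_distrib_left[symmetric] sum_chi res sum_coprime \<phi>_def ..
  finally show "(\<Sum>n<q. ch n * Ka a n) = 0" using ph by simp
  have "(\<Sum>n<q. \<bar>Ka a n\<bar>) \<le> (\<Sum>n<q. of_bool [n = a] (mod q) + 2 / \<phi> * of_bool (coprime n q))"
  proof (rule sum_mono)
    fix n
    have "\<bar>ch a * ch n\<bar> \<le> 1" unfolding abs_mult using mult_mono[OF chi_abs_le[of a] chi_abs_le[of n]] by simp
    then have "\<bar>1 + ch a * ch n\<bar> / \<phi> \<le> 2 / \<phi>" unfolding \<phi>_def by (intro divide_right_mono) linarith+
    then have "\<bar>(1 + ch a * ch n) * of_bool (coprime n q) / \<phi>\<bar> \<le> 2 / \<phi> * of_bool (coprime n q)"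
      using totient_pos by (cases "coprime n q") (simp_all add: abs_divide \<phi>_def)
    then show "\<bar>Ka a n\<bar> \<le> of_bool [n = a] (mod q) + 2 / \<phi> * of_bool (coprime n q)"
      unfolding Ka_def \<phi>_def[symmetric] by (smt (verit) of_bool_eq_0_iff of_bool_eq_1_iff zero_less_one)
  qed
  also have "... = 1 + 2 / \<phi> * \<phi>" unfolding sum.distrib sum_distrib_left[symmetric] res sum_coprime \<phi>_def ..
  finally show "(\<Sum>n<q. \<bar>Ka a n\<bar>) \<le> 3" using ph by simp
qed

lemma Ka_zero: "coprime a q \<Longrightarrow> \<not> coprime n q \<Longrightarrow> Ka a n = 0"
proof -
  assume a: "coprime a q" and n: "\<not> coprime n q"
  then have "\<not> [n = a] (mod q)" by (metis cong_imp_coprime cong_sym coprime_commute)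
  then show ?thesis using n by (simp add: Ka_def)
qed

text \<open>Orthogonality to 1 and to \<open>ch\<close> survives dilation by a unit, so the sums
  stay below an absolute constant; for other \<open>u\<close> the kernel vanishes along the
  multiples.\<close>

lemma Ka_partial_sums:
  assumes a: "coprime a q"
  shows "\<bar>\<Sum>n\<in>{s<..Z}. Ka a (u * n)\<bar> \<le> 6" "\<bar>\<Sum>n\<in>{s<..Z}. ch n * Ka a (u * n)\<bar> \<le> 6"
proof -
  have "\<bar>\<Sum>n\<in>{s<..Z}. Ka a (u * n)\<bar> \<le> 2 * 3 \<and> \<bar>\<Sum>n\<in>{s<..Z}. ch n * Ka a (u * n)\<bar> \<le> 2 * 3"
  proof (cases "coprime u q")
    case True
    have k: "Ka a (n + m * q) = Ka a n" for n m
      by (induction m) (use Ka_per in \<open>auto simp: add.assoc[symmetric] add.commute[of q] add.left_commute\<close>)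
    have per': "Ka a (u * (n + q)) = Ka a (u * n)" for n using k[of "u * n" u] by (simp add: distrib_left)
    have cu: "ch u * ch u = 1" using True by (simp add: ch_coprime)
    have q0: "q > 0" using q1 by simp
    have s1: "(\<Sum>n<q. Ka a (u * n)) = 0" using sum_mult_residues[of "Ka a" q u, OF Ka_per q0 True] Ka_sums(1)[OF a] by simp
    have s3: "(\<Sum>n<q. \<bar>Ka a (u * n)\<bar>) \<le> 3"
      using sum_mult_residues[of "\<lambda>n. \<bar>Ka a n\<bar>" q u, OF _ q0 True] Ka_per Ka_sums(3)[OF a] by simp
    have "(\<Sum>n<q. ch (u * n) * Ka a (u * n)) = 0"
      using sum_mult_residues[of "\<lambda>n. ch n * Ka a n" q u, OF _ q0 True] Ka_per per Ka_sums(2)[OF a] by simp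
    then have "ch u * (\<Sum>n<q. ch u * (ch n * Ka a (u * n))) = 0" by (simp add: chi_mult mult.assoc)
    then have s2: "(\<Sum>n<q. ch n * Ka a (u * n)) = 0" unfolding sum_distrib_left[symmetric] using cu by (simp add: mult.assoc[symmetric])
    have "(\<Sum>n<q. \<bar>ch n * Ka a (u * n)\<bar>) \<le> (\<Sum>n<q. \<bar>Ka a (u * n)\<bar>)"
      unfolding abs_mult using chi_abs_le by (intro sum_mono) (simp add: mult_left_le_one_le)
    then have s4: "(\<Sum>n<q. \<bar>ch n * Ka a (u * n)\<bar>) \<le> 3" using s3 by linarith
    show ?thesis
      using periodic_sum_bound[of "\<lambda>n. Ka a (u * n)" q 3 s Z, OF per' s1 q0 s3]
        periodic_sum_bound[of "\<lambda>n. ch n * Ka a (u * n)" q 3 s Z, OF _ s2 q0 s4] per' per by simp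
  next
    case False
    then have "Ka a (u * n) = 0" for n using Ka_zero[OF a, of "u * n"] by simp
    then show ?thesis by simp
  qed
  then show "\<bar>\<Sum>n\<in>{s<..Z}. Ka a (u * n)\<bar> \<le> 6" "\<bar>\<Sum>n\<in>{s<..Z}. ch n * Ka a (u * n)\<bar> \<le> 6" by auto
qed

text \<open>Hyperbola method for \<open>lamp\<close>, the convolution of \<open>ch\<close> with ln.
  For fixed \<open>l\<close> the kernel is summed over \<open>k\<close> against the monotone ln k,
  for fixed \<open>k\<close> over \<open>l\<close> against \<open>ch\<close>; both sums fall under
  \<open>Ka_partial_sums\<close>. The condition on \<open>e\<close> becomes divisibility of the
  inner variable by a fixed number.\<close>

lemma lamp_kernel:
  assumes a: "coprime a q" and e: "e > 0" and Y: "Y \<ge> 1"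
  shows "\<bar>\<Sum>m\<in>ivl Y. of_bool (e dvd c * m) * Ka a (c * m) * lamp m\<bar> \<le> 18 * sqrt Y * ln Y"
proof -
  define S where "S = sqrt Y"
  have S: "S \<ge> 1" "S * S = Y" using Y by (auto simp: S_def)
  have lnY: "ln Y \<ge> 0" using Y by simp
  have SY: "S \<le> Y" using S mult_left_mono[of 1 S S] by simp
  define G where "G = (\<lambda>l k. of_bool (e dvd c * (l * k)) * Ka a (c * (l * k)) * (ch l * ln (real k)))"
  have "(\<Sum>m\<in>ivl Y. of_bool (e dvd c * m) * Ka a (c * m) * lamp m) = (\<Sum>m\<in>ivl Y. \<Sum>d | d dvd m. G d (m div d))"
    unfolding lamp_def conv_def sum_distrib_left G_def by (intro sum.cong refl) auto
  also have "... = (\<Sum>l\<in>ivl Y. \<Sum>k\<in>ivl (Y / real l). G l k)" by (rule sum_divisors_ivl)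
  also have "... = (\<Sum>l\<in>ivl S. \<Sum>k\<in>ivl (Y / real l). G l k) + (\<Sum>k\<in>ivl S. \<Sum>l\<in>fivl S (Y / real k). G l k)"
    unfolding S_def using Y by (intro hyperbola) simp
  finally have eq: "(\<Sum>m\<in>ivl Y. of_bool (e dvd c * m) * Ka a (c * m) * lamp m) = ..." .
  have fq: "e div gcd e u > 0" for u using e by (simp add: div_greater_zero_iff dvd_imp_le)
  have A: "\<bar>\<Sum>l\<in>ivl S. \<Sum>k\<in>ivl (Y / real l). G l k\<bar> \<le> (\<Sum>l\<in>ivl S. 12 * ln Y)"
  proof (rule order_trans[OF sum_abs], rule sum_mono)
    fix l assume l: "l \<in> ivl S"
    then have l1: "real l \<ge> 1" by (auto simp: mem_ivl)
    define f where "f = e div gcd e (c * l)"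
    have f0: "f > 0" unfolding f_def by (rule fq)
    have f1: "real f \<ge> 1" using f0 by linarith
    define Z where "Z = Y / real l / real f"
    define N where "N = nat \<lfloor>Z\<rfloor>"
    have "(\<Sum>k\<in>ivl (Y / real l). G l k) = ch l * (\<Sum>k\<in>ivl (Y / real l). if f dvd k then Ka a (c * l * k) * ln (real k) else 0)"
      unfolding sum_distrib_left G_def mult.assoc[symmetric] f_def dvd_mult_iff_quotient[OF e]
      by (intro sum.cong refl) simp
    also have "(\<Sum>k\<in>ivl (Y / real l). if f dvd k then Ka a (c * l * k) * ln (real k) else 0) = (\<Sum>k | k \<in> ivl (Y / real l) \<and> f dvd k. Ka a (c * l * k) * ln (real k))"
      by (subst sum.inter_filter) auto
    also have "... = (\<Sum>k\<in>ivl Z. Ka a (c * l * (f * k)) * ln (real (f * k)))"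
      unfolding Z_def by (rule sum_ivl_dvd[OF f0])
    also have "... = (\<Sum>k\<in>{0<..N}. Ka a ((c * l * f) * k) * ln (real (f * k)))"
      by (rule sum.cong) (auto simp: ivl_def N_def mult_ac)
    finally have e1: "(\<Sum>k\<in>ivl (Y / real l). G l k) = ch l * (\<Sum>k\<in>{0<..N}. Ka a ((c * l * f) * k) * ln (real (f * k)))" .
    have "\<bar>\<Sum>k\<in>{0<..N}. Ka a ((c * l * f) * k) * ln (real (f * k))\<bar> \<le> 12 * ln Y"
    proof (cases "N = 0")
      case False
      have "\<bar>\<Sum>k\<in>{0<..N}. Ka a ((c * l * f) * k) * ln (real (f * k))\<bar> \<le> 2 * 6 * ln (real (f * N))"
        using False f0 by (intro abel_inc Ka_partial_sums(1)[OF a]) (auto intro!: ln_mono)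
      also have "... \<le> 2 * 6 * ln Y"
      proof (intro mult_left_mono ln_mono)
        have "real N \<le> Z" unfolding N_def Z_def using Y l1 by simp
        then have "real f * real N \<le> real f * Z" by (intro mult_left_mono) auto
        also have "... = Y / real l" unfolding Z_def using f0 by simp
        also have "... \<le> Y / 1" using l1 Y by (intro divide_left_mono) auto
        finally show "real (f * N) \<le> Y" by simp
        show "0 < real (f * N)" using f0 False by simp
      qed auto
      finally show ?thesis by simp
    qed (use lnY in simp)
    then have "\<bar>ch l\<bar> * \<bar>\<Sum>k\<in>{0<..N}. Ka a ((c * l * f) * k) * ln (real (f * k))\<bar> \<le> 1 * (12 * ln Y)"
      by (intro mult_mono chi_abs_le) auto
    then show "\<bar>\<Sum>k\<in>ivl (Y / real l). G l k\<bar> \<le> 12 * ln Y" unfolding e1 abs_mult by simp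
  qed
  have B: "\<bar>\<Sum>k\<in>ivl S. \<Sum>l\<in>fivl S (Y / real k). G l k\<bar> \<le> (\<Sum>k\<in>ivl S. 6 * ln Y)"
  proof (rule order_trans[OF sum_abs], rule sum_mono)
    fix k assume k: "k \<in> ivl S"
    then have k1: "real k \<ge> 1" "real k \<le> Y" using SY by (auto simp: mem_ivl)
    define f where "f = e div gcd e (c * k)"
    have f0: "f > 0" unfolding f_def by (rule fq)
    have "(\<Sum>l\<in>fivl S (Y / real k). G l k) = ln (real k) * (\<Sum>l\<in>fivl S (Y / real k). if f dvd l then ch l * Ka a (c * k * l) else 0)"
    proof -
      have "G l k = ln (real k) * (if f dvd l then ch l * Ka a (c * k * l) else 0)" for l
      proof -
        have E: "c * (l * k) = (c * k) * l" by (simp add: mult_ac)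
        show ?thesis unfolding G_def f_def E using dvd_mult_iff_quotient[OF e, of "c * k" l] by simp
      qed
      then show ?thesis by (simp only: sum_distrib_left)
    qed
    also have "(\<Sum>l\<in>fivl S (Y / real k). if f dvd l then ch l * Ka a (c * k * l) else 0) = (\<Sum>l | l \<in> fivl S (Y / real k) \<and> f dvd l. ch l * Ka a (c * k * l))"
      by (subst sum.inter_filter) auto
    also have "... = (\<Sum>l\<in>fivl (S / real f) (Y / real k / real f). ch (f * l) * Ka a (c * k * (f * l)))"
      using S by (intro sum_floor_dvd f0) simp
    also have "... = ch f * (\<Sum>l\<in>fivl (S / real f) (Y / real k / real f). ch l * Ka a ((c * k * f) * l))"
      unfolding sum_distrib_left chi_mult by (intro sum.cong refl) (simp only: mult.assoc)
    finally have e2: "(\<Sum>l\<in>fivl S (Y / real k). G l k) = ln (real k) * (ch f * (\<Sum>l\<in>fivl (S / real f) (Y / real k / real f). ch l * Ka a ((c * k * f) * l)))" .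
    have "\<bar>ln (real k)\<bar> * (\<bar>ch f\<bar> * \<bar>\<Sum>l\<in>fivl (S / real f) (Y / real k / real f). ch l * Ka a ((c * k * f) * l)\<bar>) \<le> ln Y * (1 * 6)"
      using k1 by (intro mult_mono chi_abs_le Ka_partial_sums(2)[OF a]) auto
    then show "\<bar>\<Sum>l\<in>fivl S (Y / real k). G l k\<bar> \<le> 6 * ln Y" unfolding e2 abs_mult by simp
  qed
  have cS: "real (card (ivl S)) \<le> S" using S by (intro card_ivl_le) simp
  have "(\<Sum>l\<in>ivl S. 12 * ln Y) + (\<Sum>k\<in>ivl S. 6 * ln Y) = real (card (ivl S)) * (18 * ln Y)" by simp
  also have "... \<le> S * (18 * ln Y)" using cS lnY by (intro mult_right_mono) auto
  finally show ?thesis unfolding eq S_def[symmetric] using A B by (simp add: mult_ac)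
qed

lemma coprime_residue: "of_bool (coprime n q) \<le> (\<Sum>c\<in>totatives q. of_bool [n = c] (mod q) :: real)"
proof (cases "coprime n q")
  case True
  have m: "n mod q \<in> totatives q"
  proof -
    have "ch (n mod q) = ch n" by (rule chi_cong) (simp add: cong_def)
    then have c: "coprime (n mod q) q" using True chi_zero_iff[of n] chi_zero_iff[of "n mod q"] by simp
    then have "n mod q \<noteq> 0" using q1 by (metis coprime_0_left_iff nat_dvd_1_iff_1 less_irrefl)
    then show ?thesis using c q1 by (auto simp: totatives_def intro: less_imp_le)
  qed
  have "(\<Sum>c\<in>{n mod q}. of_bool [n = c] (mod q) :: real) \<le> (\<Sum>c\<in>totatives q. of_bool [n = c] (mod q))"
    using m by (intro sum_mono2) auto
  then show ?thesis using True by (simp add: cong_def)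
qed (auto intro: sum_nonneg)

text \<open>The tail is accessible to upper bounds only, so the kernel is replaced by nonnegative
  indicators of classes: that of \<open>a\<close>, and phi(q) classes with weight 2 / phi(q)
  each.\<close>

lemma Ka_abs_le: "\<bar>Ka a n\<bar> \<le> of_bool [n = a] (mod q) + 2 / phq * (\<Sum>c\<in>totatives q. of_bool [n = c] (mod q))"
proof -
  have ph: "phq > 0" using totient_pos by linarith
  have "\<bar>Ka a n\<bar> \<le> of_bool [n = a] (mod q) + 2 / phq * of_bool (coprime n q)"
  proof -
    have "\<bar>ch a * ch n\<bar> \<le> 1" unfolding abs_mult using mult_mono[OF chi_abs_le[of a] chi_abs_le[of n]] by simp
    then have "\<bar>1 + ch a * ch n\<bar> / phq \<le> 2 / phq" by (intro divide_right_mono) linarith+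
    then have "\<bar>(1 + ch a * ch n) * of_bool (coprime n q) / phq\<bar> \<le> 2 / phq * of_bool (coprime n q)"
      using ph by (cases "coprime n q") (simp_all add: abs_divide)
    then show ?thesis unfolding Ka_def by (smt (verit) of_bool_eq_0_iff of_bool_eq_1_iff zero_less_one)
  qed
  moreover have "2 / phq * of_bool (coprime n q) \<le> 2 / phq * (\<Sum>c\<in>totatives q. of_bool [n = c] (mod q))"
    using coprime_residue by (intro mult_left_mono) auto
  ultimately show ?thesis by linarith
qed

lemma Ka_abs_le_3: "\<bar>Ka a n\<bar> \<le> 3"
proof -
  have k: "\<bar>ch a * ch n\<bar> \<le> 1" unfolding abs_mult using mult_mono[OF chi_abs_le[of a] chi_abs_le[of n]] by simp
  then have k2: "\<bar>1 + ch a * ch n\<bar> \<le> 2" by linarith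
  have "\<bar>(1 + ch a * ch n) * of_bool (coprime n q)\<bar> \<le> 2 * 1" unfolding abs_mult[of "1 + ch a * ch n"] using k2 by (intro mult_mono) auto
  then have "\<bar>(1 + ch a * ch n) * of_bool (coprime n q)\<bar> / phq \<le> 2 / 1" using totient_pos by (intro frac_le) auto
  then have "\<bar>(1 + ch a * ch n) * of_bool (coprime n q) / phq\<bar> \<le> 2" by (simp add: abs_divide)
  moreover have "\<bar>of_bool [n = a] (mod q) :: real\<bar> \<le> 1" by simp
  ultimately show ?thesis unfolding Ka_def by linarith
qed

end

section \<open>The kernel summed over primes\<close>

context siegel
begin

lemma w_ge_exp: "exp (real Mc) \<le> w"
proof -
  have "exp (real Mc) = exp 1 ^ Mc" by (simp add: exp_of_nat_mult[symmetric])
  also have "... \<le> Q0 ^ Mc" using exp_le Q0_ge by (intro power_mono) auto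
  also have "... \<le> Q0 ^ (2 ^ Mc)" using Q0_ge less_exp[of Mc] by (intro power_increasing) auto
  finally show ?thesis using w_large by linarith
qed

lemma gap_w': "1 \<le> w * ((1 - b) / phq)"
proof -
  have ph: "phq \<ge> 1" "phq \<le> real q" using totient_pos by auto
  have "phq / (1 - b) \<le> 1 / (1 - b) * real q * 20" using b ph by (simp add: divide_right_mono)
  then have "phq / (1 - b) \<le> w" using gap_w by linarith
  then have "phq \<le> w * (1 - b)" using b by (simp add: pos_divide_le_eq)
  then show ?thesis using ph by (simp add: pos_le_divide_eq)
qed

text \<open>A comfortable target: w^900 falls short of y = w^1000 by much more than the factor
  phi(q) / (1 - b), which is at most w.\<close>

lemma small_bound:
  assumes "x \<le> w ^ 900"
  shows "x \<le> (1 - b) * (y / phq)"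
proof -
  have "w ^ 900 \<le> w ^ 999 * 1" using w_ge by (simp add: power_increasing)
  also have "... \<le> w ^ 999 * (w * ((1 - b) / phq))" using gap_w' w_ge by (intro mult_left_mono) auto
  also have "... = (w ^ 999 * w) * ((1 - b) / phq)" by (simp only: mult.assoc)
  also have "w ^ 999 * w = y" unfolding y_def by (simp add: power_Suc2[symmetric] del: power_Suc2 power_Suc)
  finally show ?thesis using assms by (simp add: mult.commute)
qed

lemma sqrt_y: "sqrt y = w ^ 500"
proof -
  have "y = (w ^ 500)\<^sup>2" unfolding y_def by (simp add: power_mult[symmetric])
  then show ?thesis using w_ge by (simp only: real_sqrt_abs) simp
qed

lemma ln_y_le: "ln y \<le> w\<^sup>2" "ln y \<ge> 1"
proof -
  have "ln w \<le> w" using w_ge ln_le_minus_one[of w] by linarith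
  then have "ln y \<le> 1000 * w" unfolding ln_y by simp
  also have "... \<le> w * w" using w_ge by (intro mult_right_mono) auto
  finally show "ln y \<le> w\<^sup>2" by (simp add: power2_eq_square)
  have "ln 2 \<le> ln w" using w_ge by (intro ln_mono) auto
  then show "ln y \<ge> 1" unfolding ln_y using ln2_ge_two_thirds by linarith
qed

text \<open>\<open>lamp_kernel\<close> bounds the sum over the multiples of any \<open>e\<close>
  without a main term, so the sieve expansion is used with X = 0 and g = 0 as a pure error bound.
  What remains is sqrt y = w^500 times small powers of w from the cutoff w^2 and from the sieve
  coefficients.\<close>

lemma first_sum_tiny:
  assumes a: "coprime a q"
  shows "\<bar>\<Sum>n\<in>ivl y. Ka a n * conv (nuB (w\<^sup>2)) lamp n * rho q w n\<bar> \<le> (1 - b) * (y / phq)"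
proof -
  define B where "B = w\<^sup>2"
  define F where "F = (\<lambda>n. Ka a n * conv (nuB B) lamp n)"
  define Er where "Er = B * (B * (18 * sqrt y * ln y))"
  have B1: "B \<ge> 1" unfolding B_def using w_ge by (intro one_le_power) auto
  have l0: "18 * sqrt y * ln y \<ge> 0" using y_ge by auto
  have Bl0: "B * (18 * sqrt y * ln y) \<ge> 0" using B1 by (intro mult_nonneg_nonneg[OF _ l0]) simp
  then have Er0: "Er \<ge> 0" unfolding Er_def using B1 by (intro mult_nonneg_nonneg[OF _ Bl0]) simp
  have dist: "\<bar>\<Sum>n | n \<in> ivl y \<and> e dvd n. F n\<bar> \<le> Er" if e: "e > 0" for e
  proof -
    have "(\<Sum>n | n \<in> ivl y \<and> e dvd n. F n) = (\<Sum>n\<in>ivl y. of_bool (e dvd n) * F n)"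
      by (rule sum.mono_neutral_cong_left) auto
    also have "... = (\<Sum>n\<in>ivl y. \<Sum>d | d dvd n. nuB B d * (of_bool (e dvd d * (n div d)) * Ka a (d * (n div d)) * lamp (n div d)))"
      unfolding F_def conv_def sum_distrib_left by (intro sum.cong refl) auto
    also have "... = (\<Sum>d\<in>ivl y. \<Sum>m\<in>ivl (y / real d). nuB B d * (of_bool (e dvd d * m) * Ka a (d * m) * lamp m))"
      by (rule sum_divisors_ivl)
    also have "... = (\<Sum>d\<in>ivl y. nuB B d * (\<Sum>m\<in>ivl (y / real d). of_bool (e dvd d * m) * Ka a (d * m) * lamp m))"
      by (simp only: sum_distrib_left)
    also have "\<bar>...\<bar> \<le> (\<Sum>d\<in>ivl y. if real d \<le> B then B * (18 * sqrt y * ln y) else 0)"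
    proof (rule order_trans[OF sum_abs], rule sum_mono)
      fix d assume d: "d \<in> ivl y"
      then have d1: "real d \<ge> 1" "real d \<le> y" "d > 0" by (auto simp: mem_ivl)
      show "\<bar>nuB B d * (\<Sum>m\<in>ivl (y / real d). of_bool (e dvd d * m) * Ka a (d * m) * lamp m)\<bar> \<le> (if real d \<le> B then B * (18 * sqrt y * ln y) else 0)"
      proof (cases "real d \<le> B")
        case True
        have "\<bar>nuB B d\<bar> \<le> B" using abs_nu_le[OF d1(3)] lam_le[of d] True by (simp add: nuB_def)
        moreover have "\<bar>\<Sum>m\<in>ivl (y / real d). of_bool (e dvd d * m) * Ka a (d * m) * lamp m\<bar> \<le> 18 * sqrt y * ln y"
        proof -
          have Y: "1 \<le> y / real d" "y / real d \<le> y" using d1 by (auto simp: field_simps)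
          have "\<bar>\<Sum>m\<in>ivl (y / real d). of_bool (e dvd d * m) * Ka a (d * m) * lamp m\<bar> \<le> 18 * sqrt (y / real d) * ln (y / real d)"
            by (rule lamp_kernel[OF a e Y(1)])
          also have "... \<le> 18 * sqrt y * ln y"
          proof (intro mult_mono ln_mono real_sqrt_le_mono)
            show "0 \<le> ln (y / real d)" using Y by (intro ln_ge_zero)
          qed (use Y y_ge in \<open>auto simp del: divide_le_eq\<close>)
          finally show ?thesis .
        qed
        ultimately show ?thesis unfolding abs_mult using True B1 by (simp add: mult_mono)
      qed (simp add: nuB_def)
    qed
    also have "... = (\<Sum>d | d \<in> ivl y \<and> real d \<le> B. B * (18 * sqrt y * ln y))" by (subst sum.inter_filter) auto
    also have "... \<le> (\<Sum>d\<in>ivl B. B * (18 * sqrt y * ln y))"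
      using Bl0 by (intro sum_mono2) (auto simp: mem_ivl)
    also have "... = real (card (ivl B)) * (B * (18 * sqrt y * ln y))" by simp
    also have "... \<le> Er" unfolding Er_def using B1 by (intro mult_right_mono[OF _ Bl0] card_ivl_le) simp
    finally show ?thesis .
  qed
  have "\<bar>(\<Sum>n | n \<in> ivl y \<and> (\<forall>p\<in>({}::nat set). p dvd n). F n * (\<Prod>i<Jn w. \<Sum>E\<in>Pow (Rg q w i \<inter> {p. p dvd n}). aco (rr i) 0 (card E)))
     - 0 * (\<Prod>p\<in>({}::nat set). 0) * (\<Prod>i<Jn w. \<Sum>E\<in>Pow (Rg q w i). aco (rr i) 0 (card E) * (\<Prod>p\<in>E. 0))\<bar>
     \<le> Er * 3 ^ card ({}::nat set) * (\<Prod>i<Jn w. \<Sum>E\<in>Pow (Rg q w i). \<bar>aco (rr i) 0 (card E)\<bar> * 3 ^ card E)"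
  proof (rule sieve_sum[where A = "ivl y" and R = "Rg q w" and J = "Jn w" and F = F and X = 0 and g = "\<lambda>_. 0" and Er = Er and j = "Jn w" and ?E0.0 = "{}" and a = "\<lambda>i. aco (rr i) 0"])
    fix E assume E: "finite E" "E \<subseteq> (\<Union>i<Jn w. Rg q w i)"
    then have pr: "prime p" if "p \<in> E" for p using that by (auto simp: Rg_def)
    have "\<Prod>E > 0" using pr by (intro prod_pos) (auto simp: prime_gt_0_nat)
    then have "\<bar>\<Sum>n | n \<in> ivl y \<and> \<Prod>E dvd n. F n\<bar> \<le> Er" by (rule dist)
    moreover have "(\<forall>p\<in>E. p dvd n) \<longleftrightarrow> \<Prod>E dvd n" for n using E(1) pr by (rule prod_primes_dvd_iff)
    moreover have "Er * 1 \<le> Er * 3 ^ card E" using Er0 by (intro mult_left_mono one_le_power) auto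
    ultimately show "\<bar>(\<Sum>n | n \<in> ivl y \<and> (\<forall>p\<in>E. p dvd n). F n) - 0 * (\<Prod>p\<in>E. 0)\<bar> \<le> Er * 3 ^ card E" by simp
  qed (use Rg_disj[OF w_ge(3)] in auto)
  then have "\<bar>\<Sum>n\<in>ivl y. F n * rho q w n\<bar> \<le> Er * (\<Prod>i<Jn w. \<Sum>E\<in>Pow (Rg q w i). \<bar>aco (rr i) 0 (card E)\<bar> * 3 ^ card E)"
    by (simp add: rho_def brun_def)
  also have "... \<le> Er * (w ^ 40 * w)"
  proof (intro mult_left_mono Er0)
    have om1: "om q w i (Suc 0) = 0" for i by (auto simp: om_def Rg_def)
    have "(\<Prod>i<Jn w. \<Sum>E\<in>Pow (Rg q w i). \<bar>aco (rr i) 0 (card E)\<bar> * 3 ^ card E) \<le> w ^ 40 * kap q w (Suc 0)"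
      using sieve_count_bound[OF w_ge(3), of q "Suc 0"] by (simp add: om1)
    also have "... \<le> w ^ 40 * w" using kap_one_le[of q w] w_ge_exp w_ge by (intro mult_left_mono) auto
    finally show "(\<Prod>i<Jn w. \<Sum>E\<in>Pow (Rg q w i). \<bar>aco (rr i) 0 (card E)\<bar> * 3 ^ card E) \<le> w ^ 40 * w" .
  qed
  also have "... \<le> w ^ 900"
  proof -
    have "Er \<le> w ^ 2 * (w ^ 2 * (w * w ^ 500 * w ^ 2))"
      unfolding Er_def B_def sqrt_y using w_ge ln_y_le by (intro mult_left_mono mult_mono) auto
    also have "... = w ^ 507" by (simp add: power_add[symmetric] power_Suc[symmetric] del: power_Suc)
    finally have "Er * (w ^ 40 * w) \<le> w ^ 507 * (w ^ 40 * w)" using w_ge by (intro mult_right_mono) auto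
    also have "... = w ^ 548" by (simp add: power_add[symmetric] power_Suc2[symmetric] del: power_Suc2 power_Suc)
    also have "... \<le> w ^ 900" using w_ge by (intro power_increasing) auto
    finally show ?thesis .
  qed
  finally show ?thesis unfolding F_def B_def by (rule small_bound)
qed

definition W :: "nat \<Rightarrow> nat \<Rightarrow> nat \<Rightarrow> nat \<Rightarrow> real" where
  "W c d1 d2 d = of_bool [d1 * d2 * d = c] (mod q) * rho q w (d1 * d2 * d) * (lam d1 * lam d2 * mangoldt d)"

lemma W_nonneg: "W c d1 d2 d \<ge> 0"
  unfolding W_def by (intro mult_nonneg_nonneg rho_nonneg mangoldt_nonneg) auto

lemma W_commute: "W c d1 d2 d = W c d2 d1 d"
  by (simp add: W_def mult_ac)

text \<open>When \<open>d\<close> is the product of two of the three variables and d^3 \<le> y^2,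
  the third one ranges up to y / d \<ge> y^(1/3) \<ge> w^82, long enough for the sieve
  bounds.\<close>

lemma cube_bound:
  assumes "d > 0" "real d ^ 3 \<le> y\<^sup>2"
  shows "w ^ 82 \<le> y / real d" "y / real d \<le> y"
proof -
  have d: "real d > 0" "real d \<ge> 1" using assms by auto
  have y0: "y > 0" using y_ge by simp
  have "y * real d ^ 3 \<le> y * y\<^sup>2" using assms y0 by (intro mult_left_mono) auto
  also have "... = y ^ 3" by (simp add: power3_eq_cube power2_eq_square)
  finally have "y \<le> y ^ 3 / real d ^ 3" using d by (simp add: pos_le_divide_eq)
  also have "... = (y / real d) ^ 3" by (simp add: power_divide)
  finally have "y \<le> (y / real d) ^ 3" .
  moreover have "(w ^ 82) ^ 3 \<le> y" unfolding y_def power_mult[symmetric] using w_ge by (intro power_increasing) auto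
  ultimately have "(w ^ 82) ^ 3 \<le> (y / real d) ^ 3" by linarith
  then show "w ^ 82 \<le> y / real d" using y0 d by (rule_tac power_le_imp_le_base[of _ 2]) (auto simp: numeral_3_eq_3)
  show "y / real d \<le> y" using d y0 by (simp add: divide_le_eq mult_le_cancel_left1)
qed

lemma coprime_of_cong: "coprime c q \<Longrightarrow> [m * n = c] (mod q) \<Longrightarrow> coprime m q"
  by (metis cong_imp_coprime cong_sym coprime_mult_left_iff)

text \<open>Here the variable of \<open>mangoldt\<close> is the long one and is summed by
  \<open>brun_titchmarsh\<close>. \<open>kap_le_hh_mult\<close> separates d1 from d2, and d1 > w
  gains the factor \<open>dlt\<close> through \<open>hh_sum_tail\<close>.\<close>

lemma part_large_prime:
  assumes c: "coprime c q"
  shows "(\<Sum>d1 | d1 \<in> ivl y \<and> w < real d1. \<Sum>d2\<in>ivl y. if real (d1 * d2) ^ 3 \<le> y\<^sup>2 then \<Sum>d\<in>ivl (y / real (d1 * d2)). W c d1 d2 d else 0)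
    \<le> (real Mc)\<^sup>2 * cBT * (y / phq) * (real Mc * dlt * cS * cS)"
proof -
  define \<phi> where "\<phi> = phq"
  define K where "K = (real Mc)\<^sup>2 * cBT * (y / \<phi>)"
  have K0: "K \<ge> 0" unfolding K_def \<phi>_def using cBT_pos y_ge by (intro mult_nonneg_nonneg) auto
  define g where "g = (\<lambda>n. of_bool (coprime n q) * (lam n / real n * hh q w n))"
  have g0: "g n \<ge> 0" for n unfolding g_def using hh_nonneg by (intro mult_nonneg_nonneg) auto
  have "(\<Sum>d1 | d1 \<in> ivl y \<and> w < real d1. \<Sum>d2\<in>ivl y. if real (d1 * d2) ^ 3 \<le> y\<^sup>2 then \<Sum>d\<in>ivl (y / real (d1 * d2)). W c d1 d2 d else 0)
     \<le> (\<Sum>d1 | d1 \<in> ivl y \<and> w < real d1. \<Sum>d2\<in>ivl y. K * (g d1 * g d2))"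
  proof (intro sum_mono)
    fix d1 d2 assume "d1 \<in> {d1. d1 \<in> ivl y \<and> w < real d1}" "d2 \<in> ivl y"
    then have pos: "d1 > 0" "d2 > 0" by (auto simp: mem_ivl)
    show "(if real (d1 * d2) ^ 3 \<le> y\<^sup>2 then \<Sum>d\<in>ivl (y / real (d1 * d2)). W c d1 d2 d else 0) \<le> K * (g d1 * g d2)"
    proof (cases "real (d1 * d2) ^ 3 \<le> y\<^sup>2 \<and> coprime (d1 * d2) q")
      case True
      define t where "t = d1 * d2"
      have t: "t > 0" "coprime t q" "real t ^ 3 \<le> y\<^sup>2" using True pos by (auto simp: t_def)
      have Y: "w ^ 82 \<le> y / real t" "y / real t \<le> y" using cube_bound[OF t(1,3)] by auto
      have "(\<Sum>d\<in>ivl (y / real t). W c d1 d2 d) \<le> (\<Sum>d\<in>ivl (y / real t). (real Mc)\<^sup>2 * (hh q w d1 * hh q w d2) * (lam d1 * lam d2) * (of_bool [d * t = c] (mod q) * mangoldt d))"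
      proof (rule sum_mono)
        fix d
        show "W c d1 d2 d \<le> (real Mc)\<^sup>2 * (hh q w d1 * hh q w d2) * (lam d1 * lam d2) * (of_bool [d * t = c] (mod q) * mangoldt d)"
        proof (cases "primepow d")
          case pp: True
          have "rho q w (t * d) \<le> kap q w (t * d)" by (rule rho_le_kap)
          also have "... \<le> (real Mc)\<^sup>2 * kap q w t" by (rule kap_primepow_le[OF w_ge(3) pp])
          also have "... \<le> (real Mc)\<^sup>2 * (hh q w d1 * hh q w d2)" unfolding t_def by (intro mult_left_mono kap_le_hh_mult) auto
          finally have r: "rho q w (t * d) \<le> (real Mc)\<^sup>2 * (hh q w d1 * hh q w d2)" .
          have "rho q w (t * d) * (lam d1 * lam d2 * (of_bool [d * t = c] (mod q) * mangoldt d)) \<le> (real Mc)\<^sup>2 * (hh q w d1 * hh q w d2) * (lam d1 * lam d2 * (of_bool [d * t = c] (mod q) * mangoldt d))"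
            using r by (intro mult_right_mono mult_nonneg_nonneg mangoldt_nonneg) auto
          then show ?thesis unfolding W_def t_def[symmetric] by (simp add: mult_ac)
        qed (simp add: W_def mangoldt_def)
      qed
      also have "... = (real Mc)\<^sup>2 * (hh q w d1 * hh q w d2) * (lam d1 * lam d2) * (\<Sum>d\<in>ivl (y / real t). of_bool [d * t = c] (mod q) * mangoldt d)"
        by (simp only: sum_distrib_left)
      also have "... \<le> (real Mc)\<^sup>2 * (hh q w d1 * hh q w d2) * (lam d1 * lam d2) * (cBT * (y / real t / phq))"
        using Y w_ge t by (intro mult_left_mono brun_titchmarsh) (auto simp: y_def hh_nonneg)
      also have "... = K * (g d1 * g d2)" using True pos by (simp add: K_def g_def \<phi>_def t_def field_simps)
      finally show ?thesis using True by (simp add: t_def)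
    next
      case False
      have "W c d1 d2 d = 0" if "\<not> coprime (d1 * d2) q" for d
      proof -
        have "\<not> [d1 * d2 * d = c] (mod q)" using coprime_of_cong[OF c, of "d1 * d2" d] that by blast
        then show ?thesis by (simp add: W_def)
      qed
      then have "(if real (d1 * d2) ^ 3 \<le> y\<^sup>2 then \<Sum>d\<in>ivl (y / real (d1 * d2)). W c d1 d2 d else 0) = 0" using False by auto
      then show ?thesis using K0 g0 by simp
    qed
  qed
  also have "... = K * ((\<Sum>d1 | d1 \<in> ivl y \<and> w < real d1. g d1) * (\<Sum>d2\<in>ivl y. g d2))"
    unfolding sum_product by (simp only: sum_distrib_left)
  also have "... \<le> K * ((real Mc * dlt * cS) * cS)"
  proof (intro mult_left_mono[OF _ K0] mult_mono)
    have "(\<Sum>d1 | d1 \<in> ivl y \<and> w < real d1. g d1) = (\<Sum>n | n \<in> ivl y \<and> coprime n q \<and> w < real n. lam n / real n * hh q w n)"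
      unfolding g_def by (rule sum.mono_neutral_cong_right) auto
    then show "(\<Sum>d1 | d1 \<in> ivl y \<and> w < real d1. g d1) \<le> real Mc * dlt * cS" using hh_sum_tail by simp
    have "(\<Sum>d2\<in>ivl y. g d2) = (\<Sum>n | n \<in> ivl y \<and> coprime n q. lam n / real n * hh q w n)"
      unfolding g_def by (rule sum.mono_neutral_cong_right) auto
    then show "(\<Sum>d2\<in>ivl y. g d2) \<le> cS" using hh_sum_all by simp
    show "0 \<le> real Mc * dlt * cS" using dlt_bounds by (auto simp: cS_def)
    show "0 \<le> (\<Sum>d2\<in>ivl y. g d2)" by (intro sum_nonneg g0)
  qed
  finally show ?thesis by (simp add: K_def \<phi>_def mult_ac)
qed

text \<open>Here d1 is the long variable, and \<open>lam_sieve\<close> yields the factor 1 - b at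
  once; the sum of mangoldt d / d costs ln y.\<close>

lemma part_large_lam:
  assumes c: "coprime c q"
  shows "(\<Sum>d2\<in>ivl y. \<Sum>d\<in>ivl y. if real (d2 * d) ^ 3 \<le> y\<^sup>2 then \<Sum>d1\<in>ivl (y / real (d2 * d)). W c d1 d2 d else 0)
    \<le> 9 * (real Mc)\<^sup>2 * ((1 - b) * (y / phq)) * (cS * (7 * ln y))"
proof -
  define \<phi> where "\<phi> = phq"
  define K where "K = 9 * (real Mc)\<^sup>2 * ((1 - b) * (y / \<phi>))"
  have K0: "K \<ge> 0" unfolding K_def \<phi>_def using b y_ge by (intro mult_nonneg_nonneg) auto
  define g where "g = (\<lambda>n. of_bool (coprime n q) * (lam n / real n * hh q w n))"
  have g0: "g n \<ge> 0" for n unfolding g_def using hh_nonneg by (intro mult_nonneg_nonneg) auto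
  have "(\<Sum>d2\<in>ivl y. \<Sum>d\<in>ivl y. if real (d2 * d) ^ 3 \<le> y\<^sup>2 then \<Sum>d1\<in>ivl (y / real (d2 * d)). W c d1 d2 d else 0)
     \<le> (\<Sum>d2\<in>ivl y. \<Sum>d\<in>ivl y. K * (g d2 * (mangoldt d / real d)))"
  proof (intro sum_mono)
    fix d2 d assume "d2 \<in> ivl y" "d \<in> ivl y"
    then have pos: "d2 > 0" "d > 0" by (auto simp: mem_ivl)
    show "(if real (d2 * d) ^ 3 \<le> y\<^sup>2 then \<Sum>d1\<in>ivl (y / real (d2 * d)). W c d1 d2 d else 0) \<le> K * (g d2 * (mangoldt d / real d))"
    proof (cases "real (d2 * d) ^ 3 \<le> y\<^sup>2 \<and> coprime (d2 * d) q \<and> primepow d")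
      case True
      define t where "t = d2 * d"
      have t: "t > 0" "coprime t q" "real t ^ 3 \<le> y\<^sup>2" using True pos by (auto simp: t_def)
      have Y: "w ^ 82 \<le> y / real t" "y / real t \<le> y" using cube_bound[OF t(1,3)] by auto
      have l0: "lam d2 * mangoldt d \<ge> 0" by (intro mult_nonneg_nonneg mangoldt_nonneg) simp
      have "(\<Sum>d1\<in>ivl (y / real t). W c d1 d2 d) = (lam d2 * mangoldt d) * (\<Sum>d1\<in>ivl (y / real t). of_bool [d1 * t = c] (mod q) * lam d1 * rho q w (d1 * t))"
        unfolding sum_distrib_left W_def t_def by (intro sum.cong refl) (simp add: mult_ac)
      also have "... \<le> (lam d2 * mangoldt d) * (9 * ((1 - b) * (y / real t / phq)) * kap q w t)"
        using Y t c by (intro mult_left_mono[OF _ l0] lam_sieve) auto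
      also have "... \<le> (lam d2 * mangoldt d) * (9 * ((1 - b) * (y / real t / phq)) * ((real Mc)\<^sup>2 * hh q w d2))"
      proof (intro mult_left_mono[OF _ l0] mult_left_mono)
        have "kap q w t \<le> (real Mc)\<^sup>2 * kap q w d2" unfolding t_def using True by (intro kap_primepow_le w_ge) auto
        also have "... \<le> (real Mc)\<^sup>2 * hh q w d2" by (intro mult_left_mono kap_le_hh) auto
        finally show "kap q w t \<le> (real Mc)\<^sup>2 * hh q w d2" .
        show "0 \<le> 9 * ((1 - b) * (y / real t / phq))" using b y_ge by (intro mult_nonneg_nonneg) auto
      qed
      also have "... = K * (g d2 * (mangoldt d / real d))" using True pos by (simp add: K_def g_def \<phi>_def t_def field_simps)
      finally show ?thesis using True by (simp add: t_def)
    next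
      case False
      have "W c d1 d2 d = 0" if "\<not> coprime (d2 * d) q \<or> \<not> primepow d" for d1
      proof (cases "primepow d")
        case True
        have "\<not> [(d2 * d) * d1 = c] (mod q)" using coprime_of_cong[OF c, of "d2 * d" d1] that True by blast
        then show ?thesis by (simp add: W_def mult_ac)
      qed (simp add: W_def mangoldt_def)
      then have "(if real (d2 * d) ^ 3 \<le> y\<^sup>2 then \<Sum>d1\<in>ivl (y / real (d2 * d)). W c d1 d2 d else 0) = 0" using False by auto
      then show ?thesis using K0 g0 mangoldt_nonneg[of d] by simp
    qed
  qed
  also have "... = K * ((\<Sum>d2\<in>ivl y. g d2) * (\<Sum>d\<in>ivl y. mangoldt d / real d))"
    unfolding sum_product by (simp only: sum_distrib_left)
  also have "... \<le> K * (cS * (7 * ln y))"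
  proof (intro mult_left_mono[OF _ K0] mult_mono)
    have "(\<Sum>d2\<in>ivl y. g d2) = (\<Sum>n | n \<in> ivl y \<and> coprime n q. lam n / real n * hh q w n)"
      unfolding g_def by (rule sum.mono_neutral_cong_right) auto
    then show "(\<Sum>d2\<in>ivl y. g d2) \<le> cS" using hh_sum_all by simp
    have N: "nat \<lfloor>y\<rfloor> \<ge> 1" "real (nat \<lfloor>y\<rfloor>) \<le> y" using y_ge by linarith+
    have "(\<Sum>d\<in>ivl y. mangoldt d / real d) \<le> ln (real (nat \<lfloor>y\<rfloor>)) + 6" unfolding ivl_def using N(1) by (rule mertens_upper)
    also have "... \<le> ln y + 6" using N by simp
    also have "... \<le> 7 * ln y" using ln_y_le by simp
    finally show "(\<Sum>d\<in>ivl y. mangoldt d / real d) \<le> 7 * ln y" .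
    show "0 \<le> cS" by (simp add: cS_def)
    show "0 \<le> (\<Sum>d\<in>ivl y. mangoldt d / real d)" by (intro sum_nonneg divide_nonneg_nonneg mangoldt_nonneg) auto
  qed
  finally show ?thesis by (simp add: K_def \<phi>_def)
qed

text \<open>Built from \<open>Mc\<close> alone, so the constant is the same for all moduli and
  zeros.\<close>

definition C1 :: real where
  "C1 = 2 * ((real Mc)\<^sup>2 * cBT * (real Mc * 64 * cS * cS)) + 2 * (9 * (real Mc)\<^sup>2 * (cS * 7))"

lemma ivl_cut:
  fixes f :: "nat \<Rightarrow> real"
  assumes "u > 0"
  shows "(\<Sum>d\<in>ivl (y / real u). f d) = (\<Sum>d\<in>ivl y. if real (u * d) \<le> y then f d else 0)"
proof (rule sum.mono_neutral_cong_left)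
  have u1: "real u \<ge> 1" using assms by simp
  have "y / real u \<le> y / 1" using u1 y_ge by (intro divide_left_mono) auto
  then show "ivl (y / real u) \<subseteq> ivl y" by (intro ivl_mono) simp
  show "\<forall>i\<in>ivl y - ivl (y / real u). (if real (u * i) \<le> y then f i else 0) = 0"
    using assms by (auto simp: mem_ivl field_simps)
  show "\<And>x. x \<in> ivl (y / real u) \<Longrightarrow> f x = (if real (u * x) \<le> y then f x else 0)"
    using assms by (auto simp: mem_ivl field_simps)
qed auto

text \<open>As d1 d2 = N > w^2, one of d1 and d2 exceeds w. If \<open>d\<close> is the largest of
  the three variables, \<open>part_large_prime\<close> applies with that one; if d1 or d2 is the
  largest, \<open>part_large_lam\<close> applies.\<close>

lemma class_tail:
  assumes c: "coprime c q"
  shows "(\<Sum>n\<in>ivl y. of_bool [n = c] (mod q) * (rho q w n * (\<Sum>N | N dvd n \<and> w\<^sup>2 < real N. conv lam lam N * mangoldt (n div N))))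
     \<le> C1 * ((1 - b) * ln y * (y / phq))"
proof -
  define W' where "W' = (\<lambda>d1 d2 d. if real (d1 * d2 * d) \<le> y then W c d1 d2 d else 0)"
  have W'0: "W' d1 d2 d \<ge> 0" for d1 d2 d by (simp add: W'_def W_nonneg)
  have Wc: "W' d1 d2 d = W' d2 d1 d" for d1 d2 d unfolding W'_def by (simp add: W_commute[of c d1] mult.commute[of d1])
  define sm where "sm = (\<lambda>u v::nat. real (u * v) ^ 3 \<le> y\<^sup>2)"
  define S3 where "S3 = (\<lambda>F::nat \<Rightarrow> nat \<Rightarrow> nat \<Rightarrow> real. \<Sum>d1\<in>ivl y. \<Sum>d2\<in>ivl y. \<Sum>d\<in>ivl y. F d1 d2 d)"
  define A1 where "A1 = (\<lambda>d1 d2 d. if w < real d1 \<and> sm d1 d2 then W' d1 d2 d else 0)"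
  define A3 where "A3 = (\<lambda>d1 d2 d. if sm d2 d then W' d1 d2 d else 0)"
  define G where "G = (\<lambda>d1 d2. if w\<^sup>2 < real (d1 * d2) then \<Sum>d\<in>ivl (y / real (d1 * d2)). W c d1 d2 d else 0)"
  have G0: "G d1 d2 \<ge> 0" for d1 d2 unfolding G_def using W_nonneg by (auto intro!: sum_nonneg)
  have "(\<Sum>n\<in>ivl y. of_bool [n = c] (mod q) * (rho q w n * (\<Sum>N | N dvd n \<and> w\<^sup>2 < real N. conv lam lam N * mangoldt (n div N))))
     = (\<Sum>n\<in>ivl y. \<Sum>N | N dvd n. (if w\<^sup>2 < real N then of_bool [N * (n div N) = c] (mod q) * rho q w (N * (n div N)) * (conv lam lam N * mangoldt (n div N)) else 0))"
  proof (rule sum.cong[OF refl])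
    fix n assume "n \<in> ivl y"
    then have fin: "finite {N. N dvd n}" by (intro finite_divisors_nat) (auto simp: mem_ivl)
    have "(\<Sum>N | N dvd n \<and> w\<^sup>2 < real N. conv lam lam N * mangoldt (n div N)) = (\<Sum>N | N dvd n. if w\<^sup>2 < real N then conv lam lam N * mangoldt (n div N) else 0)"
      using fin by (subst sum.inter_filter[symmetric]) auto
    then show "of_bool [n = c] (mod q) * (rho q w n * (\<Sum>N | N dvd n \<and> w\<^sup>2 < real N. conv lam lam N * mangoldt (n div N)))
      = (\<Sum>N | N dvd n. (if w\<^sup>2 < real N then of_bool [N * (n div N) = c] (mod q) * rho q w (N * (n div N)) * (conv lam lam N * mangoldt (n div N)) else 0))"
      by (simp only: sum_distrib_left) (intro sum.cong refl, auto)
  qed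
  also have "... = (\<Sum>N\<in>ivl y. \<Sum>d\<in>ivl (y / real N). (if w\<^sup>2 < real N then of_bool [N * d = c] (mod q) * rho q w (N * d) * (conv lam lam N * mangoldt d) else 0))"
    by (rule sum_divisors_ivl)
  also have "... = (\<Sum>N\<in>ivl y. \<Sum>d1 | d1 dvd N. G d1 (N div d1))"
  proof (rule sum.cong[OF refl])
    fix N assume "N \<in> ivl y"
    have "(\<Sum>d\<in>ivl (y / real N). (if w\<^sup>2 < real N then of_bool [N * d = c] (mod q) * rho q w (N * d) * (conv lam lam N * mangoldt d) else 0))
       = (\<Sum>d\<in>ivl (y / real N). \<Sum>d1 | d1 dvd N. if w\<^sup>2 < real (d1 * (N div d1)) then W c d1 (N div d1) d else 0)"
    proof (intro sum.cong refl)
      fix d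
      show "(if w\<^sup>2 < real N then of_bool [N * d = c] (mod q) * rho q w (N * d) * (conv lam lam N * mangoldt d) else 0)
        = (\<Sum>d1 | d1 dvd N. if w\<^sup>2 < real (d1 * (N div d1)) then W c d1 (N div d1) d else 0)"
        by (auto simp: conv_def W_def sum_distrib_left sum_distrib_right mult_ac intro!: sum.cong)
    qed
    also have "... = (\<Sum>d1 | d1 dvd N. \<Sum>d\<in>ivl (y / real N). if w\<^sup>2 < real (d1 * (N div d1)) then W c d1 (N div d1) d else 0)"
      by (rule sum.swap)
    also have "... = (\<Sum>d1 | d1 dvd N. G d1 (N div d1))"
    proof (intro sum.cong refl)
      fix d1 assume "d1 \<in> {d1. d1 dvd N}"
      then have "d1 * (N div d1) = N" by auto
      then show "(\<Sum>d\<in>ivl (y / real N). if w\<^sup>2 < real (d1 * (N div d1)) then W c d1 (N div d1) d else 0) = G d1 (N div d1)"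
        unfolding G_def by (simp only:) simp
    qed
    finally show "(\<Sum>d\<in>ivl (y / real N). (if w\<^sup>2 < real N then of_bool [N * d = c] (mod q) * rho q w (N * d) * (conv lam lam N * mangoldt d) else 0))
       = (\<Sum>d1 | d1 dvd N. G d1 (N div d1))" .
  qed
  also have "... = (\<Sum>d1\<in>ivl y. \<Sum>d2\<in>ivl (y / real d1). G d1 d2)" by (rule sum_divisors_ivl)
  also have "... \<le> (\<Sum>d1\<in>ivl y. \<Sum>d2\<in>ivl y. G d1 d2)"
  proof (intro sum_mono sum_mono2 G0 finite_ivl)
    fix d1 assume "d1 \<in> ivl y"
    then have "y / real d1 \<le> y / 1" using y_ge by (intro divide_left_mono) (auto simp: mem_ivl)
    then show "ivl (y / real d1) \<subseteq> ivl y" by (intro ivl_mono) simp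
  qed
  also have "... \<le> S3 (\<lambda>d1 d2 d. A1 d1 d2 d + A1 d2 d1 d + A3 d1 d2 d + A3 d2 d1 d)"
    unfolding S3_def
  proof (intro sum_mono)
    fix d1 d2 assume d: "d1 \<in> ivl y" "d2 \<in> ivl y"
    then have pos: "d1 > 0" "d2 > 0" by (auto simp: mem_ivl)
    have "G d1 d2 = (\<Sum>d\<in>ivl y. if w\<^sup>2 < real (d1 * d2) then W' d1 d2 d else 0)"
      unfolding G_def W'_def using ivl_cut[of "d1 * d2" "W c d1 d2"] pos by simp
    also have "... \<le> (\<Sum>d\<in>ivl y. A1 d1 d2 d + A1 d2 d1 d + A3 d1 d2 d + A3 d2 d1 d)"
    proof (rule sum_mono)
      fix d assume "d \<in> ivl y"
      have "w < real d1 \<or> w < real d2" if "w\<^sup>2 < real (d1 * d2)"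
      proof (rule ccontr)
        assume "\<not> (w < real d1 \<or> w < real d2)"
        then have "real d1 * real d2 \<le> w * w" by (intro mult_mono) auto
        then show False using that by (simp add: power2_eq_square)
      qed
      moreover have "sm d1 d2 \<or> sm d2 d \<or> sm d1 d" if "real (d1 * d2 * d) \<le> y"
      proof -
        \<comment> \<open>For the largest variable \<open>x\<close> one has u v \<le> x^2, hence (u
          v)^3 \<le> (u v x)^2.\<close>
        have cube: "sm u v" if "u \<le> x" "v \<le> x" "real (u * v * x) \<le> y" for u v x :: nat
        proof -
          have "(u * v) ^ 3 = (u * v)\<^sup>2 * (u * v)" by (simp add: power3_eq_cube power2_eq_square)
          also have "... \<le> (u * v)\<^sup>2 * (x * x)" using that by (intro mult_left_mono mult_mono) auto
          also have "... = (u * v * x)\<^sup>2" by (simp add: power2_eq_square mult_ac)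
          finally have "real (u * v) ^ 3 \<le> real (u * v * x) ^ 2" by (metis of_nat_le_iff of_nat_power)
          also have "... \<le> y\<^sup>2" using that by (intro power_mono) auto
          finally show ?thesis by (simp add: sm_def)
        qed
        consider "d1 \<le> d \<and> d2 \<le> d" | "d2 \<le> d1 \<and> d \<le> d1" | "d1 \<le> d2 \<and> d \<le> d2" by linarith
        then show ?thesis
        proof cases
          case 1
          then show ?thesis using cube[of d1 d d2] that by simp
        next
          case 2
          then show ?thesis using cube[of d2 d1 d] that by (simp add: mult_ac)
        next
          case 3
          then show ?thesis using cube[of d1 d2 d] that by (simp add: mult_ac)
        qed
      qed
      moreover have "W' d1 d2 d = 0" if "\<not> real (d1 * d2 * d) \<le> y" using that by (simp add: W'_def)
      moreover have "sm d2 d1 = sm d1 d2" by (simp add: sm_def mult.commute)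
      ultimately show "(if w\<^sup>2 < real (d1 * d2) then W' d1 d2 d else 0) \<le> A1 d1 d2 d + A1 d2 d1 d + A3 d1 d2 d + A3 d2 d1 d"
        using W'0[of d1 d2 d] Wc[of d2 d1 d] unfolding A1_def A3_def by (smt (verit))
    qed
    finally show "G d1 d2 \<le> ..." .
  qed
  also have "... = S3 A1 + S3 (\<lambda>d1 d2. A1 d2 d1) + S3 A3 + S3 (\<lambda>d1 d2. A3 d2 d1)"
    unfolding S3_def by (simp only: sum.distrib)
  finally have le4: "(\<Sum>n\<in>ivl y. of_bool [n = c] (mod q) * (rho q w n * (\<Sum>N | N dvd n \<and> w\<^sup>2 < real N. conv lam lam N * mangoldt (n div N)))) \<le> ..." .
  have swap: "S3 (\<lambda>d1 d2. F d2 d1) = S3 F" for F unfolding S3_def by (rule sum.swap)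
  define P where "P = (real Mc)\<^sup>2 * cBT * (y / phq) * (real Mc * dlt * cS * cS)"
  define Q where "Q = 9 * (real Mc)\<^sup>2 * ((1 - b) * (y / phq)) * (cS * (7 * ln y))"
  have P: "S3 A1 \<le> P"
  proof -
    have "(\<Sum>d2\<in>ivl y. \<Sum>d\<in>ivl y. A1 d1 d2 d) = (if w < real d1 then \<Sum>d2\<in>ivl y. if sm d1 d2 then \<Sum>d\<in>ivl (y / real (d1 * d2)). W c d1 d2 d else 0 else 0)"
      if d1: "d1 \<in> ivl y" for d1
    proof (cases "w < real d1")
      case True
      have "(\<Sum>d\<in>ivl y. A1 d1 d2 d) = (if sm d1 d2 then \<Sum>d\<in>ivl (y / real (d1 * d2)). W c d1 d2 d else 0)" if d2: "d2 \<in> ivl y" for d2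
      proof -
        have pos: "d1 * d2 > 0" using d1 d2 by (auto simp: mem_ivl)
        show ?thesis unfolding A1_def W'_def ivl_cut[OF pos] using True by simp
      qed
      then show ?thesis using True by simp
    qed (simp add: A1_def)
    then have "S3 A1 = (\<Sum>d1\<in>ivl y. if w < real d1 then \<Sum>d2\<in>ivl y. if sm d1 d2 then \<Sum>d\<in>ivl (y / real (d1 * d2)). W c d1 d2 d else 0 else 0)"
      unfolding S3_def by (rule sum.cong[OF refl])
    also have "... = (\<Sum>d1 | d1 \<in> ivl y \<and> w < real d1. \<Sum>d2\<in>ivl y. if sm d1 d2 then \<Sum>d\<in>ivl (y / real (d1 * d2)). W c d1 d2 d else 0)"
      by (rule sum.inter_filter[symmetric]) simp
    also have "... \<le> P" unfolding P_def sm_def by (rule part_large_prime[OF c])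
    finally show ?thesis .
  qed
  have Q: "S3 A3 \<le> Q"
  proof -
    have "S3 A3 = (\<Sum>d2\<in>ivl y. \<Sum>d\<in>ivl y. \<Sum>d1\<in>ivl y. A3 d1 d2 d)"
      unfolding S3_def by (subst sum.swap, rule sum.cong[OF refl], rule sum.swap)
    also have "... = (\<Sum>d2\<in>ivl y. \<Sum>d\<in>ivl y. if sm d2 d then \<Sum>d1\<in>ivl (y / real (d2 * d)). W c d1 d2 d else 0)"
    proof (rule sum.cong[OF refl], rule sum.cong[OF refl])
      fix d2 d assume d: "d2 \<in> ivl y" "d \<in> ivl y"
      have pos: "d2 * d > 0" using d by (auto simp: mem_ivl)
      have "d1 * d2 * d = d2 * d * d1" for d1 by (simp add: mult_ac)
      then show "(\<Sum>d1\<in>ivl y. A3 d1 d2 d) = (if sm d2 d then \<Sum>d1\<in>ivl (y / real (d2 * d)). W c d1 d2 d else 0)"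
        unfolding A3_def W'_def ivl_cut[OF pos] by (simp add: mult_ac)
    qed
    also have "... \<le> Q" unfolding Q_def sm_def by (rule part_large_lam[OF c])
    finally show ?thesis .
  qed
  have "P + P + Q + Q = C1 * ((1 - b) * ln y * (y / phq))"
  proof -
    have "m\<^sup>2 * k * v * (m * (64 * (r * l)) * s * s) + m\<^sup>2 * k * v * (m * (64 * (r * l)) * s * s) + 9 * m\<^sup>2 * (r * v) * (s * (7 * l)) + 9 * m\<^sup>2 * (r * v) * (s * (7 * l))
      = (2 * (m\<^sup>2 * k * (m * 64 * s * s)) + 2 * (9 * m\<^sup>2 * (s * 7))) * (r * l * v)" for m k v r l s :: real
      by (simp add: algebra_simps)
    then show ?thesis unfolding P_def Q_def C1_def dlt_def by (simp only: mult.assoc)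
  qed
  then show ?thesis using le4 P Q swap[of A1] swap[of A3] by linarith
qed

text \<open>The 3 is 1 + 2: the class of \<open>a\<close>, and all phi(q) reduced classes with
  weight 2 / phi(q). The remaining 1 comes from \<open>first_sum_tiny\<close>.\<close>

lemma theta_sieved:
  assumes a: "coprime a q"
  shows "\<bar>\<Sum>n\<in>ivl y. Ka a n * (mangoldt n * rho q w n)\<bar> \<le> (3 * C1 + 1) * ((1 - b) * ln y * (y / phq))"
proof -
  define R where "R = (1 - b) * ln y * (y / phq)"
  define T where "T = (\<lambda>n. \<Sum>N | N dvd n \<and> w\<^sup>2 < real N. conv lam lam N * mangoldt (n div N) :: real)"
  define T' where "T' = (\<lambda>n. \<Sum>N | N dvd n \<and> w\<^sup>2 < real N. cB (w\<^sup>2) N * mangoldt (n div N) :: real)"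
  have TT: "\<bar>T' n\<bar> \<le> T n" if "n > 0" for n
    unfolding T_def T'_def
  proof (rule order_trans[OF sum_abs], rule sum_mono)
    fix N assume "N \<in> {N. N dvd n \<and> w\<^sup>2 < real N}"
    then have "N > 0" using that by (auto intro: dvd_pos_nat)
    then show "\<bar>cB (w\<^sup>2) N * mangoldt (n div N)\<bar> \<le> conv lam lam N * mangoldt (n div N)"
      unfolding abs_mult using abs_cB_le mangoldt_nonneg[of "n div N"] by (simp add: mult_right_mono)
  qed
  have B1: "w\<^sup>2 \<ge> 1" using w_ge by (intro one_le_power) auto
  have ident: "mangoldt n = conv (nuB (w\<^sup>2)) lamp n - T' n" if "n \<in> ivl y" for n
    unfolding T'_def using that B1 by (intro truncated_identity) (auto simp: mem_ivl)
  have "(\<Sum>n\<in>ivl y. Ka a n * (mangoldt n * rho q w n)) = (\<Sum>n\<in>ivl y. Ka a n * conv (nuB (w\<^sup>2)) lamp n * rho q w n - Ka a n * T' n * rho q w n)"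
    by (intro sum.cong refl) (simp add: ident algebra_simps)
  then have eq: "(\<Sum>n\<in>ivl y. Ka a n * (mangoldt n * rho q w n)) = (\<Sum>n\<in>ivl y. Ka a n * conv (nuB (w\<^sup>2)) lamp n * rho q w n) - (\<Sum>n\<in>ivl y. Ka a n * T' n * rho q w n)"
    by (simp only: sum_subtractf)
  have ct: "(\<Sum>n\<in>ivl y. of_bool [n = c] (mod q) * (rho q w n * T n)) \<le> C1 * R" if "coprime c q" for c
    unfolding T_def R_def by (rule class_tail[OF that])
  have "\<bar>\<Sum>n\<in>ivl y. Ka a n * T' n * rho q w n\<bar> \<le> (\<Sum>n\<in>ivl y. (of_bool [n = a] (mod q) + 2 / phq * (\<Sum>c\<in>totatives q. of_bool [n = c] (mod q))) * (rho q w n * T n))"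
  proof (rule order_trans[OF sum_abs], rule sum_mono)
    fix n assume "n \<in> ivl y"
    then have "\<bar>T' n\<bar> \<le> T n" by (intro TT) (auto simp: mem_ivl)
    then have "\<bar>rho q w n\<bar> * \<bar>T' n\<bar> \<le> rho q w n * T n" using rho_nonneg[of q w n] by (intro mult_mono) auto
    then have "\<bar>Ka a n\<bar> * (\<bar>rho q w n\<bar> * \<bar>T' n\<bar>) \<le> (of_bool [n = a] (mod q) + 2 / phq * (\<Sum>c\<in>totatives q. of_bool [n = c] (mod q))) * (rho q w n * T n)"
      by (rule mult_mono[OF Ka_abs_le]) (auto intro!: add_nonneg_nonneg mult_nonneg_nonneg sum_nonneg)
    then show "\<bar>Ka a n * T' n * rho q w n\<bar> \<le> (of_bool [n = a] (mod q) + 2 / phq * (\<Sum>c\<in>totatives q. of_bool [n = c] (mod q))) * (rho q w n * T n)"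
      by (simp only: abs_mult mult_ac)
  qed
  also have "... = (\<Sum>n\<in>ivl y. of_bool [n = a] (mod q) * (rho q w n * T n)) + (\<Sum>n\<in>ivl y. \<Sum>c\<in>totatives q. 2 / phq * (of_bool [n = c] (mod q) * (rho q w n * T n)))"
    unfolding distrib_right sum.distrib sum_distrib_left sum_distrib_right by (simp only: mult.assoc)
  also have "(\<Sum>n\<in>ivl y. \<Sum>c\<in>totatives q. 2 / phq * (of_bool [n = c] (mod q) * (rho q w n * T n)))
     = (\<Sum>c\<in>totatives q. 2 / phq * (\<Sum>n\<in>ivl y. of_bool [n = c] (mod q) * (rho q w n * T n)))"
    by (subst sum.swap) (simp only: sum_distrib_left)
  also have "(\<Sum>n\<in>ivl y. of_bool [n = a] (mod q) * (rho q w n * T n)) + ... \<le> C1 * R + (\<Sum>c\<in>totatives q. 2 / phq * (C1 * R))"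
    using a by (intro add_mono sum_mono mult_left_mono ct) (auto simp: totatives_def)
  also have "... = 3 * (C1 * R)" using totient_pos by (simp add: totient_def)
  finally have sec: "\<bar>\<Sum>n\<in>ivl y. Ka a n * T' n * rho q w n\<bar> \<le> 3 * (C1 * R)" .
  have "(1 - b) * (y / phq) * 1 \<le> (1 - b) * (y / phq) * ln y"
    using b y_ge ln_y_le by (intro mult_left_mono) auto
  then have "(1 - b) * (y / phq) \<le> R" by (simp add: R_def mult_ac)
  then have "\<bar>\<Sum>n\<in>ivl y. Ka a n * (mangoldt n * rho q w n)\<bar> \<le> R + 3 * (C1 * R)"
    unfolding eq using first_sum_tiny[OF a] sec by linarith
  then show ?thesis unfolding R_def[symmetric] by (simp add: algebra_simps)
qed

lemma rho_primepow_le: "primepow n \<Longrightarrow> rho q w n \<le> w ^ 3"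
proof -
  assume n: "primepow n"
  have "rho q w n \<le> kap q w (1 * n)" using rho_le_kap by simp
  also have "... \<le> (real Mc)\<^sup>2 * kap q w 1" by (intro kap_primepow_le w_ge n)
  also have "... \<le> w\<^sup>2 * w"
  proof (intro mult_mono power_mono)
    show "real Mc \<le> w" using w_ge_exp exp_ge_add_one_self[of "real Mc"] by linarith
    show "kap q w 1 \<le> w" using kap_one_le[of q w] w_ge_exp by simp
  qed (use kap_nonneg in auto)
  finally show ?thesis by (simp add: power3_eq_cube power2_eq_square)
qed

text \<open>\<open>rho\<close> is 1 at primes above w, so dropping it affects only proper prime
  powers and n \<le> w: at most w^502 terms of size at most w^6.\<close>

lemma theta_primes:
  assumes a: "coprime a q"
  shows "\<bar>\<Sum>p\<in>primes_le y. Ka a p * ln (real p)\<bar> \<le> (3 * C1 + 2) * ((1 - b) * ln y * (y / phq))"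
proof -
  define D where "D = (\<lambda>n. Ka a n * (mangoldt n * rho q w n) - of_bool (prime n) * (Ka a n * ln (real n)))"
  define B where "B = {d. primepow d \<and> \<not> prime d \<and> real d \<le> y} \<union> ivl w"
  have fB: "finite B" unfolding B_def by (auto intro: finite_subset[OF _ finite_nat_real_le[of y]])
  have "(\<Sum>p\<in>primes_le y. Ka a p * ln (real p)) = (\<Sum>n\<in>ivl y. of_bool (prime n) * (Ka a n * ln (real n)))"
    by (rule sum.mono_neutral_cong_left) (auto simp: mem_ivl prime_gt_0_nat Suc_le_eq)
  then have eq: "(\<Sum>n\<in>ivl y. Ka a n * (mangoldt n * rho q w n)) - (\<Sum>p\<in>primes_le y. Ka a p * ln (real p)) = (\<Sum>n\<in>ivl y. D n)"
    by (simp add: D_def sum_subtractf)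
  have D0: "D n = 0" if "n \<in> ivl y" "n \<notin> B" for n
  proof (cases "prime n")
    case True
    then have "w < real n" using that by (auto simp: B_def mem_ivl prime_gt_0_nat)
    then show ?thesis using True rho_large_prime[OF w_ge(3) True, of q] by (simp add: D_def mangoldt_prime)
  next
    case False
    then have "\<not> primepow n" using that by (auto simp: B_def mem_ivl)
    then show ?thesis using False by (simp add: D_def mangoldt_def)
  qed
  have D1: "\<bar>D n\<bar> \<le> w ^ 6" if n: "n \<in> ivl y" for n
  proof (cases "primepow n")
    case True
    have l: "mangoldt n \<le> ln y" "ln (real n) \<le> ln y" "0 \<le> ln (real n)" using mangoldt_le[of n] n by (auto simp: mem_ivl intro: order_trans)
    have "\<bar>mangoldt n * rho q w n\<bar> \<le> w\<^sup>2 * w ^ 3"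
      unfolding abs_mult using l(1) ln_y_le rho_primepow_le[OF True] rho_nonneg[of q w n] mangoldt_nonneg[of n] by (intro mult_mono) auto
    moreover have "\<bar>of_bool (prime n) * ln (real n)\<bar> \<le> w\<^sup>2 * w ^ 3"
    proof -
      have "w\<^sup>2 * 1 \<le> w\<^sup>2 * w ^ 3" using w_ge by (intro mult_left_mono one_le_power) auto
      moreover have "\<bar>of_bool (prime n) * ln (real n)\<bar> \<le> ln (real n)" using l by (cases "prime n") auto
      ultimately show ?thesis using l ln_y_le by linarith
    qed
    ultimately have "\<bar>mangoldt n * rho q w n - of_bool (prime n) * ln (real n)\<bar> \<le> 2 * (w\<^sup>2 * w ^ 3)" by linarith
    then have "\<bar>Ka a n\<bar> * \<bar>mangoldt n * rho q w n - of_bool (prime n) * ln (real n)\<bar> \<le> 3 * (2 * (w\<^sup>2 * w ^ 3))"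
      by (intro mult_mono Ka_abs_le_3) auto
    also have "... = 6 * w ^ 5" by (simp add: power_add[symmetric])
    also have "... \<le> w * w ^ 5" using w_ge by (intro mult_right_mono) auto
    also have "... = w ^ 6" by (simp add: power_Suc[symmetric] del: power_Suc)
    finally show ?thesis unfolding D_def abs_mult[symmetric] by (simp add: algebra_simps)
  next
    case False
    then have "\<not> prime n" by auto
    then show ?thesis using False w_ge by (simp add: D_def mangoldt_def)
  qed
  have "\<bar>\<Sum>n\<in>ivl y. D n\<bar> = \<bar>\<Sum>n\<in>ivl y \<inter> B. D n\<bar>"
    using D0 by (intro arg_cong[of _ _ abs] sum.mono_neutral_right) auto
  also have "... \<le> (\<Sum>n\<in>ivl y \<inter> B. w ^ 6)"
    using D1 by (intro order_trans[OF sum_abs] sum_mono) auto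
  also have "... \<le> real (card B) * w ^ 6"
    using fB w_ge by (simp add: card_mono mult_right_mono)
  also have "... \<le> w ^ 502 * w ^ 6"
  proof (intro mult_right_mono)
    have "real (card B) \<le> real (card {d. primepow d \<and> \<not> prime d \<and> real d \<le> y}) + real (card (ivl w))"
      unfolding B_def of_nat_add[symmetric] of_nat_le_iff by (rule card_Un_le)
    also have "... \<le> 2 * sqrt y + w" using y_ge w_ge by (intro add_mono card_nonprime_primepow_le card_ivl_le) auto
    also have "... \<le> 2 * w ^ 500 + w ^ 500" unfolding sqrt_y using w_ge by (intro add_mono self_le_power) auto
    also have "... = 3 * w ^ 500" by simp
    also have "... \<le> w\<^sup>2 * w ^ 500" using w_ge self_le_power[of w 2] by (intro mult_right_mono) auto
    also have "... = w ^ 502" by (simp add: power_add[symmetric])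
    finally show "real (card B) \<le> w ^ 502" .
  qed (use w_ge in auto)
  also have "... = w ^ 508" by (simp add: power_add[symmetric])
  also have "... \<le> w ^ 900" using w_ge by (intro power_increasing) auto
  finally have "\<bar>\<Sum>n\<in>ivl y. D n\<bar> \<le> (1 - b) * (y / phq)" by (rule small_bound)
  moreover have "(1 - b) * (y / phq) * 1 \<le> (1 - b) * (y / phq) * ln y"
    using b y_ge ln_y_le by (intro mult_left_mono) auto
  ultimately have "\<bar>\<Sum>n\<in>ivl y. D n\<bar> \<le> (1 - b) * ln y * (y / phq)" by (simp add: mult_ac)
  moreover have split: "(3 * C1 + 2) * R = (3 * C1 + 1) * R + R" for R by (simp add: algebra_simps)
  ultimately show ?thesis unfolding split using theta_sieved[OF a] eq by linarith
qed

text \<open>\<open>lam_sieve\<close> with t = 1 is summed over all reduced classes, and primes up to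
  w are covered by \<open>small_bound\<close>. Since lam p = 1 + ch p, the result says that ch p =
  -1 for most primes.\<close>

lemma lam_primes: "(\<Sum>p\<in>primes_le y. lam p) \<le> (9 * exp (real Mc) + 1) * ((1 - b) * y)"
proof -
  define G where "G = (\<lambda>n c. of_bool [n * 1 = c] (mod q) * lam n * rho q w (n * 1))"
  have G0: "G n c \<ge> 0" for n c unfolding G_def by (intro mult_nonneg_nonneg rho_nonneg) auto
  have "lam p \<le> (\<Sum>c\<in>totatives q. G p c) + (if real p \<le> w then 2 else 0)" if p: "p \<in> primes_le y" for p
  proof (cases "real p \<le> w")
    case True
    have "lam p \<le> 2" using p lam_prime[of p] chi_abs_le[of p] by simp
    moreover have "(\<Sum>c\<in>totatives q. G p c) \<ge> 0" by (intro sum_nonneg G0)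
    ultimately show ?thesis using True by simp
  next
    case False
    have pr: "prime p" using p by simp
    have "\<not> p dvd q" using False w_ge(5) q1 dvd_imp_le[of p q] by fastforce
    then have cp: "coprime p q" using pr by (intro prime_imp_coprime)
    have "(\<Sum>c\<in>totatives q. G p c) = (\<Sum>c\<in>totatives q. of_bool [p = c] (mod q)) * lam p"
      unfolding G_def sum_distrib_right using rho_large_prime[OF w_ge(3) pr, of q] False by simp
    moreover have "1 \<le> (\<Sum>c\<in>totatives q. of_bool [p = c] (mod q) :: real)" using coprime_residue[of p] cp by simp
    then have "1 * lam p \<le> (\<Sum>c\<in>totatives q. of_bool [p = c] (mod q)) * lam p" by (intro mult_right_mono) auto
    ultimately show ?thesis using False by simp
  qed
  then have "(\<Sum>p\<in>primes_le y. lam p) \<le> (\<Sum>p\<in>primes_le y. (\<Sum>c\<in>totatives q. G p c) + (if real p \<le> w then 2 else 0))" by (rule sum_mono)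
  also have "... \<le> (\<Sum>p\<in>ivl y. (\<Sum>c\<in>totatives q. G p c) + (if real p \<le> w then 2 else 0))"
    using G0 by (intro sum_mono2) (auto simp: mem_ivl prime_gt_0_nat Suc_le_eq intro!: sum_nonneg add_nonneg_nonneg)
  also have "... = (\<Sum>p\<in>ivl y. \<Sum>c\<in>totatives q. G p c) + (\<Sum>p\<in>ivl y. if real p \<le> w then 2 else 0)" by (rule sum.distrib)
  also have "(\<Sum>p\<in>ivl y. if real p \<le> w then 2 else 0) = (\<Sum>p | p \<in> ivl y \<and> real p \<le> w. 2::real)" by (rule sum.inter_filter[symmetric]) simp
  also have "... \<le> (\<Sum>p\<in>ivl w. 2)" by (rule sum_mono2) (auto simp: mem_ivl)
  also have "... = 2 * real (card (ivl w))" by simp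
  also have "... \<le> 2 * w" using w_ge by (intro mult_left_mono card_ivl_le) auto
  also have "... \<le> w ^ 2" unfolding power2_eq_square using w_ge by (intro mult_right_mono) auto
  also have "... \<le> w ^ 900" using w_ge by (intro power_increasing) auto
  also have "... \<le> (1 - b) * (y / phq)" by (rule small_bound) simp
  also have "... \<le> (1 - b) * (y / 1)" using b y_ge totient_pos by (intro mult_left_mono divide_left_mono) auto
  also have "(\<Sum>p\<in>ivl y. \<Sum>c\<in>totatives q. G p c) = (\<Sum>c\<in>totatives q. \<Sum>p\<in>ivl y. G p c)" by (rule sum.swap)
  also have "... \<le> (\<Sum>c\<in>totatives q. 9 * ((1 - b) * (y / phq)) * kap q w 1)"
  proof (rule sum_mono)
    fix c assume "c \<in> totatives q"
    then have c: "coprime c q" by (simp add: totatives_def)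
    have Y: "w ^ 82 \<le> y" unfolding y_def using w_ge by (intro power_increasing) auto
    show "(\<Sum>p\<in>ivl y. G p c) \<le> 9 * ((1 - b) * (y / phq)) * kap q w 1"
      unfolding G_def by (rule lam_sieve) (use c Y in auto)
  qed
  also have "... = 9 * ((1 - b) * y) * kap q w 1" using totient_pos by (simp add: totient_def)
  also have "... \<le> 9 * ((1 - b) * y) * exp (real Mc)" using b y_ge kap_one_le[of q w] by (intro mult_left_mono) auto
  finally show ?thesis by (simp add: algebra_simps)
qed

end

section \<open>Products of large primes\<close>

text \<open>A list of primes with product \<open>n\<close> is an ordering of the multiset
  \<open>prime_factorization n\<close>, so the conditions on the list become conditions on
  \<open>n\<close>.\<close>

lemma rough_products_iff:
  "n \<in> rough_products k x z \<longleftrightarrow> real n \<le> x \<and> n \<noteq> 0 \<and> size (prime_factorization n) = k \<and> (\<forall>p\<in>prime_factors n. z < real p)"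
proof
  assume "n \<in> rough_products k x z"
  then obtain ps where ps: "real n \<le> x" "length ps = k" "\<forall>p\<in>set ps. prime p \<and> z < real p" "n = prod_list ps"
    by (auto simp: rough_products_def)
  have n: "n = prod_mset (mset ps)" using ps(4) by (simp add: prod_mset_prod_list)
  have pf: "prime_factorization n = mset ps" unfolding n using ps(3) by (intro prime_factorization_prod_mset_primes) auto
  have "n \<noteq> 0" unfolding n using ps(3) by (auto simp: prod_mset_zero_iff)
  then show "real n \<le> x \<and> n \<noteq> 0 \<and> size (prime_factorization n) = k \<and> (\<forall>p\<in>prime_factors n. z < real p)" using ps pf by simp
next
  assume n: "real n \<le> x \<and> n \<noteq> 0 \<and> size (prime_factorization n) = k \<and> (\<forall>p\<in>prime_factors n. z < real p)"
  obtain ps where ps: "mset ps = prime_factorization n" using ex_mset by blast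
  have "prod_list ps = prod_mset (prime_factorization n)" unfolding ps[symmetric] by (simp add: prod_mset_prod_list)
  also have "... = n" using n by (simp add: prod_mset_prime_factorization_nat)
  finally have "n = prod_list ps" by simp
  moreover have "length ps = k" using n ps by (metis size_mset)
  moreover have "\<forall>p\<in>set ps. prime p \<and> z < real p" using n ps by (metis in_prime_factors_imp_prime set_mset_mset)
  ultimately show "n \<in> rough_products k x z" using n by (auto simp: rough_products_def)
qed

lemma finite_rough_products [simp, intro]: "finite (rough_products k x z)"
  by (rule finite_subset[OF _ finite_nat_real_le[of x]]) (auto simp: rough_products_iff)

lemma rough_products_mono: "x \<le> x' \<Longrightarrow> rough_products k x z \<subseteq> rough_products k x' z"
  by (auto simp: rough_products_iff)

lemma rough_products_0: "x \<ge> 1 \<Longrightarrow> rough_products 0 x z = {1}"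
  by (auto simp: rough_products_iff prime_factorization_empty_iff)

definition primes_in :: "real \<Rightarrow> real \<Rightarrow> nat set" where
  "primes_in z y = {p. prime p \<and> z < real p \<and> real p \<le> y}"

lemma finite_primes_in [simp, intro]: "finite (primes_in z y)"
  by (rule finite_subset[OF _ finite_nat_real_le[of y]]) (auto simp: primes_in_def)

lemma primes_in_mono: "y \<le> y' \<Longrightarrow> primes_in z y \<subseteq> primes_in z y'"
  by (auto simp: primes_in_def)

text \<open>Pairs (n, p) with p dividing n correspond to the pairs (n / p, p). The left inner sum
  runs over distinct primes, so the correspondence is bijective even for repeated factors.\<close>

lemma sum_rough_products_Suc:
  fixes F :: "nat \<Rightarrow> nat \<Rightarrow> real"
  shows "(\<Sum>n\<in>rough_products (Suc k) x z. \<Sum>p\<in>prime_factors n. F n p)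
    = (\<Sum>m\<in>rough_products k x z. \<Sum>p\<in>primes_in z (x / real m). F (m * p) p)"
proof -
  have up: "m * p \<in> rough_products (Suc k) x z" "p \<in> prime_factors (m * p)" "m \<noteq> 0" "p \<noteq> 0"
    if "m \<in> rough_products k x z" "p \<in> primes_in z (x / real m)" for m p
  proof -
    have m: "m \<noteq> 0" and p: "prime p" "z < real p" "real p \<le> x / real m" using that by (auto simp: rough_products_iff primes_in_def)
    have le: "real (m * p) \<le> x" using m p(3) by (simp add: field_simps)
    have "prime_factorization (m * p) = prime_factorization m + {#p#}"
      using m p(1) by (simp add: prime_factorization_mult prime_factorization_prime prime_gt_0_nat)
    then show "m * p \<in> rough_products (Suc k) x z" "p \<in> prime_factors (m * p)"
      using that le m p by (auto simp: rough_products_iff prime_gt_0_nat)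
    show "m \<noteq> 0" "p \<noteq> 0" using m p by auto
  qed
  have down: "n div p \<in> rough_products k x z" "p \<in> primes_in z (x / real (n div p))" "n div p * p = n" "p \<noteq> 0"
    if "n \<in> rough_products (Suc k) x z" "p \<in> prime_factors n" for n p
  proof -
    have n: "n \<noteq> 0" "real n \<le> x" "size (prime_factorization n) = Suc k" "\<forall>r\<in>prime_factors n. z < real r" using that by (auto simp: rough_products_iff)
    have p: "prime p" "p dvd n" using that(2) by auto
    show e: "n div p * p = n" using p by simp
    define m where "m = n div p"
    have m: "n = m * p" "m \<noteq> 0" using e n(1) unfolding m_def by (simp, metis mult_0)
    have pf: "prime_factorization n = prime_factorization m + {#p#}"
      unfolding m(1) using m(2) p(1) by (simp add: prime_factorization_mult prime_factorization_prime prime_gt_0_nat)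
    have "real m * 1 \<le> real m * real p" using p prime_ge_1_nat[OF p(1)] by (intro mult_left_mono) auto
    then have "real m \<le> x" using n(2) unfolding m(1) of_nat_mult by linarith
    then show "n div p \<in> rough_products k x z" using n pf m by (simp add: rough_products_iff m_def[symmetric])
    have "real p \<le> x / real m" using n(2) m by (simp add: field_simps)
    then show "p \<in> primes_in z (x / real (n div p))" using n(4) that(2) p by (simp add: primes_in_def m_def)
    show "p \<noteq> 0" using p by auto
  qed
  have "(\<Sum>n\<in>rough_products (Suc k) x z. \<Sum>p\<in>prime_factors n. F n p) = (\<Sum>(n,p)\<in>(SIGMA n:rough_products (Suc k) x z. prime_factors n). F n p)"
    by (subst sum.Sigma) auto
  also have "... = (\<Sum>(m,p)\<in>(SIGMA m:rough_products k x z. primes_in z (x / real m)). F (m * p) p)"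
    by (rule sum.reindex_bij_witness[where i = "\<lambda>(m,p). (m * p, p)" and j = "\<lambda>(n,p). (n div p, p)"])
       (use up down in auto)
  also have "... = (\<Sum>m\<in>rough_products k x z. \<Sum>p\<in>primes_in z (x / real m). F (m * p) p)"
    by (subst sum.Sigma) auto
  finally show ?thesis .
qed

lemma card_prime_factors_rough:
  assumes "n \<in> rough_products k x z"
  shows "card (prime_factors n) \<le> k" "k > 0 \<Longrightarrow> card (prime_factors n) \<ge> 1"
proof -
  have s: "size (prime_factorization n) = k" using assms by (simp add: rough_products_iff)
  have "card (prime_factors n) = size (mset_set (prime_factors n))" by simp
  also have "... \<le> size (prime_factorization n)" by (intro size_mset_mono mset_set_set_mset_msubset)
  finally show "card (prime_factors n) \<le> k" using s by simp
  assume "k > 0"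
  then have "prime_factors n \<noteq> {}" using s by auto
  then show "card (prime_factors n) \<ge> 1" by (simp add: Suc_le_eq card_gt_0_iff)
qed

section \<open>Reciprocal sums and the number of products of large primes\<close>

lemma sum_recip_primes_le:
  assumes z: "z \<ge> 2" and x: "x \<le> z powr u" and u: "u \<ge> 1"
  shows "(\<Sum>p\<in>primes_in z x. 1 / real p) \<le> 16 * u"
proof (cases "x > z")
  case True
  have "ln 2 \<le> ln z" using z by (intro ln_mono) auto
  then have lz: "ln z > 0" "ln z \<ge> 2/3" using ln2_ge_two_thirds by linarith+
  have lx: "ln x \<le> u * ln z" using x True z ln_mono[of x "z powr u"] by (simp add: ln_powr)
  have N: "nat \<lfloor>x\<rfloor> \<ge> 1" "real (nat \<lfloor>x\<rfloor>) \<le> x" using z True by linarith+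
  have "(\<Sum>p\<in>primes_in z x. 1 / real p) \<le> (\<Sum>p\<in>primes_in z x. mangoldt p / real p / ln z)"
  proof (rule sum_mono)
    fix p assume p: "p \<in> primes_in z x"
    then have "ln z \<le> ln (real p)" using z by (auto simp: primes_in_def)
    then have "1 / real p * ln z \<le> 1 / real p * ln (real p)" by (intro mult_left_mono) auto
    then have "1 / real p \<le> 1 / real p * ln (real p) / ln z" by (simp only: pos_le_divide_eq[OF lz(1)])
    then show "1 / real p \<le> mangoldt p / real p / ln z" using p by (simp add: primes_in_def mangoldt_prime)
  qed
  also have "... \<le> (\<Sum>d=1..nat \<lfloor>x\<rfloor>. mangoldt d / real d / ln z)"
    using lz(1) by (intro sum_mono2) (auto simp: primes_in_def prime_gt_0_nat Suc_le_eq le_nat_floor intro!: divide_nonneg_nonneg mangoldt_nonneg)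
  also have "... = (\<Sum>d=1..nat \<lfloor>x\<rfloor>. mangoldt d / real d) / ln z" by (rule sum_divide_distrib[symmetric])
  also have "... \<le> (ln (real (nat \<lfloor>x\<rfloor>)) + 6) / ln z" using lz N by (intro divide_right_mono mertens_upper) auto
  also have "... \<le> (16 * u * ln z) / ln z"
  proof (intro divide_right_mono)
    have "ln (real (nat \<lfloor>x\<rfloor>)) \<le> u * ln z" using N lx ln_mono[of "real (nat \<lfloor>x\<rfloor>)" x] by linarith
    moreover have "1 * (2/3) \<le> u * ln z" using u lz by (intro mult_mono) auto
    ultimately show "ln (real (nat \<lfloor>x\<rfloor>)) + 6 \<le> 16 * u * ln z" by linarith
  qed (use lz in simp)
  finally show ?thesis using lz by simp
next
  case False
  then have "primes_in z x = {}" by (auto simp: primes_in_def)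
  then show ?thesis using u by simp
qed

text \<open>Each \<open>n\<close> has at least one prime factor, so splitting one off in all
  possible ways overcounts; every split costs a factor 16 u.\<close>

lemma sum_recip_rough_le:
  assumes z: "z \<ge> 2" and x: "x \<le> z powr u" "x \<ge> 1" and u: "u \<ge> 1"
  shows "(\<Sum>n\<in>rough_products k x z. 1 / real n) \<le> (16 * u) ^ k"
proof (induction k)
  case 0
  then show ?case using x by (simp add: rough_products_0)
next
  case (Suc k)
  have "(\<Sum>n\<in>rough_products (Suc k) x z. 1 / real n) \<le> (\<Sum>n\<in>rough_products (Suc k) x z. \<Sum>p\<in>prime_factors n. 1 / real n)"
  proof (rule sum_mono)
    fix n assume "n \<in> rough_products (Suc k) x z"
    then have "1 * (1 / real n) \<le> real (card (prime_factors n)) * (1 / real n)"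
      using card_prime_factors_rough(2) by (intro mult_right_mono) force+
    then show "1 / real n \<le> (\<Sum>p\<in>prime_factors n. 1 / real n)" by simp
  qed
  also have "... = (\<Sum>m\<in>rough_products k x z. 1 / real m * (\<Sum>p\<in>primes_in z (x / real m). 1 / real p))"
    unfolding sum_rough_products_Suc sum_distrib_left by simp
  also have "... \<le> (\<Sum>m\<in>rough_products k x z. 1 / real m * (16 * u))"
  proof (intro sum_mono mult_left_mono sum_recip_primes_le z u)
    fix m assume "m \<in> rough_products k x z"
    then have "real m \<ge> 1" by (auto simp: rough_products_iff)
    then have "x / real m \<le> x / 1" using x by (intro divide_left_mono) auto
    then show "x / real m \<le> z powr u" using x by simp
  qed auto
  also have "... = (\<Sum>m\<in>rough_products k x z. 1 / real m) * (16 * u)" by (rule sum_distrib_right[symmetric])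
  also have "... \<le> (16 * u) ^ k * (16 * u)" using Suc u by (intro mult_right_mono) auto
  finally show ?case by (simp add: mult.commute)
qed

text \<open>Mertens' bounds give at least \<eta> ln z - (C + 7) for the sum of ln p / p, with 6 from
  the upper bound at \<open>z\<close> and 1 from rounding. Half of \<eta> ln z survives for large
  \<open>z\<close>, and ln p \<le> (1 + \<eta>) ln z.\<close>

lemma sum_recip_primes_ge:
  assumes e: "\<eta> > 0"
  obtains Z where "Z \<ge> 2" "\<And>z. z \<ge> Z \<Longrightarrow> (\<Sum>p\<in>primes_in z (z powr (1 + \<eta>)). 1 / real p) \<ge> \<eta> / (2 * (1 + \<eta>))"
proof -
  obtain C where C: "C > 0" "\<And>N. N \<ge> 1 \<Longrightarrow> (\<Sum>p\<in>primes_le (real N). ln (real p) / real p) \<ge> ln (real N) - C"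
    using mertens_primes_lower by blast
  define Z where "Z = max 2 (exp (2 * (C + 7) / \<eta>))"
  show ?thesis
  proof (rule that)
    show "Z \<ge> 2" by (simp add: Z_def)
    fix z assume zZ: "z \<ge> Z"
    then have z: "z \<ge> 2" "z \<ge> exp (2 * (C + 7) / \<eta>)" by (auto simp: Z_def)
    define y where "y = z powr (1 + \<eta>)"
    have lz: "ln z > 0" using z by simp
    have "2 * (C + 7) / \<eta> \<le> ln z" using z by (subst ln_ge_iff) auto
    then have big: "2 * (C + 7) \<le> \<eta> * ln z" using e by (simp add: divide_le_eq mult.commute)
    have yz: "y \<ge> z" unfolding y_def using z e powr_mono[of 1 "1 + \<eta>" z] by simp
    have ly: "ln y = (1 + \<eta>) * ln z" unfolding y_def using z by (simp add: ln_powr)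
    define N where "N = nat \<lfloor>y\<rfloor>"
    have N: "N \<ge> 1" "real N \<le> y" "y < real N + 1" using yz z unfolding N_def by linarith+
    have "ln y \<le> ln (2 * real N)" using N yz z by (intro ln_mono) auto
    also have "... = ln 2 + ln (real N)" using N by (subst ln_mult) auto
    also have "... \<le> 1 + ln (real N)" using ln_2_less_1 by simp
    finally have lN: "ln (real N) \<ge> ln y - 1" by simp
    have M: "nat \<lfloor>z\<rfloor> \<ge> 1" "real (nat \<lfloor>z\<rfloor>) \<le> z" using z by linarith+
    have "real p \<le> real N \<longleftrightarrow> real p \<le> y" for p by (metis N(2) N_def le_nat_floor of_nat_mono order_trans)
    then have "primes_le (real N) = primes_le y" by (auto simp: primes_le_def)
    also have "... = primes_le z \<union> primes_in z y" using yz by (auto simp: primes_in_def)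
    finally have "(\<Sum>p\<in>primes_le (real N). ln (real p) / real p) = (\<Sum>p\<in>primes_le z. ln (real p) / real p) + (\<Sum>p\<in>primes_in z y. ln (real p) / real p)"
      by (simp only:) (rule sum.union_disjoint, auto simp: primes_in_def)
    moreover have "(\<Sum>p\<in>primes_le z. ln (real p) / real p) \<le> (\<Sum>d=1..nat \<lfloor>z\<rfloor>. mangoldt d / real d)"
    proof -
      have "(\<Sum>p\<in>primes_le z. ln (real p) / real p) = (\<Sum>p\<in>primes_le z. mangoldt p / real p)"
        by (intro sum.cong) (auto simp: mangoldt_prime)
      also have "... \<le> (\<Sum>d=1..nat \<lfloor>z\<rfloor>. mangoldt d / real d)"
        by (intro sum_mono2) (auto simp: prime_gt_0_nat Suc_le_eq le_nat_floor intro!: divide_nonneg_nonneg mangoldt_nonneg)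
      finally show ?thesis .
    qed
    moreover have "(\<Sum>d=1..nat \<lfloor>z\<rfloor>. mangoldt d / real d) \<le> ln z + 6" using mertens_upper[OF M(1)] M by (smt (verit) ln_le_cancel_iff of_nat_1 of_nat_mono)
    ultimately have low: "(\<Sum>p\<in>primes_in z y. ln (real p) / real p) \<ge> \<eta> * ln z / 2"
      using C(2)[OF N(1)] lN big ly by (simp add: algebra_simps)
    have "(\<Sum>p\<in>primes_in z y. ln (real p) / real p) \<le> (\<Sum>p\<in>primes_in z y. ln y * (1 / real p))"
    proof (rule sum_mono)
      fix p assume p: "p \<in> primes_in z y"
      then have "ln (real p) \<le> ln y" using z by (auto simp: primes_in_def prime_gt_0_nat)
      then show "ln (real p) / real p \<le> ln y * (1 / real p)" by (simp add: divide_right_mono)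
    qed
    then have "\<eta> * ln z / 2 \<le> ln y * (\<Sum>p\<in>primes_in z y. 1 / real p)" using low unfolding sum_distrib_left by linarith
    then have "ln z * (\<eta> / (2 * (1 + \<eta>))) \<le> ln z * (\<Sum>p\<in>primes_in z y. 1 / real p)"
      unfolding ly using e by (simp add: field_simps)
    then show "(\<Sum>p\<in>primes_in z (z powr (1 + \<eta>)). 1 / real p) \<ge> \<eta> / (2 * (1 + \<eta>))"
      unfolding y_def[symmetric] using lz by (simp only: mult_le_cancel_left_pos)
  qed
qed

text \<open>An \<open>n\<close> with k + 1 prime factors arises from at most k + 1 choices of the
  split prime, whence the factorial.\<close>

lemma sum_recip_rough_ge:
  assumes z: "z \<ge> 2" and V: "V \<ge> 1" and s: "(\<Sum>p\<in>primes_in z V. 1 / real p) \<ge> s" "s \<ge> 0"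
  shows "(\<Sum>n\<in>rough_products k (V ^ k) z. 1 / real n) \<ge> s ^ k / fact k"
proof (induction k)
  case 0
  then show ?case by (simp add: rough_products_0)
next
  case (Suc k)
  have Vk: "V ^ k \<le> V ^ Suc k" using V by (intro power_increasing) auto
  have "s ^ k / fact k * s \<le> (\<Sum>m\<in>rough_products k (V ^ k) z. 1 / real m) * s" using Suc s by (intro mult_right_mono) auto
  also have "... = (\<Sum>m\<in>rough_products k (V ^ k) z. 1 / real m * s)" by (rule sum_distrib_right)
  also have "... \<le> (\<Sum>m\<in>rough_products k (V ^ k) z. 1 / real m * (\<Sum>p\<in>primes_in z (V ^ Suc k / real m). 1 / real p))"
  proof (intro sum_mono mult_left_mono)
    fix m assume "m \<in> rough_products k (V ^ k) z"
    then have m: "real m \<ge> 1" "real m \<le> V ^ k" by (auto simp: rough_products_iff)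
    then have "V * real m \<le> V * V ^ k" using V by (intro mult_left_mono) auto
    then have "V \<le> V ^ Suc k / real m" using m by (simp add: pos_le_divide_eq)
    then have "(\<Sum>p\<in>primes_in z V. 1 / real p) \<le> (\<Sum>p\<in>primes_in z (V ^ Suc k / real m). 1 / real p)"
      by (intro sum_mono2 primes_in_mono) auto
    then show "s \<le> (\<Sum>p\<in>primes_in z (V ^ Suc k / real m). 1 / real p)" using s by linarith
  qed auto
  also have "... \<le> (\<Sum>m\<in>rough_products k (V ^ Suc k) z. 1 / real m * (\<Sum>p\<in>primes_in z (V ^ Suc k / real m). 1 / real p))"
    using Vk by (intro sum_mono2 rough_products_mono) (auto intro!: mult_nonneg_nonneg sum_nonneg divide_nonneg_nonneg)
  also have "... = (\<Sum>n\<in>rough_products (Suc k) (V ^ Suc k) z. \<Sum>p\<in>prime_factors n. 1 / real n)"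
    unfolding sum_rough_products_Suc sum_distrib_left by simp
  also have "... \<le> (\<Sum>n\<in>rough_products (Suc k) (V ^ Suc k) z. real (Suc k) * (1 / real n))"
  proof (rule sum_mono)
    fix n assume "n \<in> rough_products (Suc k) (V ^ Suc k) z"
    then have "real (card (prime_factors n)) * (1 / real n) \<le> real (Suc k) * (1 / real n)"
      using card_prime_factors_rough(1) by (intro mult_right_mono) force+
    then show "(\<Sum>p\<in>prime_factors n. 1 / real n) \<le> real (Suc k) * (1 / real n)" by simp
  qed
  also have "... = real (Suc k) * (\<Sum>n\<in>rough_products (Suc k) (V ^ Suc k) z. 1 / real n)" by (rule sum_distrib_left[symmetric])
  finally have "s ^ k / fact k * s / real (Suc k) \<le> (\<Sum>n\<in>rough_products (Suc k) (V ^ Suc k) z. 1 / real n)"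
    by (simp add: pos_divide_le_eq mult.commute)
  then show ?case by (simp add: field_simps)
qed

text \<open>The room in k < u is used through \<eta> = u / k - 1 and V = z^(1+\<eta>), so that V^k =
  x. If m \<le> V^(k-1) is a product of k - 1 primes, the last prime may run up to x / m \<ge> V,
  where the primes up to \<open>z\<close> are negligible. The order x / ln x comes from Chebyshev's
  bound for this last prime.\<close>

lemma card_rough_products_ge:
  assumes k: "k > 0" "real k < u"
  obtains c Z where "c > 0" "Z \<ge> 2" "\<And>z. z \<ge> Z \<Longrightarrow> real (card (rough_products k (z powr u) z)) \<ge> c * (z powr u / ln (z powr u))"
proof -
  obtain j where j: "k = Suc j" using k by (cases k) auto
  define \<eta> where "\<eta> = u / real k - 1"
  have e: "\<eta> > 0" using k by (simp add: \<eta>_def field_simps)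
  obtain Z1 where Z1: "Z1 \<ge> 2" "\<And>z. z \<ge> Z1 \<Longrightarrow> (\<Sum>p\<in>primes_in z (z powr (1 + \<eta>)). 1 / real p) \<ge> \<eta> / (2 * (1 + \<eta>))"
    using sum_recip_primes_ge[OF e] by blast
  obtain Y0 where Y0: "Y0 > 1" "\<And>y. y \<ge> Y0 \<Longrightarrow> real (card (primes_le y)) \<ge> y / (24 * ln y)" using pi_ge by blast
  define t where "t = 1 / (1 + \<eta>)"
  have t: "0 < t" "t < 1" using e by (auto simp: t_def)
  have "eventually (\<lambda>Y::real. Y powr t \<le> Y / (48 * ln Y)) at_top" using t by real_asymp
  then obtain Y1 where Y1: "\<And>Y. Y \<ge> Y1 \<Longrightarrow> Y powr t \<le> Y / (48 * ln Y)" by (auto simp: eventually_at_top_linorder)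
  define Z where "Z = max Z1 (max Y0 Y1)"
  define s where "s = \<eta> / (2 * (1 + \<eta>))"
  have s0: "s > 0" using e by (simp add: s_def)
  define c where "c = s ^ j / fact j / (48 * real k)"
  show ?thesis
  proof (rule that)
    show "c > 0" using s0 k by (simp add: c_def)
    show "Z \<ge> 2" using Z1 by (simp add: Z_def)
    fix z assume "z \<ge> Z"
    then have z: "z \<ge> 2" "z \<ge> Z1" "z \<ge> Y0" "z \<ge> Y1" using Z1 by (auto simp: Z_def)
    define V where "V = z powr (1 + \<eta>)"
    define x where "x = z powr u"
    have Vz: "V \<ge> z" unfolding V_def using z e powr_mono[of 1 "1 + \<eta>" z] by simp
    have "V ^ k = z powr (real k * (1 + \<eta>))" unfolding V_def using z by (simp add: powr_powr powr_realpow[symmetric] mult.commute)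
    also have "real k * (1 + \<eta>) = u" using k by (simp add: \<eta>_def)
    finally have Vx: "V ^ k = x" by (simp add: x_def)
    have xV: "x \<ge> V" unfolding Vx[symmetric] using Vz z k by (intro self_le_power) auto
    have lx: "ln x > 0" using xV Vz z by simp
    have Vjx: "V ^ j \<le> x" unfolding Vx[symmetric] j using Vz z by (intro power_increasing) auto
    have cnt: "real (card (primes_in z (x / real m))) \<ge> x / real m / (48 * ln x)" if m: "m \<in> rough_products j (V ^ j) z" for m
    proof -
      have m: "real m \<ge> 1" "real m \<le> V ^ j" using m by (auto simp: rough_products_iff)
      define Y where "Y = x / real m"
      have "V * real m \<le> V * V ^ j" using m Vz z by (intro mult_left_mono) auto
      then have YV: "V \<le> Y" unfolding Y_def using m Vx by (simp add: pos_le_divide_eq j)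
      have Y1': "Y > 1" "Y \<ge> Y0" "Y \<ge> Y1" using YV Vz z by auto
      have Yx: "Y \<le> x" unfolding Y_def using m xV Vz z by (simp add: divide_le_eq mult_le_cancel_left1)
      have "z = V powr t" unfolding V_def t_def using z e by (simp add: powr_powr)
      also have "... \<le> Y powr t" using YV Vz z t by (intro powr_mono2) auto
      also have "... \<le> Y / (48 * ln Y)" by (rule Y1[OF Y1'(3)])
      finally have zY: "z \<le> Y / (48 * ln Y)" .
      have "primes_le Y \<subseteq> primes_in z Y \<union> ivl z" by (auto simp: primes_in_def mem_ivl prime_gt_0_nat Suc_le_eq)
      then have "card (primes_le Y) \<le> card (primes_in z Y \<union> ivl z)" by (intro card_mono) auto
      also have "... \<le> card (primes_in z Y) + card (ivl z)" by (rule card_Un_le)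
      finally have "real (card (primes_le Y)) \<le> real (card (primes_in z Y)) + z" using card_ivl_le[of z] z by linarith
      moreover have "Y / (24 * ln Y) = Y / (48 * ln Y) + Y / (48 * ln Y)" by simp
      ultimately have "real (card (primes_in z Y)) \<ge> Y / (48 * ln Y)" using Y0(2)[OF Y1'(2)] zY by linarith
      moreover have "Y / (48 * ln x) \<le> Y / (48 * ln Y)" using Y1' Yx by (intro divide_left_mono) auto
      ultimately show ?thesis by (simp add: Y_def)
    qed
    have "c * (x / ln x) * real k = s ^ j / fact j * (x / (48 * ln x))" using k by (simp add: c_def)
    also have "... \<le> (\<Sum>m\<in>rough_products j (V ^ j) z. 1 / real m) * (x / (48 * ln x))"
      using Z1(2)[OF z(2)] z Vz s0 lx xV unfolding s_def[symmetric] V_def[symmetric]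
      by (intro mult_right_mono sum_recip_rough_ge) auto
    also have "... = (\<Sum>m\<in>rough_products j (V ^ j) z. x / real m / (48 * ln x))" unfolding sum_distrib_right by simp
    also have "... \<le> (\<Sum>m\<in>rough_products j (V ^ j) z. real (card (primes_in z (x / real m))))" by (intro sum_mono cnt)
    also have "... \<le> (\<Sum>m\<in>rough_products j x z. real (card (primes_in z (x / real m))))"
      using Vjx by (intro sum_mono2 rough_products_mono) auto
    also have "... = (\<Sum>m\<in>rough_products j x z. \<Sum>p\<in>primes_in z (x / real m). 1)" by simp
    also have "... = (\<Sum>n\<in>rough_products k x z. \<Sum>p\<in>prime_factors n. 1)"
      unfolding j by (rule sum_rough_products_Suc[where F = "\<lambda>_ _. 1", symmetric])
    also have "... \<le> (\<Sum>n\<in>rough_products k x z. real k)" using card_prime_factors_rough(1) by (intro sum_mono) auto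
    also have "... = real (card (rough_products k x z)) * real k" by simp
    finally have "c * (x / ln x) \<le> real (card (rough_products k x z))" using k by (simp only: mult_le_cancel_right_pos of_nat_0_less_iff)
    then show "real (card (rough_products k (z powr u) z)) \<ge> c * (z powr u / ln (z powr u))" by (simp only: x_def)
  qed
qed

lemma rough_quotient:
  assumes m: "m \<in> rough_products j x z" and x: "x > 0" and b: "b < 1" "(1 - b) * ln x \<le> 1"
  shows "0 < x / real m" "x / real m \<le> x" "(1 - b) * ln (x / real m) \<le> 1"
proof -
  have m1: "real m \<ge> 1" using m by (auto simp: rough_products_iff)
  then show Y: "0 < x / real m" "x / real m \<le> x" using x by (auto simp: divide_le_eq mult_le_cancel_left1)
  have "ln (x / real m) \<le> ln x" using Y by (intro ln_mono) auto
  then have "(1 - b) * ln (x / real m) \<le> (1 - b) * ln x" using b by (intro mult_left_mono) auto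
  then show "(1 - b) * ln (x / real m) \<le> 1" using b by linarith
qed

definition C2 :: real where "C2 = \<bar>3 * siegel.C1 + 2\<bar>"
definition C3 :: real where "C3 = 9 * exp (real Mc) + 1"

lemma C2_C3_nonneg: "C2 \<ge> 0" "C3 \<ge> 0"
  by (auto simp: C2_def C3_def intro!: add_nonneg_nonneg)

section \<open>Equidistribution of products of large primes\<close>

context rchar
begin

text \<open>Y \<ge> Zq is what makes w = Y^(1/1000) admissible in the locale
  \<open>siegel\<close>.\<close>

definition Zq :: real where "Zq = (Q0 ^ (2 ^ Mc)) ^ 1000"

lemma Zq_ge: "Q0 ^ 82 \<le> Zq" "Q0 \<le> Zq" "real q \<le> Zq" "1408 \<le> Zq"
proof -
  have Q: "Q0 \<ge> 1" by (rule Q0_ge)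
  have "Zq = Q0 ^ (2 ^ Mc * 1000)" by (simp add: Zq_def power_mult)
  moreover have "(82::nat) \<le> 2 ^ Mc * 1000" using one_le_power[of "2::nat" Mc] by linarith
  ultimately show 1: "Q0 ^ 82 \<le> Zq" using Q by (simp add: power_increasing)
  moreover have "Q0 \<le> Q0 ^ 82" using Q by (intro self_le_power) auto
  ultimately show "Q0 \<le> Zq" by linarith
  then show "real q \<le> Zq" "1408 \<le> Zq" using Q0_ge by linarith+
qed

lemma theta_at:
  assumes b: "3/4 \<le> b" "b < 1" "Lser b = 0" and Y: "Y \<ge> Zq" "(1 - b) * ln Y \<le> 1"
  shows "coprime a q \<Longrightarrow> \<bar>\<Sum>p\<in>primes_le Y. Ka a p * ln (real p)\<bar> \<le> C2 * ((1 - b) * ln Y * (Y / phq))"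
    and "(\<Sum>p\<in>primes_le Y. lam p) \<le> C3 * ((1 - b) * Y)"
proof -
  define w where "w = Y powr (1/1000)"
  have Y0: "Y > 0" using Y Zq_ge by linarith
  have wY: "w ^ 1000 = Y" unfolding w_def using Y0 by (simp add: powr_realpow[symmetric] powr_powr)
  have w0: "w \<ge> 0" by (simp add: w_def)
  interpret siegel q ch b w
  proof
    show "w \<ge> Q0 ^ (2 ^ Mc)"
    proof -
      have "(Q0 ^ (2 ^ Mc)) ^ 1000 \<le> w ^ 1000" using Y(1) unfolding wY Zq_def .
      then show ?thesis using Q0_ge w0 by (subst (asm) power_mono_iff) auto
    qed
    have "ln Y = 1000 * ln w" unfolding w_def using Y0 by (simp add: ln_powr)
    then show "(1 - b) * (1000 * ln w) \<le> 1" using Y by simp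
  qed (use b in auto)
  have y: "y = Y" by (simp add: y_def wY)
  show "coprime a q \<Longrightarrow> \<bar>\<Sum>p\<in>primes_le Y. Ka a p * ln (real p)\<bar> \<le> C2 * ((1 - b) * ln Y * (Y / phq))"
  proof -
    assume a: "coprime a q"
    have "(1 - b) * ln Y * (Y / phq) \<ge> 0" using b Y0 y_ge unfolding y by (intro mult_nonneg_nonneg) auto
    then have "(3 * C1 + 2) * ((1 - b) * ln Y * (Y / phq)) \<le> C2 * ((1 - b) * ln Y * (Y / phq))"
      unfolding C2_def by (rule mult_right_mono[OF abs_ge_self])
    then show ?thesis using theta_primes[OF a] unfolding y by linarith
  qed
  show "(\<Sum>p\<in>primes_le Y. lam p) \<le> C3 * ((1 - b) * Y)" using lam_primes unfolding y C3_def .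
qed

text \<open>Partial summation against 1 / ln n removes the weight ln p. The free lower end
  \<open>v\<close> is for \<open>rough_kernel\<close>, where the prime must not be smaller than the
  prime factors of the cofactor.\<close>

lemma prime_kernel:
  assumes a: "coprime a q" and b: "3/4 \<le> b" "b < 1" "Lser b = 0" and z: "z \<ge> Zq" "z \<le> v"
    and Y: "0 < Y" "Y \<le> z powr u" "(1 - b) * ln Y \<le> 1" and u: "u \<ge> 1"
  shows "\<bar>\<Sum>p\<in>primes_in v Y. Ka a p\<bar> \<le> 2 * C2 * u * ((1 - b) * (Y / phq))"
proof -
  define m where "m = nat \<lfloor>v\<rfloor>"
  define N where "N = nat \<lfloor>Y\<rfloor>"
  have v: "v \<ge> 1408" using z Zq_ge by linarith
  have m: "real m \<le> v" "v < real m + 1" "m \<ge> 2" using v unfolding m_def by linarith+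
  have memm: "v < real p \<longleftrightarrow> m < p" for p unfolding m_def using v by (simp add: nat_less_iff floor_less_iff)
  have memN: "real p \<le> Y \<longleftrightarrow> p \<le> N" for p unfolding N_def using Y by (simp add: le_nat_iff le_floor_iff)
  have rhs0: "0 \<le> 2 * C2 * u * ((1 - b) * (Y / phq))"
    using C2_C3_nonneg b Y u by (intro mult_nonneg_nonneg) auto
  show ?thesis
  proof (cases "m < N")
    case False
    then have "primes_in v Y = {}" by (auto simp: primes_in_def memm memN)
    then show ?thesis using rhs0 by simp
  next
    case True
    define R where "R = C2 * ((1 - b) * ln Y * (Y / phq))"
    have NY: "real N \<le> Y" using memN by blast
    have vY: "v < Y" using True NY memm[of N] by linarith
    have th: "\<bar>\<Sum>p\<in>primes_le t. Ka a p * ln (real p)\<bar> \<le> R" if t: "v \<le> t" "t \<le> Y" for t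
    proof -
      have t0: "t > 0" "ln t \<ge> 0" "ln t \<le> ln Y" using t v by auto
      have "(1 - b) * ln t \<le> (1 - b) * ln Y" using b t0 by (intro mult_left_mono) auto
      then have "\<bar>\<Sum>p\<in>primes_le t. Ka a p * ln (real p)\<bar> \<le> C2 * ((1 - b) * ln t * (t / phq))"
        using t z Y by (intro theta_at(1) a b) auto
      also have "... \<le> R" unfolding R_def using t t0 b C2_C3_nonneg by (intro mult_left_mono mult_mono divide_right_mono) auto
      finally show ?thesis .
    qed
    define c where "c = (\<lambda>n. of_bool (prime n) * (Ka a n * ln (real n)))"
    have R0: "R \<ge> 0" using th[of v] vY by force
    have part: "\<bar>\<Sum>n\<in>{m<..k}. c n\<bar> \<le> 2 * R" if k: "m \<le> k" "k \<le> N" for k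
    proof (cases "k = m")
      case False
      then have vk: "v < real k" "real k \<le> Y" using k memm memN by auto
      have "primes_le (real k) = primes_le v \<union> {p \<in> {m<..k}. prime p}" using vk by (auto simp: memm[symmetric])
      then have "(\<Sum>p\<in>primes_le (real k). Ka a p * ln (real p)) = (\<Sum>p\<in>primes_le v. Ka a p * ln (real p)) + (\<Sum>p | p \<in> {m<..k} \<and> prime p. Ka a p * ln (real p))"
        by (simp only:) (rule sum.union_disjoint, auto simp: memm[symmetric])
      also have "(\<Sum>p | p \<in> {m<..k} \<and> prime p. Ka a p * ln (real p)) = (\<Sum>n\<in>{m<..k}. c n)"
        unfolding c_def by (rule sum.mono_neutral_cong_left) auto
      finally show ?thesis using th[of v] th[of "real k"] vk vY by linarith
    qed (use R0 in simp)
    have "\<bar>\<Sum>n\<in>{m<..N}. c n * (1 / ln (real n))\<bar> \<le> 2 * R * (1 / ln (real (Suc m)))"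
      using m True by (intro abel_dec part divide_left_mono mult_pos_pos) auto
    also have "(\<Sum>n\<in>{m<..N}. c n * (1 / ln (real n))) = (\<Sum>p\<in>primes_in v Y. Ka a p)"
      unfolding c_def using m by (intro sum.mono_neutral_cong_right) (auto simp: primes_in_def memm memN)
    also have "2 * R * (1 / ln (real (Suc m))) \<le> 2 * R * (1 / ln z)"
      using m z v R0 Zq_ge by (intro mult_left_mono divide_left_mono ln_mono mult_pos_pos) auto
    also have "... \<le> 2 * C2 * u * ((1 - b) * (Y / phq))"
    proof -
      have lz: "ln z > 0" using z Zq_ge by simp
      have "ln Y \<le> ln (z powr u)" using Y by (intro ln_mono) auto
      then have "ln Y / ln z \<le> u" using lz by (simp add: pos_divide_le_eq ln_powr)
      then have "2 * C2 * ((1 - b) * (Y / phq)) * (ln Y / ln z) \<le> 2 * C2 * ((1 - b) * (Y / phq)) * u"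
        using C2_C3_nonneg b Y by (intro mult_left_mono mult_nonneg_nonneg) auto
      then show ?thesis by (simp add: R_def mult_ac)
    qed
    finally show ?thesis .
  qed
qed

lemma prime_lam_le:
  assumes b: "3/4 \<le> b" "b < 1" "Lser b = 0" and z: "z \<ge> Zq" and Y: "0 < Y" "(1 - b) * ln Y \<le> 1"
  shows "(\<Sum>p\<in>primes_in z Y. lam p) \<le> C3 * ((1 - b) * Y)"
proof (cases "z \<le> Y")
  case True
  have "(\<Sum>p\<in>primes_in z Y. lam p) \<le> (\<Sum>p\<in>primes_le Y. lam p)" by (intro sum_mono2) (auto simp: primes_in_def)
  also have "... \<le> C3 * ((1 - b) * Y)" using z True Y by (intro theta_at(2) b) auto
  finally show ?thesis .
next
  case False
  then have "primes_in z Y = {}" by (auto simp: primes_in_def)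
  then show ?thesis using C2_C3_nonneg b Y by simp
qed

text \<open>With w = z^(1/82) the weight \<open>rho\<close> is 1 on the primes concerned, and Y
  \<ge> w^82 absorbs the remainder by doubling the bound: 164 = 2 * 82.\<close>

lemma prime_progression_le:
  assumes t: "coprime t q" and z: "z \<ge> Zq" and Y: "Y > 0"
  shows "(\<Sum>p\<in>primes_in z Y. of_bool [p * t = a] (mod q)) \<le> 164 * exp (real Mc) * (Y / (phq * ln z))"
proof (cases "z \<le> Y")
  case True
  define w where "w = z powr (1/82)"
  have z0: "z \<ge> 1408" using z Zq_ge by linarith
  have wz: "w ^ 82 = z" unfolding w_def using z0 by (simp add: powr_realpow[symmetric] powr_powr)
  have w0: "w \<ge> 0" by (simp add: w_def)
  have "Q0 ^ 82 \<le> w ^ 82" using z Zq_ge(1) unfolding wz by linarith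
  then have "w \<ge> Q0" using Q0_ge w0 by (subst (asm) power_mono_iff) auto
  then have w: "w \<ge> 1408" "real q \<le> w" using Q0_ge by linarith+
  have lw: "ln w > 0" "ln w \<le> w" using w ln_le_minus_one[of w] by auto
  have lz: "ln z = 82 * ln w" unfolding wz[symmetric] using w by (simp add: ln_realpow)
  have ph: "phq > 0" "phq \<le> w" using totient_pos totient_le[of q] w by linarith+
  have "w \<le> z" unfolding wz[symmetric] using w by (intro self_le_power) auto
  then have rho1: "rho q w p = 1" if "p \<in> primes_in z Y" for p using that w by (intro rho_large_prime) (auto simp: primes_in_def)
  have "(\<Sum>p\<in>primes_in z Y. of_bool [p * t = a] (mod q)) = (\<Sum>p\<in>primes_in z Y. of_bool [p * t = a] (mod q) * rho q w p)"
    by (intro sum.cong refl) (simp add: rho1)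
  also have "... \<le> (\<Sum>n\<in>ivl Y. of_bool [n * t = a] (mod q) * rho q w n)"
    by (intro sum_mono2) (auto simp: primes_in_def mem_ivl prime_gt_0_nat Suc_le_eq intro!: mult_nonneg_nonneg rho_nonneg)
  also have "... \<le> exp (real Mc) * (Y / (phq * ln w) + 5 * w ^ 40)"
    using w t Y by (intro sieve_residue_class) auto
  also have "... \<le> exp (real Mc) * (2 * (Y / (phq * ln w)))"
  proof -
    have "5 * w ^ 40 * (phq * ln w) \<le> w * w ^ 40 * (w * w)"
      using w ph lw by (intro mult_mono) auto
    also have "... = w ^ (1 + 40 + 2)" by (simp only: power_add power_one_right power2_eq_square)
    also have "... \<le> w ^ 82" using w by (intro power_increasing) auto
    also have "... \<le> Y" using wz True by simp
    finally have "5 * w ^ 40 \<le> Y / (phq * ln w)" using ph lw by (simp add: pos_le_divide_eq)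
    then have "Y / (phq * ln w) + 5 * w ^ 40 \<le> 2 * (Y / (phq * ln w))" unfolding mult_2 by (rule add_left_mono)
    then show ?thesis by (rule mult_left_mono) simp
  qed
  also have "... = 164 * exp (real Mc) * (Y / (phq * ln z))" unfolding lz by (simp add: mult_ac)
  finally show ?thesis .
next
  case False
  then have "primes_in z Y = {}" by (auto simp: primes_in_def)
  moreover have "ln z > 0" using z Zq_ge by simp
  ultimately show ?thesis using Y by simp
qed

lemma rough_coprime:
  assumes "n \<in> rough_products k x z" "real q \<le> z"
  shows "coprime n q"
proof (rule ccontr)
  assume "\<not> coprime n q"
  then have "gcd n q \<noteq> 1" using coprime_iff_gcd_eq_1 by blast
  then obtain p where p: "prime p" "p dvd gcd n q" using prime_factor_nat by blast
  have "p \<le> q" using p q1 by (intro dvd_imp_le) auto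
  moreover have "z < real p" using assms(1) p by (auto simp: rough_products_iff prime_factors_dvd)
  ultimately show False using assms(2) by simp
qed

text \<open>The new class is \<open>a\<close> times an inverse m' of \<open>m\<close>, and ch m' =
  ch m because both values are 1 or -1.\<close>

lemma Ka_shift:
  assumes m: "coprime m q" and a: "coprime a q"
  obtains a' where "coprime a' q" "\<And>p. Ka a (m * p) = Ka a' p"
proof -
  obtain m' where m': "[m * m' = 1] (mod q)" using cong_solve_coprime_nat[OF m] by auto
  have cm': "coprime m' q"
    using m' by (metis cong_imp_coprime cong_sym coprime_1_left coprime_mult_left_iff)
  define a' where "a' = a * m'"
  have chm: "ch m * ch m' = 1" using chi_cong[OF m'] chi_mult[of m m'] chi_1 by simp
  then have "ch m' = ch m" using chi_vals[of m] chi_vals[of m'] by auto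
  then have cha: "ch a' = ch a * ch m" by (simp add: a'_def chi_mult)
  have res: "[m * p = a] (mod q) \<longleftrightarrow> [p = a'] (mod q)" for p
  proof
    assume "[m * p = a] (mod q)"
    then have "[m * p * m' = a * m'] (mod q)" by (rule cong_scalar_right)
    moreover have "[m * m' * p = 1 * p] (mod q)" using m' by (rule cong_scalar_right)
    ultimately show "[p = a'] (mod q)" unfolding a'_def by (metis cong_sym cong_trans mult.assoc mult.commute mult_1)
  next
    assume "[p = a'] (mod q)"
    then have "[m * p = m * (a * m')] (mod q)" unfolding a'_def by (rule cong_scalar_left)
    moreover have "[m * m' * a = 1 * a] (mod q)" using m' by (rule cong_scalar_right)
    ultimately show "[m * p = a] (mod q)" by (metis cong_trans mult.assoc mult.commute mult_1)
  qed
  show ?thesis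
  proof (rule that)
    show "coprime a' q" using a cm' by (simp add: a'_def)
    fix p
    show "Ka a (m * p) = Ka a' p" using m by (simp add: Ka_def res cha chi_mult mult_ac)
  qed
qed

text \<open>Splitting off the largest prime factor counts every \<open>n\<close> exactly once, so no multiplicities arise.\<close>

lemma rough_kernel:
  assumes a: "coprime a q" and b: "3/4 \<le> b" "b < 1" "Lser b = 0" and z: "z \<ge> Zq" and x: "x = z powr u"
    and small: "(1 - b) * ln x \<le> 1" and u: "u \<ge> 1"
  shows "\<bar>\<Sum>n\<in>rough_products (Suc j) x z. Ka a n\<bar> \<le> 2 * C2 * u * (16 * u) ^ j * ((1 - b) * (x / phq))"
proof -
  have z0: "z \<ge> 1408" "real q \<le> z" using z Zq_ge by linarith+
  have xz: "x \<ge> z" unfolding x using z0 u powr_mono[of 1 u z] by simp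
  have "(\<Sum>n\<in>rough_products (Suc j) x z. Ka a n) = (\<Sum>n\<in>rough_products (Suc j) x z. \<Sum>p\<in>prime_factors n. of_bool (\<forall>r\<in>prime_factors n. r \<le> p) * Ka a n)"
  proof (rule sum.cong[OF refl])
    fix n assume n: "n \<in> rough_products (Suc j) x z"
    have ne: "prime_factors n \<noteq> {}" using card_prime_factors_rough(2)[OF n] by force
    define P where "P = Max (prime_factors n)"
    have P: "P \<in> prime_factors n" unfolding P_def using ne by (intro Max_in) auto
    have "(\<forall>r\<in>prime_factors n. r \<le> p) \<longleftrightarrow> p = P" if "p \<in> prime_factors n" for p
    proof
      assume "\<forall>r\<in>prime_factors n. r \<le> p"
      then have "P \<le> p" using P by blast
      moreover have "p \<le> P" unfolding P_def using that by (intro Max_ge) auto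
      ultimately show "p = P" by simp
    qed (auto simp: P_def)
    then have "(\<Sum>p\<in>prime_factors n. of_bool (\<forall>r\<in>prime_factors n. r \<le> p) * Ka a n) = (\<Sum>p\<in>prime_factors n. if p = P then Ka a n else 0)"
      by (intro sum.cong refl) auto
    then show "Ka a n = (\<Sum>p\<in>prime_factors n. of_bool (\<forall>r\<in>prime_factors n. r \<le> p) * Ka a n)" using P by simp
  qed
  also have "... = (\<Sum>m\<in>rough_products j x z. \<Sum>p\<in>primes_in z (x / real m). of_bool (\<forall>r\<in>prime_factors (m * p). r \<le> p) * Ka a (m * p))"
    by (rule sum_rough_products_Suc)
  also have "\<bar>...\<bar> \<le> (\<Sum>m\<in>rough_products j x z. 2 * C2 * u * ((1 - b) * (x / real m / phq)))"
  proof (rule order_trans[OF sum_abs], rule sum_mono)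
    fix m assume m: "m \<in> rough_products j x z"
    then have m1: "real m \<ge> 1" "m \<noteq> 0" by (auto simp: rough_products_iff)
    obtain a' where a': "coprime a' q" "\<And>p. Ka a (m * p) = Ka a' p"
      by (rule Ka_shift[OF rough_coprime[OF m z0(2)] a], rule that)
    \<comment> \<open>Subtracting 1 turns the strict condition v < p into r \<le> p for the prime
      factors \<open>r\<close> of \<open>m\<close>, so the largest prime factor may be
      repeated.\<close>
    define v where "v = Max (insert z ((\<lambda>r. real r - 1) ` prime_factors m))"
    have vz: "z \<le> v" unfolding v_def by (intro Max_ge) auto
    have mem: "p \<in> primes_in z (x / real m) \<and> (\<forall>r\<in>prime_factors (m * p). r \<le> p) \<longleftrightarrow> p \<in> primes_in v (x / real m)" for p
    proof (cases "prime p")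
      case True
      have "prime_factors (m * p) = insert p (prime_factors m)"
        using m1 True by (simp add: prime_factorization_mult prime_factorization_prime prime_gt_0_nat)
      moreover have "v < real p \<longleftrightarrow> z < real p \<and> (\<forall>r\<in>prime_factors m. real r - 1 < real p)"
        unfolding v_def by (subst Max_less_iff) auto
      moreover have "real r - 1 < real p \<longleftrightarrow> r \<le> p" for r by linarith
      ultimately show ?thesis using True by (auto simp: primes_in_def)
    qed (simp add: primes_in_def)
    have x0: "x > 0" using xz z0 by simp
    note Y = rough_quotient(1,2)[OF m x0 b(2) small] and sm = rough_quotient(3)[OF m x0 b(2) small]
    have "(\<Sum>p\<in>A. of_bool (Q p) * Ka a' p) = (\<Sum>p | p \<in> A \<and> Q p. Ka a' p)" if "finite A" for A Q
      using that by (intro sum.mono_neutral_cong_right) auto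
    then have "(\<Sum>p\<in>primes_in z (x / real m). of_bool (\<forall>r\<in>prime_factors (m * p). r \<le> p) * Ka a (m * p)) = (\<Sum>p\<in>primes_in v (x / real m). Ka a' p)"
      unfolding a'(2) mem[symmetric] by (simp only: finite_primes_in Collect_mem_eq mem)
    also have "\<bar>...\<bar> \<le> 2 * C2 * u * ((1 - b) * (x / real m / phq))"
      using Y x by (intro prime_kernel[OF a'(1) b z vz _ _ sm u]) auto
    finally show "\<bar>\<Sum>p\<in>primes_in z (x / real m). of_bool (\<forall>r\<in>prime_factors (m * p). r \<le> p) * Ka a (m * p)\<bar> \<le> 2 * C2 * u * ((1 - b) * (x / real m / phq))" .
  qed
  also have "... = 2 * C2 * u * ((1 - b) * (x / phq)) * (\<Sum>m\<in>rough_products j x z. 1 / real m)"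
    unfolding sum_distrib_left by (simp add: mult.commute)
  also have "... \<le> 2 * C2 * u * ((1 - b) * (x / phq)) * (16 * u) ^ j"
    using C2_C3_nonneg u b x xz z0 by (intro mult_left_mono sum_recip_rough_le mult_nonneg_nonneg) auto
  finally show ?thesis by (simp only: mult_ac)
qed

text \<open>Each prime reverses the sign up to the error lam p = 1 + ch p. The sum on the right runs
  over distinct primes; the factor \<open>length ps\<close> makes up for repetitions.\<close>

lemma abs_ch_prod_list_le:
  "\<forall>p\<in>set ps. prime p \<Longrightarrow> \<bar>ch (prod_list ps) - (-1) ^ length ps\<bar> \<le> real (length ps) * (\<Sum>p\<in>set ps. lam p)"
proof (induction ps)
  case (Cons p ps)
  define c where "c = ch (prod_list ps)"
  define s where "s = (-1::real) ^ length ps"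
  define S where "S = (\<Sum>p\<in>set (p # ps). lam p)"
  have lp: "lam p = 1 + ch p" using Cons by (simp add: lam_prime)
  have c1: "\<bar>c\<bar> \<le> 1" unfolding c_def by (rule chi_abs_le)
  have S1: "lam p \<le> S" unfolding S_def by (rule member_le_sum) auto
  have S2: "(\<Sum>p\<in>set ps. lam p) \<le> S" unfolding S_def by (rule sum_mono2) auto
  have "ch (prod_list (p # ps)) - (-1) ^ length (p # ps) = lam p * c - (c - s)"
    by (simp add: chi_mult lp c_def s_def algebra_simps)
  moreover have "\<bar>lam p * c\<bar> \<le> lam p * 1" unfolding abs_mult using c1 by (intro mult_mono) auto
  moreover have "\<bar>c - s\<bar> \<le> real (length ps) * S"
    using Cons S2 mult_left_mono[OF S2, of "real (length ps)"] unfolding c_def s_def by simp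
  moreover have "real (length (p # ps)) * S = real (length ps) * S + S" by (simp add: algebra_simps)
  ultimately show ?case unfolding S_def[symmetric] using S1 by linarith
qed (simp add: chi_1)

lemma rough_sign:
  assumes b: "3/4 \<le> b" "b < 1" "Lser b = 0" and z: "z \<ge> Zq" and x: "x = z powr u"
    and small: "(1 - b) * ln x \<le> 1" and u: "u \<ge> 1"
  shows "(\<Sum>n\<in>rough_products (Suc j) x z. \<bar>ch n - (-1) ^ Suc j\<bar>) \<le> real (Suc j) * C3 * (16 * u) ^ j * ((1 - b) * x)"
proof -
  have z0: "z \<ge> 1408" "real q \<le> z" using z Zq_ge by linarith+
  have xz: "x \<ge> z" unfolding x using z0 u powr_mono[of 1 u z] by simp
  have "(\<Sum>n\<in>rough_products (Suc j) x z. \<bar>ch n - (-1) ^ Suc j\<bar>) \<le> (\<Sum>n\<in>rough_products (Suc j) x z. \<Sum>p\<in>prime_factors n. real (Suc j) * lam p)"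
  proof (rule sum_mono)
    fix n assume "n \<in> rough_products (Suc j) x z"
    then have n: "n \<noteq> 0" "size (prime_factorization n) = Suc j" by (auto simp: rough_products_iff)
    obtain ps where ps: "mset ps = prime_factorization n" using ex_mset by blast
    have "prod_list ps = prod_mset (prime_factorization n)" unfolding ps[symmetric] by (simp add: prod_mset_prod_list)
    also have "... = n" using n by (simp add: prod_mset_prime_factorization_nat)
    finally have "prod_list ps = n" .
    moreover have "set ps = prime_factors n" "length ps = Suc j" using ps n(2) by (metis set_mset_mset, metis size_mset)
    ultimately show "\<bar>ch n - (-1) ^ Suc j\<bar> \<le> (\<Sum>p\<in>prime_factors n. real (Suc j) * lam p)"
      using abs_ch_prod_list_le[of ps] unfolding sum_distrib_left[symmetric] by auto
  qed
  also have "... = (\<Sum>m\<in>rough_products j x z. \<Sum>p\<in>primes_in z (x / real m). real (Suc j) * lam p)"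
    by (rule sum_rough_products_Suc)
  also have "... = (\<Sum>m\<in>rough_products j x z. real (Suc j) * (\<Sum>p\<in>primes_in z (x / real m). lam p))"
    by (simp only: sum_distrib_left)
  also have "... \<le> (\<Sum>m\<in>rough_products j x z. real (Suc j) * (C3 * ((1 - b) * (x / real m))))"
  proof (intro sum_mono mult_left_mono)
    fix m assume m: "m \<in> rough_products j x z"
    have x0: "x > 0" using xz z0 by simp
    show "(\<Sum>p\<in>primes_in z (x / real m). lam p) \<le> C3 * ((1 - b) * (x / real m))"
      by (intro prime_lam_le b z rough_quotient[OF m x0 b(2) small])
  qed auto
  also have "... = real (Suc j) * C3 * ((1 - b) * x) * (\<Sum>m\<in>rough_products j x z. 1 / real m)"
    unfolding sum_distrib_left by (simp add: mult.assoc)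
  also have "... \<le> real (Suc j) * C3 * ((1 - b) * x) * (16 * u) ^ j"
    using C2_C3_nonneg u b x xz z0 by (intro mult_left_mono sum_recip_rough_le mult_nonneg_nonneg) auto
  finally show ?thesis by (simp only: mult_ac)
qed

text \<open>One prime is split off and counted by \<open>prime_progression_le\<close>, with its
  cofactor as multiplier. The zero does not enter, so the bound covers the range where (1 - b) ln x
  is large.\<close>

lemma rough_progression_le:
  assumes a: "coprime a q" and z: "z \<ge> Zq" and x: "x = z powr u" and u: "u \<ge> 1"
  shows "real (card {n \<in> rough_products (Suc j) x z. [n = a] (mod q)}) \<le> 164 * exp (real Mc) * (16 * u) ^ j * (x / (phq * ln z))"
proof -
  have z0: "z \<ge> 1408" "real q \<le> z" using z Zq_ge by linarith+
  have xz: "x \<ge> z" unfolding x using z0 u powr_mono[of 1 u z] by simp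
  have lz: "ln z > 0" using z0 by simp
  have "real (card {n \<in> rough_products (Suc j) x z. [n = a] (mod q)}) = (\<Sum>n | n \<in> rough_products (Suc j) x z \<and> [n = a] (mod q). 1)"
    by simp
  also have "... = (\<Sum>n\<in>rough_products (Suc j) x z. of_bool [n = a] (mod q))"
    by (rule sum.mono_neutral_cong_left) auto
  also have "... \<le> (\<Sum>n\<in>rough_products (Suc j) x z. \<Sum>p\<in>prime_factors n. of_bool [n = a] (mod q))"
  proof (rule sum_mono)
    fix n assume "n \<in> rough_products (Suc j) x z"
    then have "1 * (of_bool [n = a] (mod q) :: real) \<le> real (card (prime_factors n)) * of_bool [n = a] (mod q)"
      using card_prime_factors_rough(2) by (intro mult_right_mono) force+
    then show "(of_bool [n = a] (mod q) :: real) \<le> (\<Sum>p\<in>prime_factors n. of_bool [n = a] (mod q))" by simp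
  qed
  also have "... = (\<Sum>m\<in>rough_products j x z. \<Sum>p\<in>primes_in z (x / real m). of_bool [m * p = a] (mod q))"
    by (rule sum_rough_products_Suc)
  also have "... \<le> (\<Sum>m\<in>rough_products j x z. 164 * exp (real Mc) * (x / real m / (phq * ln z)))"
  proof (rule sum_mono)
    fix m assume m: "m \<in> rough_products j x z"
    then have m1: "real m \<ge> 1" "m \<noteq> 0" by (auto simp: rough_products_iff)
    have "0 < x / real m" using m1 xz z0 by auto
    then show "(\<Sum>p\<in>primes_in z (x / real m). of_bool [m * p = a] (mod q)) \<le> 164 * exp (real Mc) * (x / real m / (phq * ln z))"
      using prime_progression_le[OF rough_coprime[OF m z0(2)] z, of "x / real m" a] by (simp add: mult.commute)
  qed
  also have "... = 164 * exp (real Mc) * (x / (phq * ln z)) * (\<Sum>m\<in>rough_products j x z. 1 / real m)"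
    unfolding sum_distrib_left by (simp add: mult_ac)
  also have "... \<le> 164 * exp (real Mc) * (x / (phq * ln z)) * (16 * u) ^ j"
    using u x xz z0 lz by (intro mult_left_mono sum_recip_rough_le mult_nonneg_nonneg) auto
  finally show ?thesis by (simp only: mult_ac)
qed

text \<open>These \<open>n\<close> are prime to \<open>q\<close>, so the indicator of the class is
  \<open>Ka a n\<close> plus (1 + ch a ch n) / phi(q). The kernel is summed by
  \<open>rough_kernel\<close>, and replacing ch n by the sign is \<open>rough_sign\<close>.\<close>

lemma rough_equidistribution:
  assumes a: "coprime a q" and b: "3/4 \<le> b" "b < 1" "Lser b = 0" and z: "z \<ge> Zq" and x: "x = z powr u"
    and small: "(1 - b) * ln x \<le> 1" and u: "u \<ge> 1"
  shows "\<bar>real (card {n \<in> rough_products (Suc j) x z. [n = a] (mod q)}) - (1 + (-1) ^ Suc j * ch a) * (real (card (rough_products (Suc j) x z)) / phq)\<bar>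
    \<le> (2 * C2 * u + real (Suc j) * C3) * (16 * u) ^ j * ((1 - b) * (x / phq))"
proof -
  define R where "R = rough_products (Suc j) x z"
  define \<phi> where "\<phi> = phq"
  have ph: "\<phi> > 0" using totient_pos by (simp add: \<phi>_def)
  have z0: "real q \<le> z" using z Zq_ge by linarith
  have fR: "finite R" by (simp add: R_def)
  define D where "D = (\<Sum>n\<in>R. ch n - (-1) ^ Suc j)"
  have "(\<Sum>n\<in>R. Ka a n) = (\<Sum>n\<in>R. of_bool [n = a] (mod q) - ((1 + (-1) ^ Suc j * ch a) / \<phi> + ch a / \<phi> * (ch n - (-1) ^ Suc j)))"
  proof (rule sum.cong[OF refl])
    fix n assume "n \<in> R"
    then have "coprime n q" unfolding R_def using z0 by (rule rough_coprime)
    then show "Ka a n = of_bool [n = a] (mod q) - ((1 + (-1) ^ Suc j * ch a) / \<phi> + ch a / \<phi> * (ch n - (-1) ^ Suc j))"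
      by (simp add: Ka_def \<phi>_def[symmetric] add_divide_distrib[symmetric] algebra_simps)
  qed
  also have "... = (\<Sum>n\<in>R. of_bool [n = a] (mod q)) - (real (card R) * ((1 + (-1) ^ Suc j * ch a) / \<phi>) + ch a / \<phi> * D)"
    unfolding D_def by (simp only: sum_subtractf sum.distrib sum_distrib_left[symmetric] sum_constant)
  also have "(\<Sum>n\<in>R. of_bool [n = a] (mod q) :: real) = (\<Sum>n\<in>{n\<in>R. [n = a] (mod q)}. 1)"
    using fR by (intro sum.mono_neutral_cong_right) auto
  also have "... = real (card {n\<in>R. [n = a] (mod q)})" by simp
  finally have eq: "real (card {n\<in>R. [n = a] (mod q)}) - (1 + (-1) ^ Suc j * ch a) * (real (card R) / \<phi>) = (\<Sum>n\<in>R. Ka a n) + ch a / \<phi> * D"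
    by (simp add: mult_ac)
  have "\<bar>D\<bar> \<le> real (Suc j) * C3 * (16 * u) ^ j * ((1 - b) * x)"
    unfolding D_def R_def by (rule order_trans[OF sum_abs rough_sign[OF b z x small u]])
  then have "\<bar>D\<bar> / \<phi> \<le> real (Suc j) * C3 * (16 * u) ^ j * ((1 - b) * x) / \<phi>" using ph by (intro divide_right_mono) auto
  moreover have "\<bar>ch a / \<phi> * D\<bar> \<le> \<bar>D\<bar> / \<phi>"
  proof -
    have "\<bar>ch a\<bar> * \<bar>D\<bar> \<le> 1 * \<bar>D\<bar>" by (intro mult_right_mono chi_abs_le) auto
    then show ?thesis using ph by (simp add: abs_mult divide_right_mono)
  qed
  moreover have "\<bar>\<Sum>n\<in>R. Ka a n\<bar> \<le> 2 * C2 * u * (16 * u) ^ j * ((1 - b) * (x / \<phi>))"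
    unfolding R_def \<phi>_def by (rule rough_kernel[OF a b z x small u])
  moreover have split: "(p + r) * s * (v * (x / \<phi>)) = p * s * (v * (x / \<phi>)) + r * s * (v * x) / \<phi>" for p r s v by (simp add: algebra_simps add_divide_distrib)
  ultimately show ?thesis unfolding R_def[symmetric] \<phi>_def[symmetric] eq split by linarith
qed

end

section \<open>Entire continuation by repeated partial summation\<close>

definition mean_psum :: "nat \<Rightarrow> (nat \<Rightarrow> complex) \<Rightarrow> complex" where
  "mean_psum q g = (\<Sum>n<q. \<Sum>k<Suc n. g k) / of_nat q"

text \<open>A discrete antiderivative normalised to mean zero over a period. It is again periodic
  and bounded, so summation by parts can be repeated.\<close>

definition antidiff :: "nat \<Rightarrow> (nat \<Rightarrow> complex) \<Rightarrow> nat \<Rightarrow> complex" where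
  "antidiff q g n = (\<Sum>k<Suc n. g k) - mean_psum q g"

definition mean_zero :: "nat \<Rightarrow> (nat \<Rightarrow> complex) \<Rightarrow> bool" where
  "mean_zero q g \<longleftrightarrow> q > 0 \<and> (\<forall>n. g (n + q) = g n) \<and> (\<Sum>n<q. g n) = 0"

lemma mean_zero_antidiff:
  assumes "mean_zero q g"
  shows "mean_zero q (antidiff q g)"
proof -
  have g: "q > 0" "\<And>n. g (n + q) = g n" "(\<Sum>n<q. g n) = 0" using assms by (auto simp: mean_zero_def)
  have "(\<Sum>k<n + q. g k) = (\<Sum>k<n. g k)" for n by (induction n) (use g in auto)
  from this[of "Suc _"] have "antidiff q g (n + q) = antidiff q g n" for n by (simp add: antidiff_def)
  moreover have "(\<Sum>n<q. antidiff q g n) = 0" using g(1) by (simp add: antidiff_def sum_subtractf mean_psum_def del: sum.lessThan_Suc)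
  ultimately show ?thesis using g by (simp add: mean_zero_def)
qed

lemma mean_zero_funpow: "mean_zero q g \<Longrightarrow> mean_zero q ((antidiff q ^^ r) g)"
  by (induction r) (auto intro: mean_zero_antidiff)

lemma mean_zero_bounded:
  assumes "mean_zero q g"
  shows "norm (g n) \<le> (\<Sum>k<q. norm (g k))"
proof -
  have g: "q > 0" "\<And>n. g (n + q) = g n" using assms by (auto simp: mean_zero_def)
  have "g (n + m * q) = g n" for n m by (induction m) (use g in \<open>auto simp: add.assoc[symmetric] add.commute[of q] add.left_commute\<close>)
  from this[of "n mod q" "n div q"] have "g n = g (n mod q)" by simp
  also have "norm ... \<le> (\<Sum>k<q. norm (g k))" using g(1) by (intro member_le_sum[of "n mod q"]) auto
  finally show ?thesis .
qed

text \<open>The boundary term at infinity vanishes because \<open>antidiff\<close> is bounded; the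
  normalisation leaves \<open>mean_psum q g * h 0\<close> at the other end.\<close>

lemma sums_by_parts:
  assumes g: "mean_zero q g" and h: "h \<longlonglongrightarrow> 0" and B: "(\<lambda>n. antidiff q g n * (h n - h (Suc n))) sums B"
  shows "(\<lambda>n. g n * h n) sums (B + mean_psum q g * h 0)"
proof -
  have part: "(\<Sum>n<N. g n * h n) = (\<Sum>n<N. antidiff q g n * (h n - h (Suc n))) + mean_psum q g * h 0 + ((\<Sum>k<N. g k) - mean_psum q g) * h N" for N
    by (induction N) (simp_all add: antidiff_def algebra_simps)
  have "(\<lambda>N. ((\<Sum>k<N. g k) - mean_psum q g) * h N) \<longlonglongrightarrow> 0"
  proof (rule LIMSEQ_imp_Suc, rule Lim_null_comparison)
    let ?M = "\<Sum>k<q. norm (antidiff q g k)"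
    show "\<forall>\<^sub>F N in sequentially. norm (((\<Sum>k<Suc N. g k) - mean_psum q g) * h (Suc N)) \<le> ?M * norm (h (Suc N))"
      using mean_zero_bounded[OF mean_zero_antidiff[OF g]]
      by (intro always_eventually allI) (simp add: norm_mult mult_right_mono antidiff_def[symmetric] del: sum.lessThan_Suc)
    have "(\<lambda>N. norm (h (Suc N))) \<longlonglongrightarrow> 0" using h LIMSEQ_Suc tendsto_norm_zero by blast
    then show "(\<lambda>N. ?M * norm (h (Suc N))) \<longlonglongrightarrow> 0" by (rule tendsto_mult_right_zero)
  qed
  then have "(\<lambda>N. (\<Sum>n<N. antidiff q g n * (h n - h (Suc n))) + mean_psum q g * h 0 + ((\<Sum>k<N. g k) - mean_psum q g) * h N) \<longlonglongrightarrow> B + mean_psum q g * h 0 + 0"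
    using B by (intro tendsto_add tendsto_const) (auto simp: sums_def)
  then show ?thesis unfolding sums_def part by simp
qed

text \<open>The r-th difference of x^(-s) with step 1, with the sign that summation by parts
  produces.\<close>

fun dpow :: "nat \<Rightarrow> complex \<Rightarrow> complex \<Rightarrow> complex" where
  "dpow 0 s x = x powr (-s)" |
  "dpow (Suc r) s x = dpow r s x - dpow r s (x + 1)"

lemma dpow_has_field_derivative:
  "Re x > 0 \<Longrightarrow> ((\<lambda>x. dpow r s x) has_field_derivative (- s * dpow r (s + 1) x)) (at x)"
proof (induction r arbitrary: x)
  case 0
  then have "x \<notin> \<real>\<^sub>\<le>\<^sub>0" by (auto elim!: nonpos_Reals_cases)
  then have "((\<lambda>x. x powr (-s)) has_field_derivative (-s) * x powr (-s - 1)) (at x)" by (rule has_field_derivative_powr)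
  moreover have "- s - 1 = - (s + 1)" by simp
  ultimately show ?case by (simp only: dpow.simps)
next
  case (Suc r)
  have "((\<lambda>x. dpow r s (x + 1)) has_field_derivative (- s * dpow r (s + 1) (x + 1))) (at x)"
    using Suc.IH[of "x + 1"] Suc.prems DERIV_shift[of "dpow r s" "- s * dpow r (s + 1) (x + 1)" x 1] by simp
  then have "((\<lambda>x. dpow r s x - dpow r s (x + 1)) has_field_derivative (- s * dpow r (s + 1) x - (- s * dpow r (s + 1) (x + 1)))) (at x)"
    using Suc by (intro DERIV_diff) auto
  then show ?case by (simp add: algebra_simps)
qed

text \<open>A difference over a unit step is bounded by the derivative, and differentiation leads
  from s to s + 1 with the factor - s. Each step gains one power of \<open>t\<close> and one factor
  of the product.\<close>

lemma norm_dpow_le: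
  "t \<ge> 1 \<Longrightarrow> Re s + real r \<ge> 0 \<Longrightarrow> norm (dpow r s (of_real t)) \<le> (\<Prod>i<r. norm (s + of_nat i)) * t powr (- Re s - real r)"
proof (induction r arbitrary: s t)
  case 0
  then show ?case by (simp add: norm_powr_real_powr)
next
  case (Suc r)
  define P where "P = (\<Prod>i<r. norm (s + 1 + of_nat i))"
  define S where "S = closed_segment (complex_of_real t) (complex_of_real (t + 1))"
  have S: "\<exists>t'. x = of_real t' \<and> t \<le> t'" if "x \<in> S" for x
  proof -
    obtain v where v: "0 \<le> v" "x = (1 - v) *\<^sub>R complex_of_real t + v *\<^sub>R complex_of_real (t + 1)" using \<open>x \<in> S\<close> by (auto simp: S_def closed_segment_def)
    then have "x = of_real (t + v)" by (simp add: scaleR_conv_of_real algebra_simps)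
    then show ?thesis using v by (intro exI[of _ "t + v"]) auto
  qed
  have "norm (dpow r s (of_real t) - dpow r s (of_real (t + 1))) \<le> norm s * (P * t powr (- Re s - real (Suc r))) * norm (complex_of_real t - complex_of_real (t + 1))"
  proof (rule field_differentiable_bound[of S "dpow r s" "\<lambda>x. - s * dpow r (s + 1) x"])
    show "convex S" by (simp add: S_def)
    show "complex_of_real t \<in> S" "complex_of_real (t + 1) \<in> S" by (auto simp: S_def)
    fix x assume "x \<in> S"
    then obtain t' where t': "x = of_real t'" "t \<le> t'" using S by blast
    show "(dpow r s has_field_derivative - s * dpow r (s + 1) x) (at x within S)"
      by (rule has_field_derivative_at_within[OF dpow_has_field_derivative]) (use t' Suc.prems in auto)
    have "norm (dpow r (s + 1) x) \<le> P * t' powr (- Re (s + 1) - real r)"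
      unfolding P_def t'(1) using Suc.prems t' by (intro Suc.IH) auto
    also have "- Re (s + 1) - real r = - Re s - real (Suc r)" by simp
    also have "P * t' powr (- Re s - real (Suc r)) \<le> P * t powr (- Re s - real (Suc r))"
      using Suc.prems t' unfolding P_def by (intro mult_left_mono powr_mono2' prod_nonneg) auto
    finally show "norm (- s * dpow r (s + 1) x) \<le> norm s * (P * t powr (- Re s - real (Suc r)))"
      by (simp add: norm_mult mult_left_mono)
  qed
  moreover have "norm s * P = (\<Prod>i<Suc r. norm (s + of_nat i))"
    unfolding P_def prod.lessThan_Suc_shift by (simp add: add.assoc)
  ultimately show ?case by (simp add: mult.assoc[symmetric] del: prod.lessThan_Suc)
qed

lemma holomorphic_dpow: "(\<lambda>s. dpow r s (of_nat (Suc n))) holomorphic_on A"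
proof (induction r arbitrary: n)
  case 0
  then show ?case by (auto intro!: holomorphic_intros simp del: of_nat_Suc)
next
  case (Suc r)
  have "(\<lambda>s. dpow r s (of_nat (Suc n)) - dpow r s (of_nat (Suc (Suc n)))) holomorphic_on A"
    by (intro holomorphic_on_diff Suc.IH)
  then show ?case by (simp add: add_ac)
qed

text \<open>Where the series converges absolutely after r summations by parts.\<close>

definition half :: "nat \<Rightarrow> complex set" where "half r = {s. Re s > 1 - real r}"

lemma open_half: "open (half r)"
  unfolding half_def by (simp add: open_halfspace_Re_gt)

definition Lterm :: "nat \<Rightarrow> (nat \<Rightarrow> complex) \<Rightarrow> nat \<Rightarrow> complex \<Rightarrow> nat \<Rightarrow> complex" where
  "Lterm q g r s n = (antidiff q ^^ r) g n * dpow r s (of_nat (Suc n))"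

text \<open>The series after r summations by parts together with the boundary terms split off so
  far.\<close>

definition Lcont :: "nat \<Rightarrow> (nat \<Rightarrow> complex) \<Rightarrow> nat \<Rightarrow> complex \<Rightarrow> complex" where
  "Lcont q g r s = (\<Sum>n. Lterm q g r s n) + (\<Sum>j<r. mean_psum q ((antidiff q ^^ j) g) * dpow j s 1)"

lemma dpow_limit: "s \<in> half r \<Longrightarrow> (\<lambda>n. dpow r s (of_nat (Suc n))) \<longlonglongrightarrow> 0"
proof (rule Lim_null_comparison)
  assume s: "s \<in> half r"
  let ?e = "- Re s - real r"
  have e: "?e < 0" using s by (simp add: half_def)
  show "\<forall>\<^sub>F n in sequentially. norm (dpow r s (of_nat (Suc n))) \<le> (\<Prod>i<r. norm (s + of_nat i)) * real (Suc n) powr ?e"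
    using norm_dpow_le[of "real (Suc _)" s r] e by (intro always_eventually allI) (simp del: of_nat_Suc)
  have "(\<lambda>n. real (Suc n) powr ?e) \<longlonglongrightarrow> 0"
    using e by (intro tendsto_neg_powr filterlim_compose[OF filterlim_real_sequentially filterlim_Suc])
  then show "(\<lambda>n. (\<Prod>i<r. norm (s + of_nat i)) * real (Suc n) powr ?e) \<longlonglongrightarrow> 0" by (rule tendsto_mult_right_zero)
qed

lemma Lterm_majorant:
  assumes g: "mean_zero q g" and s0: "s0 \<in> half r"
  obtains d M where "d > 0" "cball s0 d \<subseteq> half r" "summable M" "\<And>n s. s \<in> cball s0 d \<Longrightarrow> norm (Lterm q g r s n) \<le> M n"
proof -
  define d where "d = (Re s0 + real r - 1) / 2"
  have d: "d > 0" using s0 by (simp add: d_def half_def)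
  define B where "B = (\<Sum>k<q. norm ((antidiff q ^^ r) g k))"
  define K where "K = norm s0 + d + real r"
  define M where "M = (\<lambda>n. B * (K ^ r * real (Suc n) powr (- 1 - d)))"
  have re: "Re s + real r \<ge> 1 + d" if "s \<in> cball s0 d" for s
  proof -
    have "\<bar>Re (s0 - s)\<bar> \<le> d" using that abs_Re_le_cmod[of "s0 - s"] by (simp add: dist_norm)
    then have "Re s \<ge> Re s0 - d" by (simp add: abs_le_iff)
    moreover have "Re s0 + real r = 1 + 2 * d" by (simp add: d_def field_simps)
    ultimately show ?thesis by linarith
  qed
  show ?thesis
  proof (rule that[OF d])
    show "cball s0 d \<subseteq> half r"
    proof
      fix s assume "s \<in> cball s0 d"
      then show "s \<in> half r" using re[of s] d by (simp add: half_def)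
    qed
    have "summable (\<lambda>n. real n powr (- 1 - d))" using d by (subst summable_real_powr_iff) auto
    then have "summable (\<lambda>n. real (Suc n) powr (- 1 - d))" by (subst summable_Suc_iff)
    then show "summable M" unfolding M_def by (intro summable_mult)
    fix n s assume s: "s \<in> cball s0 d"
    have "norm (dpow r s (of_nat (Suc n))) \<le> (\<Prod>i<r. norm (s + of_nat i)) * real (Suc n) powr (- Re s - real r)"
      using norm_dpow_le[of "real (Suc n)" s r] re[OF s] d by (simp del: of_nat_Suc)
    also have "... \<le> K ^ r * real (Suc n) powr (- 1 - d)"
    proof (intro mult_mono powr_mono)
      have "(\<Prod>i<r. norm (s + of_nat i)) \<le> (\<Prod>i<r. K)"
      proof (intro prod_mono conjI)
        fix i assume i: "i \<in> {..<r}"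
        have "norm (s + of_nat i) \<le> norm s + norm (of_nat i :: complex)" by (rule norm_triangle_ineq)
        moreover have "norm s \<le> norm s0 + d" using s norm_triangle_ineq2[of s s0] by (simp add: dist_norm norm_minus_commute)
        ultimately show "norm (s + of_nat i) \<le> K" using i by (simp add: K_def)
      qed simp
      then show "(\<Prod>i<r. norm (s + of_nat i)) \<le> K ^ r" by simp
      show "- Re s - real r \<le> - 1 - d" using re[OF s] by linarith
      show "0 \<le> K ^ r" using d by (simp add: K_def)
    qed auto
    finally show "norm (Lterm q g r s n) \<le> M n"
      unfolding Lterm_def norm_mult M_def B_def using mean_zero_bounded[OF mean_zero_funpow[OF g]]
      by (intro mult_mono) (auto intro: sum_nonneg)
  qed
qed

lemma summable_Lterm: "mean_zero q g \<Longrightarrow> s \<in> half r \<Longrightarrow> summable (Lterm q g r s)"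
  by (erule Lterm_majorant, assumption) (rule summable_comparison_test', auto)

text \<open>One summation by parts. The limit is a hypothesis so that the lemma reaches beyond
  \<open>half r\<close>: with r = 0 it gives the convergent series for all real s > 0.\<close>

lemma Lterm_sums:
  assumes g: "mean_zero q g" and s: "s \<in> half (Suc r)" and lim: "(\<lambda>n. dpow r s (of_nat (Suc n))) \<longlonglongrightarrow> 0"
  shows "Lterm q g r s sums (Lcont q g (Suc r) s - (\<Sum>j<r. mean_psum q ((antidiff q ^^ j) g) * dpow j s 1))"
proof -
  let ?g = "(antidiff q ^^ r) g"
  have "Lterm q g (Suc r) s = (\<lambda>n. antidiff q ?g n * (dpow r s (of_nat (Suc n)) - dpow r s (of_nat (Suc (Suc n)))))"
    by (simp add: Lterm_def fun_eq_iff add_ac)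
  then have "(\<lambda>n. ?g n * dpow r s (of_nat (Suc n))) sums ((\<Sum>n. Lterm q g (Suc r) s n) + mean_psum q ?g * dpow r s (of_nat (Suc 0)))"
    using summable_sums[OF summable_Lterm[OF g s]] by (intro sums_by_parts mean_zero_funpow g lim) simp
  then show ?thesis by (simp add: Lcont_def Lterm_def[abs_def])
qed

lemma Lcont_Suc:
  assumes g: "mean_zero q g" and s: "s \<in> half r"
  shows "Lcont q g (Suc r) s = Lcont q g r s"
proof -
  have "s \<in> half (Suc r)" using s by (simp add: half_def)
  from sums_unique[OF Lterm_sums[OF g this dpow_limit[OF s]]] show ?thesis by (simp add: Lcont_def)
qed

lemma Lcont_mono:
  assumes g: "mean_zero q g" and s: "s \<in> half r" and "r \<le> r'"
  shows "Lcont q g r' s = Lcont q g r s"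
  using assms(3)
proof (induction r' rule: dec_induct)
  case (step n)
  then have "s \<in> half n" using s by (simp add: half_def)
  then show ?case using step Lcont_Suc[OF g] by simp
qed simp

lemma holomorphic_Lcont:
  assumes g: "mean_zero q g"
  shows "Lcont q g r holomorphic_on half r"
proof -
  have "(\<lambda>s. \<Sum>n. Lterm q g r s n) holomorphic_on half r"
  proof (rule holomorphic_uniform_sequence[OF open_half])
    show "(\<lambda>s. \<Sum>n<N. Lterm q g r s n) holomorphic_on half r" for N
      unfolding Lterm_def by (intro holomorphic_intros holomorphic_dpow)
    fix s0 assume "s0 \<in> half r"
    then obtain d M where d: "d > 0" "cball s0 d \<subseteq> half r" "summable M" "\<And>n s. s \<in> cball s0 d \<Longrightarrow> norm (Lterm q g r s n) \<le> M n"
      using Lterm_majorant[OF g] by blast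
    have "uniform_limit (cball s0 d) (\<lambda>N s. \<Sum>n<N. Lterm q g r s n) (\<lambda>s. \<Sum>n. Lterm q g r s n) sequentially"
      using d(3,4) by (intro Weierstrass_m_test)
    then show "\<exists>d>0. cball s0 d \<subseteq> half r \<and> uniform_limit (cball s0 d) (\<lambda>N s. \<Sum>n<N. Lterm q g r s n) (\<lambda>s. \<Sum>n. Lterm q g r s n) sequentially"
      using d by blast
  qed
  moreover have "(\<lambda>s. dpow j s 1) holomorphic_on half r" for j using holomorphic_dpow[of j 0 "half r"] by simp
  ultimately show ?thesis unfolding Lcont_def[abs_def] by (intro holomorphic_intros)
qed

text \<open>The number of summations is large enough for \<open>s\<close> to lie in the
  corresponding half-plane; \<open>Lcont_mono\<close> makes the value independent of this
  choice.\<close>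

definition Lentire :: "nat \<Rightarrow> (nat \<Rightarrow> complex) \<Rightarrow> complex \<Rightarrow> complex" where
  "Lentire q g s = Lcont q g (nat \<lceil>2 - Re s\<rceil>) s"

lemma Lentire_eq:
  assumes g: "mean_zero q g" and s: "s \<in> half r"
  shows "Lentire q g s = Lcont q g r s"
proof -
  define r0 where "r0 = nat \<lceil>2 - Re s\<rceil>"
  have "s \<in> half r0" unfolding half_def r0_def by simp linarith
  then have "Lcont q g r0 s = Lcont q g r s"
    using Lcont_mono[OF g s, of r0] Lcont_mono[OF g, of s r0 r] by (metis nat_le_linear)
  then show ?thesis by (simp add: Lentire_def r0_def)
qed

lemma continues_Lentire:
  assumes g: "mean_zero q g" and chi: "\<And>n. g n = chi (int (Suc n))"
  shows "continues_dirichlet_series chi (Lentire q g)"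
  unfolding continues_dirichlet_series_def
proof (intro conjI allI impI)
  have "Lentire q g holomorphic_on half r" for r
    using holomorphic_Lcont[OF g] Lentire_eq[OF g] by (subst holomorphic_cong[OF refl]) auto
  then have "Lentire q g holomorphic_on (\<Union>r. half r)" using open_half by (intro holomorphic_on_UN_open) auto
  moreover have "(\<Union>r. half r) = UNIV"
  proof -
    have "s \<in> half (nat \<lceil>2 - Re s\<rceil>)" for s unfolding half_def by simp linarith
    then show ?thesis by blast
  qed
  ultimately have "Lentire q g holomorphic_on UNIV" by simp
  then have "Lentire q g analytic_on UNIV" by (simp add: analytic_on_open)
  then show "Lentire q g nicely_meromorphic_on UNIV" by (rule analytic_on_imp_nicely_meromorphic_on)
  fix s :: complex assume "Re s > 1"
  then have s: "s \<in> half 0" by (simp add: half_def)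
  have "Lterm q g 0 s sums (\<Sum>n. Lterm q g 0 s n)" by (intro summable_sums summable_Lterm g s)
  moreover have "(\<Sum>n. Lterm q g 0 s n) = Lentire q g s" using Lentire_eq[OF g s] by (simp add: Lcont_def)
  moreover have "Lterm q g 0 s = (\<lambda>n. chi (int (Suc n)) / of_nat (Suc n) powr s)"
    by (simp add: Lterm_def chi fun_eq_iff powr_minus_divide del: of_nat_Suc)
  ultimately show "(\<lambda>n. chi (int (Suc n)) / of_nat (Suc n) powr s) sums Lentire q g s" by simp
qed

text \<open>The series is tied to \<open>dirichlet_L\<close> by definition only for Re s > 1. One
  summation by parts extends the agreement with the continued function to the conditionally
  convergent series at all real s > 0.\<close>

lemma (in rchar) dirichlet_L_eq_Lser:
  assumes chi: "\<And>n. chi (int n) = complex_of_real (ch n)" and s: "s > 0"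
  shows "dirichlet_L chi (complex_of_real s) = complex_of_real (Lser s)"
proof -
  define g where "g = (\<lambda>n. complex_of_real (ch (Suc n)))"
  have "(\<Sum>n<q. ch (Suc n)) = (\<Sum>n<Suc q. ch n) - ch 0" by (simp only: sum.lessThan_Suc_shift)
  also have "... = 0" using sum_chi per[of 0] by simp
  finally have g: "mean_zero q g" unfolding mean_zero_def g_def using q1 per[of "Suc _"] by (auto simp del: of_real_sum simp: of_real_sum[symmetric])
  have "dirichlet_L chi = Lentire q g"
    by (intro dirichlet_L_eqI continues_Lentire g) (simp add: g_def chi del: of_nat_Suc)
  moreover have h: "complex_of_real s \<in> half (Suc 0)" using s by (simp add: half_def)
  moreover have "Lterm q g 0 (of_real s) = (\<lambda>n. complex_of_real (ch (Suc n) * real (Suc n) powr (- s)))"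
    unfolding Lterm_def g_def fun_eq_iff using powr_of_real[of "real (Suc _)" "- s"] by (simp del: of_nat_Suc)
  moreover have "(\<lambda>n. complex_of_real (ch (Suc n) * real (Suc n) powr (- s))) sums complex_of_real (Lser s)"
    using Lser_sums_tail(1)[OF s] by (rule sums_of_real)
  moreover have "(\<lambda>n. dpow 0 (of_real s) (of_nat (Suc n))) \<longlonglongrightarrow> 0"
  proof -
    have "(\<lambda>n. real (Suc n) powr (- s)) \<longlonglongrightarrow> 0"
      using s by (intro tendsto_neg_powr filterlim_compose[OF filterlim_real_sequentially filterlim_Suc]) auto
    then have "(\<lambda>n. complex_of_real (real (Suc n) powr (- s))) \<longlonglongrightarrow> of_real 0" by (rule tendsto_of_real)
    then show ?thesis using powr_of_real[of "real (Suc _)" "- s"] by (simp del: of_nat_Suc)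
  qed
  ultimately show ?thesis using Lterm_sums[OF g h] Lentire_eq[OF g h] by (simp add: sums_iff)
qed

section \<open>The asymptotic formula\<close>

lemma dirichlet_character_periodic:
  assumes "dirichlet_character q chi"
  shows "chi (n + int q * j) = chi n"
proof (induction j rule: int_induct[where k = 0])
  case (step1 i)
  have "chi (n + int q * (i + 1)) = chi (n + int q * i + int q)" by (simp add: algebra_simps)
  then show ?case using assms step1 by (simp only: dirichlet_character_def)
next
  case (step2 i)
  have "chi (n + int q * i) = chi (n + int q * (i - 1) + int q)" by (simp add: algebra_simps)
  then show ?case using assms step2 by (simp only: dirichlet_character_def)
qed simp

text \<open>For q > 1 the principal character is induced from modulus 1, so a primitive one has a
  value other than 1 at some unit n0, and multiplication by n0 shows that the sum over a period
  vanishes. Euler's theorem makes the values at units real roots of unity.\<close>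

lemma primitive_real_character:
  assumes q: "q > 1" and prim: "primitive_character q chi" and re: "real_character chi"
  shows "rchar q (\<lambda>n. Re (chi (int n)))" "chi n = complex_of_real (Re (chi n))"
proof -
  have dc: "dirichlet_character q chi" using prim by (simp add: primitive_character_def)
  then have per: "\<And>n. chi (n + int q) = chi n" and mult: "\<And>m n. chi (m * n) = chi m * chi n" and nz: "\<And>n. chi n \<noteq> 0 \<longleftrightarrow> coprime n (int q)"
    by (auto simp: dirichlet_character_def)
  show R: "chi n = complex_of_real (Re (chi n))" for n using re by (simp add: real_character_def)
  define ch where "ch = (\<lambda>n. Re (chi (int n)))"
  have chC: "chi (int n) = complex_of_real (ch n)" for n unfolding ch_def by (rule R)
  have chper: "ch (n + q) = ch n" for n using per[of "int n"] by (simp add: ch_def)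
  have chmult: "ch (m * n) = ch m * ch n" for m n
  proof -
    have "complex_of_real (ch (m * n)) = complex_of_real (ch m * ch n)" using mult[of "int m" "int n"] by (simp add: chC[symmetric])
    then show ?thesis by (simp only: of_real_eq_iff)
  qed
  have "ch n \<noteq> 0 \<longleftrightarrow> coprime n q" for n using nz[of "int n"] by (simp add: chC coprime_int_iff)
  then have chz: "ch n = 0 \<longleftrightarrow> \<not> coprime n q" for n by blast
  have ch1: "ch 1 = 1" using chmult[of 1 1] chz[of 1] by simp
  have chpow: "ch (n ^ m) = ch n ^ m" for n m by (induction m) (simp_all add: chmult ch1[unfolded One_nat_def])
  have chk: "ch (n + m * q) = ch n" for n m
    by (induction m) (use chper in \<open>auto simp: add.assoc[symmetric] add.commute[of q] add.left_commute\<close>)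
  have chmod: "ch n = ch (n mod q)" for n using chk[of "n mod q" "n div q"] by simp
  have chvals: "ch n \<in> {-1, 0, 1}" for n
  proof (cases "coprime n q")
    case True
    have tp: "totient q > 0" using q by simp
    have "[n ^ totient q = 1] (mod q)" by (rule euler_theorem[OF True])
    then have "ch (n ^ totient q) = ch 1" using chmod[of "n ^ totient q"] chmod[of 1] by (simp add: cong_def)
    then have "ch n ^ totient q = 1" by (simp add: chpow ch1[unfolded One_nat_def])
    then have "\<bar>ch n\<bar> ^ totient q = 1" by (simp add: power_abs[symmetric])
    then have "\<bar>ch n\<bar> = 1" using tp power_eq_iff_eq_base[of "totient q" "\<bar>ch n\<bar>" 1] by simp
    then show ?thesis by (auto simp: abs_if split: if_splits)
  qed (use chz in auto)
  have "\<exists>n0. coprime n0 q \<and> ch n0 \<noteq> 1"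
  proof (rule ccontr)
    assume "\<not> ?thesis"
    then have one: "ch n = 1" if "coprime n q" for n using that by blast
    have "chi n = 1" if n: "coprime n (int q)" for n
    proof -
      define m where "m = nat (n mod int q)"
      have m: "int m = n mod int q" using q by (simp add: m_def)
      have cm: "chi n = chi (int m)" using dirichlet_character_periodic[OF dc, of "int m" "n div int q"] by (simp add: m)
      have "coprime (int m) (int q)" using n nz[of n] nz[of "int m"] unfolding cm by blast
      then have "coprime m q" by (simp only: coprime_int_iff)
      then show ?thesis unfolding cm using one[of m] by (simp add: chC)
    qed
    moreover have "dirichlet_character 1 (\<lambda>_. 1)" by (simp add: dirichlet_character_def)
    ultimately have "\<exists>d \<psi>. d dvd q \<and> d < q \<and> dirichlet_character d \<psi> \<and> (\<forall>n. coprime n (int q) \<longrightarrow> chi n = \<psi> n)"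
      using q by (intro exI[of _ 1] exI[of _ "\<lambda>_. 1"]) auto
    then show False using prim by (simp add: primitive_character_def)
  qed
  then obtain n0 where n0: "coprime n0 q" "ch n0 \<noteq> 1" by blast
  have "(\<Sum>n<q. ch (n0 * n)) = (\<Sum>n<q. ch n)" using q by (intro sum_mult_residues[where f = ch] chper n0) auto
  then have "ch n0 * (\<Sum>n<q. ch n) = (\<Sum>n<q. ch n)" by (simp add: chmult sum_distrib_left)
  then have "(\<Sum>n<q. ch n) = 0" using n0(2) by simp
  then have "rchar q ch" using q chper chmult chvals chz by unfold_locales auto
  then show "rchar q (\<lambda>n. Re (chi (int n)))" by (simp add: ch_def)
qed

text \<open>
  \<open>Kmain\<close> serves the case \<open>(1 - b) ln x \<le> 1\<close>, \<open>Kbig\<close> the case \<open>(1 - b) ln x > 1\<close>, where \<open>\<Delta> > 1\<close> and an upper bound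
  sieve suffices, and \<open>Ksmall\<close> the case \<open>z < Z\<close>, where \<open>q\<close> is bounded and hence \<open>\<Delta>\<close> is bounded below.
\<close>

definition Kmain :: "real \<Rightarrow> nat \<Rightarrow> real" where
  "Kmain u j = (2 * C2 * u + real (Suc j) * C3) * (16 * u) ^ j"
definition Kbig :: "real \<Rightarrow> nat \<Rightarrow> real" where
  "Kbig u j = 164 * exp (real Mc) * (16 * u) ^ j"
definition Ksmall :: "real \<Rightarrow> real" where
  "Ksmall Z = (Z + 2) * (256 * Z * (1408 * Z\<^sup>2) ^ 8)"

definition Kall :: "real \<Rightarrow> nat \<Rightarrow> real \<Rightarrow> real \<Rightarrow> real" where
  "Kall u j c Z = Kmain u j / c + (Kbig u j * u / c + 2) + Ksmall Z"

lemma (in rchar) rough_products_equidistributed: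
  assumes a: "coprime a q" and b: "b < 1" "b > 0 \<Longrightarrow> Lser b = 0" and z: "z \<ge> Zq" and x: "x = z powr u" and u: "u \<ge> 1"
    and D: "(1 - b) * ln x \<le> \<Delta>" and cZ: "c > 0" "Z \<ge> 2"
    and low: "z \<ge> Z \<Longrightarrow> real (card (rough_products (Suc j) x z)) \<ge> c * (x / ln x)"
  shows "\<exists>E. \<bar>E\<bar> \<le> Kall u j c Z * \<Delta> \<and>
    real (card {n \<in> rough_products (Suc j) x z. [n = a] (mod q)}) = (1 + (-1) ^ Suc j * ch a + E) * (real (card (rough_products (Suc j) x z)) / phq)"
proof -
  define N where "N = real (card (rough_products (Suc j) x z))"
  define Na where "Na = real (card {n \<in> rough_products (Suc j) x z. [n = a] (mod q)})"
  define \<phi> where "\<phi> = phq"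
  define T where "T = 1 + (-1) ^ Suc j * ch a"
  have ph: "\<phi> > 0" "\<phi> \<le> real q" using totient_pos totient_le[of q] by (auto simp: \<phi>_def)
  have NaN: "0 \<le> Na" "Na \<le> N" unfolding Na_def N_def by (auto intro!: card_mono)
  have T2: "\<bar>T\<bar> \<le> 2"
  proof -
    have "\<bar>(-1) ^ Suc j * ch a\<bar> \<le> 1" unfolding abs_mult using chi_abs_le[of a] by (simp add: power_abs)
    then show ?thesis unfolding T_def by linarith
  qed
  have z0: "z \<ge> 1408" "real q \<le> z" using z Zq_ge by linarith+
  have xz: "x \<ge> z" unfolding x using z0 u powr_mono[of 1 u z] by simp
  \<comment> \<open>The bound ln x \<ge> 4 forces b \<ge> 3/4 as soon as (1 - b) ln x \<le>
    1.\<close>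
  have "exp 4 = exp (1::real) ^ 4" by (simp add: exp_of_nat_mult[symmetric])
  also have "... \<le> 3 ^ 4" using exp_le by (intro power_mono) auto
  finally have "exp 4 \<le> x" using xz z0 by simp
  then have lx: "ln x \<ge> 4" using xz z0 by (subst ln_ge_iff) auto
  have lz: "ln z > 0" "ln x = u * ln z" using z0 by (auto simp: x ln_powr)
  have K0: "0 \<le> Kmain u j / c" "0 \<le> Kbig u j * u / c + 2" "0 \<le> Ksmall Z"
    using C2_C3_nonneg u cZ by (auto simp: Kmain_def Kbig_def Ksmall_def intro!: divide_nonneg_nonneg mult_nonneg_nonneg add_nonneg_nonneg)
  have D0: "\<Delta> \<ge> 0" using D b lx by (smt (verit) mult_nonneg_nonneg)
  have big: "y \<le> Kall u j c Z * \<Delta>"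
    if "y \<le> Kmain u j / c * \<Delta> \<or> y \<le> (Kbig u j * u / c + 2) * \<Delta> \<or> y \<le> Ksmall Z * \<Delta>" for y
    unfolding Kall_def distrib_right using that K0 D0 mult_nonneg_nonneg[OF K0(1) D0] mult_nonneg_nonneg[OF K0(2) D0] mult_nonneg_nonneg[OF K0(3) D0]
    unfolding distrib_right by linarith
  show ?thesis
  proof (cases "N = 0")
    case True
    then have "Na = 0" using NaN by simp
    then show ?thesis using True big[of 0] mult_nonneg_nonneg[OF K0(1) D0] by (intro exI[of _ 0]) (simp add: N_def Na_def)
  next
    case False
    then have N0: "N > 0" using NaN by linarith
    define E where "E = Na * \<phi> / N - T"
    have eq: "Na = (T + E) * (N / \<phi>)" using N0 ph by (simp add: E_def)
    have E1: "\<bar>E\<bar> \<le> Na * \<phi> / N + 2"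
    proof -
      have "Na * \<phi> / N \<ge> 0" using NaN ph N0 by (intro divide_nonneg_nonneg mult_nonneg_nonneg) auto
      then show ?thesis unfolding E_def using T2 by linarith
    qed
    have "\<bar>E\<bar> \<le> Kmain u j / c * \<Delta> \<or> \<bar>E\<bar> \<le> (Kbig u j * u / c + 2) * \<Delta> \<or> \<bar>E\<bar> \<le> Ksmall Z * \<Delta>"
    proof (cases "z \<ge> Z")
      case True
      \<comment> \<open>The lower bound for \<open>N\<close> converts the error (1 - b) x into (1 -
        b) ln x \<le> \<Delta> relative to \<open>N\<close>.\<close>
      have lowN: "x \<le> N * ln x / c" using low[OF True] cZ lx unfolding N_def[symmetric] by (simp add: field_simps)
      show ?thesis
      proof (cases "(1 - b) * ln x \<le> 1")
        case small: True
        have "(1 - b) * 4 \<le> (1 - b) * ln x" using b lx by (intro mult_left_mono) auto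
        then have "(1 - b) * 4 \<le> 1" using small by (rule order_trans)
        then have b34: "3/4 \<le> b" by simp
        have "\<bar>Na - T * (N / \<phi>)\<bar> \<le> Kmain u j * ((1 - b) * (x / \<phi>))"
          unfolding Na_def T_def N_def \<phi>_def Kmain_def
          by (rule rough_equidistribution[OF a b34 b(1) b(2) z x small u]) (use b34 in auto)
        also have "... \<le> Kmain u j * ((1 - b) * (N * ln x / c / \<phi>))"
          using lowN b ph C2_C3_nonneg u by (intro mult_left_mono divide_right_mono) (auto simp: Kmain_def)
        finally have "\<bar>Na - T * (N / \<phi>)\<bar> * (\<phi> / N) \<le> Kmain u j * ((1 - b) * (N * ln x / c / \<phi>)) * (\<phi> / N)"
          using ph N0 by (intro mult_right_mono) auto
        moreover have "\<bar>E\<bar> = \<bar>Na - T * (N / \<phi>)\<bar> * (\<phi> / N)"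
        proof -
          have "E = (Na - T * (N / \<phi>)) * (\<phi> / N)" using ph N0 by (simp add: E_def field_simps)
          then show ?thesis using ph N0 by (simp add: abs_mult)
        qed
        moreover have "Kmain u j * ((1 - b) * (N * ln x / c / \<phi>)) * (\<phi> / N) = Kmain u j / c * ((1 - b) * ln x)"
          using ph N0 cZ by simp
        moreover have "Kmain u j / c * ((1 - b) * ln x) \<le> Kmain u j / c * \<Delta>" using D K0 by (intro mult_left_mono) auto
        ultimately show ?thesis by linarith
      next
        case large: False
        then have D1: "\<Delta> \<ge> 1" using D by linarith
        have "Na \<le> Kbig u j * (x / (\<phi> * ln z))"
          unfolding Na_def \<phi>_def Kbig_def by (rule rough_progression_le[OF a z x u])
        also have "... \<le> Kbig u j * (N * ln x / c / (\<phi> * ln z))"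
          using lowN ph lz u by (intro mult_left_mono divide_right_mono) (auto simp: Kbig_def)
        finally have "Na * \<phi> / N \<le> Kbig u j * (N * ln x / c / (\<phi> * ln z)) * \<phi> / N" using ph N0 by (intro divide_right_mono mult_right_mono) auto
        also have "... = Kbig u j * u / c" using ph N0 cZ lz by simp
        finally have "\<bar>E\<bar> \<le> (Kbig u j * u / c + 2) * 1" unfolding mult_1_right by (intro order_trans[OF E1] add_right_mono)
        also have "... \<le> (Kbig u j * u / c + 2) * \<Delta>" using D1 K0 by (intro mult_left_mono) auto
        finally show ?thesis by blast
      qed
    next
      case False
      have qZ: "real q \<le> Z" "real q \<ge> 1" using z0 False q1 by auto
      have "Na * \<phi> / N \<le> 1 * \<phi>" using NaN N0 ph by (simp add: divide_le_eq mult.commute)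
      then have E2: "\<bar>E\<bar> \<le> Z + 2" using E1 ph qZ by linarith
      \<comment> \<open>The vanishing of \<open>Lser b\<close> is available for b > 0; for b \<le> 0
        the gap is at least 1 anyway.\<close>
      have "1 / (128 * real q * Q0) \<le> 1 - b"
      proof (cases "b > 0")
        case True
        then show ?thesis using b by (intro zero_gap) auto
      next
        case False
        have "128 * real q * Q0 \<ge> 1 * 1" using qZ Q0_ge by (intro mult_mono) auto
        then have "1 / (128 * real q * Q0) \<le> 1" by simp
        then show ?thesis using False by linarith
      qed
      moreover have "1 / (128 * Z * (1408 * Z\<^sup>2) ^ 8) \<le> 1 / (128 * real q * Q0)"
        unfolding Q0_def using qZ by (intro divide_left_mono mult_mono power_mono mult_pos_pos zero_less_power) auto
      ultimately have gap: "1 / (128 * Z * (1408 * Z\<^sup>2) ^ 8) \<le> 1 - b" by linarith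
      define G where "G = 128 * Z * (1408 * Z\<^sup>2) ^ 8"
      have G0: "G > 0" using cZ by (simp add: G_def)
      have "1 / G * 1 \<le> (1 - b) * ln x" using gap lx b unfolding G_def[symmetric] by (intro mult_mono) auto
      then have "1 / G \<le> \<Delta>" using D unfolding mult_1_right by (rule order_trans)
      then have "1 \<le> G * \<Delta>" using G0 by (simp add: divide_le_eq mult.commute)
      then have "(Z + 2) * 1 \<le> (Z + 2) * (2 * G * \<Delta>)" using cZ by (intro mult_left_mono) auto
      then have "\<bar>E\<bar> \<le> Ksmall Z * \<Delta>" using E2 unfolding Ksmall_def G_def by (simp add: mult_ac)
      then show ?thesis by blast
    qed
    then have "\<bar>E\<bar> \<le> Kall u j c Z * \<Delta>" by (rule big)
    then show ?thesis using eq unfolding Na_def N_def T_def \<phi>_def by blast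
  qed
qed

text \<open>13 = 11 + 2, from 1408 \<le> 2^11 \<le> q^11 and the square of q; the other factors are
  the exponents in \<open>Q0\<close> and \<open>Zq\<close>.\<close>

definition expo :: nat where "expo = 13 * (8 * (2 ^ Mc * 1000))"

lemma (in rchar) Zq_le: "Zq \<le> real q powr real expo"
proof -
  have q2: "real q \<ge> 2" using q1 by simp
  have "1408 * (real q)\<^sup>2 \<le> 2 ^ 11 * (real q)\<^sup>2" by (intro mult_right_mono) auto
  also have "... \<le> real q ^ 11 * (real q)\<^sup>2" using q2 by (intro mult_right_mono power_mono) auto
  also have "... = real q ^ 13" by (simp add: power_add[symmetric])
  finally have "(1408 * (real q)\<^sup>2) ^ (8 * (2 ^ Mc * 1000)) \<le> (real q ^ 13) ^ (8 * (2 ^ Mc * 1000))" by (intro power_mono) auto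
  then have "Zq \<le> real q ^ expo" unfolding Zq_def Q0_def expo_def by (simp only: power_mult)
  then show ?thesis using q2 by (simp add: powr_realpow)
qed

definition asymptotic_bound :: "real \<Rightarrow> real \<Rightarrow> nat \<Rightarrow> real \<Rightarrow> bool" where
  "asymptotic_bound A u k C \<longleftrightarrow> C > 0 \<and> (\<forall>(q::nat) chi \<beta> z x \<Delta> a.
     q > 1 \<longrightarrow> primitive_character q chi \<longrightarrow> real_character chi \<longrightarrow> dirichlet_L chi (complex_of_real \<beta>) = 0 \<longrightarrow>
     z \<ge> real q powr A \<longrightarrow> x = z powr u \<longrightarrow> \<Delta> > 0 \<longrightarrow> (1 - \<beta>) * ln x \<le> \<Delta> \<longrightarrow> coprime a (int q) \<longrightarrow>
     (\<exists>E. \<bar>E\<bar> \<le> C * \<Delta> \<and> real (pi_progression k x z q a) =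
        (1 + (-1) ^ k * Re (chi a) + E) * (real (pi_coprime k q x z) / real (totient q))))"

lemma asymptotic_bound_exists:
  assumes k: "k > 0" "real k < u"
  shows "\<exists>C. asymptotic_bound (real expo) u k C"
proof -
  obtain j where j: "k = Suc j" using k by (cases k) auto
  have u: "u \<ge> 1" using k by linarith
  obtain c Z where cZ: "c > 0" "Z \<ge> 2" and low: "\<And>z. z \<ge> Z \<Longrightarrow> real (card (rough_products k (z powr u) z)) \<ge> c * (z powr u / ln (z powr u))"
    using card_rough_products_ge[OF k] by blast
  define C where "C = max 1 (Kall u j c Z)"
  show ?thesis
    unfolding asymptotic_bound_def
  proof (rule exI[of _ C], intro conjI allI impI)
    show "C > 0" by (simp add: C_def)
    fix q :: nat and chi :: "int \<Rightarrow> complex" and \<beta> z x \<Delta> :: real and a :: int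
    assume q: "q > 1" and prim: "primitive_character q chi" and re: "real_character chi" and L0: "dirichlet_L chi (complex_of_real \<beta>) = 0"
      and z: "z \<ge> real q powr real expo" and x: "x = z powr u" and D: "\<Delta> > 0" "(1 - \<beta>) * ln x \<le> \<Delta>" and a: "coprime a (int q)"
    define ch where "ch = (\<lambda>n. Re (chi (int n)))"
    interpret rchar q ch unfolding ch_def by (rule primitive_real_character(1)[OF q prim re])
    have chC: "chi (int n) = complex_of_real (ch n)" for n unfolding ch_def by (rule primitive_real_character(2)[OF q prim re])
    have Lz: "Lser \<beta> = 0" if "\<beta> > 0" using L0 dirichlet_L_eq_Lser[of chi \<beta>, OF chC that] by simp
    \<comment> \<open>L(1, chi) is positive and L has no real zero beyond 1.\<close>
    have b1: "\<beta> < 1"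
    proof (rule ccontr)
      assume "\<not> \<beta> < 1"
      then consider "\<beta> = 1" | "\<beta> > 1" by linarith
      then show False
      proof cases
        case 1
        then show False using Lz L1_pos by (simp add: L1_def)
      next
        case 2
        then show False using Lz Lser_nonzero_gt1[of \<beta>] by simp
      qed
    qed
    define a' where "a' = nat (a mod int q)"
    have a': "int a' = a mod int q" using q by (simp add: a'_def)
    have dc: "dirichlet_character q chi" using prim by (simp add: primitive_character_def)
    have "chi a = chi (int a')" using dirichlet_character_periodic[OF dc, of "int a'" "a div int q"] by (simp add: a')
    then have cha: "Re (chi a) = ch a'" by (simp add: ch_def)
    have ca: "coprime a' q"
    proof -
      have "coprime (int a') (int q)" unfolding a' using a q by (simp add: coprime_mod_left_iff)
      then show ?thesis by (simp add: coprime_int_iff)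
    qed
    have zq: "z \<ge> Zq" using z Zq_le by linarith
    have res: "[int n = a] (mod int q) \<longleftrightarrow> [n = a'] (mod q)" for n
    proof -
      have "[n = a'] (mod q) \<longleftrightarrow> [int n = int a'] (mod int q)" by (simp add: cong_int_iff)
      also have "... \<longleftrightarrow> [int n = a] (mod int q)" unfolding a' by (simp add: cong_def)
      finally show ?thesis by simp
    qed
    have pp: "pi_progression k x z q a = card {n \<in> rough_products (Suc j) x z. [n = a'] (mod q)}" unfolding pi_progression_def res j ..
    have "real q \<le> z" using zq Zq_ge by linarith
    then have "{n \<in> rough_products k x z. coprime n q} = rough_products k x z" using rough_coprime by blast
    then have pc: "pi_coprime k q x z = card (rough_products (Suc j) x z)" by (simp add: pi_coprime_def j)
    have "\<exists>E. \<bar>E\<bar> \<le> Kall u j c Z * \<Delta> \<and>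
      real (card {n \<in> rough_products (Suc j) x z. [n = a'] (mod q)}) = (1 + (-1) ^ Suc j * ch a' + E) * (real (card (rough_products (Suc j) x z)) / real (totient q))"
      by (rule rough_products_equidistributed[OF ca b1 Lz zq x u D(2) cZ]) (use low x j in auto)
    then obtain E where E: "\<bar>E\<bar> \<le> Kall u j c Z * \<Delta>"
      "real (card {n \<in> rough_products (Suc j) x z. [n = a'] (mod q)}) = (1 + (-1) ^ Suc j * ch a' + E) * (real (card (rough_products (Suc j) x z)) / real (totient q))" by blast
    have "Kall u j c Z * \<Delta> \<le> C * \<Delta>" unfolding C_def using D by (intro mult_right_mono) auto
    then have "\<bar>E\<bar> \<le> C * \<Delta>" using E(1) by linarith
    then show "\<exists>E. \<bar>E\<bar> \<le> C * \<Delta> \<and> real (pi_progression k x z q a) = (1 + (-1) ^ k * Re (chi a) + E) * (real (pi_coprime k q x z) / real (totient q))"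
      using E(2) unfolding pp pc cha unfolding j by (intro exI[of _ E] conjI)
  qed
qed

theorem theorem1:
  shows "\<exists>A::real. A > 0 \<and> (\<forall>u::real. u > 1 \<longrightarrow> (\<exists>C::real. C > 0 \<and>
    (\<forall>(\<kappa>::real) (q::nat) (chi::int \<Rightarrow> complex) (\<beta>::real) (z::real) (x::real) (\<Delta>::real).
       \<kappa> > 0 \<and> q > 1 \<and> primitive_character q chi \<and> real_character chi \<and>
       dirichlet_L chi (complex_of_real \<beta>) = 0 \<and> \<beta> \<ge> 1 - \<kappa> / ln (real q) \<and>
       z \<ge> real q powr A \<and> x = z powr u \<and> \<Delta> > 0 \<and> (1 - \<beta>) * ln x \<le> \<Delta> \<longrightarrow>
       (\<forall>(k::nat) (a::int). k > 0 \<and> real k < u \<and> coprime a (int q) \<longrightarrow>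
          (\<exists>E::real. \<bar>E\<bar> \<le> C * \<Delta> \<and>
             real (pi_progression k x z q a) =
               (1 + (-1) ^ k * Re (chi a) + E) * (real (pi_coprime k q x z) / real (totient q)))))))"
proof (rule exI[of _ "real expo"], intro conjI allI impI, goal_cases)
  case 1
  show ?case by (simp add: expo_def)
next
  case (2 u)
  \<comment> \<open>Only finitely many \<open>k\<close> lie below u, so one constant depending on u
    serves them all.\<close>
  define S where "S = {k::nat. k > 0 \<and> real k < u}"
  have fS: "finite S" unfolding S_def by (rule finite_subset[OF _ finite_nat_real_le[of u]]) auto
  have "\<forall>k\<in>S. \<exists>C. asymptotic_bound (real expo) u k C" unfolding S_def using asymptotic_bound_exists by blast
  then obtain F where F: "\<forall>k\<in>S. asymptotic_bound (real expo) u k (F k)" using bchoice[of S "asymptotic_bound (real expo) u"] by blast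
  define C where "C = 1 + (\<Sum>k\<in>S. F k)"
  have F0: "F k > 0" if "k \<in> S" for k using F that by (auto simp: asymptotic_bound_def)
  have FC: "F k \<le> C" if "k \<in> S" for k
    unfolding C_def using member_le_sum[of k S F] that F0 fS by (force intro: less_imp_le)
  have "(\<Sum>k\<in>S. F k) \<ge> 0" using F0 by (intro sum_nonneg) (auto intro: less_imp_le)
  then have C0: "C > 0" by (simp add: C_def)
  show ?case
  proof (rule exI[of _ C], intro conjI allI impI C0, goal_cases)
    case (1 \<kappa> q chi \<beta> z x \<Delta> k a)
    then have kS: "k \<in> S" by (simp add: S_def)
    then have "asymptotic_bound (real expo) u k (F k)" using F by blast
    then obtain E where E: "\<bar>E\<bar> \<le> F k * \<Delta>" "real (pi_progression k x z q a) = (1 + (-1) ^ k * Re (chi a) + E) * (real (pi_coprime k q x z) / real (totient q))"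
      unfolding asymptotic_bound_def using 1 by blast
    have "F k * \<Delta> \<le> C * \<Delta>" using FC[OF kS] 1 by (intro mult_right_mono) auto
    then show ?case using E by (intro exI[of _ E]) linarith
  qed
qed

end
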